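(* Let $K\subsetneq\mathbb{C}$ be a closed set, and $\psi$ a subharmonic function on $\mathbb{C}$. Then the following hold. \begin{itemize} \item[(1)] If $K$ is nonpolar, then $A^2_{e^{-\psi}}(\mathbb{C}\setminus K)$ is infinite dimensional. \item[(2)] If $K$ is polar, then $A^2_{e^{-\psi}}(\mathbb{C}\setminus K)$ is isomorphic to $A^2_{e^{-\psi}}(\mathbb{C})$. \end{itemize}
   Context: Subharmonic functions are upper semicontinuous with values in $[-\infty,\infty)$ and are not identically $-\infty$. For an open set $\Omega\subseteq\mathbb{C}$ and a subharmonic function $\psi$ on $\Omega$, the weighted Bergman space with weight $e^{-\psi}$ is $$A^2_{e^{-\psi}}(\Omega)=\left\{f:\Omega\to\mathbb{C}\text{ holomorphic}:\ \|f\|:=\left(\int_\Omega|f(z)|^2e^{-\psi(z)}\,\lambda(z)\right)^{1/2}<\infty\right\},$$ where $\lambda$ is Lebesgue measure (the standard volume form) on $\mathbb{C}$. A set $K\subset\mathbb{C}$ is polar if there is a nonconstant subharmonic function $s$ on $\mathbb{C}$ such that $K\subseteq\{z\in\mathbb{C}:s(z)=-\infty\}$; otherwise it is nonpolar. *)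

theory Defs
  imports
    "HOL-Complex_Analysis.Complex_Analysis"
    "HOL-Library.Function_Algebras"
begin

definition upper_semicontinuous_on :: "'a::topological_space set \<Rightarrow> ('a \<Rightarrow> ereal) \<Rightarrow> bool" where
  "upper_semicontinuous_on S u \<longleftrightarrow> (\<forall>c. openin (top_of_set S) {x \<in> S. u x < c})"

text \<open>
  The mean of an extended real function over a circle is the integral of its positive part minus
  the integral of its negative part (\<^const>\<open>e2ennreal\<close> sends negative arguments to 0).  For an upper
  semicontinuous function with values below \<open>\<infinity>\<close> the first of these is finite, so the difference is
  well defined, with \<open>-\<infinity>\<close> as a possible value.
\<close>
definition circle_mean :: "(complex \<Rightarrow> ereal) \<Rightarrow> complex \<Rightarrow> real \<Rightarrow> ereal" where
  "circle_mean u z r =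
     (enn2ereal (\<integral>\<^sup>+t\<in>{0..2*pi}. e2ennreal (u (z + rcis r t)) \<partial>lborel)
      - enn2ereal (\<integral>\<^sup>+t\<in>{0..2*pi}. e2ennreal (- u (z + rcis r t)) \<partial>lborel)) / ereal (2 * pi)"

definition subharmonic_on :: "complex set \<Rightarrow> (complex \<Rightarrow> ereal) \<Rightarrow> bool" where
  "subharmonic_on \<Omega> u \<longleftrightarrow>
     upper_semicontinuous_on \<Omega> u \<and>
     (\<forall>z\<in>\<Omega>. u z \<noteq> \<infinity>) \<and>
     (\<exists>z\<in>\<Omega>. u z \<noteq> - \<infinity>) \<and>
     (\<forall>z r. 0 < r \<and> cball z r \<subseteq> \<Omega> \<longrightarrow> u z \<le> circle_mean u z r)"

definition polar :: "complex set \<Rightarrow> bool" where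
  "polar K \<longleftrightarrow>
     (\<exists>s. subharmonic_on UNIV s \<and> \<not> s constant_on UNIV \<and> K \<subseteq> {z. s z = - \<infinity>})"

definition exp_ereal :: "ereal \<Rightarrow> ennreal" where
  "exp_ereal x = (case x of ereal r \<Rightarrow> ennreal (exp r) | PInfty \<Rightarrow> \<infinity> | MInfty \<Rightarrow> 0)"

definition bergman_sqnorm :: "(complex \<Rightarrow> ereal) \<Rightarrow> complex set \<Rightarrow> (complex \<Rightarrow> complex) \<Rightarrow> ennreal" where
  "bergman_sqnorm \<psi> \<Omega> f =
     (\<integral>\<^sup>+z\<in>\<Omega>. ennreal ((cmod (f z))\<^sup>2) * exp_ereal (- \<psi> z) \<partial>lborel)"

text \<open>
  A function on \<open>\<Omega>\<close> is represented by its extension by 0 to the whole plane, so that distinct elements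
  of the set below are distinct functions on \<open>\<Omega>\<close> and the pointwise operations on
  \<^typ>\<open>complex \<Rightarrow> complex\<close> are the vector space operations of the Bergman space.
\<close>
definition bergman_space :: "(complex \<Rightarrow> ereal) \<Rightarrow> complex set \<Rightarrow> (complex \<Rightarrow> complex) set" where
  "bergman_space \<psi> \<Omega> =
     {f. f holomorphic_on \<Omega> \<and> (\<forall>z. z \<notin> \<Omega> \<longrightarrow> f z = 0) \<and> bergman_sqnorm \<psi> \<Omega> f < \<infinity>}"

definition bergman_norm :: "(complex \<Rightarrow> ereal) \<Rightarrow> complex set \<Rightarrow> (complex \<Rightarrow> complex) \<Rightarrow> real" where
  "bergman_norm \<psi> \<Omega> f = sqrt (enn2real (bergman_sqnorm \<psi> \<Omega> f))"

definition cscale :: "complex \<Rightarrow> (complex \<Rightarrow> complex) \<Rightarrow> (complex \<Rightarrow> complex)" where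
  "cscale c f = (\<lambda>z. c * f z)"

global_interpretation cfun: vector_space cscale
  by standard (auto simp: cscale_def fun_eq_iff algebra_simps)

definition infinite_dimensional :: "(complex \<Rightarrow> complex) set \<Rightarrow> bool" where
  "infinite_dimensional V \<longleftrightarrow> \<not> (\<exists>B. finite B \<and> B \<subseteq> V \<and> V \<subseteq> cfun.span B)"

text \<open>
  Isomorphism of Bergman spaces as Hilbert spaces: a linear bijection preserving the norm
  (equivalently, by polarization, the inner product).
\<close>
definition bergman_isomorphic :: "(complex \<Rightarrow> ereal) \<Rightarrow> complex set \<Rightarrow> complex set \<Rightarrow> bool" where
  "bergman_isomorphic \<psi> \<Omega> \<Omega>' \<longleftrightarrow>
     (\<exists>T. bij_betw T (bergman_space \<psi> \<Omega>) (bergman_space \<psi> \<Omega>') \<and>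
          (\<forall>f\<in>bergman_space \<psi> \<Omega>. \<forall>g\<in>bergman_space \<psi> \<Omega>. T (f + g) = T f + T g) \<and>
          (\<forall>c. \<forall>f\<in>bergman_space \<psi> \<Omega>. T (cscale c f) = cscale c (T f)) \<and>
          (\<forall>f\<in>bergman_space \<psi> \<Omega>. bergman_norm \<psi> \<Omega>' (T f) = bergman_norm \<psi> \<Omega> f))"

end

theory Submission
  imports Defs "HOL-Library.Diagonal_Subsequence"
begin

text \<open>
  For nonpolar \<open>K\<close>, a minimax argument gives a compact part of \<open>K\<close> and finite averages of the
  functions \<open>ln |z - w|\<close> with \<open>w\<close> in that part which are bounded below by \<open>ln (1 + |z|) - M\<close>, with \<open>M\<close>
  uniform, on any given compact set disjoint from it; otherwise weighted sums of smoothed logarithmic potentials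
  would exhibit \<open>K\<close> as polar. Such an average \<open>h\<close> plays the role of the Green function in an
  Ohsawa--Takegoshi extension from a point on the bounded sets \<open>{|z| < j, dist z K > 1 / j}\<close>, with
  \<open>\<psi>\<close> replaced by mollifications and with additional poles \<open>ln (|z - a|\<^sup>2 + \<delta>) - 2 h\<close>. The constants do not
  depend on \<open>j\<close>, so a normal families limit is a function in the Bergman space with value 1 at one
  point and 0 at finitely many others, and triangular families of such functions are independent.
  The extension itself comes from duality: a smoothed Cauchy transform built from the \<open>L\<^sup>2\<close>-minimal function
  with value 1 at the point is compactly supported, by orthogonality, and is inserted as a test
  function into a weighted inequality for the \<open>\<partial>\<close>-bar operator.

  For polar \<open>K \<subseteq> {s = -\<infinity>}\<close>, the convolution of a Bergman function \<open>f\<close> with a bump function is entire: logarithmic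
  cut-offs in \<open>u = C + 1 - s\<^sub>\<epsilon>\<close>, with \<open>s\<^sub>\<epsilon>\<close> a mollification of \<open>s\<close>, vanish near \<open>K\<close> and their gradients tend to 0 in
  \<open>L\<^sup>2\<close> by the Caccioppoli inequality for the positive superharmonic function \<open>u\<close>. Away from \<open>K\<close> the convolution is a
  multiple of \<open>f\<close> by the mean value property, so the identity theorem extends \<open>f\<close> to an entire function.
\<close>

section \<open>Wirtinger derivatives\<close>

text \<open>Two obstacles shape the proof. The function \<open>exp (- \<psi>)\<close> need not be
  locally integrable, so no function with prescribed values can be written down and corrected: even
  one point value needs an extension theorem, and it is possible only where \<open>\<psi>\<close> is
  finite. Mollifications lie above \<open>\<psi>\<close>, so they never spoil the bound at such a
  point, and Fatou's lemma recovers the true weight. Secondly, the domain is unbounded and the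
  extension constant must survive the exhaustion. What it involves of the domain is the value of
  \<open>h\<close> at the base point, and the same \<open>M\<close> that bounds \<open>h\<close>
  from below bounds this value from above. All integrations by parts rest on one fact: first
  derivatives of a compactly supported function have integral 0. For this reason the kernels are
  polynomial bump functions with derivatives in closed form, of class C2 and no better. The constant
  \<open>10240 * pi\<close> is the product of 5 from the dbar-inequality,
  \<open>64 * pi\<^sup>2\<close> from smoothing the Cauchy transform, and \<open>32 / pi\<close>
  from the lower bound near the base point.\<close>

definition has_wirtinger :: "(complex \<Rightarrow> complex) \<Rightarrow> complex \<Rightarrow> complex \<Rightarrow> complex \<Rightarrow> bool" where
  "has_wirtinger f a b z \<longleftrightarrow> (f has_derivative (\<lambda>h. a * h + b * cnj h)) (at z)"

lemma has_wirtinger_eq: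
  "has_wirtinger f a b z \<Longrightarrow> a = a' \<Longrightarrow> b = b' \<Longrightarrow> has_wirtinger f a' b' z"
  by simp

lemma has_wirtinger_const: "has_wirtinger (\<lambda>z. c) 0 0 z"
  by (simp add: has_wirtinger_def)

lemma has_wirtinger_add:
  "has_wirtinger f a b z \<Longrightarrow> has_wirtinger g c d z \<Longrightarrow> has_wirtinger (\<lambda>z. f z + g z) (a + c) (b + d) z"
  unfolding has_wirtinger_def
  by (drule (1) has_derivative_add) (simp add: algebra_simps)

lemma has_wirtinger_minus: "has_wirtinger f a b z \<Longrightarrow> has_wirtinger (\<lambda>z. - f z) (- a) (- b) z"
  unfolding has_wirtinger_def
  by (drule has_derivative_minus) (simp add: algebra_simps)

lemma has_wirtinger_diff:
  "has_wirtinger f a b z \<Longrightarrow> has_wirtinger g c d z \<Longrightarrow> has_wirtinger (\<lambda>z. f z - g z) (a - c) (b - d) z"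
  using has_wirtinger_add[of f a b z "\<lambda>z. - g z" "- c" "- d"] has_wirtinger_minus[of g c d z] by simp

lemma has_wirtinger_mult:
  "has_wirtinger f a b z \<Longrightarrow> has_wirtinger g c d z \<Longrightarrow>
   has_wirtinger (\<lambda>z. f z * g z) (f z * c + a * g z) (f z * d + b * g z) z"
  unfolding has_wirtinger_def
  by (drule (1) has_derivative_mult) (simp add: algebra_simps)

lemma has_wirtinger_cnj: "has_wirtinger f a b z \<Longrightarrow> has_wirtinger (\<lambda>z. cnj (f z)) (cnj b) (cnj a) z"
  unfolding has_wirtinger_def
  by (drule has_derivative_cnj) (simp add: algebra_simps)

lemma has_wirtinger_ident: "has_wirtinger (\<lambda>z. z) 1 0 z"
  unfolding has_wirtinger_def by simp

lemma has_wirtinger_chain: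
  assumes "has_wirtinger f a b z" "(g has_field_derivative g') (at (f z))"
  shows "has_wirtinger (\<lambda>z. g (f z)) (g' * a) (g' * b) z"
  using diff_chain_at[OF assms(1)[unfolded has_wirtinger_def] assms(2)[unfolded has_field_derivative_def]]
  unfolding has_wirtinger_def o_def by (simp add: algebra_simps)

lemma has_wirtinger_field_derivative:
  "(g has_field_derivative g') (at z) \<Longrightarrow> has_wirtinger g g' 0 z"
  using has_wirtinger_chain[OF has_wirtinger_ident] by auto

lemma has_wirtinger_imp_field_derivative:
  "has_wirtinger g g' 0 z \<Longrightarrow> (g has_field_derivative g') (at z)"
  unfolding has_wirtinger_def has_field_derivative_def by simp

text \<open>The differential of a real-valued \<open>u\<close> takes real values, so the real factor
  \<open>F'\<close> scales both coefficients alike. All compositions with \<open>exp\<close>,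
  \<open>ln\<close>, \<open>inverse\<close> and the cut-offs are differentiated in this way.\<close>

lemma has_wirtinger_real_chain:
  fixes u :: "complex \<Rightarrow> real" and F :: "real \<Rightarrow> real"
  assumes u: "has_wirtinger (\<lambda>z. complex_of_real (u z)) a b z"
    and F: "(F has_real_derivative F') (at (u z))"
  shows "has_wirtinger (\<lambda>z. complex_of_real (F (u z))) (F' * a) (F' * b) z"
proof -
  have 1: "(u has_derivative (\<lambda>h. Re (a * h + b * cnj h))) (at z)"
    using has_derivative_Re[OF u[unfolded has_wirtinger_def]] by simp
  have im: "Im (a * h + b * cnj h) = 0" for h
    using has_derivative_Im[OF u[unfolded has_wirtinger_def]]
    by (simp add: fun_eq_iff) (drule has_derivative_unique[OF has_derivative_const], metis)
  have 2: "((\<lambda>z. F (u z)) has_derivative (\<lambda>h. F' * Re (a * h + b * cnj h))) (at z)"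
    using diff_chain_at[OF 1 F[unfolded has_field_derivative_def]] by (simp add: o_def)
  have 3: "complex_of_real (F' * Re (a * h + b * cnj h)) = F' * a * h + F' * b * cnj h" for h
  proof -
    have "complex_of_real (Re (a * h + b * cnj h)) = a * h + b * cnj h"
      using im[of h] by (simp add: complex_eq_iff)
    then show ?thesis by (simp only: of_real_mult) (simp add: algebra_simps)
  qed
  show ?thesis
    using has_derivative_of_real[OF 2, where 'a=complex] unfolding has_wirtinger_def 3 .
qed

lemma has_wirtinger_transform:
  assumes "has_wirtinger f a b z" "open S" "z \<in> S" "\<And>w. w \<in> S \<Longrightarrow> f w = g w"
  shows "has_wirtinger g a b z"
  using assms has_derivative_transform_within_open unfolding has_wirtinger_def by blast

lemma has_wirtinger_isCont: "has_wirtinger f a b z \<Longrightarrow> isCont f z"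
  unfolding has_wirtinger_def by (rule has_derivative_continuous)

lemma has_wirtinger_shift:
  assumes "has_wirtinger f a b (z + c)" shows "has_wirtinger (\<lambda>z. f (z + c)) a b z"
proof -
  have "((\<lambda>z. z + c) has_derivative (\<lambda>h. h)) (at z)" by (auto intro!: derivative_eq_intros)
  from diff_chain_at[OF this assms[unfolded has_wirtinger_def]] show ?thesis
    by (simp add: has_wirtinger_def o_def)
qed

lemma has_wirtinger_linear:
  assumes "has_wirtinger f a b (c * z)" shows "has_wirtinger (\<lambda>z. f (c * z)) (a * c) (b * cnj c) z"
proof -
  have "((\<lambda>z. c * z) has_derivative (\<lambda>h. c * h)) (at z)" by (auto intro!: derivative_eq_intros)
  from diff_chain_at[OF this assms[unfolded has_wirtinger_def]] show ?thesis
    by (simp add: has_wirtinger_def o_def mult.assoc)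
qed

lemma has_wirtinger_real_conj:
  assumes "has_wirtinger (\<lambda>z. complex_of_real (u z)) a b z" shows "b = cnj a"
proof -
  have im: "Im (a * h + b * cnj h) = 0" for h
    using has_derivative_Im[OF assms[unfolded has_wirtinger_def]]
    by (simp add: fun_eq_iff) (drule has_derivative_unique[OF has_derivative_const], metis)
  show ?thesis using im[of 1] im[of \<i>] by (simp add: complex_eq_iff)
qed

lemma has_wirtinger_norm2: "has_wirtinger (\<lambda>z. complex_of_real ((cmod z)\<^sup>2)) (cnj z) z z"
proof -
  have "has_wirtinger (\<lambda>z. z * cnj z) (z * 0 + 1 * cnj z) (z * 1 + 0 * cnj z) z"
    using has_wirtinger_mult[OF has_wirtinger_ident has_wirtinger_cnj[OF has_wirtinger_ident], of z]
    by simp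
  then show ?thesis by (simp only: complex_norm_square mult_zero_right mult_1 mult_1_right add_0 add_0_right mult_zero_left)
qed

lemma has_wirtinger_Lipschitz:
  assumes der: "\<And>z. has_wirtinger f (a z) (b z) z" and B: "\<And>z. cmod (a z) + cmod (b z) \<le> B"
  shows "cmod (f x - f y) \<le> B * cmod (x - y)"
proof -
  have "norm (f x - f y) \<le> B * norm (x - y)"
  proof (rule differentiable_bound[of UNIV f "\<lambda>z h. a z * h + b z * cnj h"])
    fix z show "(f has_derivative (\<lambda>h. a z * h + b z * cnj h)) (at z within UNIV)"
      using der[of z] by (simp add: has_wirtinger_def)
    show "onorm (\<lambda>h. a z * h + b z * cnj h) \<le> B"
    proof (rule onorm_le)
      fix h
      have "norm (a z * h + b z * cnj h) \<le> norm (a z) * norm h + norm (b z) * norm h"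
        by (rule order_trans[OF norm_triangle_ineq]) (simp add: norm_mult)
      also have "\<dots> \<le> B * norm h"
        using mult_right_mono[OF B[of z], of "norm h"] by (simp add: algebra_simps)
      finally show "norm (a z * h + b z * cnj h) \<le> B * norm h" .
    qed
  qed auto
  then show ?thesis by simp
qed

lemma has_wirtinger_imp_continuous_on:
  "(\<And>z. z \<in> S \<Longrightarrow> has_wirtinger f (a z) (b z) z) \<Longrightarrow> continuous_on S f"
  by (meson continuous_at_imp_continuous_on has_wirtinger_isCont)

section \<open>Lebesgue measure on the plane\<close>

text \<open>Passing to \<open>real^2\<close> turns multiplication by a unit complex number into an
  orthogonal transformation, whose invariance of Lebesgue measure then carries over to the complex
  plane.\<close>

definition vec2_complex :: "real^2 \<Rightarrow> complex" where
  "vec2_complex v = Complex (v $ 1) (v $ 2)"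

definition complex_vec2 :: "complex \<Rightarrow> real^2" where
  "complex_vec2 z = vector [Re z, Im z]"

lemma vec2_complex_inverse [simp]: "vec2_complex (complex_vec2 z) = z" "complex_vec2 (vec2_complex v) = v"
  by (auto simp: vec2_complex_def complex_vec2_def vec_eq_iff forall_2 vector_2)

lemma continuous_vec2_complex: "continuous_on UNIV vec2_complex"
  unfolding vec2_complex_def Complex_eq by (intro continuous_intros)

lemma lborel_distr_vec2_complex: "distr lborel borel vec2_complex = lborel"
proof (rule sym, rule lborel_eqI)
  fix l u :: complex
  assume lu: "\<And>b. b \<in> Basis \<Longrightarrow> l \<bullet> b \<le> u \<bullet> b"
  have lu': "Re l \<le> Re u" "Im l \<le> Im u" using lu[of 1] lu[of \<i>] by (auto simp: Basis_complex_def inner_complex_def)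
  have pre: "vec2_complex -` box l u = box (complex_vec2 l) (complex_vec2 u)"
    by (auto simp: vec2_complex_def complex_vec2_def mem_box_cart forall_2 vector_2 in_box_complex_iff)
  have "emeasure (distr lborel borel vec2_complex) (box l u) = emeasure lborel (vec2_complex -` box l u)"
    by (subst emeasure_distr) (auto intro: borel_measurable_continuous_onI continuous_vec2_complex)
  also have "\<dots> = ennreal ((Re u - Re l) * (Im u - Im l))"
    unfolding pre using lu'
    by (subst emeasure_lborel_box)
       (auto simp: Basis_vec_def cart_eq_inner_axis[symmetric] prod.UNION_disjoint UNIV_2 complex_vec2_def vector_2 axis_eq_axis inner_axis)
  also have "\<dots> = (\<Prod>b\<in>Basis. (u - l) \<bullet> b)"
    by (simp add: Basis_complex_def inner_complex_def)
  finally show "emeasure (distr lborel borel vec2_complex) (box l u) = (\<Prod>b\<in>Basis. (u - l) \<bullet> b)" .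
qed simp

lemma lborel_distr_orthogonal:
  fixes f :: "real^2 \<Rightarrow> real^2"
  assumes orth: "orthogonal_transformation f" shows "distr lborel borel f = lborel"
proof (rule sym, rule lborel_eqI)
  fix l u :: "real^2"
  assume lu: "\<And>b. b \<in> Basis \<Longrightarrow> l \<bullet> b \<le> u \<bullet> b"
  define g where "g = inv f"
  have g: "orthogonal_transformation g" unfolding g_def by (rule orthogonal_transformation_inv[OF orth])
  have bij: "bij f" using orth by (rule orthogonal_transformation_bij)
  have pre: "f -` box l u = g ` box l u"
    unfolding g_def by (rule bij_vimage_eq_inv_image[OF bij])
  have mf: "f \<in> borel_measurable borel"
    by (intro borel_measurable_continuous_onI linear_continuous_on linear_conv_bounded_linear[THEN iffD1] orthogonal_transformation_linear[OF orth])
  have s: "f -` box l u \<in> sets lborel" using measurable_sets_borel[OF mf, of "box l u"] by simp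
  have lm: "g ` box l u \<in> lmeasurable" by (rule measurable_orthogonal_image[OF g]) simp
  have "emeasure (distr lborel borel f) (box l u) = emeasure lborel (f -` box l u)"
    using mf by (subst emeasure_distr) auto
  also have "\<dots> = emeasure lebesgue (g ` box l u)"
    using s unfolding pre by simp
  also have "\<dots> = measure lebesgue (g ` box l u)"
    using lm by (subst emeasure_eq_measure2) auto
  also have "\<dots> = measure lebesgue (box l u)"
    by (subst measure_orthogonal_image[OF g]) auto
  also have "\<dots> = (\<Prod>b\<in>Basis. (u - l) \<bullet> b)"
    using lu by (simp add: measure_completion measure_lborel_box_eq)
  finally show "emeasure (distr lborel borel f) (box l u) = (\<Prod>b\<in>Basis. (u - l) \<bullet> b)" .
qed simp

lemma lborel_distr_mult_unit:
  assumes "cmod c = 1" shows "distr lborel borel ((*) c) = (lborel :: complex measure)"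
proof -
  define f where "f v = complex_vec2 (c * vec2_complex v)" for v
  have lin: "linear f"
    by (rule linearI) (auto simp: f_def complex_vec2_def vec2_complex_def vec_eq_iff forall_2 vector_2 algebra_simps)
  have nrm: "norm v = cmod (vec2_complex v)" for v
    by (simp add: norm_vec_def L2_set_def UNIV_2 vec2_complex_def cmod_def)
  have orth: "orthogonal_transformation f"
    unfolding orthogonal_transformation using lin assms by (auto simp: nrm f_def norm_mult)
  have mf: "f \<in> borel_measurable borel"
    by (intro borel_measurable_continuous_onI linear_continuous_on linear_conv_bounded_linear[THEN iffD1] lin)
  have mv: "vec2_complex \<in> borel_measurable borel"
    by (intro borel_measurable_continuous_onI continuous_vec2_complex)
  have "distr lborel borel ((*) c) = distr (distr lborel borel vec2_complex) borel ((*) c)"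
    by (simp add: lborel_distr_vec2_complex)
  also have "\<dots> = distr (distr lborel borel f) borel vec2_complex"
    using mf mv by (simp add: distr_distr o_def f_def)
  also have "\<dots> = lborel"
    by (simp add: lborel_distr_orthogonal[OF orth] lborel_distr_vec2_complex)
  finally show ?thesis .
qed

lemma nn_integral_mult_unit:
  fixes f :: "complex \<Rightarrow> ennreal"
  assumes "f \<in> borel_measurable borel" "cmod c = 1"
  shows "(\<integral>\<^sup>+w. f (c * w) \<partial>lborel) = (\<integral>\<^sup>+w. f w \<partial>lborel)"
  using assms
  by (subst (2) lborel_distr_mult_unit[OF assms(2), symmetric]) (simp add: nn_integral_distr)

lemma nn_integral_shift:
  fixes f :: "'a::euclidean_space \<Rightarrow> ennreal"
  assumes "f \<in> borel_measurable borel"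
  shows "(\<integral>\<^sup>+w. f (c + w) \<partial>lborel) = (\<integral>\<^sup>+w. f w \<partial>lborel)"
  using assms
  by (subst (2) lborel_distr_plus[of c, symmetric]) (simp add: nn_integral_distr)

lemma integral_shift:
  fixes f :: "'a::euclidean_space \<Rightarrow> 'b::{banach,second_countable_topology}"
  assumes "f \<in> borel_measurable borel"
  shows "(\<integral>w. f (c + w) \<partial>lborel) = (\<integral>w. f w \<partial>lborel)"
  using assms
  by (subst (2) lborel_distr_plus[of c, symmetric]) (simp add: integral_distr)

lemma emeasure_ball_complex: "0 \<le> r \<Longrightarrow> emeasure lborel (ball (z::complex) r) = ennreal (pi * r\<^sup>2)"
  by (simp add: emeasure_ball DIM_complex unit_ball_vol_2)

text \<open>The integrand is dominated by a sum over the dyadic balls of radius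
  \<open>r / 2^k\<close>. The k-th term contributes \<open>2 * pi * r / 2^k\<close>, and the
  geometric series gives twice the exact value \<open>2 * pi * r\<close>.\<close>

lemma nn_integral_inverse_cmod:
  assumes r: "0 < r"
  shows "(\<integral>\<^sup>+u. ennreal (1 / cmod (a - u)) * indicator (ball a r) u \<partial>lborel) \<le> ennreal (4 * pi * r)"
proof -
  define A where "A k = ball a (r * (1/2)^k)" for k :: nat
  have "(\<integral>\<^sup>+u. ennreal (1 / cmod (a - u)) * indicator (ball a r) u \<partial>lborel)
     \<le> (\<integral>\<^sup>+u. (\<Sum>k. ennreal (2 * 2^k / r) * indicator (A k) u) \<partial>lborel)"
  proof (rule nn_integral_mono)
    fix u :: complex
    show "ennreal (1 / cmod (a - u)) * indicator (ball a r) u \<le> (\<Sum>k. ennreal (2 * 2^k / r) * indicator (A k) u)"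
    proof (cases "u \<in> ball a r \<and> u \<noteq> a")
      case True
      define d where "d = cmod (a - u)"
      have d: "0 < d" "d < r" using True by (auto simp: d_def dist_norm)
      have "(\<lambda>k. r * (1/2)^k) \<longlonglongrightarrow> r * 0"
        by (intro tendsto_mult tendsto_const LIMSEQ_realpow_zero) auto
      then have "eventually (\<lambda>k. r * (1/2)^k < d) sequentially"
        using d(1) by (intro order_tendstoD(2)[where a=d]) auto
      then have ex: "\<exists>k. r * (1/2)^k \<le> d" by (meson eventually_sequentially order.refl less_imp_le)
      \<comment> \<open>The first dyadic radius not exceeding \<open>d\<close>; the ball one index
        earlier still contains \<open>u\<close>, and its radius is less than \<open>2 * d\<close>
        away from optimal, whence the factor 2.\<close>
      define m where "m = (LEAST k. r * (1/2)^k \<le> d)"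
      have m: "r * (1/2)^m \<le> d" unfolding m_def by (rule LeastI_ex[OF ex])
      have m0: "m \<noteq> 0" using m d by (cases m) auto
      then obtain k where k: "m = Suc k" by (cases m) auto
      have k1: "\<not> r * (1/2)^k \<le> d" using not_less_Least[of k "\<lambda>k. r * (1/2)^k \<le> d"] k m_def by auto
      have uA: "u \<in> A k" using k1 by (simp add: A_def d_def dist_norm)
      have "1 / d \<le> 2 * 2^k / r"
        using m k d r by (simp add: field_simps power_one_over)
      then have "ennreal (1/d) \<le> ennreal (2 * 2^k / r) * indicator (A k) u" using uA by (simp add: ennreal_leI)
      also have "\<dots> \<le> (\<Sum>k. ennreal (2 * 2^k / r) * indicator (A k) u)"
        using sum_le_suminf[OF summableI, of "{k}" "\<lambda>k. ennreal (2 * 2^k / r) * indicator (A k) u"]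
        by (simp del: sum_mult_indicator)
      finally show ?thesis using True by (simp add: d_def)
    qed (auto simp: indicator_def)
  qed
  also have "\<dots> = (\<Sum>k. \<integral>\<^sup>+u. ennreal (2 * 2^k / r) * indicator (A k) u \<partial>lborel)"
    by (rule nn_integral_suminf) (auto simp: A_def intro!: borel_measurable_times_ennreal borel_measurable_indicator)
  also have "\<dots> = (\<Sum>k. ennreal ((2 * pi * r) * (1/2)^k))"
  proof (rule suminf_cong)
    fix k
    have "(\<integral>\<^sup>+u. ennreal (2 * 2^k / r) * indicator (A k) u \<partial>lborel) = ennreal (2 * 2^k / r) * ennreal (pi * (r * (1/2)^k)\<^sup>2)"
      using r by (simp add: A_def nn_integral_cmult_indicator emeasure_ball_complex)
    also have "\<dots> = ennreal ((2 * pi * r) * (1/2)^k)"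
      using r by (subst ennreal_mult[symmetric]) (auto simp: power2_eq_square field_simps power_one_over)
    finally show "(\<integral>\<^sup>+u. ennreal (2 * 2^k / r) * indicator (A k) u \<partial>lborel) = ennreal ((2 * pi * r) * (1/2)^k)" .
  qed
  also have "\<dots> = ennreal (4 * pi * r)"
  proof -
    have "(\<lambda>k. (2 * pi * r) * (1/2)^k) sums ((2 * pi * r) * (1 / (1 - 1/2)))"
      by (intro sums_mult geometric_sums) auto
    then show ?thesis using r
      by (intro suminf_eq_SUP[THEN trans] sums_unique[symmetric] suminf_ennreal_eq[of "\<lambda>k. (2 * pi * r) * (1/2)^k"])
         (auto simp: field_simps)
  qed
  finally show ?thesis .
qed

lemma has_wirtinger_unique:
  assumes "has_wirtinger f a b z" "has_wirtinger f c d z" shows "a = c" "b = d"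
proof -
  have *: "a * h + b * cnj h = c * h + d * cnj h" for h
    using has_derivative_unique[OF assms[unfolded has_wirtinger_def]] by meson
  have "2 * a = 2 * c" using *[of 1] *[of \<i>]
    by (simp add: complex_eq_iff)
  then show "a = c" by simp
  then show "b = d" using *[of 1] by simp
qed

lemma integrable_compact_support:
  fixes f :: "complex \<Rightarrow> 'b::{banach,second_countable_topology}"
  assumes "continuous_on UNIV f" "compact S" "\<And>z. z \<notin> S \<Longrightarrow> f z = 0"
  shows "integrable lborel f"
proof -
  have "integrable lborel (\<lambda>x. indicator S x *\<^sub>R f x)"
    using assms by (intro borel_integrable_compact) (auto intro: continuous_on_subset)
  moreover have "(\<lambda>x. indicator S x *\<^sub>R f x) = f" using assms(3) by (auto simp: fun_eq_iff indicator_def)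
  ultimately show ?thesis by simp
qed

text \<open>Translation invariance makes the integral of every difference quotient of
  \<open>X\<close> vanish, and dominated convergence passes this to directional derivatives. The
  directions 1 and \<i> then separate \<open>a\<close> from \<open>b\<close>. This is the form of
  Stokes' theorem used throughout.\<close>

lemma integral_wirtinger_compact_support:
  assumes X: "\<And>z. has_wirtinger X (a z) (b z) z"
    and ca: "continuous_on UNIV a" and cb: "continuous_on UNIV b"
    and S: "compact S" and 0: "\<And>z. z \<notin> S \<Longrightarrow> X z = 0"
  shows "integrable lborel a" "integrable lborel b" "(\<integral>z. a z \<partial>lborel) = 0" "(\<integral>z. b z \<partial>lborel) = 0"
proof -
  have ab0: "a z = 0" "b z = 0" if "z \<notin> S" for z
  proof -
    have "has_wirtinger X 0 0 z"
      by (rule has_wirtinger_transform[OF has_wirtinger_const[of 0], of "- S"])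
         (use that 0 S in \<open>auto simp: compact_imp_closed open_closed\<close>)
    then show "a z = 0" "b z = 0" using has_wirtinger_unique[OF X] by auto
  qed
  show ia: "integrable lborel a" by (rule integrable_compact_support[OF ca S ab0(1)])
  show ib: "integrable lborel b" by (rule integrable_compact_support[OF cb S ab0(2)])
  have cX: "continuous_on UNIV X" by (rule has_wirtinger_imp_continuous_on[OF X])
  have mX: "X \<in> borel_measurable borel" by (rule borel_measurable_continuous_onI[OF cX])
  have iX: "integrable lborel X" by (rule integrable_compact_support[OF cX S 0])
  obtain R where R: "S \<subseteq> cball 0 R" using bounded_subset_ballD[OF compact_imp_bounded[OF S], of 0] ball_subset_cball by (metis order_trans)
  have "bounded ((\<lambda>z. cmod (a z) + cmod (b z)) ` S)"
    by (intro compact_imp_bounded compact_continuous_image S continuous_intros continuous_on_subset[OF ca] continuous_on_subset[OF cb]) auto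
  then obtain B where B': "\<forall>y\<in>(\<lambda>z. cmod (a z) + cmod (b z)) ` S. norm y \<le> B" unfolding bounded_iff by metis
  have B: "cmod (a z) + cmod (b z) \<le> max B 0" for z
  proof (cases "z \<in> S")
    case True
    then have "norm (cmod (a z) + cmod (b z)) \<le> B" using B' by blast
    then show ?thesis by simp
  qed (simp add: ab0)
  have dir: "(\<integral>z. a z * d + b z * cnj d \<partial>lborel) = 0" if d: "cmod d = 1" for d
  proof -
    define F where "F n z = of_nat (Suc n) * (X (d / of_nat (Suc n) + z) - X z)" for n :: nat and z
    have F0: "(\<integral>z. F n z \<partial>lborel) = 0" for n
    proof -
      have "integrable lborel (\<lambda>z. X (d / of_nat (Suc n) + z))"
        using iX lborel_distr_plus[of "d / of_nat (Suc n)"] integrable_distr_eq[of "\<lambda>z. d / of_nat (Suc n) + z" lborel borel X] mX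
        by simp
      then show ?thesis using iX integral_shift[OF mX, of "d / of_nat (Suc n)"]
        by (simp add: F_def del: of_nat_Suc)
    qed
    have "(\<lambda>n. \<integral>z. F n z \<partial>lborel) \<longlonglongrightarrow> (\<integral>z. a z * d + b z * cnj d \<partial>lborel)"
    proof (rule integral_dominated_convergence[where w="\<lambda>z. max B 0 * indicator (cball 0 (R + 1)) z"])
      show "(\<lambda>z. a z * d + b z * cnj d) \<in> borel_measurable lborel" using ia ib by auto
      show "F n \<in> borel_measurable lborel" for n unfolding F_def using mX by measurable
      show "integrable lborel (\<lambda>z. max B 0 * indicator (cball (0::complex) (R + 1)) z)"
        using emeasure_lborel_cball_finite[of "0::complex" "R + 1"]
        by (intro integrable_mult_right integrable_real_indicator) auto
      show "AE z in lborel. (\<lambda>n. F n z) \<longlonglongrightarrow> a z * d + b z * cnj d"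
      proof (rule AE_I2)
        fix z
        define h where "h = (\<lambda>n. d / of_nat (Suc n))"
        have "(\<lambda>n. d * of_real (inverse (real (Suc n)))) \<longlonglongrightarrow> d * of_real 0"
          by (intro tendsto_intros LIMSEQ_inverse_real_of_nat)
        then have lim: "h \<longlonglongrightarrow> 0" by (simp add: h_def divide_inverse)
        have hn: "norm (h n) = 1 / real (Suc n)" for n using d by (simp add: h_def norm_divide del: of_nat_Suc)
        have "((\<lambda>h. norm (X (z + h) - X z - (a z * h + b z * cnj h)) / norm h) \<longlongrightarrow> 0) (at 0)"
          using X[of z] unfolding has_wirtinger_def has_derivative_at by blast
        moreover have "\<forall>i. h i \<in> UNIV - {0}"
          using hn by (metis DiffI UNIV_I divide_eq_0_iff norm_zero of_nat_eq_0_iff one_neq_zero nat.distinct(1) singletonD)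
        ultimately have "((\<lambda>h. norm (X (z + h) - X z - (a z * h + b z * cnj h)) / norm h) \<circ> h) \<longlonglongrightarrow> 0"
          using lim unfolding tendsto_at_iff_sequentially by blast
        then have "(\<lambda>n. norm (X (z + h n) - X z - (a z * h n + b z * cnj (h n))) / norm (h n)) \<longlonglongrightarrow> 0"
          by (simp only: o_def)
        moreover have "norm (X (z + h n) - X z - (a z * h n + b z * cnj (h n))) / norm (h n) = norm (F n z - (a z * d + b z * cnj d))" for n
        proof -
          have "F n z - (a z * d + b z * cnj d) = of_nat (Suc n) * (X (z + h n) - X z - (a z * h n + b z * cnj (h n)))"
            by (simp add: F_def h_def field_simps del: of_nat_Suc)
          then show ?thesis by (simp add: hn norm_mult del: of_nat_Suc)
        qed
        ultimately have "(\<lambda>n. norm (F n z - (a z * d + b z * cnj d))) \<longlonglongrightarrow> 0" by simp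
        then show "(\<lambda>n. F n z) \<longlonglongrightarrow> a z * d + b z * cnj d"
          using LIM_zero_iff tendsto_norm_zero_iff by blast
      qed
      show "AE z in lborel. norm (F n z) \<le> max B 0 * indicator (cball 0 (R + 1)) z" for n
      proof (rule AE_I2)
        fix z
        show "norm (F n z) \<le> max B 0 * indicator (cball 0 (R + 1)) z"
        proof (cases "z \<in> cball 0 (R + 1)")
          case True
          have "cmod (X (d / of_nat (Suc n) + z) - X z) \<le> max B 0 * cmod (d / of_nat (Suc n) + z - z)"
            by (rule has_wirtinger_Lipschitz[OF X B])
          then have "cmod (X (d / of_nat (Suc n) + z) - X z) \<le> max B 0 / real (Suc n)"
            using d by (simp add: norm_divide del: of_nat_Suc)
          then have "real (Suc n) * cmod (X (d / of_nat (Suc n) + z) - X z) \<le> max B 0"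
            by (simp add: field_simps del: of_nat_Suc)
          then show ?thesis using True by (simp add: F_def norm_mult del: of_nat_Suc)
        next
          case False
          have "cmod (d / of_nat (Suc n)) \<le> 1" using d by (simp add: norm_divide divide_simps del: of_nat_Suc)
          moreover have "cmod z \<le> cmod (d / of_nat (Suc n) + z) + cmod (d / of_nat (Suc n))"
            by (metis add_diff_cancel_left' norm_triangle_ineq4)
          ultimately have "d / of_nat (Suc n) + z \<notin> S" "z \<notin> S"
            using False R by (auto simp del: of_nat_Suc)
          then show ?thesis using False 0 by (simp add: F_def)
        qed
      qed
    qed
    then show ?thesis using F0 by (simp add: LIMSEQ_const_iff)
  qed
  have e1: "(\<integral>z. a z \<partial>lborel) + (\<integral>z. b z \<partial>lborel) = 0"
    using dir[of 1] ia ib by simp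
  have e2: "(\<integral>z. a z \<partial>lborel) * \<i> - (\<integral>z. b z \<partial>lborel) * \<i> = 0"
    using dir[of \<i>] ia ib by simp
  then have "(\<integral>z. a z \<partial>lborel) = (\<integral>z. b z \<partial>lborel)" by simp
  then show "(\<integral>z. a z \<partial>lborel) = 0" "(\<integral>z. b z \<partial>lborel) = 0" using e1 by auto
qed

section \<open>Convolution with smooth kernels\<close>

lemma integrable_mult_bounded:
  fixes g k :: "complex \<Rightarrow> complex"
  assumes g: "integrable lborel g" and k: "k \<in> borel_measurable borel" and B: "\<And>u. cmod (k u) \<le> B"
  shows "integrable lborel (\<lambda>z. g z * k (\<zeta> - z))"
proof (rule Bochner_Integration.integrable_bound[of _ "\<lambda>z. B * norm (g z)"])
  show "(\<lambda>z. g z * k (\<zeta> - z)) \<in> borel_measurable lborel" using g k by measurable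
  show "AE x in lborel. norm (g x * k (\<zeta> - x)) \<le> norm (B * norm (g x))"
  proof (rule AE_I2)
    fix x
    have "norm (g x) * norm (k (\<zeta> - x)) \<le> norm (g x) * B" by (intro mult_left_mono B) auto
    also have "\<dots> \<le> norm (B * norm (g x))" by (simp add: mult.commute)
    finally show "norm (g x * k (\<zeta> - x)) \<le> norm (B * norm (g x))" by (simp add: norm_mult)
  qed
qed (use g in auto)

lemma continuous_convolution:
  fixes g k :: "complex \<Rightarrow> complex"
  assumes g: "integrable lborel g" and k: "continuous_on UNIV k" and B: "\<And>u. cmod (k u) \<le> B"
  shows "continuous_on UNIV (\<lambda>\<zeta>. \<integral>z. g z * k (\<zeta> - z) \<partial>lborel)"
proof -
  have mk: "k \<in> borel_measurable borel" by (rule borel_measurable_continuous_onI[OF k])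
  have "isCont (\<lambda>\<zeta>. \<integral>z. g z * k (\<zeta> - z) \<partial>lborel) \<zeta>" for \<zeta>
  proof (rule continuous_at_sequentiallyI)
    fix X assume X: "X \<longlonglongrightarrow> \<zeta>"
    show "(\<lambda>n. \<integral>z. g z * k (X n - z) \<partial>lborel) \<longlonglongrightarrow> (\<integral>z. g z * k (\<zeta> - z) \<partial>lborel)"
    proof (rule integral_dominated_convergence[where w="\<lambda>z. B * norm (g z)"])
      show "AE z in lborel. (\<lambda>n. g z * k (X n - z)) \<longlonglongrightarrow> g z * k (\<zeta> - z)"
      proof (rule AE_I2)
        fix z
        have "(\<lambda>n. X n - z) \<longlonglongrightarrow> \<zeta> - z" by (intro tendsto_intros X)
        moreover have "isCont k (\<zeta> - z)" using k by (simp add: continuous_on_eq_continuous_at)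
        ultimately show "(\<lambda>n. g z * k (X n - z)) \<longlonglongrightarrow> g z * k (\<zeta> - z)"
          by (intro tendsto_mult tendsto_const) (rule isCont_tendsto_compose)
      qed
      show "AE z in lborel. norm (g z * k (X n - z)) \<le> B * norm (g z)" for n
        by (rule AE_I2) (simp add: norm_mult, metis B mult.commute mult_left_mono norm_ge_zero)
    qed (use g mk in auto)
  qed
  then show ?thesis by (simp add: continuous_at_imp_continuous_on)
qed

text \<open>All regularity comes from the kernel: its Lipschitz bound dominates the difference
  quotients by a multiple of \<open>|g|\<close>, so the density \<open>g\<close> only has to be
  integrable.\<close>

lemma has_wirtinger_convolution:
  assumes g: "integrable lborel g" and k: "\<And>u. has_wirtinger k (ka u) (kb u) u"
    and ca: "continuous_on UNIV ka" and cb: "continuous_on UNIV kb"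
    and B: "\<And>u. cmod (k u) \<le> B" and Ba: "\<And>u. cmod (ka u) \<le> B" and Bb: "\<And>u. cmod (kb u) \<le> B"
  shows "has_wirtinger (\<lambda>\<zeta>. \<integral>z. g z * k (\<zeta> - z) \<partial>lborel)
           (\<integral>z. g z * ka (\<zeta> - z) \<partial>lborel) (\<integral>z. g z * kb (\<zeta> - z) \<partial>lborel) \<zeta>"
proof -
  have ck: "continuous_on UNIV k" by (rule has_wirtinger_imp_continuous_on[OF k])
  note m = borel_measurable_continuous_onI[OF ck] borel_measurable_continuous_onI[OF ca] borel_measurable_continuous_onI[OF cb]
  note i = integrable_mult_bounded[OF g m(1) B] integrable_mult_bounded[OF g m(2) Ba] integrable_mult_bounded[OF g m(3) Bb]
  define F where "F = (\<lambda>\<zeta>. \<integral>z. g z * k (\<zeta> - z) \<partial>lborel)"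
  define D where "D h = (\<integral>z. g z * ka (\<zeta> - z) \<partial>lborel) * h + (\<integral>z. g z * kb (\<zeta> - z) \<partial>lborel) * cnj h" for h
  have bl: "bounded_linear D" unfolding D_def
    by (intro bounded_linear_add bounded_linear_mult_right bounded_linear_compose[OF bounded_linear_mult_right bounded_linear_cnj])
  have "((\<lambda>h. norm (F (\<zeta> + h) - F \<zeta> - D h) / norm h) \<longlongrightarrow> 0) (at 0)"
    unfolding tendsto_at_iff_sequentially
  proof (intro allI impI)
    fix h :: "nat \<Rightarrow> complex"
    assume h0: "\<forall>i. h i \<in> UNIV - {0}" and h: "h \<longlonglongrightarrow> 0"
    define E where "E n z = g z * ((k (\<zeta> + h n - z) - k (\<zeta> - z) - (ka (\<zeta> - z) * h n + kb (\<zeta> - z) * cnj (h n))) /\<^sub>R norm (h n))" for n z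
    have "(\<lambda>n. \<integral>z. E n z \<partial>lborel) \<longlonglongrightarrow> (\<integral>z. 0 \<partial>(lborel :: complex measure))"
    proof (rule integral_dominated_convergence[where w="\<lambda>z. (4 * B) * norm (g z)"])
      show "E n \<in> borel_measurable lborel" for n unfolding E_def using g m by measurable
      show "AE z in lborel. (\<lambda>n. E n z) \<longlonglongrightarrow> 0"
      proof (rule AE_I2)
        fix z
        have "((\<lambda>h. (k (\<zeta> - z + h) - k (\<zeta> - z) - (ka (\<zeta> - z) * h + kb (\<zeta> - z) * cnj h)) /\<^sub>R norm h) \<longlongrightarrow> 0) (at 0)"
          using k[of "\<zeta> - z"] unfolding has_wirtinger_def has_derivative_at
          by (subst tendsto_norm_zero_iff[symmetric]) (auto simp: divide_inverse mult.commute)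
        then have "(\<lambda>n. (k (\<zeta> - z + h n) - k (\<zeta> - z) - (ka (\<zeta> - z) * h n + kb (\<zeta> - z) * cnj (h n))) /\<^sub>R norm (h n)) \<longlonglongrightarrow> 0"
          unfolding tendsto_at_iff_sequentially using h0 h by (auto simp: o_def)
        from tendsto_mult[OF tendsto_const[of "g z"] this]
        show "(\<lambda>n. E n z) \<longlonglongrightarrow> 0" by (simp add: E_def algebra_simps)
      qed
      show "AE z in lborel. norm (E n z) \<le> (4 * B) * norm (g z)" for n
      proof (rule AE_I2)
        fix z
        have n0: "norm (h n) > 0" using h0 by auto
        have B2: "cmod (ka u) + cmod (kb u) \<le> 2 * B" for u using Ba[of u] Bb[of u] by simp
        have 1: "cmod (k (\<zeta> + h n - z) - k (\<zeta> - z)) \<le> (2 * B) * cmod (h n)"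
          using has_wirtinger_Lipschitz[OF k B2, of "\<zeta> + h n - z" "\<zeta> - z"] by (simp add: algebra_simps)
        have 2: "cmod (ka (\<zeta> - z) * h n + kb (\<zeta> - z) * cnj (h n)) \<le> (2 * B) * cmod (h n)"
        proof -
          have "cmod (ka (\<zeta> - z) * h n + kb (\<zeta> - z) * cnj (h n)) \<le> (cmod (ka (\<zeta> - z)) + cmod (kb (\<zeta> - z))) * cmod (h n)"
            by (rule order_trans[OF norm_triangle_ineq]) (simp add: norm_mult algebra_simps)
          also have "\<dots> \<le> (2 * B) * cmod (h n)" by (intro mult_right_mono B2) auto
          finally show ?thesis .
        qed
        have "cmod (k (\<zeta> + h n - z) - k (\<zeta> - z) - (ka (\<zeta> - z) * h n + kb (\<zeta> - z) * cnj (h n))) \<le> (4 * B) * cmod (h n)"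
          using 1 2 norm_triangle_ineq4[of "k (\<zeta> + h n - z) - k (\<zeta> - z)" "ka (\<zeta> - z) * h n + kb (\<zeta> - z) * cnj (h n)"] by linarith
        then have "cmod ((k (\<zeta> + h n - z) - k (\<zeta> - z) - (ka (\<zeta> - z) * h n + kb (\<zeta> - z) * cnj (h n))) /\<^sub>R norm (h n)) \<le> 4 * B"
          using n0 by (simp only: norm_scaleR abs_inverse abs_norm_cancel) (simp add: inverse_eq_divide pos_divide_le_eq)
        then show "norm (E n z) \<le> (4 * B) * norm (g z)"
          unfolding E_def norm_mult by (subst mult.commute) (intro mult_right_mono, auto)
      qed
    qed (use g in auto)
    then have lim: "(\<lambda>n. norm (\<integral>z. E n z \<partial>lborel)) \<longlonglongrightarrow> 0" by (simp add: tendsto_norm_zero)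
    have "norm (\<integral>z. E n z \<partial>lborel) = norm (F (\<zeta> + h n) - F \<zeta> - D (h n)) / norm (h n)" for n
    proof -
      have "(\<integral>z. E n z \<partial>lborel) = (\<integral>z. (g z * k (\<zeta> + h n - z) - g z * k (\<zeta> - z) - (g z * ka (\<zeta> - z) * h n + g z * kb (\<zeta> - z) * cnj (h n))) /\<^sub>R norm (h n) \<partial>lborel)"
        by (intro Bochner_Integration.integral_cong) (auto simp: E_def scaleR_conv_of_real algebra_simps)
      also have "\<dots> = (F (\<zeta> + h n) - F \<zeta> - D (h n)) /\<^sub>R norm (h n)"
        using i by (simp add: F_def D_def)
      finally show ?thesis by (simp add: divide_inverse mult.commute)
    qed
    with lim show "((\<lambda>h. norm (F (\<zeta> + h) - F \<zeta> - D h) / norm h) \<circ> h) \<longlonglongrightarrow> 0"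
      by (simp add: o_def)
  qed
  then have "(F has_derivative D) (at \<zeta>)" unfolding has_derivative_at using bl by simp
  then show ?thesis unfolding has_wirtinger_def F_def D_def .
qed

text \<open>An exponent of at least 2 makes the difference quotient at the kink 0 tend to 0, so
  truncation at 0 costs no first derivative.\<close>

lemma pos_power_has_real_derivative:
  "((\<lambda>x. (max 0 x) ^ Suc (Suc n)) has_real_derivative (real (Suc (Suc n)) * (max 0 x) ^ Suc n)) (at x)"
proof -
  consider "x > 0" | "x < 0" | "x = 0" by linarith
  then show ?thesis
  proof cases
    case 1
    have "((\<lambda>x. x ^ Suc (Suc n)) has_real_derivative (real (Suc (Suc n)) * x ^ Suc n)) (at x)"
      by (rule DERIV_pow[THEN DERIV_cong]) simp
    then have "((\<lambda>x. (max 0 x) ^ Suc (Suc n)) has_real_derivative (real (Suc (Suc n)) * x ^ Suc n)) (at x)"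
      by (rule has_field_derivative_transform_within_open[of _ _ _ "{0<..}"]) (use 1 in auto)
    then show ?thesis using 1 by (simp add: max_def)
  next
    case 2
    have "((\<lambda>x. (max 0 x) ^ Suc (Suc n)) has_real_derivative 0) (at x)"
      by (rule has_field_derivative_transform_within_open[of "\<lambda>x. 0" _ _ "{..<0}"]) (use 2 in auto)
    then show ?thesis using 2 by (simp add: max_def)
  next
    case 3
    have "((\<lambda>h::real. (max 0 h) ^ Suc (Suc n) / h) \<longlongrightarrow> 0) (at 0)"
    proof (rule Lim_null_comparison)
      show "\<forall>\<^sub>F h in at 0. norm ((max 0 h) ^ Suc (Suc n) / h) \<le> \<bar>h\<bar> ^ Suc n"
        by (rule always_eventually) (auto simp: max_def power_abs field_simps intro: mult_nonpos_nonneg)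
      have "((\<lambda>h::real. \<bar>h\<bar> ^ Suc n) \<longlongrightarrow> \<bar>0\<bar> ^ Suc n) (at 0)" by (intro tendsto_intros)
      then show "((\<lambda>h::real. \<bar>h\<bar> ^ Suc n) \<longlongrightarrow> 0) (at 0)" by simp
    qed
    then show ?thesis using 3 by (simp add: DERIV_def)
  qed
qed

section \<open>A bump function of class C2 in closed form\<close>

definition bump_base :: "complex \<Rightarrow> real" where
  "bump_base u = max 0 (1 - (cmod u)\<^sup>2)"

lemma bump_base_nonneg: "0 \<le> bump_base u" and bump_base_le_1: "bump_base u \<le> 1"
  by (auto simp: bump_base_def)

lemma bump_base_eq_0: "1 \<le> cmod u \<Longrightarrow> bump_base u = 0"
  using power_mono[of 1 "cmod u" 2] by (simp add: bump_base_def)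

lemma bump_base_pos: "cmod u < 1 \<Longrightarrow> bump_base u = 1 - (cmod u)\<^sup>2" and bump_base_pos': "cmod u < 1 \<Longrightarrow> 0 < bump_base u"
  using power_strict_mono[of "cmod u" 1 2] by (auto simp: bump_base_def)

lemma continuous_bump_base: "continuous_on S bump_base"
  unfolding bump_base_def by (intro continuous_intros)

lemma has_wirtinger_bump_base_power:
  "has_wirtinger (\<lambda>u. of_real (bump_base u) ^ Suc (Suc n))
     (- of_nat (Suc (Suc n)) * of_real (bump_base u) ^ Suc n * cnj u)
     (- of_nat (Suc (Suc n)) * of_real (bump_base u) ^ Suc n * u) u"
proof -
  have "has_wirtinger (\<lambda>u. complex_of_real ((max 0 (1 - (cmod u)\<^sup>2)) ^ Suc (Suc n)))
     (of_real (real (Suc (Suc n)) * (max 0 (1 - (cmod u)\<^sup>2)) ^ Suc n) * (0 - cnj u))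
     (of_real (real (Suc (Suc n)) * (max 0 (1 - (cmod u)\<^sup>2)) ^ Suc n) * (0 - u)) u"
  proof (rule has_wirtinger_real_chain[where F = "\<lambda>x. (max 0 x) ^ Suc (Suc n)"])
    show "has_wirtinger (\<lambda>z. complex_of_real (1 - (cmod z)\<^sup>2)) (0 - cnj u) (0 - u) u"
      using has_wirtinger_diff[OF has_wirtinger_const[of 1] has_wirtinger_norm2] by (simp only: of_real_diff of_real_1)
  qed (rule pos_power_has_real_derivative)
  then show ?thesis
    by (simp only: bump_base_def[symmetric] of_real_mult of_real_power of_real_of_nat_eq mult_minus_right diff_0 mult_minus_left)
qed

text \<open>The third power is the smallest natural power of \<open>bump_base\<close> with
  continuous second derivatives: one factor of \<open>bump_base\<close> is still left in each of
  them. Below, \<open>bump_zb\<close> is the mixed derivative, a quarter of the Laplacian.\<close>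

definition bump :: "complex \<Rightarrow> real" where "bump u = bump_base u ^ 3"

definition bump_z :: "complex \<Rightarrow> complex" where "bump_z u = - 3 * of_real (bump_base u) ^ 2 * cnj u"

definition bump_zz :: "complex \<Rightarrow> complex" where "bump_zz u = 6 * of_real (bump_base u) * cnj u * cnj u"

definition bump_zb :: "complex \<Rightarrow> real" where
  "bump_zb u = 6 * bump_base u * (cmod u)\<^sup>2 - 3 * (bump_base u)\<^sup>2"

lemma bump_nonneg: "0 \<le> bump u" and bump_le_1: "bump u \<le> 1"
  and bump_eq_0: "1 \<le> cmod u \<Longrightarrow> bump u = 0" and bump_pos: "cmod u < 1 \<Longrightarrow> 0 < bump u"
  by (auto simp: bump_def bump_base_nonneg bump_base_le_1 bump_base_eq_0 bump_base_pos' power_le_one)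

lemma has_wirtinger_bump: "has_wirtinger (\<lambda>u. of_real (bump u)) (bump_z u) (cnj (bump_z u)) u"
  using has_wirtinger_bump_base_power[of 1 u]
  by (simp add: bump_def bump_z_def eval_nat_numeral mult.assoc)

lemma has_wirtinger_bump_z: "has_wirtinger bump_z (bump_zz u) (of_real (bump_zb u)) u"
proof -
  have "has_wirtinger (\<lambda>u. (- 3 * cnj u) * of_real (bump_base u) ^ Suc (Suc 0))
     ((- 3 * cnj u) * (- of_nat (Suc (Suc 0)) * of_real (bump_base u) ^ Suc 0 * cnj u) + (-3 * 0 + 0 * cnj u) * of_real (bump_base u) ^ Suc (Suc 0))
     ((- 3 * cnj u) * (- of_nat (Suc (Suc 0)) * of_real (bump_base u) ^ Suc 0 * u) + (-3 * 1 + 0 * cnj u) * of_real (bump_base u) ^ Suc (Suc 0)) u"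
    by (intro has_wirtinger_mult has_wirtinger_const has_wirtinger_bump_base_power
        has_wirtinger_cnj[OF has_wirtinger_ident, simplified])
  then have "has_wirtinger (\<lambda>u. (- 3 * cnj u) * of_real (bump_base u) ^ Suc (Suc 0)) (bump_zz u) (of_real (bump_zb u)) u"
  proof (rule has_wirtinger_eq)
    have "of_real ((cmod u)\<^sup>2) = u * cnj u" by (rule complex_norm_square)
    then show "(- 3 * cnj u) * (- of_nat (Suc (Suc 0)) * of_real (bump_base u) ^ Suc 0 * u) + (-3 * 1 + 0 * cnj u) * of_real (bump_base u) ^ Suc (Suc 0) = complex_of_real (bump_zb u)"
      by (simp add: bump_zb_def power2_eq_square algebra_simps)
  qed (simp add: bump_zz_def algebra_simps)
  then show ?thesis
    by (rule has_wirtinger_transform[of _ _ _ _ UNIV]) (auto simp: bump_z_def eval_nat_numeral)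
qed

section \<open>A smoothed Cauchy kernel\<close>

text \<open>Away from 0 this is \<open>(1 - bump_base u ^ 4) / u\<close>; the polynomial removes the
  singularity at 0, by \<open>t * (4 - 6 * t + 4 * t^2 - t^3) = 1 - (1 - t)^4\<close> with
  \<open>t\<close> the square of \<open>cmod u\<close>. It agrees with the Cauchy kernel off the
  unit disc, and its dbar-derivative is \<open>4 * bump\<close>, a smoothing of the point mass
  \<open>pi\<close> that \<open>1 / u\<close> has at 0.\<close>

definition cauchy_ker :: "complex \<Rightarrow> complex" where
  "cauchy_ker u = (if cmod u < 1 then cnj u * of_real (4 - 6 * (cmod u)\<^sup>2 + 4 * (cmod u)^4 - (cmod u)^6) else 1 / u)"

definition cauchy_ker_z :: "complex \<Rightarrow> complex" where
  "cauchy_ker_z u = (if cmod u < 1 then (cnj u)\<^sup>2 * of_real (- 6 + 8 * (cmod u)\<^sup>2 - 3 * (cmod u)^4) else - 1 / u\<^sup>2)"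

definition cauchy_ker_zz :: "complex \<Rightarrow> complex" where
  "cauchy_ker_zz u = (if cmod u < 1 then (cnj u)^3 * of_real (8 - 6 * (cmod u)\<^sup>2) else 2 / u^3)"

definition cauchy_ker_zb :: "complex \<Rightarrow> complex" where
  "cauchy_ker_zb u = - 12 * of_real (bump_base u) ^ 2 * cnj u"

definition cauchy_ker_bb :: "complex \<Rightarrow> complex" where
  "cauchy_ker_bb u = - 12 * of_real (bump_base u) ^ 2 * u"

lemma has_wirtinger_radial_poly:
  assumes "\<And>x. (F has_real_derivative F' x) (at x)"
  shows "has_wirtinger (\<lambda>u. complex_of_real (F ((cmod u)\<^sup>2))) (of_real (F' ((cmod u)\<^sup>2)) * cnj u) (of_real (F' ((cmod u)\<^sup>2)) * u) u"
  by (rule has_wirtinger_real_chain[OF has_wirtinger_norm2 assms])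

lemma cnj_eq_norm_div: "u \<noteq> 0 \<Longrightarrow> cnj u = of_real ((cmod u)\<^sup>2) / u"
  by (simp only: complex_norm_square) simp

lemma cauchy_ker_alt:
  assumes "u \<noteq> 0" shows "cauchy_ker u = (1 - of_real (bump_base u) ^ 4) / u"
proof (cases "cmod u < 1")
  case True
  define t where "t = (cmod u)\<^sup>2"
  have t: "(cmod u)^4 = t^2" "(cmod u)^6 = t^3" by (auto simp: t_def power_mult[symmetric])
  have id: "t * (4 - 6 * t + 4 * t^2 - t^3) = 1 - (1 - t)^4"
    by (simp add: eval_nat_numeral algebra_simps)
  have "cauchy_ker u = of_real (t * (4 - 6 * t + 4 * t^2 - t^3)) / u"
    using True by (simp add: cauchy_ker_def t t_def[symmetric] cnj_eq_norm_div[OF assms])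
  also have "\<dots> = of_real (1 - (1 - t)^4) / u" by (simp only: id)
  finally show ?thesis using True by (simp add: bump_base_pos t_def)
qed (simp add: cauchy_ker_def bump_base_eq_0)

lemma cauchy_ker_z_alt:
  assumes "u \<noteq> 0"
  shows "cauchy_ker_z u = (of_real (bump_base u) ^ 4 - 1) / u\<^sup>2 + 4 * of_real (bump_base u) ^ 3 * cnj u / u"
proof (cases "cmod u < 1")
  case True
  define t where "t = (cmod u)\<^sup>2"
  have t: "(cmod u)^4 = t^2" by (auto simp: t_def power_mult[symmetric])
  have id: "t^2 * (- 6 + 8 * t - 3 * t^2) = ((1 - t)^4 - 1) + 4 * (1 - t)^3 * t"
    by (simp add: eval_nat_numeral algebra_simps)
  have "cauchy_ker_z u = of_real (t^2 * (- 6 + 8 * t - 3 * t^2)) / u^2"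
    using True by (simp add: cauchy_ker_z_def t t_def[symmetric] cnj_eq_norm_div[OF assms] power_divide)
  also have "\<dots> = of_real (((1 - t)^4 - 1) + 4 * (1 - t)^3 * t) / u\<^sup>2"
    by (simp only: id)
  also have "\<dots> = (of_real (1 - t) ^ 4 - 1) / u\<^sup>2 + 4 * of_real (1 - t) ^ 3 * (of_real t / u) / u"
    by (simp add: add_divide_distrib diff_divide_distrib power2_eq_square mult_ac)
  finally show ?thesis using True by (simp add: bump_base_pos t_def[symmetric] cnj_eq_norm_div[OF assms])
qed (simp add: cauchy_ker_z_def bump_base_eq_0)

lemma cauchy_ker_zz_alt:
  assumes "u \<noteq> 0"
  shows "cauchy_ker_zz u = - 8 * of_real (bump_base u) ^ 3 * cnj u / u\<^sup>2 - 2 * (of_real (bump_base u) ^ 4 - 1) / u^3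
    - 12 * of_real (bump_base u) ^ 2 * (cnj u)\<^sup>2 / u"
proof (cases "cmod u < 1")
  case True
  define t where "t = (cmod u)\<^sup>2"
  have id: "t^3 * (8 - 6 * t) = - 8 * (1 - t)^3 * t - 2 * ((1 - t)^4 - 1) - 12 * (1 - t)\<^sup>2 * t\<^sup>2"
    by (simp add: eval_nat_numeral algebra_simps)
  have "cauchy_ker_zz u = of_real (t^3 * (8 - 6 * t)) / u^3"
    using True by (simp add: cauchy_ker_zz_def t_def[symmetric] cnj_eq_norm_div[OF assms] power_divide)
  also have "\<dots> = of_real (- 8 * (1 - t)^3 * t - 2 * ((1 - t)^4 - 1) - 12 * (1 - t)\<^sup>2 * t\<^sup>2) / u^3"
    by (simp only: id)
  also have "\<dots> = - 8 * of_real (1 - t) ^ 3 * (of_real t / u) / u\<^sup>2 - 2 * (of_real (1 - t) ^ 4 - 1) / u^3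
    - 12 * of_real (1 - t) ^ 2 * (of_real t / u)\<^sup>2 / u"
    using assms by (simp add: diff_divide_distrib power_divide eval_nat_numeral mult_ac)
  finally show ?thesis using True by (simp add: bump_base_pos t_def[symmetric] cnj_eq_norm_div[OF assms])
qed (simp add: cauchy_ker_zz_def bump_base_eq_0)

text \<open>The polynomial expression is differentiated inside the open unit disc and the quotient
  of \<open>cauchy_ker_alt\<close> away from 0. These two open sets cover the plane, so nothing has
  to be matched along the unit circle. The derivative of \<open>cauchy_ker_z\<close> is treated in
  the same way.\<close>

lemma has_wirtinger_cauchy_ker: "has_wirtinger cauchy_ker (cauchy_ker_z u) (4 * of_real (bump u)) u"
proof (cases "cmod u < 1")
  case True
  define F where "F = (\<lambda>t::real. 4 - 6 * t + 4 * t^2 - t^3)"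
  have "has_wirtinger (\<lambda>u. cnj u * complex_of_real (F ((cmod u)\<^sup>2)))
     (cnj u * (of_real (- 6 + 8 * (cmod u)\<^sup>2 - 3 * ((cmod u)\<^sup>2)^2) * cnj u) + 0 * of_real (F ((cmod u)\<^sup>2)))
     (cnj u * (of_real (- 6 + 8 * (cmod u)\<^sup>2 - 3 * ((cmod u)\<^sup>2)^2) * u) + 1 * of_real (F ((cmod u)\<^sup>2))) u"
    by (intro has_wirtinger_mult has_wirtinger_radial_poly[of F "\<lambda>t. - 6 + 8 * t - 3 * t^2"]
        has_wirtinger_cnj[OF has_wirtinger_ident, simplified])
       (auto simp: F_def intro!: derivative_eq_intros)
  then have "has_wirtinger (\<lambda>u. cnj u * complex_of_real (F ((cmod u)\<^sup>2))) (cauchy_ker_z u) (4 * of_real (bump u)) u"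
  proof (rule has_wirtinger_eq)
    have "cnj u * (of_real (- 6 + 8 * (cmod u)\<^sup>2 - 3 * ((cmod u)\<^sup>2)^2) * u) =
      of_real ((cmod u)\<^sup>2) * of_real (- 6 + 8 * (cmod u)\<^sup>2 - 3 * ((cmod u)\<^sup>2)^2)"
      by (simp only: complex_norm_square mult_ac)
    then show "cnj u * (of_real (- 6 + 8 * (cmod u)\<^sup>2 - 3 * ((cmod u)\<^sup>2)^2) * u) + 1 * of_real (F ((cmod u)\<^sup>2)) = 4 * of_real (bump u)"
      using True by (simp add: bump_def bump_base_pos F_def eval_nat_numeral algebra_simps)
  qed (use True in \<open>simp add: cauchy_ker_z_def power2_eq_square mult_ac\<close>, simp add: eval_nat_numeral mult_ac)
  then show ?thesis
    by (rule has_wirtinger_transform[of _ _ _ _ "ball 0 1"])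
       (use True in \<open>auto simp: cauchy_ker_def F_def power_mult[symmetric]\<close>)
next
  case False
  then have u: "u \<noteq> 0" by auto
  have inv: "((\<lambda>u. 1 / u) has_field_derivative (- 1 / u\<^sup>2)) (at u)"
    using u by (auto intro!: derivative_eq_intros simp: power2_eq_square)
  have "has_wirtinger (\<lambda>u. (1 - of_real (bump_base u) ^ Suc (Suc 2)) * (1 / u))
    ((1 - of_real (bump_base u) ^ Suc (Suc 2)) * (- 1 / u\<^sup>2) + (0 - (- of_nat (Suc (Suc 2)) * of_real (bump_base u) ^ Suc 2 * cnj u)) * (1 / u))
    ((1 - of_real (bump_base u) ^ Suc (Suc 2)) * 0 + (0 - (- of_nat (Suc (Suc 2)) * of_real (bump_base u) ^ Suc 2 * u)) * (1 / u)) u"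
    by (intro has_wirtinger_mult has_wirtinger_diff has_wirtinger_const has_wirtinger_bump_base_power has_wirtinger_field_derivative inv)
  then have "has_wirtinger (\<lambda>u. (1 - of_real (bump_base u) ^ Suc (Suc 2)) * (1 / u)) (cauchy_ker_z u) (4 * of_real (bump u)) u"
    by (rule has_wirtinger_eq) (use u in \<open>auto simp: cauchy_ker_z_alt bump_def eval_nat_numeral field_simps\<close>)
  then show ?thesis
    by (rule has_wirtinger_transform[of _ _ _ _ "- {0}"]) (use u in \<open>auto simp: cauchy_ker_alt\<close>)
qed

lemma has_wirtinger_cauchy_ker_z: "has_wirtinger cauchy_ker_z (cauchy_ker_zz u) (cauchy_ker_zb u) u"
proof (cases "cmod u < 1")
  case True
  define F where "F = (\<lambda>t::real. - 6 + 8 * t - 3 * t^2)"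
  have "has_wirtinger (\<lambda>u. (cnj u * cnj u) * complex_of_real (F ((cmod u)\<^sup>2)))
     ((cnj u * cnj u) * (of_real (8 - 6 * (cmod u)\<^sup>2) * cnj u) + (cnj u * 0 + 0 * cnj u) * of_real (F ((cmod u)\<^sup>2)))
     ((cnj u * cnj u) * (of_real (8 - 6 * (cmod u)\<^sup>2) * u) + (cnj u * 1 + 1 * cnj u) * of_real (F ((cmod u)\<^sup>2))) u"
    by (intro has_wirtinger_mult has_wirtinger_radial_poly[of F "\<lambda>t. 8 - 6 * t"]
        has_wirtinger_cnj[OF has_wirtinger_ident, simplified])
       (auto simp: F_def intro!: derivative_eq_intros)
  then have "has_wirtinger (\<lambda>u. (cnj u * cnj u) * complex_of_real (F ((cmod u)\<^sup>2))) (cauchy_ker_zz u) (cauchy_ker_zb u) u"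
  proof (rule has_wirtinger_eq)
    have "(cnj u * cnj u) * (of_real (8 - 6 * (cmod u)\<^sup>2) * u) =
      cnj u * (of_real ((cmod u)\<^sup>2) * of_real (8 - 6 * (cmod u)\<^sup>2))"
      by (simp only: complex_norm_square mult_ac)
    then show "(cnj u * cnj u) * (of_real (8 - 6 * (cmod u)\<^sup>2) * u) + (cnj u * 1 + 1 * cnj u) * of_real (F ((cmod u)\<^sup>2)) = cauchy_ker_zb u"
      using True by (simp add: cauchy_ker_zb_def bump_base_pos F_def eval_nat_numeral algebra_simps)
  qed (use True in \<open>simp add: cauchy_ker_zz_def eval_nat_numeral mult_ac\<close>)
  then show ?thesis
    by (rule has_wirtinger_transform[of _ _ _ _ "ball 0 1"])
       (use True in \<open>auto simp: cauchy_ker_z_def F_def power_mult[symmetric] power2_eq_square[of "cnj _"]\<close>)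
next
  case False
  then have u: "u \<noteq> 0" by auto
  have inv: "((\<lambda>u. 1 / u) has_field_derivative (- 1 / u\<^sup>2)) (at u)"
    using u by (auto intro!: derivative_eq_intros simp: power2_eq_square)
  have inv2: "((\<lambda>u. 1 / u\<^sup>2) has_field_derivative (- 2 / u^3)) (at u)"
    using u by (auto intro!: derivative_eq_intros simp: eval_nat_numeral field_simps)
  let ?s = "complex_of_real (bump_base u)"
  have "has_wirtinger (\<lambda>u. (of_real (bump_base u) ^ Suc (Suc 2) - 1) * (1 / u\<^sup>2) + (4 * of_real (bump_base u) ^ Suc (Suc 1)) * (cnj u * (1 / u)))
    (((?s ^ Suc (Suc 2) - 1) * (- 2 / u^3) + ((- of_nat (Suc (Suc 2)) * ?s ^ Suc 2 * cnj u) - 0) * (1 / u\<^sup>2)) +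
      ((4 * ?s ^ Suc (Suc 1)) * (cnj u * (- 1 / u\<^sup>2) + 0 * (1 / u)) + (4 * (- of_nat (Suc (Suc 1)) * ?s ^ Suc 1 * cnj u) + 0 * ?s ^ Suc (Suc 1)) * (cnj u * (1/u))))
    (((?s ^ Suc (Suc 2) - 1) * 0 + ((- of_nat (Suc (Suc 2)) * ?s ^ Suc 2 * u) - 0) * (1 / u\<^sup>2)) +
      ((4 * ?s ^ Suc (Suc 1)) * (cnj u * 0 + 1 * (1 / u)) + (4 * (- of_nat (Suc (Suc 1)) * ?s ^ Suc 1 * u) + 0 * ?s ^ Suc (Suc 1)) * (cnj u * (1/u)))) u"
    by (intro has_wirtinger_add has_wirtinger_mult has_wirtinger_diff has_wirtinger_const has_wirtinger_bump_base_power
        has_wirtinger_field_derivative inv inv2 has_wirtinger_cnj[OF has_wirtinger_ident, simplified])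
  then have "has_wirtinger (\<lambda>u. (of_real (bump_base u) ^ Suc (Suc 2) - 1) * (1 / u\<^sup>2) + (4 * of_real (bump_base u) ^ Suc (Suc 1)) * (cnj u * (1 / u)))
     (cauchy_ker_zz u) (cauchy_ker_zb u) u"
    by (rule has_wirtinger_eq)
       (use u in \<open>simp add: cauchy_ker_zz_alt eval_nat_numeral field_simps\<close>,
        use u in \<open>simp add: cauchy_ker_zb_def eval_nat_numeral field_simps\<close>)
  then show ?thesis
    by (rule has_wirtinger_transform[of _ _ _ _ "- {0}"]) (use u in \<open>auto simp: cauchy_ker_z_alt eval_nat_numeral\<close>)
qed

lemma has_wirtinger_cauchy_ker_b:
  "has_wirtinger (\<lambda>u. 4 * of_real (bump u)) (cauchy_ker_zb u) (cauchy_ker_bb u) u"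
  using has_wirtinger_mult[OF has_wirtinger_const[of 4] has_wirtinger_bump]
  by (rule has_wirtinger_eq) (auto simp: bump_z_def cauchy_ker_zb_def cauchy_ker_bb_def)

lemma continuous_cauchy_ker_zz: "continuous_on UNIV cauchy_ker_zz"
proof -
  have "continuous_on (ball 0 1) (\<lambda>u. (cnj u)^3 * complex_of_real (8 - 6 * (cmod u)\<^sup>2))"
    by (intro continuous_intros)
  then have 1: "continuous_on (ball 0 1) cauchy_ker_zz"
    by (rule continuous_on_eq) (auto simp: cauchy_ker_zz_def)
  have "continuous_on (- {0}) (\<lambda>u. - 8 * of_real (bump_base u) ^ 3 * cnj u / u\<^sup>2 - 2 * (of_real (bump_base u) ^ 4 - 1) / u^3
    - 12 * of_real (bump_base u) ^ 2 * (cnj u)\<^sup>2 / u)"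
    by (intro continuous_intros continuous_bump_base) auto
  then have 2: "continuous_on (- {0}) cauchy_ker_zz"
    by (rule continuous_on_eq) (auto simp: cauchy_ker_zz_alt)
  have "continuous_on (ball 0 1 \<union> - {0}) cauchy_ker_zz"
    by (rule continuous_on_open_Un[OF _ _ 1 2]) auto
  moreover have "ball 0 1 \<union> - {0} = (UNIV :: complex set)" by auto
  ultimately show ?thesis by simp
qed

section \<open>Subharmonic functions on the plane\<close>

text \<open>Where \<open>u \<le> C\<close>, this is the nonnegative function \<open>C - u\<close>,
  with value \<open>\<infinity>\<close> where \<open>u\<close> is \<open>- \<infinity>\<close>.
  Means of \<open>u\<close> become integrals of nonnegative functions, to which Fubini's theorem
  applies before anything is known about integrability of \<open>u\<close>.\<close>

definition neg_shift :: "real \<Rightarrow> (complex \<Rightarrow> ereal) \<Rightarrow> complex \<Rightarrow> ennreal" where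
  "neg_shift C u z = e2ennreal (ereal C - u z)"

lemma usc_borel_measurable:
  assumes "upper_semicontinuous_on UNIV u" shows "u \<in> borel_measurable borel"
proof (rule borel_measurableI_less)
  fix y show "{x \<in> space borel. u x < y} \<in> sets borel"
    using assms by (auto simp: upper_semicontinuous_on_def intro!: borel_open)
qed

lemma usc_bounded_above:
  assumes "upper_semicontinuous_on UNIV u" "compact S" "\<And>z. z \<in> S \<Longrightarrow> u z \<noteq> \<infinity>"
  obtains C where "0 \<le> C" "\<And>z. z \<in> S \<Longrightarrow> u z < ereal C"
proof -
  define A where "A n = {z. u z < ereal (real n)}" for n :: nat
  have "open (A n)" for n using assms(1) by (auto simp: upper_semicontinuous_on_def A_def)
  moreover have "S \<subseteq> (\<Union>n. A n)"
  proof
    fix z assume "z \<in> S"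
    then have "u z \<noteq> \<infinity>" by (rule assms(3))
    then obtain n where "u z < ereal (real n)" by (metis less_PInf_Ex_of_nat)
    then show "z \<in> (\<Union>n. A n)" by (auto simp: A_def)
  qed
  ultimately obtain F where F: "finite F" "S \<subseteq> (\<Union>n\<in>F. A n)"
    using compactE_image[OF assms(2), of UNIV A] by auto
  show ?thesis
  proof (rule that[of "real (Max (insert 0 F))"])
    fix z assume "z \<in> S"
    then obtain n where n: "n \<in> F" "u z < ereal (real n)" using F by (auto simp: A_def)
    have "n \<le> Max (insert 0 F)" using F n by (intro Max_ge) auto
    then show "u z < ereal (real (Max (insert 0 F)))" using n(2) by (simp add: order_less_le_trans)
  qed simp
qed

lemma neg_shift_measurable [measurable]:
  "u \<in> borel_measurable borel \<Longrightarrow> neg_shift C u \<in> borel_measurable borel"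
  unfolding neg_shift_def by measurable

text \<open>The identity \<open>(C - u) + u+ = u- + C\<close>, with \<open>u+\<close> and
  \<open>u-\<close> the positive and negative parts, contains no subtraction of infinities.
  Integrated over the circle it relates the two integrals in \<open>circle_mean\<close> to that of
  \<open>neg_shift\<close>; the integral of \<open>u+\<close> is finite by the bound
  \<open>C\<close>, and the other two are finite or infinite together.\<close>

lemma submean_iff_neg_shift:
  assumes m: "u \<in> borel_measurable borel" and C: "0 \<le> C" and uC: "\<And>t. u (z + rcis r t) \<le> ereal C" and uz: "u z \<le> ereal C"
  shows "u z \<le> circle_mean u z r \<longleftrightarrow> (\<integral>\<^sup>+t\<in>{0..2*pi}. neg_shift C u (z + rcis r t) \<partial>lborel) \<le> ennreal (2 * pi) * neg_shift C u z"
proof -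
  have cont: "continuous_on UNIV (\<lambda>t. z + rcis r t)" unfolding rcis_def cis.ctr Complex_eq by (intro continuous_intros)
  have mr: "(\<lambda>t. z + rcis r t) \<in> borel_measurable borel" by (rule borel_measurable_continuous_onI[OF cont])
  have mu [measurable]: "(\<lambda>t. u (z + rcis r t)) \<in> borel_measurable borel" by (rule measurable_compose[OF mr m])
  define A where "A = (\<integral>\<^sup>+t\<in>{0..2*pi}. e2ennreal (u (z + rcis r t)) \<partial>lborel)"
  define B where "B = (\<integral>\<^sup>+t\<in>{0..2*pi}. e2ennreal (- u (z + rcis r t)) \<partial>lborel)"
  define I where "I = (\<integral>\<^sup>+t\<in>{0..2*pi}. neg_shift C u (z + rcis r t) \<partial>lborel)"
  have ind: "(\<integral>\<^sup>+t\<in>{0..2*pi}. ennreal C \<partial>lborel) = ennreal (2 * pi * C)"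
    using C by (simp add: nn_integral_cmult_indicator ennreal_mult[symmetric] mult.commute)
  have A: "A \<le> ennreal (2 * pi * C)" unfolding A_def ind[symmetric]
  proof (intro nn_integral_mono mult_right_mono)
    fix t show "e2ennreal (u (z + rcis r t)) \<le> ennreal C"
      using e2ennreal_mono[OF uC[of t]] by simp
  qed simp
  have pw: "neg_shift C u w + e2ennreal (u w) = e2ennreal (- u w) + ennreal C" if "u w \<le> ereal C" for w
  proof (cases "u w")
    case (real x)
    then have x: "x \<le> C" using that by simp
    show ?thesis
    proof (cases "0 \<le> x")
      case True
      then show ?thesis using x by (simp add: neg_shift_def real ennreal_neg ennreal_plus[symmetric] del: ennreal_plus)
    next
      case False
      then show ?thesis using x C by (simp add: neg_shift_def real ennreal_neg ennreal_plus[symmetric] del: ennreal_plus)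
    qed
  qed (use that in \<open>auto simp: neg_shift_def\<close>)
  have IA: "I + A = B + ennreal (2 * pi * C)"
  proof -
    have "I + A = (\<integral>\<^sup>+t. neg_shift C u (z + rcis r t) * indicator {0..2*pi} t + e2ennreal (u (z + rcis r t)) * indicator {0..2*pi} t \<partial>lborel)"
      unfolding I_def A_def neg_shift_def by (intro nn_integral_add[symmetric]) measurable
    also have "\<dots> = (\<integral>\<^sup>+t. e2ennreal (- u (z + rcis r t)) * indicator {0..2*pi} t + ennreal C * indicator {0..2*pi} t \<partial>lborel)"
      by (intro nn_integral_cong) (simp add: distrib_right[symmetric] pw[OF uC])
    also have "\<dots> = B + ennreal (2 * pi * C)"
      unfolding B_def ind[symmetric] by (intro nn_integral_add) measurable
    finally show ?thesis .
  qed
  have Afin: "A < \<infinity>" using A by (auto intro: le_less_trans)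
  have cm: "circle_mean u z r = (enn2ereal A - enn2ereal B) / ereal (2 * pi)"
    by (simp add: circle_mean_def A_def B_def)
  show ?thesis
  proof (cases "B = \<infinity>")
    case True
    have Iinf: "I = \<infinity>" using IA True Afin by (auto simp: top_add ennreal_add_eq_top)
    obtain a where a: "A = ennreal a" "0 \<le> a" using Afin by (cases A) auto
    have "circle_mean u z r = - \<infinity>" unfolding cm True a using a(2) by (simp add: enn2ereal_ennreal)
    moreover have "u z = - \<infinity> \<longleftrightarrow> neg_shift C u z = \<infinity>"
      using uz by (cases "u z") (auto simp: neg_shift_def)
    ultimately show ?thesis unfolding I_def[symmetric] Iinf
      by (auto simp: ennreal_mult_eq_top_iff top_unique)
  next
    case False
    then obtain b where b: "B = ennreal b" "0 \<le> b" by (cases B) auto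
    obtain a where a: "A = ennreal a" "0 \<le> a" using Afin by (cases A) auto
    have "I \<noteq> \<infinity>" using IA b a by (metis ennreal_add_eq_top ennreal_neq_top infinity_ennreal_def)
    then obtain i where i: "I = ennreal i" "0 \<le> i" by (cases I) auto
    have eq: "i + a = b + 2 * pi * C" using IA a b i C
      by (simp add: ennreal_plus[symmetric] del: ennreal_plus)
    have cm': "circle_mean u z r = ereal ((a - b) / (2 * pi))"
      unfolding cm a b using a(2) b(2) by (simp add: enn2ereal_ennreal)
    show ?thesis
    proof (cases "u z")
      case (real x)
      then have xC: "x \<le> C" using uz by simp
      have "x \<le> (a - b) / (2 * pi) \<longleftrightarrow> i \<le> 2 * pi * (C - x)"
        using eq by (intro iffI; simp add: field_simps)
      moreover have "neg_shift C u z = ennreal (C - x)" by (simp add: neg_shift_def real)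
      ultimately show ?thesis using xC unfolding I_def[symmetric] i cm' real
        by (simp add: ennreal_mult[symmetric] ennreal_le_iff)
    next
      case MInf
      then show ?thesis by (simp add: neg_shift_def ennreal_mult_eq_top_iff ennreal_mult_top)
    qed (use uz in auto)
  qed
qed

lemma nn_integral_periodic_shift:
  fixes f :: "real \<Rightarrow> ennreal"
  assumes m [measurable]: "f \<in> borel_measurable borel" and p: "\<And>t. f (t + 2 * pi) = f t" and \<theta>: "0 \<le> \<theta>" "\<theta> \<le> 2 * pi"
  shows "(\<integral>\<^sup>+t\<in>{0..2*pi}. f (t + \<theta>) \<partial>lborel) = (\<integral>\<^sup>+t\<in>{0..2*pi}. f t \<partial>lborel)"
proof -
  have half: "(\<integral>\<^sup>+t\<in>{0..2*pi}. g t \<partial>lborel) = (\<integral>\<^sup>+t\<in>{0..<2*pi}. g t \<partial>lborel)" for g :: "real \<Rightarrow> ennreal"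
    by (rule nn_integral_cong_AE, rule AE_mp[OF AE_lborel_singleton[of "2 * pi"]], rule AE_I2)
       (auto simp: indicator_def)
  have "(\<integral>\<^sup>+t\<in>{0..<2*pi}. f (t + \<theta>) \<partial>lborel) = (\<integral>\<^sup>+t. (f (\<theta> + t) * indicator {\<theta>..<\<theta>+2*pi} (\<theta> + t)) \<partial>lborel)"
    by (intro nn_integral_cong) (auto simp: indicator_def add.commute)
  also have "\<dots> = (\<integral>\<^sup>+s. f s * indicator {\<theta>..<\<theta>+2*pi} s \<partial>lborel)"
    by (rule nn_integral_shift[of "\<lambda>s. f s * indicator {\<theta>..<\<theta>+2*pi} s"]) measurable
  also have "\<dots> = (\<integral>\<^sup>+s. f s * indicator {\<theta>..<2*pi} s + f s * indicator {2*pi..<2*pi+\<theta>} s \<partial>lborel)"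
    using \<theta> by (intro nn_integral_cong) (auto simp: indicator_def)
  also have "\<dots> = (\<integral>\<^sup>+s. f s * indicator {\<theta>..<2*pi} s \<partial>lborel) + (\<integral>\<^sup>+s. f s * indicator {2*pi..<2*pi+\<theta>} s \<partial>lborel)"
    by (rule nn_integral_add) measurable
  also have "(\<integral>\<^sup>+s. f s * indicator {2*pi..<2*pi+\<theta>} s \<partial>lborel) = (\<integral>\<^sup>+s. f (2 * pi + s) * indicator {2*pi..<2*pi+\<theta>} (2 * pi + s) \<partial>lborel)"
    by (rule nn_integral_shift[symmetric, of "\<lambda>s. f s * indicator {2*pi..<2*pi+\<theta>} s"]) measurable
  also have "\<dots> = (\<integral>\<^sup>+s. f s * indicator {0..<\<theta>} s \<partial>lborel)"
    using p by (intro nn_integral_cong) (auto simp: indicator_def add.commute)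
  also have "(\<integral>\<^sup>+s. f s * indicator {\<theta>..<2*pi} s \<partial>lborel) + (\<integral>\<^sup>+s. f s * indicator {0..<\<theta>} s \<partial>lborel)
     = (\<integral>\<^sup>+s. f s * indicator {\<theta>..<2*pi} s + f s * indicator {0..<\<theta>} s \<partial>lborel)"
    by (rule nn_integral_add[symmetric]) measurable
  also have "\<dots> = (\<integral>\<^sup>+s. f s * indicator {0..<2*pi} s \<partial>lborel)"
    using \<theta> by (intro nn_integral_cong) (auto simp: indicator_def)
  finally show ?thesis unfolding half .
qed

text \<open>Averaging the circle inequality over all radii, without polar coordinates: the left-hand
  side does not change when \<open>w\<close> is rotated by \<open>cis t\<close>, so it may be
  averaged over \<open>t\<close>, and Fubini's theorem produces for every \<open>w\<close> a mean
  over the circle of radius \<open>cmod w\<close>.\<close>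

lemma neg_shift_area_mean:
  assumes u: "subharmonic_on UNIV u" and C: "0 \<le> C" and uC: "\<And>w. w \<in> cball z R \<Longrightarrow> u w \<le> ereal C"
    and k [measurable]: "k \<in> borel_measurable borel" and radial: "\<And>c w. cmod c = 1 \<Longrightarrow> k (c * w) = k w"
    and supp: "\<And>w. R < cmod w \<Longrightarrow> k w = 0"
  shows "(\<integral>\<^sup>+w. k w * neg_shift C u (z + w) \<partial>lborel) \<le> (\<integral>\<^sup>+w. k w \<partial>lborel) * neg_shift C u z"
proof -
  have mu [measurable]: "u \<in> borel_measurable borel"
    using u by (intro usc_borel_measurable) (simp add: subharmonic_on_def)
  define T where "T = neg_shift C u"
  have T [measurable]: "T \<in> borel_measurable borel" unfolding T_def by measurable
  have cc [measurable]: "cis \<in> borel_measurable borel"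
    unfolding cis.ctr Complex_eq by (intro borel_measurable_continuous_onI continuous_intros)
  have circ: "(\<integral>\<^sup>+t\<in>{0..2*pi}. T (z + cis t * w) \<partial>lborel) \<le> ennreal (2 * pi) * T z" if w: "cmod w \<le> R" for w
  proof (cases "w = 0")
    case True
    have "(\<integral>\<^sup>+t\<in>{0..2*pi}. T (z + cis t * w) \<partial>lborel) = T z * ennreal (2 * pi)"
      using True by (simp add: nn_integral_cmult_indicator)
    then show ?thesis by (simp add: mult.commute)
  next
    case False
    define r where "r = cmod w"
    have r: "0 < r" "r \<le> R" using False w by (auto simp: r_def)
    \<comment> \<open>The orbit of \<open>w\<close> under rotation starts at the argument of
      \<open>w\<close>; this phase is absorbed by periodicity.\<close>
    obtain \<theta> where \<theta>: "w = of_real r * cis \<theta>" "0 \<le> \<theta>" "\<theta> \<le> 2 * pi"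
    proof -
      obtain t where "0 \<le> t" "t < 2 * pi" "w = of_real r * exp (\<i> * of_real t)"
        using Arg2pi_ge_0 Arg2pi_lt_2pi Arg2pi_eq by (metis r_def)
      then show ?thesis using that[of t] by (simp add: cis_conv_exp)
    qed
    have "(\<integral>\<^sup>+t\<in>{0..2*pi}. T (z + cis t * w) \<partial>lborel) = (\<integral>\<^sup>+t\<in>{0..2*pi}. T (z + rcis r (t + \<theta>)) \<partial>lborel)"
      by (intro nn_integral_cong) (simp add: \<theta>(1) rcis_def cis_mult[symmetric] mult_ac)
    also have "\<dots> = (\<integral>\<^sup>+t\<in>{0..2*pi}. T (z + rcis r t) \<partial>lborel)"
    proof (rule nn_integral_periodic_shift[OF _ _ \<theta>(2,3)])
      show "(\<lambda>t. T (z + rcis r t)) \<in> borel_measurable borel" unfolding rcis_def by measurable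
      show "T (z + rcis r (t + 2 * pi)) = T (z + rcis r t)" for t
        by (simp add: rcis_def cis_mult[symmetric])
    qed
    also have "\<dots> \<le> ennreal (2 * pi) * T z"
      unfolding T_def
    proof (rule submean_iff_neg_shift[THEN iffD1, OF mu C])
      show "u (z + rcis r t) \<le> ereal C" for t
        using r by (intro uC) (simp add: dist_norm)
      show "u z \<le> ereal C" using r by (intro uC) simp
      show "u z \<le> circle_mean u z r" using u r by (auto simp: subharmonic_on_def)
    qed
    finally show ?thesis .
  qed
  have "ennreal (2 * pi) * (\<integral>\<^sup>+w. k w * T (z + w) \<partial>lborel) = (\<integral>\<^sup>+t\<in>{0..2*pi}. (\<integral>\<^sup>+w. k w * T (z + w) \<partial>lborel) \<partial>lborel)"
  proof -
    have "(\<integral>\<^sup>+t\<in>{0..2*pi}. c \<partial>lborel) = c * ennreal (2 * pi)" for c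
      by (simp add: nn_integral_cmult_indicator)
    then show ?thesis by (simp only: mult.commute[of _ "ennreal (2 * pi)"])
  qed
  also have "\<dots> = (\<integral>\<^sup>+t. (\<integral>\<^sup>+w. k w * T (z + cis t * w) * indicator {0..2*pi} t \<partial>lborel) \<partial>lborel)"
  proof (rule nn_integral_cong)
    fix t
    have "(\<integral>\<^sup>+w. k w * T (z + w) \<partial>lborel) = (\<integral>\<^sup>+w. k (cis t * w) * T (z + cis t * w) \<partial>lborel)"
      by (rule nn_integral_mult_unit[symmetric, of "\<lambda>w. k w * T (z + w)"]) auto
    also have "\<dots> = (\<integral>\<^sup>+w. k w * T (z + cis t * w) \<partial>lborel)" by (simp add: radial)
    finally show "(\<integral>\<^sup>+w. k w * T (z + w) \<partial>lborel) * indicator {0..2*pi} t = (\<integral>\<^sup>+w. k w * T (z + cis t * w) * indicator {0..2*pi} t \<partial>lborel)"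
      by (simp add: nn_integral_multc)
  qed
  also have "\<dots> = (\<integral>\<^sup>+w. (\<integral>\<^sup>+t. k w * T (z + cis t * w) * indicator {0..2*pi} t \<partial>lborel) \<partial>lborel)"
    by (rule lborel_pair.Fubini') measurable
  also have "\<dots> \<le> (\<integral>\<^sup>+w. k w * (ennreal (2 * pi) * T z) \<partial>lborel)"
  proof (rule nn_integral_mono)
    fix w
    have "(\<integral>\<^sup>+t. k w * T (z + cis t * w) * indicator {0..2*pi} t \<partial>lborel) = k w * (\<integral>\<^sup>+t\<in>{0..2*pi}. T (z + cis t * w) \<partial>lborel)"
      by (simp add: nn_integral_cmult mult.assoc)
    also have "\<dots> \<le> k w * (ennreal (2 * pi) * T z)"
      using circ[of w] supp[of w] by (cases "cmod w \<le> R") (auto intro: mult_left_mono)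
    finally show "(\<integral>\<^sup>+t. k w * T (z + cis t * w) * indicator {0..2*pi} t \<partial>lborel) \<le> k w * (ennreal (2 * pi) * T z)" .
  qed
  also have "\<dots> = ennreal (2 * pi) * ((\<integral>\<^sup>+w. k w \<partial>lborel) * T z)"
    by (subst nn_integral_multc) (auto simp: mult_ac)
  finally show ?thesis unfolding T_def[symmetric]
    by (subst (asm) ennreal_mult_le_mult_iff) auto
qed

lemma integral_mult_unit_real:
  fixes f :: "complex \<Rightarrow> real"
  assumes "f \<in> borel_measurable borel" "cmod c = 1"
  shows "(\<integral>w. f (c * w) \<partial>lborel) = (\<integral>w. f w \<partial>lborel)"
  using assms
  by (subst (2) lborel_distr_mult_unit[OF assms(2), symmetric]) (simp add: integral_distr)

lemma integral_reflect:
  fixes f :: "'a::euclidean_space \<Rightarrow> 'b::{banach,second_countable_topology}"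
  assumes "f \<in> borel_measurable borel"
  shows "(\<integral>w. f (c - w) \<partial>lborel) = (\<integral>w. f w \<partial>lborel)"
proof -
  have "(\<integral>w. f w \<partial>lborel) = (\<integral>w. f (c - w) \<partial>lborel)"
    using assms by (subst lborel_affine[of "-1" c]) (auto simp: density_1 integral_distr)
  then show ?thesis by simp
qed

lemma continuous_compact_support_bounded:
  fixes f :: "complex \<Rightarrow> 'b::real_normed_vector"
  assumes "continuous_on UNIV f" "compact S" "\<And>z. z \<notin> S \<Longrightarrow> f z = 0"
  obtains B where "0 \<le> B" "\<And>z. norm (f z) \<le> B"
proof -
  have "bounded (f ` S)"
    by (intro compact_imp_bounded compact_continuous_image assms continuous_on_subset[OF assms(1)]) auto
  then obtain B where "\<forall>y\<in>f ` S. norm y \<le> B" unfolding bounded_iff by metis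
  then have "norm (f z) \<le> max B 0" for z
    using assms(3)[of z] by (cases "z \<in> S") (force simp: le_max_iff_disj)+
  then show ?thesis using that[of "max B 0"] by simp
qed

section \<open>Mollification of subharmonic functions\<close>

definition moll_mass :: "real \<Rightarrow> real" where
  "moll_mass \<epsilon> = (\<integral>w. bump (w / of_real \<epsilon>) \<partial>lborel)"

lemma continuous_bump: "continuous_on S bump"
  unfolding bump_def by (intro continuous_intros continuous_bump_base)

lemma bump_measurable [measurable]: "bump \<in> borel_measurable borel"
  by (rule borel_measurable_continuous_onI[OF continuous_bump])

lemma continuous_bump_scaled: "continuous_on S (\<lambda>w. bump ((c - w) / of_real \<epsilon>))"
  unfolding divide_inverse by (intro continuous_on_compose2[OF continuous_bump[of UNIV]] continuous_intros) auto

lemma bump_scaled_eq_0: "0 < \<epsilon> \<Longrightarrow> \<epsilon> \<le> cmod w \<Longrightarrow> bump (w / of_real \<epsilon>) = 0"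
  by (intro bump_eq_0) (simp add: norm_divide)

lemma bump_scaled_pos: "0 < \<epsilon> \<Longrightarrow> cmod w < \<epsilon> \<Longrightarrow> 0 < bump (w / of_real \<epsilon>)"
  by (intro bump_pos) (simp add: norm_divide)

lemma bump_uminus [simp]: "bump (- w) = bump w"
  by (simp add: bump_def bump_base_def)

lemma bump_mult_unit: "cmod c = 1 \<Longrightarrow> bump (c * w / d) = bump (w / d)"
  by (simp add: bump_def bump_base_def norm_mult norm_divide)

lemma integrable_bump_scaled: "0 < \<epsilon> \<Longrightarrow> integrable lborel (\<lambda>w. bump ((c - w) / of_real \<epsilon>))"
  by (rule integrable_compact_support[OF continuous_bump_scaled, of "cball c \<epsilon>"])
     (auto simp: dist_norm intro!: bump_scaled_eq_0)

lemma integral_bump_scaled: "(\<integral>w. bump ((c - w) / of_real \<epsilon>) \<partial>lborel) = moll_mass \<epsilon>"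
  unfolding moll_mass_def by (rule integral_reflect[of "\<lambda>w. bump (w / of_real \<epsilon>)"]) measurable

lemma moll_mass_pos: assumes "0 < \<epsilon>" shows "0 < moll_mass \<epsilon>"
proof -
  have i: "integrable lborel (\<lambda>w. bump (w / of_real \<epsilon>))"
    using integrable_bump_scaled[OF assms, of 0] by (simp add: minus_divide_left[symmetric])
  have "moll_mass \<epsilon> \<noteq> 0"
  proof
    assume "moll_mass \<epsilon> = 0"
    then have "AE w in lborel. bump (w / of_real \<epsilon>) = 0"
      unfolding moll_mass_def by (subst (asm) integral_nonneg_eq_0_iff_AE[OF i]) (auto simp: bump_nonneg)
    then have "AE w in lborel. w \<notin> ball (0::complex) \<epsilon>"
      by eventually_elim (use bump_scaled_pos[OF assms] in force)
    from emeasure_eq_0_AE[OF this] have "emeasure lborel (ball (0::complex) \<epsilon>) = 0"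
      by (simp add: ball_def)
    then show False using assms by (simp add: emeasure_ball_complex)
  qed
  moreover have "0 \<le> moll_mass \<epsilon>" unfolding moll_mass_def by (intro integral_nonneg_AE) (auto simp: bump_nonneg)
  ultimately show ?thesis by simp
qed

lemma nn_integral_bump_scaled:
  "0 < \<epsilon> \<Longrightarrow> (\<integral>\<^sup>+w. ennreal (bump (w / of_real \<epsilon>)) \<partial>lborel) = ennreal (moll_mass \<epsilon>)"
  using integrable_bump_scaled[of \<epsilon> 0] unfolding moll_mass_def
  by (intro nn_integral_eq_integral) (auto simp: bump_nonneg minus_divide_left[symmetric])

text \<open>A real function with its derivatives as explicit data. Since \<open>f\<close> is real,
  its dbar-derivative is the conjugate of \<open>f_z\<close>; the mixed second derivative
  \<open>f_zb\<close> is a quarter of the Laplacian and is kept as a real number, so that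
  subharmonicity reads \<open>0 \<le> f_zb\<close>.\<close>

definition C2_real :: "complex set \<Rightarrow> (complex \<Rightarrow> real) \<Rightarrow> (complex \<Rightarrow> complex) \<Rightarrow> (complex \<Rightarrow> complex) \<Rightarrow> (complex \<Rightarrow> real) \<Rightarrow> bool" where
  "C2_real U f f_z f_zz f_zb \<longleftrightarrow>
    (\<forall>z\<in>U. has_wirtinger (\<lambda>z. of_real (f z)) (f_z z) (cnj (f_z z)) z \<and>
           has_wirtinger f_z (f_zz z) (of_real (f_zb z)) z) \<and>
    continuous_on U f_zz \<and> continuous_on U f_zb"

text \<open>If \<open>L < 0\<close>, then symmetrizing \<open>f\<close> over the four rotations by
  powers of \<i> gives a function strictly below its value at the centre on a punctured disc, and
  its mean against the bump would be negative.\<close>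

lemma laplacian_nonneg:
  assumes f: "\<And>z. has_wirtinger (\<lambda>z. complex_of_real (f z)) (p z) (cnj (p z)) z"
    and p: "has_wirtinger p q (of_real L) \<zeta>"
    and mean: "\<And>\<rho>. 0 < \<rho> \<Longrightarrow> 0 \<le> (\<integral>w. bump (w / of_real \<rho>) * (f (\<zeta> + w) - f \<zeta>) \<partial>lborel)"
  shows "0 \<le> L"
proof (rule ccontr)
  assume "\<not> 0 \<le> L"
  then have L: "L < 0" by simp
  obtain \<rho> where \<rho>: "0 < \<rho>"
    and pe: "\<And>h. cmod h < \<rho> \<Longrightarrow> cmod (p (\<zeta> + h) - p \<zeta> - (q * h + of_real L * cnj h)) \<le> (- L / 2) * cmod h"
  proof -
    have "\<exists>d>0. \<forall>y. cmod (y - \<zeta>) < d \<longrightarrow> cmod (p y - p \<zeta> - (q * (y - \<zeta>) + of_real L * cnj (y - \<zeta>))) \<le> (- L / 2) * cmod (y - \<zeta>)"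
      using p L unfolding has_wirtinger_def has_derivative_at_alt by (meson half_gt_zero neg_0_less_iff_less)
    then obtain d where d: "d > 0" "\<And>y. cmod (y - \<zeta>) < d \<Longrightarrow> cmod (p y - p \<zeta> - (q * (y - \<zeta>) + of_real L * cnj (y - \<zeta>))) \<le> (- L / 2) * cmod (y - \<zeta>)"
      by blast
    show ?thesis
      by (rule that[OF d(1)]) (use d(2)[of "\<zeta> + _"] in auto)
  qed
  have cf: "continuous_on UNIV f"
  proof -
    have "continuous_on UNIV (\<lambda>z. Re (complex_of_real (f z)))"
      by (intro continuous_on_Re has_wirtinger_imp_continuous_on[OF f])
    then show ?thesis by simp
  qed
  \<comment> \<open>In the sum over the powers of \<i> the linear term and the term of
    \<open>q\<close> cancel, since the powers and their squares both sum to 0. Only the Laplacian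
    survives.\<close>
  define S where "S w = (\<Sum>k<4. f (\<zeta> + \<i>^k * w) - f \<zeta>)" for w
  have Sneg: "S w < 0" if w: "w \<noteq> 0" "cmod w < \<rho>" for w
  proof -
    define G where "G s = (\<Sum>k<4. f (\<zeta> + \<i>^k * (of_real s * w)))" for s :: real
    define G' where "G' s = (\<Sum>k<4. 2 * Re (p (\<zeta> + \<i>^k * (of_real s * w)) * (\<i>^k * w)))" for s :: real
    have der: "(G has_real_derivative G' s) (at s)" for s
      unfolding G_def G'_def
    proof (intro DERIV_sum)
      fix k :: nat
      let ?z = "\<zeta> + \<i>^k * (of_real s * w)"
      have 1: "((\<lambda>s. \<zeta> + \<i>^k * (of_real s * w)) has_derivative (\<lambda>h. \<i>^k * (of_real h * w))) (at s)"
        by (auto intro!: derivative_eq_intros)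
      have "((\<lambda>s. complex_of_real (f (\<zeta> + \<i>^k * (of_real s * w)))) has_derivative
          (\<lambda>h. p ?z * (\<i>^k * (of_real h * w)) + cnj (p ?z) * cnj (\<i>^k * (of_real h * w)))) (at s)"
        using diff_chain_at[OF 1 f[of ?z, unfolded has_wirtinger_def]] by (simp add: o_def)
      from has_derivative_Re[OF this]
      have "((\<lambda>s. f (\<zeta> + \<i>^k * (of_real s * w))) has_derivative
          (\<lambda>h. Re (p ?z * (\<i>^k * (of_real h * w)) + cnj (p ?z) * cnj (\<i>^k * (of_real h * w))))) (at s)"
        by simp
      moreover have "Re (p ?z * (\<i>^k * (of_real h * w)) + cnj (p ?z) * cnj (\<i>^k * (of_real h * w))) = h * (2 * Re (p ?z * (\<i>^k * w)))" for h
      proof -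
        have "p ?z * (\<i>^k * (of_real h * w)) + cnj (p ?z) * cnj (\<i>^k * (of_real h * w)) = of_real h * (p ?z * (\<i>^k * w) + cnj (p ?z * (\<i>^k * w)))"
          by (simp add: algebra_simps)
        then show ?thesis by (simp only: complex_add_cnj) simp
      qed
      ultimately show "((\<lambda>s. f (\<zeta> + \<i>^k * (of_real s * w))) has_real_derivative 2 * Re (p ?z * (\<i>^k * w))) (at s)"
        by (simp only: has_field_derivative_def mult_commute_abs)
    qed
    have "\<exists>s::real>0. s < 1 \<and> G 1 - G 0 = (1 - 0) * G' s"
      using MVT2[of 0 1 G G'] der by auto
    then obtain s :: real where s: "0 < s" "s < 1" "G 1 - G 0 = G' s" by auto
    have trm: "2 * Re (p (\<zeta> + \<i>^k * (of_real s * w)) * (\<i>^k * w)) \<le>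
        2 * Re ((p \<zeta> + q * (\<i>^k * (of_real s * w)) + of_real L * cnj (\<i>^k * (of_real s * w))) * (\<i>^k * w)) + 2 * ((- L / 2) * s * (cmod w)\<^sup>2)" for k
    proof -
      let ?h = "\<i>^k * (of_real s * w)"
      have h: "cmod ?h = s * cmod w" using s by (simp add: norm_mult norm_power)
      then have "cmod ?h < \<rho>" using w s by (smt (verit) mult_left_le_one_le norm_ge_zero)
      from pe[OF this] have e: "cmod (p (\<zeta> + ?h) - p \<zeta> - (q * ?h + of_real L * cnj ?h)) \<le> (- L / 2) * (s * cmod w)"
        unfolding h .
      have "Re ((p (\<zeta> + ?h) - p \<zeta> - (q * ?h + of_real L * cnj ?h)) * (\<i>^k * w)) \<le> cmod ((p (\<zeta> + ?h) - p \<zeta> - (q * ?h + of_real L * cnj ?h)) * (\<i>^k * w))"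
        by (rule complex_Re_le_cmod)
      also have "\<dots> \<le> (- L / 2) * (s * cmod w) * cmod w"
        using mult_right_mono[OF e, of "cmod w"] by (simp add: norm_mult norm_power)
      finally have "Re ((p (\<zeta> + ?h) - p \<zeta> - (q * ?h + of_real L * cnj ?h)) * (\<i>^k * w)) \<le> (- L / 2) * s * (cmod w)\<^sup>2"
        by (simp add: power2_eq_square mult_ac)
      moreover have "p (\<zeta> + ?h) * (\<i>^k * w) = (p (\<zeta> + ?h) - p \<zeta> - (q * ?h + of_real L * cnj ?h)) * (\<i>^k * w) + (p \<zeta> + q * ?h + of_real L * cnj ?h) * (\<i>^k * w)"
        by (simp add: algebra_simps)
      ultimately show ?thesis by (simp only: plus_complex.sel) simp
    qed
    have i4: "(\<Sum>k<4. g k) = g 0 + g 1 + g 2 + g (3::nat)" for g :: "nat \<Rightarrow> real"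
      by (simp add: eval_nat_numeral)
    have "G' s \<le> (\<Sum>k<4. 2 * Re ((p \<zeta> + q * (\<i>^k * (of_real s * w)) + of_real L * cnj (\<i>^k * (of_real s * w))) * (\<i>^k * w)) + 2 * ((- L / 2) * s * (cmod w)\<^sup>2))"
      unfolding G'_def by (intro sum_mono trm)
    \<comment> \<open>The Laplacian contributes \<open>8 * L * s\<close> times the square of
      \<open>cmod w\<close>, and the errors, bounded by \<open>- L / 2\<close> times the distance,
      cancel at most half of it.\<close>
    also have "\<dots> = 4 * L * s * (cmod w)\<^sup>2"
      unfolding i4 cmod_power2 by (simp add: power2_eq_square eval_nat_numeral algebra_simps)
    also have "\<dots> < 0" using L s w by (simp add: mult_neg_pos)
    finally have "G 1 < G 0" using s by simp
    moreover have "S w = G 1 - G 0" unfolding S_def G_def by (simp add: sum_subtractf)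
    ultimately show ?thesis by simp
  qed
  have cS: "continuous_on UNIV S" unfolding S_def
    by (intro continuous_intros continuous_on_compose2[OF cf]) auto
  have cb: "continuous_on UNIV (\<lambda>w. bump (w / of_real \<rho>))"
    using \<rho> by (intro continuous_on_compose2[OF continuous_bump[of UNIV]] continuous_intros) auto
  have iS: "integrable lborel (\<lambda>w. bump (w / of_real \<rho>) * S w)"
    by (rule integrable_compact_support[of _ "cball 0 \<rho>"])
       (use \<rho> in \<open>auto intro!: continuous_intros cb cS bump_scaled_eq_0\<close>)
  have "(\<integral>w. bump (w / of_real \<rho>) * S w \<partial>lborel) = (\<Sum>k<4. \<integral>w. bump (w / of_real \<rho>) * (f (\<zeta> + \<i>^k * w) - f \<zeta>) \<partial>lborel)"
    unfolding S_def sum_distrib_left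
  proof (rule Bochner_Integration.integral_sum)
    fix k :: nat
    show "integrable lborel (\<lambda>w. bump (w / of_real \<rho>) * (f (\<zeta> + \<i>^k * w) - f \<zeta>))"
      by (rule integrable_compact_support[of _ "cball 0 \<rho>"])
         (use \<rho> in \<open>auto intro!: continuous_intros cb continuous_on_compose2[OF cf] bump_scaled_eq_0\<close>)
  qed
  also have "\<dots> = (\<Sum>k<4::nat. \<integral>w. bump (w / of_real \<rho>) * (f (\<zeta> + w) - f \<zeta>) \<partial>lborel)"
  proof (rule sum.cong[OF refl])
    fix k :: nat
    have u: "cmod (\<i>^k) = 1" by (simp add: norm_power)
    have mf: "f \<in> borel_measurable borel" by (rule borel_measurable_continuous_onI[OF cf])
    have "(\<integral>w. bump (\<i>^k * w / of_real \<rho>) * (f (\<zeta> + \<i>^k * w) - f \<zeta>) \<partial>lborel) = (\<integral>w. bump (w / of_real \<rho>) * (f (\<zeta> + w) - f \<zeta>) \<partial>lborel)"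
      by (rule integral_mult_unit_real[OF _ u, of "\<lambda>w. bump (w / of_real \<rho>) * (f (\<zeta> + w) - f \<zeta>)"])
         (use mf in measurable)
    then show "(\<integral>w. bump (w / of_real \<rho>) * (f (\<zeta> + \<i>^k * w) - f \<zeta>) \<partial>lborel) = (\<integral>w. bump (w / of_real \<rho>) * (f (\<zeta> + w) - f \<zeta>) \<partial>lborel)"
      by (simp add: bump_mult_unit u)
  qed
  also have "\<dots> \<ge> 0" using mean[OF \<rho>] by simp
  finally have ge: "0 \<le> (\<integral>w. bump (w / of_real \<rho>) * S w \<partial>lborel)" .
  have le: "0 \<le> - (bump (w / of_real \<rho>) * S w)" for w
  proof (cases "w = 0 \<or> \<rho> \<le> cmod w")
    case True
    then show ?thesis using bump_scaled_eq_0[OF \<rho>] by (auto simp: S_def)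
  next
    case False
    then have "S w < 0" using Sneg[of w] by auto
    then show ?thesis using bump_nonneg by (simp add: mult_nonneg_nonpos)
  qed
  have iS': "integrable lborel (\<lambda>w. - (bump (w / of_real \<rho>) * S w))" using iS by simp
  have "(\<integral>w. - (bump (w / of_real \<rho>) * S w) \<partial>lborel) = 0"
  proof -
    have "0 \<le> (\<integral>w. - (bump (w / of_real \<rho>) * S w) \<partial>lborel)"
      by (rule Bochner_Integration.integral_nonneg[OF le])
    then show ?thesis using ge by simp
  qed
  then have "AE w in lborel. - (bump (w / of_real \<rho>) * S w) = 0"
    by (subst (asm) integral_nonneg_eq_0_iff_AE[OF iS']) (use le in auto)
  then have "AE w in lborel. w \<notin> ball (0::complex) \<rho>"
    using AE_lborel_singleton[of "0::complex"]
  proof eventually_elim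
    case (elim w)
    then show ?case using Sneg[of w] bump_scaled_pos[OF \<rho>, of w] by auto
  qed
  from emeasure_eq_0_AE[OF this] have "emeasure lborel (ball (0::complex) \<rho>) = 0"
    by (simp add: ball_def)
  then show False using \<rho> by (simp add: emeasure_ball_complex)
qed

lemma subharmonic_measurable: "subharmonic_on UNIV u \<Longrightarrow> u \<in> borel_measurable borel"
  by (intro usc_borel_measurable) (simp add: subharmonic_on_def)

lemma subharmonic_bounded_above:
  assumes "subharmonic_on UNIV u" "compact S"
  obtains C where "0 \<le> C" "\<And>z. z \<in> S \<Longrightarrow> u z < ereal C"
  using usc_bounded_above[of u S] assms by (auto simp: subharmonic_on_def)

text \<open>The area mean inequality on a disc around a point \<open>z0\<close> with finite value
  bounds the integral over that disc; the disc is chosen large enough to contain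
  \<open>ball 0 R\<close>. This gives local integrability of \<open>u\<close>, and that
  \<open>u\<close> is finite almost everywhere.\<close>

lemma subharmonic_neg_shift_integral_finite:
  assumes u: "subharmonic_on UNIV u"
  shows "\<exists>C. 0 \<le> C \<and> (\<forall>w\<in>ball 0 R. u w \<le> ereal C) \<and> (\<integral>\<^sup>+z\<in>ball 0 R. neg_shift C u z \<partial>lborel) < \<infinity>"
proof -
  note [measurable] = subharmonic_measurable[OF u]
  obtain z0 where z0: "u z0 \<noteq> - \<infinity>" using u by (auto simp: subharmonic_on_def)
  define R' where "R' = max R 0 + cmod z0"
  obtain C where C: "0 \<le> C" "\<And>z. z \<in> cball z0 R' \<Longrightarrow> u z < ereal C"
    using subharmonic_bounded_above[OF u compact_cball[of z0 R']] by blast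
  have sub: "ball (0::complex) R \<subseteq> ball z0 R'"
  proof
    fix w :: complex assume "w \<in> ball 0 R"
    then have "cmod w < R" by simp
    then show "w \<in> ball z0 R'"
      using norm_triangle_ineq4[of z0 w] by (simp add: R'_def dist_norm)
  qed
  have "(\<integral>\<^sup>+z\<in>ball 0 R. neg_shift C u z \<partial>lborel) \<le> (\<integral>\<^sup>+z. indicator (ball z0 R') z * neg_shift C u z \<partial>lborel)"
  proof (rule nn_integral_mono)
    fix z show "neg_shift C u z * indicator (ball 0 R) z \<le> indicator (ball z0 R') z * neg_shift C u z"
      using sub by (auto simp: indicator_def dist_norm norm_minus_commute)
  qed
  also have "\<dots> = (\<integral>\<^sup>+w. indicator (ball 0 R') w * neg_shift C u (z0 + w) \<partial>lborel)"
  proof -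
    have "(\<lambda>z. indicator (ball z0 R') z * neg_shift C u z) \<in> borel_measurable borel"
      by (intro borel_measurable_times_ennreal borel_measurable_indicator) auto
    from nn_integral_shift[OF this, of z0] show ?thesis
      by (simp add: indicator_def dist_norm)
  qed
  also have "\<dots> \<le> (\<integral>\<^sup>+w. indicator (ball (0::complex) R') w \<partial>lborel) * neg_shift C u z0"
    by (rule neg_shift_area_mean[OF u C(1), where R = R' and k = "indicator (ball 0 R')"])
       (use C(2) in \<open>auto simp: indicator_def norm_mult intro!: borel_measurable_indicator order.strict_implies_order\<close>)
  also have "\<dots> < \<infinity>"
  proof -
    have "u z0 < \<infinity>" using u by (auto simp: subharmonic_on_def)
    then have "neg_shift C u z0 < \<infinity>" using z0 unfolding neg_shift_def by (cases "u z0") auto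
    moreover have "(\<integral>\<^sup>+w. indicator (ball (0::complex) R') w \<partial>lborel) < \<infinity>"
      using emeasure_lborel_ball_finite[of "0::complex" R'] by simp
    ultimately show ?thesis by (simp add: ennreal_mult_less_top)
  qed
  finally have "(\<integral>\<^sup>+z\<in>ball 0 R. neg_shift C u z \<partial>lborel) < \<infinity>" .
  moreover have "\<forall>w\<in>ball 0 R. u w \<le> ereal C"
    using sub C(2) ball_subset_cball by (blast intro: order.strict_implies_order)
  ultimately show ?thesis using C(1) by blast
qed

lemma subharmonic_AE_finite:
  assumes u: "subharmonic_on UNIV u"
  shows "AE z in lborel. u z \<noteq> - \<infinity>"
proof -
  note [measurable] = subharmonic_measurable[OF u]
  have "AE z in lborel. \<forall>n::nat. z \<in> ball 0 (real n) \<longrightarrow> u z \<noteq> - \<infinity>"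
    unfolding AE_all_countable
  proof
    fix n :: nat
    obtain C where C: "(\<integral>\<^sup>+z\<in>ball 0 (real n). neg_shift C u z \<partial>lborel) < \<infinity>"
      using subharmonic_neg_shift_integral_finite[OF u] by blast
    have "AE z in lborel. neg_shift C u z * indicator (ball 0 (real n)) z \<noteq> \<infinity>"
      using C by (intro nn_integral_noteq_infinite borel_measurable_times_ennreal) (auto intro!: borel_measurable_indicator)
    then show "AE z in lborel. z \<in> ball 0 (real n) \<longrightarrow> u z \<noteq> - \<infinity>"
      by eventually_elim (auto simp: neg_shift_def)
  qed
  then show ?thesis
  proof eventually_elim
    case (elim z)
    obtain n :: nat where "cmod z < real n" using reals_Archimedean2 by blast
    then show ?case using elim by auto
  qed
qed

lemma subharmonic_integrable:
  assumes u: "subharmonic_on UNIV u"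
  shows "integrable lborel (\<lambda>z. indicator (ball 0 R) z * real_of_ereal (u z))"
proof -
  note [measurable] = subharmonic_measurable[OF u]
  obtain C where C: "0 \<le> C" "\<And>w. w \<in> ball 0 R \<Longrightarrow> u w \<le> ereal C" "(\<integral>\<^sup>+z\<in>ball 0 R. neg_shift C u z \<partial>lborel) < \<infinity>"
    using subharmonic_neg_shift_integral_finite[OF u] by blast
  show ?thesis
  proof (rule integrableI_bounded)
    have "(\<integral>\<^sup>+z. ennreal (norm (indicator (ball 0 R) z * real_of_ereal (u z))) \<partial>lborel)
      \<le> (\<integral>\<^sup>+z. neg_shift C u z * indicator (ball 0 R) z + ennreal C * indicator (ball 0 R) z \<partial>lborel)"
    proof (rule nn_integral_mono)
      fix z
      show "ennreal (norm (indicator (ball 0 R) z * real_of_ereal (u z))) \<le> neg_shift C u z * indicator (ball 0 R) z + ennreal C * indicator (ball 0 R) z"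
      proof (cases "z \<in> ball 0 R")
        case True
        then have "u z \<le> ereal C" by (rule C(2))
        then show ?thesis using True C(1)
          by (cases "u z") (auto simp: neg_shift_def ennreal_plus[symmetric] simp del: ennreal_plus intro!: ennreal_leI)
      qed simp
    qed
    also have "\<dots> = (\<integral>\<^sup>+z\<in>ball 0 R. neg_shift C u z \<partial>lborel) + ennreal C * emeasure lborel (ball (0::complex) R)"
      by (subst nn_integral_add) (auto simp: nn_integral_cmult_indicator intro!: borel_measurable_times_ennreal borel_measurable_indicator)
    also have "\<dots> < \<infinity>" using C(3) emeasure_lborel_ball_finite[of "0::complex" R] by (simp add: ennreal_mult_less_top)
    finally show "(\<integral>\<^sup>+z. ennreal (norm (indicator (ball 0 R) z * real_of_ereal (u z))) \<partial>lborel) < \<infinity>" .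
  qed (intro borel_measurable_times borel_measurable_indicator, auto)
qed

text \<open>\<open>real_of_ereal\<close> replaces \<open>- \<infinity>\<close> by 0, which alters a
  subharmonic function on a null set only. The codomain is left open so that both the bump and its
  complex derivatives can serve as kernels.\<close>

definition conv_real :: "(complex \<Rightarrow> ereal) \<Rightarrow> (complex \<Rightarrow> 'a::{real_normed_field,banach,second_countable_topology}) \<Rightarrow> real \<Rightarrow> complex \<Rightarrow> 'a" where
  "conv_real u k \<epsilon> \<zeta> = (\<integral>z. of_real (real_of_ereal (u z)) * k ((\<zeta> - z) / of_real \<epsilon>) \<partial>lborel)"

lemma conv_real_of_real: "conv_real u (\<lambda>w. complex_of_real (k w)) \<epsilon> \<zeta> = of_real (conv_real u k \<epsilon> \<zeta>)"
  unfolding conv_real_def by (simp only: of_real_mult[symmetric] integral_complex_of_real of_real_eq_id id_apply)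

text \<open>Subharmonic functions are integrable only locally. For \<zeta> in a fixed disc the
  convolution sees \<open>u\<close> on a larger disc only, so that \<open>u\<close> may be replaced
  by an integrable function.\<close>

lemma conv_real_local:
  assumes k: "\<And>w. 1 \<le> cmod w \<Longrightarrow> k w = 0" and \<epsilon>: "0 < \<epsilon>" and \<zeta>: "\<zeta> \<in> ball 0 R"
  shows "conv_real u k \<epsilon> \<zeta> = (\<integral>z. of_real (indicator (ball 0 (R + \<epsilon>)) z * real_of_ereal (u z)) * k ((\<zeta> - z) / of_real \<epsilon>) \<partial>lborel)"
  unfolding conv_real_def
proof (rule Bochner_Integration.integral_cong[OF refl])
  fix z
  show "of_real (real_of_ereal (u z)) * k ((\<zeta> - z) / of_real \<epsilon>) = of_real (indicator (ball 0 (R + \<epsilon>)) z * real_of_ereal (u z)) * k ((\<zeta> - z) / of_real \<epsilon>)"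
  proof (cases "z \<in> ball 0 (R + \<epsilon>)")
    case False
    then have "\<epsilon> \<le> cmod (\<zeta> - z)" using \<zeta> norm_triangle_ineq2[of z \<zeta>] by (simp add: norm_minus_commute)
    then have "k ((\<zeta> - z) / of_real \<epsilon>) = 0" using \<epsilon> by (intro k) (simp add: norm_divide)
    then show ?thesis by simp
  qed simp
qed

lemma conv_real_wirtinger:
  fixes k ka kb :: "complex \<Rightarrow> complex"
  assumes u: "subharmonic_on UNIV u" and k: "\<And>w. has_wirtinger k (ka w) (kb w) w"
    and c: "continuous_on UNIV ka" "continuous_on UNIV kb"
    and 0: "\<And>w. 1 \<le> cmod w \<Longrightarrow> k w = 0" "\<And>w. 1 \<le> cmod w \<Longrightarrow> ka w = 0" "\<And>w. 1 \<le> cmod w \<Longrightarrow> kb w = 0"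
    and \<epsilon>: "0 < \<epsilon>"
  shows "has_wirtinger (conv_real u k \<epsilon>) (conv_real u ka \<epsilon> \<zeta> / of_real \<epsilon>) (conv_real u kb \<epsilon> \<zeta> / of_real \<epsilon>) \<zeta>"
proof -
  define R where "R = cmod \<zeta> + 1"
  have \<zeta>: "\<zeta> \<in> ball 0 R" by (simp add: R_def)
  define g where "g z = complex_of_real (indicator (ball 0 (R + \<epsilon>)) z * real_of_ereal (u z))" for z
  have g: "integrable lborel g" unfolding g_def by (intro integrable_of_real subharmonic_integrable[OF u])
  have ck: "continuous_on UNIV k" by (rule has_wirtinger_imp_continuous_on[OF k])
  obtain B1 where B1: "0 \<le> B1" "\<And>z. cmod (k z) \<le> B1" using continuous_compact_support_bounded[OF ck compact_cball[of 0 1]] 0(1) by auto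
  obtain B2 where B2: "0 \<le> B2" "\<And>z. cmod (ka z) \<le> B2" using continuous_compact_support_bounded[OF c(1) compact_cball[of 0 1]] 0(2) by auto
  obtain B3 where B3: "0 \<le> B3" "\<And>z. cmod (kb z) \<le> B3" using continuous_compact_support_bounded[OF c(2) compact_cball[of 0 1]] 0(3) by auto
  define B where "B = B1 + B2 / \<epsilon> + B3 / \<epsilon>"
  let ?e = "complex_of_real (1 / \<epsilon>)"
  have cc: "continuous_on UNIV (\<lambda>w. f (?e * w) * c)" if "continuous_on UNIV f" for f :: "complex \<Rightarrow> complex" and c
    by (intro continuous_intros continuous_on_compose2[OF that]) auto
  have w0: "has_wirtinger (\<lambda>\<zeta>. \<integral>z. g z * k (?e * (\<zeta> - z)) \<partial>lborel)
      (\<integral>z. g z * (ka (?e * (\<zeta> - z)) * ?e) \<partial>lborel) (\<integral>z. g z * (kb (?e * (\<zeta> - z)) * cnj ?e) \<partial>lborel) \<zeta>"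
  proof (rule has_wirtinger_convolution[OF g, of "\<lambda>w. k (?e * w)" "\<lambda>w. ka (?e * w) * ?e" "\<lambda>w. kb (?e * w) * cnj ?e" B])
    show "has_wirtinger (\<lambda>w. k (?e * w)) (ka (?e * w) * ?e) (kb (?e * w) * cnj ?e) w" for w
      by (rule has_wirtinger_linear[OF k])
    show "continuous_on UNIV (\<lambda>w. ka (?e * w) * ?e)" by (rule cc[OF c(1)])
    show "continuous_on UNIV (\<lambda>w. kb (?e * w) * cnj ?e)" by (rule cc[OF c(2)])
    show "cmod (k (?e * w)) \<le> B" for w using B1(2)[of "?e * w"] divide_nonneg_pos[OF B2(1) \<epsilon>] divide_nonneg_pos[OF B3(1) \<epsilon>] unfolding B_def by linarith
    show "cmod (ka (?e * w) * ?e) \<le> B" for w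
    proof -
      have "cmod (ka (?e * w) * ?e) = cmod (ka (?e * w)) / \<epsilon>" using \<epsilon> by (simp add: norm_mult norm_divide)
      also have "\<dots> \<le> B2 / \<epsilon>" using B2(2)[of "?e * w"] \<epsilon> by (intro divide_right_mono) auto
      also have "\<dots> \<le> B" using B1 B3(1) \<epsilon> by (simp add: B_def)
      finally show ?thesis .
    qed
    show "cmod (kb (?e * w) * cnj ?e) \<le> B" for w
    proof -
      have "cmod (kb (?e * w) * cnj ?e) = cmod (kb (?e * w)) / \<epsilon>" using \<epsilon> by (simp add: norm_mult norm_divide)
      also have "\<dots> \<le> B3 / \<epsilon>" using B3(2)[of "?e * w"] \<epsilon> by (intro divide_right_mono) auto
      also have "\<dots> \<le> B" using B1 B2(1) \<epsilon> by (simp add: B_def)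
      finally show ?thesis .
    qed
  qed
  have loc: "conv_real u f \<epsilon> w = (\<integral>z. g z * f (?e * (w - z)) \<partial>lborel)"
    if "\<And>w. 1 \<le> cmod w \<Longrightarrow> f w = 0" "w \<in> ball 0 R" for f :: "complex \<Rightarrow> complex" and w
    using conv_real_local[OF that(1) \<epsilon> that(2)] by (simp add: g_def divide_inverse mult.commute)
  have e1: "(\<integral>z. g z * (ka (?e * (\<zeta> - z)) * ?e) \<partial>lborel) = conv_real u ka \<epsilon> \<zeta> / of_real \<epsilon>"
  proof -
    have "(\<integral>z. g z * (ka (?e * (\<zeta> - z)) * ?e) \<partial>lborel) = (\<integral>z. g z * ka (?e * (\<zeta> - z)) \<partial>lborel) * ?e"
      by (simp only: mult.assoc[symmetric] integral_mult_left_zero)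
    also have "\<dots> = conv_real u ka \<epsilon> \<zeta> / of_real \<epsilon>"
      by (simp only: loc[OF 0(2) \<zeta>]) (simp add: divide_inverse)
    finally show ?thesis .
  qed
  have e2: "(\<integral>z. g z * (kb (?e * (\<zeta> - z)) * cnj ?e) \<partial>lborel) = conv_real u kb \<epsilon> \<zeta> / of_real \<epsilon>"
  proof -
    have "(\<integral>z. g z * (kb (?e * (\<zeta> - z)) * cnj ?e) \<partial>lborel) = (\<integral>z. g z * kb (?e * (\<zeta> - z)) \<partial>lborel) * cnj ?e"
      by (simp only: mult.assoc[symmetric] integral_mult_left_zero)
    also have "\<dots> = conv_real u kb \<epsilon> \<zeta> / of_real \<epsilon>"
      by (simp only: loc[OF 0(3) \<zeta>]) (simp add: divide_inverse)
    finally show ?thesis .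
  qed
  show ?thesis
    using w0 unfolding e1 e2
    by (rule has_wirtinger_transform[of _ _ _ _ "ball 0 R"]) (use \<zeta> loc[OF 0(1)] in auto)
qed

lemma conv_real_continuous:
  fixes k :: "complex \<Rightarrow> complex"
  assumes u: "subharmonic_on UNIV u" and c: "continuous_on UNIV k"
    and 0: "\<And>w. 1 \<le> cmod w \<Longrightarrow> k w = 0" and \<epsilon>: "0 < \<epsilon>"
  shows "continuous_on UNIV (conv_real u k \<epsilon>)"
proof -
  obtain B where B: "0 \<le> B" "\<And>z. cmod (k z) \<le> B" using continuous_compact_support_bounded[OF c compact_cball[of 0 1]] 0 by auto
  have "isCont (conv_real u k \<epsilon>) \<zeta>" for \<zeta>
  proof -
    define R where "R = cmod \<zeta> + 1"
    have \<zeta>: "\<zeta> \<in> ball 0 R" by (simp add: R_def)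
    define g where "g z = complex_of_real (indicator (ball 0 (R + \<epsilon>)) z * real_of_ereal (u z))" for z
    have g: "integrable lborel g" unfolding g_def by (intro integrable_of_real subharmonic_integrable[OF u])
    have "continuous_on UNIV (\<lambda>w. \<integral>z. g z * k ((w - z) / of_real \<epsilon>) \<partial>lborel)"
      using \<epsilon> by (intro continuous_convolution[OF g, of "\<lambda>w. k (w / of_real \<epsilon>)" B] B(2)
            continuous_on_compose2[OF c] continuous_intros) auto
    then have "continuous_on (ball 0 R) (\<lambda>w. \<integral>z. g z * k ((w - z) / of_real \<epsilon>) \<partial>lborel)"
      by (rule continuous_on_subset) auto
    then have "continuous_on (ball 0 R) (conv_real u k \<epsilon>)"
      by (rule continuous_on_eq) (simp add: conv_real_local[OF 0 \<epsilon>] g_def)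
    then show ?thesis using \<zeta> by (simp add: continuous_on_eq_continuous_at)
  qed
  then show ?thesis by (simp add: continuous_at_imp_continuous_on)
qed

definition moll :: "(complex \<Rightarrow> ereal) \<Rightarrow> real \<Rightarrow> complex \<Rightarrow> real" where
  "moll u \<epsilon> \<zeta> = conv_real u bump \<epsilon> \<zeta> / moll_mass \<epsilon>"

definition moll_z :: "(complex \<Rightarrow> ereal) \<Rightarrow> real \<Rightarrow> complex \<Rightarrow> complex" where
  "moll_z u \<epsilon> \<zeta> = conv_real u bump_z \<epsilon> \<zeta> / of_real (\<epsilon> * moll_mass \<epsilon>)"

definition moll_zz :: "(complex \<Rightarrow> ereal) \<Rightarrow> real \<Rightarrow> complex \<Rightarrow> complex" where
  "moll_zz u \<epsilon> \<zeta> = conv_real u bump_zz \<epsilon> \<zeta> / of_real (\<epsilon>\<^sup>2 * moll_mass \<epsilon>)"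

definition moll_zb :: "(complex \<Rightarrow> ereal) \<Rightarrow> real \<Rightarrow> complex \<Rightarrow> real" where
  "moll_zb u \<epsilon> \<zeta> = conv_real u bump_zb \<epsilon> \<zeta> / (\<epsilon>\<^sup>2 * moll_mass \<epsilon>)"

lemma bump_derivs_eq_0:
  "1 \<le> cmod w \<Longrightarrow> bump_z w = 0" "1 \<le> cmod w \<Longrightarrow> bump_zz w = 0" "1 \<le> cmod w \<Longrightarrow> bump_zb w = 0"
  by (auto simp: bump_z_def bump_zz_def bump_zb_def bump_base_eq_0)

lemma bump_derivs_continuous:
  "continuous_on S bump_z" "continuous_on S bump_zz" "continuous_on S bump_zb"
  unfolding bump_z_def bump_zz_def bump_zb_def by (intro continuous_intros continuous_bump_base)+

lemma moll_C2:
  assumes u: "subharmonic_on UNIV u" and \<epsilon>: "0 < \<epsilon>"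
  shows "C2_real UNIV (moll u \<epsilon>) (moll_z u \<epsilon>) (moll_zz u \<epsilon>) (moll_zb u \<epsilon>)"
proof -
  have m: "0 < moll_mass \<epsilon>" by (rule moll_mass_pos[OF \<epsilon>])
  have scale: "has_wirtinger (\<lambda>z. c * f z) (c * a) (c * b) z" if "has_wirtinger f a b z" for c f a b z
    using has_wirtinger_mult[OF has_wirtinger_const[of c] that] by simp
  have 1: "has_wirtinger (\<lambda>z. of_real (moll u \<epsilon> z)) (moll_z u \<epsilon> z) (cnj (moll_z u \<epsilon> z)) z" for z
  proof -
    have "has_wirtinger (\<lambda>z. of_real (1 / moll_mass \<epsilon>) * conv_real u (\<lambda>w. complex_of_real (bump w)) \<epsilon> z)
      (of_real (1 / moll_mass \<epsilon>) * (conv_real u bump_z \<epsilon> z / of_real \<epsilon>))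
      (of_real (1 / moll_mass \<epsilon>) * (conv_real u (\<lambda>w. cnj (bump_z w)) \<epsilon> z / of_real \<epsilon>)) z"
      by (intro scale conv_real_wirtinger[OF u has_wirtinger_bump] bump_derivs_continuous continuous_intros \<epsilon>)
         (auto simp: bump_derivs_eq_0 bump_eq_0)
    then have w: "has_wirtinger (\<lambda>z. of_real (moll u \<epsilon> z)) (moll_z u \<epsilon> z)
        (of_real (1 / moll_mass \<epsilon>) * (conv_real u (\<lambda>w. cnj (bump_z w)) \<epsilon> z / of_real \<epsilon>)) z"
      by (simp add: conv_real_of_real moll_def moll_z_def mult.commute)
    show ?thesis using w has_wirtinger_real_conj[OF w] by simp
  qed
  have 2: "has_wirtinger (moll_z u \<epsilon>) (moll_zz u \<epsilon> z) (of_real (moll_zb u \<epsilon> z)) z" for z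
  proof -
    have "has_wirtinger (\<lambda>z. of_real (1 / (\<epsilon> * moll_mass \<epsilon>)) * conv_real u bump_z \<epsilon> z)
      (of_real (1 / (\<epsilon> * moll_mass \<epsilon>)) * (conv_real u bump_zz \<epsilon> z / of_real \<epsilon>))
      (of_real (1 / (\<epsilon> * moll_mass \<epsilon>)) * (conv_real u (\<lambda>w. of_real (bump_zb w)) \<epsilon> z / of_real \<epsilon>)) z"
      by (intro scale conv_real_wirtinger[OF u has_wirtinger_bump_z] bump_derivs_continuous continuous_intros \<epsilon>)
         (auto simp: bump_derivs_eq_0)
    then have "has_wirtinger (\<lambda>z. of_real (1 / (\<epsilon> * moll_mass \<epsilon>)) * conv_real u bump_z \<epsilon> z)
      (moll_zz u \<epsilon> z) (of_real (moll_zb u \<epsilon> z)) z"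
      by (rule has_wirtinger_eq) (auto simp: conv_real_of_real moll_zz_def moll_zb_def power2_eq_square mult_ac)
    then show ?thesis
      by (rule has_wirtinger_transform[of _ _ _ _ UNIV]) (auto simp: moll_z_def)
  qed
  have 3: "continuous_on UNIV (moll_zz u \<epsilon>)" unfolding moll_zz_def
    using m \<epsilon> by (intro continuous_intros conv_real_continuous[OF u] bump_derivs_continuous) (auto simp: bump_derivs_eq_0)
  have "continuous_on UNIV (\<lambda>z. Re (conv_real u (\<lambda>w. complex_of_real (bump_zb w)) \<epsilon> z))"
    by (intro continuous_on_Re conv_real_continuous[OF u] bump_derivs_continuous continuous_intros \<epsilon>) (auto simp: bump_derivs_eq_0)
  then have 4: "continuous_on UNIV (moll_zb u \<epsilon>)" unfolding moll_zb_def conv_real_of_real Re_complex_of_real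
    using m \<epsilon> by (intro continuous_intros) auto
  show ?thesis unfolding C2_real_def using 1 2 3 4 by simp
qed

text \<open>Translates between the nonnegative integrals of \<open>neg_shift\<close> and the real
  number \<open>moll u \<epsilon> \<zeta>\<close>. The second claim makes every upper bound for
  \<open>u\<close> near \<zeta> an upper bound for the mollification; \<open>C\<close> may have
  either sign.\<close>

lemma moll_neg_shift:
  assumes u: "subharmonic_on UNIV u" and \<epsilon>: "0 < \<epsilon>" and C: "\<And>w. w \<in> ball \<zeta> \<epsilon> \<Longrightarrow> u w \<le> ereal C"
  shows "(\<integral>\<^sup>+z. ennreal (bump ((\<zeta> - z) / of_real \<epsilon>)) * neg_shift C u z \<partial>lborel) = ennreal (moll_mass \<epsilon> * (C - moll u \<epsilon> \<zeta>))"
    and "moll u \<epsilon> \<zeta> \<le> C"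
proof -
  note [measurable] = subharmonic_measurable[OF u]
  have m: "0 < moll_mass \<epsilon>" by (rule moll_mass_pos[OF \<epsilon>])
  define b where "b z = bump ((\<zeta> - z) / of_real \<epsilon>)" for z
  have b0: "0 \<le> b z" for z by (simp add: b_def bump_nonneg)
  have bz: "b z = 0" if "z \<notin> ball \<zeta> \<epsilon>" for z
    using that \<epsilon> unfolding b_def by (intro bump_scaled_eq_0) (auto simp: dist_norm)
  have ib: "integrable lborel b" unfolding b_def by (rule integrable_bump_scaled[OF \<epsilon>])
  have cb: "continuous_on UNIV b" unfolding b_def by (rule continuous_bump_scaled)
  have iu: "integrable lborel (\<lambda>z. real_of_ereal (u z) * b z)"
  proof (rule Bochner_Integration.integrable_bound[OF subharmonic_integrable[OF u, of "cmod \<zeta> + \<epsilon>"]])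
    show "AE z in lborel. norm (real_of_ereal (u z) * b z) \<le> norm (indicator (ball 0 (cmod \<zeta> + \<epsilon>)) z * real_of_ereal (u z))"
    proof (rule AE_I2)
      fix z
      show "norm (real_of_ereal (u z) * b z) \<le> norm (indicator (ball 0 (cmod \<zeta> + \<epsilon>)) z * real_of_ereal (u z))"
      proof (cases "z \<in> ball \<zeta> \<epsilon>")
        case True
        then have "z \<in> ball 0 (cmod \<zeta> + \<epsilon>)"
          using norm_triangle_ineq2[of z \<zeta>] by (simp add: dist_norm norm_minus_commute)
        moreover have "\<bar>real_of_ereal (u z)\<bar> * \<bar>b z\<bar> \<le> \<bar>real_of_ereal (u z)\<bar> * 1"
          by (intro mult_left_mono abs_ge_zero) (simp add: b_def bump_le_1 bump_nonneg)
        ultimately show ?thesis by (simp add: abs_mult)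
      qed (simp add: bz)
    qed
  qed (use borel_measurable_continuous_onI[OF cb] in measurable)
  have int: "integrable lborel (\<lambda>z. C * b z - real_of_ereal (u z) * b z)" using ib iu by simp
  have AEn: "AE z in lborel. 0 \<le> C * b z - real_of_ereal (u z) * b z"
    using subharmonic_AE_finite[OF u]
  proof eventually_elim
    case (elim z)
    show ?case
    proof (cases "z \<in> ball \<zeta> \<epsilon>")
      case True
      then have "real_of_ereal (u z) \<le> C" using C[OF True] elim by (cases "u z") auto
      then show ?thesis using b0 by (simp add: mult_right_mono)
    qed (simp add: bz)
  qed
  have val: "(\<integral>z. C * b z - real_of_ereal (u z) * b z \<partial>lborel) = moll_mass \<epsilon> * (C - moll u \<epsilon> \<zeta>)"
  proof -
    have "(\<integral>z. real_of_ereal (u z) * b z \<partial>lborel) = moll_mass \<epsilon> * moll u \<epsilon> \<zeta>"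
      using m by (simp add: moll_def conv_real_def b_def)
    moreover have "(\<integral>z. b z \<partial>lborel) = moll_mass \<epsilon>" unfolding b_def by (rule integral_bump_scaled)
    ultimately show ?thesis using ib iu by (simp add: algebra_simps)
  qed
  have "(\<integral>\<^sup>+z. ennreal (b z) * neg_shift C u z \<partial>lborel) = (\<integral>\<^sup>+z. ennreal (C * b z - real_of_ereal (u z) * b z) \<partial>lborel)"
  proof (rule nn_integral_cong_AE)
    show "AE z in lborel. ennreal (b z) * neg_shift C u z = ennreal (C * b z - real_of_ereal (u z) * b z)"
      using subharmonic_AE_finite[OF u]
    proof eventually_elim
      case (elim z)
      show ?case
      proof (cases "z \<in> ball \<zeta> \<epsilon>")
        case True
        then obtain x where x: "u z = ereal x" "x \<le> C" using C[OF True] elim by (cases "u z") auto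
        then show ?thesis using b0[of z] by (simp add: neg_shift_def ennreal_mult[symmetric] algebra_simps)
      qed (simp add: bz)
    qed
  qed
  also have "\<dots> = ennreal (moll_mass \<epsilon> * (C - moll u \<epsilon> \<zeta>))"
    by (subst nn_integral_eq_integral[OF int AEn]) (simp add: val)
  finally show "(\<integral>\<^sup>+z. ennreal (bump ((\<zeta> - z) / of_real \<epsilon>)) * neg_shift C u z \<partial>lborel) = ennreal (moll_mass \<epsilon> * (C - moll u \<epsilon> \<zeta>))"
    by (simp add: b_def)
  have "0 \<le> moll_mass \<epsilon> * (C - moll u \<epsilon> \<zeta>)"
    unfolding val[symmetric] by (rule integral_nonneg_AE[OF AEn])
  then show "moll u \<epsilon> \<zeta> \<le> C" using m by (simp add: zero_le_mult_iff)
qed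

lemma bump_area_mean:
  assumes u: "subharmonic_on UNIV u" and C: "0 \<le> C" and uC: "\<And>w. w \<in> cball z \<rho> \<Longrightarrow> u w \<le> ereal C" and \<rho>: "0 < \<rho>"
  shows "(\<integral>\<^sup>+w. ennreal (bump (w / of_real \<rho>)) * neg_shift C u (z + w) \<partial>lborel) \<le> ennreal (moll_mass \<rho>) * neg_shift C u z"
  unfolding nn_integral_bump_scaled[OF \<rho>, symmetric]
proof (rule neg_shift_area_mean[OF u C uC])
  show "(\<lambda>w. ennreal (bump (w / of_real \<rho>))) \<in> borel_measurable borel" by measurable
qed (use \<rho> in \<open>auto simp: bump_mult_unit bump_scaled_eq_0\<close>)

text \<open>This is the submean inequality averaged against the bump. It is used where a finite
  value of the given subharmonic function must bound the mollification from below, uniformly in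
  \<epsilon>.\<close>

lemma moll_ge:
  assumes u: "subharmonic_on UNIV u" and \<epsilon>: "0 < \<epsilon>"
  shows "u \<zeta> \<le> ereal (moll u \<epsilon> \<zeta>)"
proof -
  note [measurable] = subharmonic_measurable[OF u]
  obtain C where C: "0 \<le> C" "\<And>z. z \<in> cball \<zeta> \<epsilon> \<Longrightarrow> u z < ereal C"
    using subharmonic_bounded_above[OF u compact_cball[of \<zeta> \<epsilon>]] by blast
  have C': "\<And>z. z \<in> cball \<zeta> \<epsilon> \<Longrightarrow> u z \<le> ereal C" using C(2) by (blast intro: order.strict_implies_order)
  have Cb: "\<And>z. z \<in> ball \<zeta> \<epsilon> \<Longrightarrow> u z \<le> ereal C" using C' ball_subset_cball by blast
  have m: "0 < moll_mass \<epsilon>" by (rule moll_mass_pos[OF \<epsilon>])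
  have meas: "(\<lambda>z. ennreal (bump ((\<zeta> - z) / of_real \<epsilon>)) * neg_shift C u z) \<in> borel_measurable borel" by measurable
  have "ennreal (moll_mass \<epsilon> * (C - moll u \<epsilon> \<zeta>)) = (\<integral>\<^sup>+z. ennreal (bump ((\<zeta> - z) / of_real \<epsilon>)) * neg_shift C u z \<partial>lborel)"
    by (rule moll_neg_shift(1)[OF u \<epsilon> Cb, symmetric])
  also have "\<dots> = (\<integral>\<^sup>+w. ennreal (bump (w / of_real \<epsilon>)) * neg_shift C u (\<zeta> + w) \<partial>lborel)"
    using nn_integral_shift[OF meas, of \<zeta>] by (simp add: minus_divide_left[symmetric])
  also have "\<dots> \<le> ennreal (moll_mass \<epsilon>) * neg_shift C u \<zeta>"
    by (rule bump_area_mean[OF u C(1) C' \<epsilon>])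
  finally have le: "ennreal (moll_mass \<epsilon> * (C - moll u \<epsilon> \<zeta>)) \<le> ennreal (moll_mass \<epsilon>) * neg_shift C u \<zeta>" .
  show ?thesis
  proof (cases "u \<zeta>")
    case (real x)
    then have "x \<le> C" using C'[of \<zeta>] \<epsilon> by simp
    then have "moll_mass \<epsilon> * (C - moll u \<epsilon> \<zeta>) \<le> moll_mass \<epsilon> * (C - x)"
      using le m real by (simp add: neg_shift_def ennreal_mult[symmetric] ennreal_le_iff)
    then show ?thesis using m real by simp
  qed (use u in \<open>auto simp: subharmonic_on_def\<close>)
qed

lemma moll_continuous:
  assumes "subharmonic_on UNIV u" "0 < \<epsilon>" shows "continuous_on S (moll u \<epsilon>)"
proof -
  have "continuous_on UNIV (\<lambda>z. Re (complex_of_real (moll u \<epsilon> z)))"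
    using moll_C2[OF assms] by (intro continuous_on_Re has_wirtinger_imp_continuous_on) (auto simp: C2_real_def)
  then have "continuous_on UNIV (moll u \<epsilon>)" by simp
  then show ?thesis by (rule continuous_on_subset) auto
qed

text \<open>Convolutions commute: the bump mean of the mollification is the mollification of the
  bump means, which dominate \<open>u\<close>. Thus the mollification satisfies the mean inequality
  demanded by \<open>laplacian_nonneg\<close>.\<close>

lemma moll_zb_nonneg:
  assumes u: "subharmonic_on UNIV u" and \<epsilon>: "0 < \<epsilon>"
  shows "0 \<le> moll_zb u \<epsilon> \<zeta>"
proof (rule laplacian_nonneg)
  show "has_wirtinger (\<lambda>z. complex_of_real (moll u \<epsilon> z)) (moll_z u \<epsilon> z) (cnj (moll_z u \<epsilon> z)) z" for z
    using moll_C2[OF u \<epsilon>] by (simp add: C2_real_def)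
  show "has_wirtinger (moll_z u \<epsilon>) (moll_zz u \<epsilon> \<zeta>) (of_real (moll_zb u \<epsilon> \<zeta>)) \<zeta>"
    using moll_C2[OF u \<epsilon>] by (simp add: C2_real_def)
  fix \<rho> :: real assume \<rho>: "0 < \<rho>"
  note [measurable] = subharmonic_measurable[OF u]
  have m: "0 < moll_mass \<epsilon>" "0 < moll_mass \<rho>" by (rule moll_mass_pos[OF \<epsilon>], rule moll_mass_pos[OF \<rho>])
  \<comment> \<open>One bound for \<open>u\<close> on the disc of radius \<epsilon> + \<rho> serves
    all the translates that occur, so a single \<open>neg_shift C u\<close> enters Fubini's
    theorem.\<close>
  obtain C where C: "0 \<le> C" "\<And>z. z \<in> cball \<zeta> (\<epsilon> + \<rho>) \<Longrightarrow> u z < ereal C"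
    using subharmonic_bounded_above[OF u compact_cball[of \<zeta> "\<epsilon> + \<rho>"]] by blast
  have C': "u z \<le> ereal C" if "cmod (z - \<zeta>) \<le> \<epsilon> + \<rho>" for z
    using C(2)[of z] that by (simp add: dist_norm norm_minus_commute order.strict_implies_order)
  have U: "(\<integral>\<^sup>+z. ennreal (bump ((\<zeta> + w - z) / of_real \<epsilon>)) * neg_shift C u z \<partial>lborel) = ennreal (moll_mass \<epsilon> * (C - moll u \<epsilon> (\<zeta> + w)))"
    and Ule: "moll u \<epsilon> (\<zeta> + w) \<le> C" if "cmod w \<le> \<rho>" for w
  proof -
    have b: "\<And>x. x \<in> ball (\<zeta> + w) \<epsilon> \<Longrightarrow> u x \<le> ereal C"
    proof -
      fix x assume "x \<in> ball (\<zeta> + w) \<epsilon>"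
      then have "cmod (x - (\<zeta> + w)) < \<epsilon>" by (simp add: dist_norm norm_minus_commute)
      then have "cmod (x - \<zeta>) \<le> \<epsilon> + \<rho>" using that norm_triangle_ineq[of "x - (\<zeta> + w)" w] by simp
      then show "u x \<le> ereal C" by (rule C')
    qed
    show "(\<integral>\<^sup>+z. ennreal (bump ((\<zeta> + w - z) / of_real \<epsilon>)) * neg_shift C u z \<partial>lborel) = ennreal (moll_mass \<epsilon> * (C - moll u \<epsilon> (\<zeta> + w)))"
      by (rule moll_neg_shift(1)[OF u \<epsilon> b])
    show "moll u \<epsilon> (\<zeta> + w) \<le> C" by (rule moll_neg_shift(2)[OF u \<epsilon> b])
  qed
  define V where "V w = C - moll u \<epsilon> (\<zeta> + w)" for w
  have "(\<integral>\<^sup>+w. ennreal (bump (w / of_real \<rho>) * (moll_mass \<epsilon> * V w)) \<partial>lborel)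
     = (\<integral>\<^sup>+w. \<integral>\<^sup>+z. ennreal (bump (w / of_real \<rho>)) * (ennreal (bump ((\<zeta> + w - z) / of_real \<epsilon>)) * neg_shift C u z) \<partial>lborel \<partial>lborel)"
  proof (rule nn_integral_cong)
    fix w
    show "ennreal (bump (w / of_real \<rho>) * (moll_mass \<epsilon> * V w)) = (\<integral>\<^sup>+z. ennreal (bump (w / of_real \<rho>)) * (ennreal (bump ((\<zeta> + w - z) / of_real \<epsilon>)) * neg_shift C u z) \<partial>lborel)"
    proof (cases "cmod w \<le> \<rho>")
      case True
      show ?thesis
        by (subst nn_integral_cmult) (auto simp: U[OF True] V_def bump_nonneg Ule[OF True] m less_imp_le intro!: ennreal_mult)
    next
      case False
      then show ?thesis using \<rho> by (simp add: bump_scaled_eq_0)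
    qed
  qed
  also have "\<dots> = (\<integral>\<^sup>+w. \<integral>\<^sup>+z. ennreal (bump (w / of_real \<rho>)) * (ennreal (bump ((\<zeta> - z) / of_real \<epsilon>)) * neg_shift C u (z + w)) \<partial>lborel \<partial>lborel)"
  proof (rule nn_integral_cong)
    fix w
    show "(\<integral>\<^sup>+z. ennreal (bump (w / of_real \<rho>)) * (ennreal (bump ((\<zeta> + w - z) / of_real \<epsilon>)) * neg_shift C u z) \<partial>lborel)
      = (\<integral>\<^sup>+z. ennreal (bump (w / of_real \<rho>)) * (ennreal (bump ((\<zeta> - z) / of_real \<epsilon>)) * neg_shift C u (z + w)) \<partial>lborel)"
      using nn_integral_shift[of "\<lambda>z. ennreal (bump (w / of_real \<rho>)) * (ennreal (bump ((\<zeta> + w - z) / of_real \<epsilon>)) * neg_shift C u z)" w]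
      by (simp add: add.commute)
  qed
  also have "\<dots> = (\<integral>\<^sup>+z. \<integral>\<^sup>+w. ennreal (bump (w / of_real \<rho>)) * (ennreal (bump ((\<zeta> - z) / of_real \<epsilon>)) * neg_shift C u (z + w)) \<partial>lborel \<partial>lborel)"
    by (rule lborel_pair.Fubini') measurable
  also have "\<dots> \<le> (\<integral>\<^sup>+z. ennreal (moll_mass \<rho>) * (ennreal (bump ((\<zeta> - z) / of_real \<epsilon>)) * neg_shift C u z) \<partial>lborel)"
  proof (rule nn_integral_mono)
    fix z
    have "(\<integral>\<^sup>+w. ennreal (bump (w / of_real \<rho>)) * (ennreal (bump ((\<zeta> - z) / of_real \<epsilon>)) * neg_shift C u (z + w)) \<partial>lborel)
      = ennreal (bump ((\<zeta> - z) / of_real \<epsilon>)) * (\<integral>\<^sup>+w. ennreal (bump (w / of_real \<rho>)) * neg_shift C u (z + w) \<partial>lborel)"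
      by (subst nn_integral_cmult[symmetric]) (auto simp: mult_ac)
    also have "\<dots> \<le> ennreal (bump ((\<zeta> - z) / of_real \<epsilon>)) * (ennreal (moll_mass \<rho>) * neg_shift C u z)"
    proof (cases "cmod (\<zeta> - z) < \<epsilon>")
      case True
      have "(\<integral>\<^sup>+w. ennreal (bump (w / of_real \<rho>)) * neg_shift C u (z + w) \<partial>lborel) \<le> ennreal (moll_mass \<rho>) * neg_shift C u z"
      proof (rule bump_area_mean[OF u C(1) _ \<rho>])
        fix w assume "w \<in> cball z \<rho>"
        then have "cmod (w - \<zeta>) \<le> \<epsilon> + \<rho>"
          using True norm_triangle_ineq[of "w - z" "z - \<zeta>"] by (simp add: dist_norm norm_minus_commute)
        then show "u w \<le> ereal C" by (rule C')
      qed
      then show ?thesis by (rule mult_left_mono) simp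
    next
      case False
      then show ?thesis using \<epsilon> by (simp add: bump_scaled_eq_0)
    qed
    finally show "(\<integral>\<^sup>+w. ennreal (bump (w / of_real \<rho>)) * (ennreal (bump ((\<zeta> - z) / of_real \<epsilon>)) * neg_shift C u (z + w)) \<partial>lborel)
       \<le> ennreal (moll_mass \<rho>) * (ennreal (bump ((\<zeta> - z) / of_real \<epsilon>)) * neg_shift C u z)"
      by (simp add: mult_ac)
  qed
  also have "\<dots> = ennreal (moll_mass \<rho>) * ennreal (moll_mass \<epsilon> * V 0)"
    using U[of 0] \<rho> by (subst nn_integral_cmult) (auto simp: V_def)
  also have "\<dots> = ennreal (moll_mass \<rho> * (moll_mass \<epsilon> * V 0))"
    using m Ule[of 0] \<rho> by (intro ennreal_mult[symmetric]) (auto simp: V_def)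
  finally have le: "(\<integral>\<^sup>+w. ennreal (bump (w / of_real \<rho>) * (moll_mass \<epsilon> * V w)) \<partial>lborel) \<le> ennreal (moll_mass \<rho> * (moll_mass \<epsilon> * V 0))" .
  have cV: "continuous_on UNIV V" unfolding V_def
    by (intro continuous_intros continuous_on_compose2[OF moll_continuous[OF u \<epsilon>, of UNIV]]) auto
  have cb: "continuous_on UNIV (\<lambda>w. bump (w / of_real \<rho>))"
    using \<rho> by (intro continuous_on_compose2[OF continuous_bump[of UNIV]] continuous_intros) auto
  have iV: "integrable lborel (\<lambda>w. bump (w / of_real \<rho>) * V w)"
    by (rule integrable_compact_support[of _ "cball 0 \<rho>"])
       (use \<rho> in \<open>auto intro!: continuous_intros cb cV bump_scaled_eq_0\<close>)
  have ib: "integrable lborel (\<lambda>w. bump (w / of_real \<rho>))"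
    by (rule integrable_compact_support[of _ "cball 0 \<rho>"]) (use \<rho> in \<open>auto intro!: cb bump_scaled_eq_0\<close>)
  have pos: "0 \<le> bump (w / of_real \<rho>) * (moll_mass \<epsilon> * V w)" for w
    using m Ule[of w] bump_nonneg bump_scaled_eq_0[OF \<rho>, of w] by (cases "cmod w \<le> \<rho>") (auto simp: V_def)
  have "(\<integral>\<^sup>+w. ennreal (bump (w / of_real \<rho>) * (moll_mass \<epsilon> * V w)) \<partial>lborel) = ennreal (\<integral>w. bump (w / of_real \<rho>) * (moll_mass \<epsilon> * V w) \<partial>lborel)"
  proof (rule nn_integral_eq_integral)
    have "integrable lborel (\<lambda>w. moll_mass \<epsilon> * (bump (w / of_real \<rho>) * V w))" using iV by simp
    then show "integrable lborel (\<lambda>w. bump (w / of_real \<rho>) * (moll_mass \<epsilon> * V w))" by (simp add: mult_ac)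
  qed (use pos in auto)
  also have "(\<integral>w. bump (w / of_real \<rho>) * (moll_mass \<epsilon> * V w) \<partial>lborel) = moll_mass \<epsilon> * (\<integral>w. bump (w / of_real \<rho>) * V w \<partial>lborel)"
    by (simp add: mult.left_commute)
  finally have "moll_mass \<epsilon> * (\<integral>w. bump (w / of_real \<rho>) * V w \<partial>lborel) \<le> moll_mass \<rho> * (moll_mass \<epsilon> * V 0)"
    using le m Ule[of 0] \<rho> by (simp add: ennreal_le_iff V_def)
  then have "(\<integral>w. bump (w / of_real \<rho>) * V w \<partial>lborel) \<le> moll_mass \<rho> * V 0"
    using m by (simp add: mult.left_commute)
  moreover have "(\<integral>w. bump (w / of_real \<rho>) * (V 0 - V w) \<partial>lborel) = moll_mass \<rho> * V 0 - (\<integral>w. bump (w / of_real \<rho>) * V w \<partial>lborel)"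
    using ib iV by (simp add: right_diff_distrib moll_mass_def)
  ultimately show "0 \<le> (\<integral>w. bump (w / of_real \<rho>) * (moll u \<epsilon> (\<zeta> + w) - moll u \<epsilon> \<zeta>) \<partial>lborel)"
    by (simp add: V_def)
qed

text \<open>Upper semicontinuity keeps \<open>u\<close> below \<open>c\<close> on a small disc.
  Together with \<open>moll_ge\<close> this gives pointwise convergence of the mollifications,
  without monotonicity in \<epsilon>.\<close>

lemma moll_le_usc:
  assumes u: "subharmonic_on UNIV u" and c: "u \<zeta> < ereal c"
  obtains d where "0 < d" "\<And>\<epsilon>. 0 < \<epsilon> \<Longrightarrow> \<epsilon> \<le> d \<Longrightarrow> moll u \<epsilon> \<zeta> \<le> c"
proof -
  have "open {z. u z < ereal c}" using u by (auto simp: subharmonic_on_def upper_semicontinuous_on_def)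
  then obtain d where d: "0 < d" "ball \<zeta> d \<subseteq> {z. u z < ereal c}" using c by (metis mem_Collect_eq open_contains_ball)
  show ?thesis
  proof (rule that[OF d(1)])
    fix \<epsilon> :: real assume e: "0 < \<epsilon>" "\<epsilon> \<le> d"
    then have "ball \<zeta> \<epsilon> \<subseteq> ball \<zeta> d" by auto
    then show "moll u \<epsilon> \<zeta> \<le> c"
      using d(2) by (intro moll_neg_shift(2)[OF u e(1)]) (auto simp: subset_iff order.strict_implies_order)
  qed
qed

section \<open>The weighted $\bar\partial$-inequality\<close>

text \<open>Extension by 0 reduces this to functions on the plane: \<open>X\<close> vanishes on the
  open set \<open>U - S\<close>, so its derivatives vanish there and also extend
  continuously.\<close>

lemma integral_wirtinger_local:
  assumes U: "open U" and X: "\<And>z. z \<in> U \<Longrightarrow> has_wirtinger X (a z) (b z) z"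
    and ca: "continuous_on U a" and cb: "continuous_on U b"
    and S: "compact S" "S \<subseteq> U" and 0: "\<And>z. z \<in> U \<Longrightarrow> z \<notin> S \<Longrightarrow> X z = 0"
  shows "integrable lborel (\<lambda>z. indicator S z *\<^sub>R a z)" "(\<integral>z. indicator S z *\<^sub>R a z \<partial>lborel) = 0"
    "integrable lborel (\<lambda>z. indicator S z *\<^sub>R b z)" "(\<integral>z. indicator S z *\<^sub>R b z \<partial>lborel) = 0"
proof -
  have oS: "open (- S)" using S by (simp add: compact_imp_closed open_Compl)
  have ab0: "a z = 0" "b z = 0" if "z \<in> U" "z \<notin> S" for z
  proof -
    have "has_wirtinger X 0 0 z"
      by (rule has_wirtinger_transform[OF has_wirtinger_const[of 0] open_Int[OF U oS]]) (use that 0 in auto)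
    then show "a z = 0" "b z = 0" using has_wirtinger_unique[OF X[OF that(1)]] by auto
  qed
  define X' where "X' z = (if z \<in> S then X z else 0)" for z
  define a' where "a' z = indicator S z *\<^sub>R a z" for z
  define b' where "b' z = indicator S z *\<^sub>R b z" for z
  have cont: "continuous_on UNIV (\<lambda>z. indicator S z *\<^sub>R f z)" if "continuous_on U f" "\<And>z. z \<in> U \<Longrightarrow> z \<notin> S \<Longrightarrow> f z = 0" for f :: "complex \<Rightarrow> complex"
  proof -
    have "continuous_on (U \<union> - S) (\<lambda>z. indicator S z *\<^sub>R f z)"
    proof (rule continuous_on_open_Un[OF U oS])
      show "continuous_on U (\<lambda>z. indicator S z *\<^sub>R f z)"
        by (rule continuous_on_eq[OF that(1)]) (use that(2) in \<open>auto simp: indicator_def\<close>)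
      show "continuous_on (- S) (\<lambda>z. indicator S z *\<^sub>R f z)"
        by (rule continuous_on_eq[OF continuous_on_const[of _ 0]]) auto
    qed
    moreover have "U \<union> - S = UNIV" using S by auto
    ultimately show ?thesis by simp
  qed
  have der: "has_wirtinger X' (a' z) (b' z) z" for z
  proof (cases "z \<in> U")
    case True
    have "has_wirtinger X' (a z) (b z) z"
      by (rule has_wirtinger_transform[OF X[OF True] U True]) (use 0 in \<open>auto simp: X'_def\<close>)
    then show ?thesis using ab0[OF True] by (cases "z \<in> S") (auto simp: a'_def b'_def)
  next
    case False
    have "has_wirtinger X' 0 0 z"
      by (rule has_wirtinger_transform[OF has_wirtinger_const[of 0] oS]) (use False S in \<open>auto simp: X'_def\<close>)
    then show ?thesis using False S by (auto simp: a'_def b'_def indicator_def)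
  qed
  note r = integral_wirtinger_compact_support[OF der cont[OF ca ab0(1), folded a'_def] cont[OF cb ab0(2), folded b'_def] S(1)]
  show "integrable lborel (\<lambda>z. indicator S z *\<^sub>R a z)" "(\<integral>z. indicator S z *\<^sub>R a z \<partial>lborel) = 0"
    "integrable lborel (\<lambda>z. indicator S z *\<^sub>R b z)" "(\<integral>z. indicator S z *\<^sub>R b z \<partial>lborel) = 0"
    using r unfolding a'_def b'_def X'_def by auto
qed

lemma C2_realD:
  assumes "C2_real U f f_z f_zz f_zb"
  shows "z \<in> U \<Longrightarrow> has_wirtinger (\<lambda>z. of_real (f z)) (f_z z) (cnj (f_z z)) z"
    and "z \<in> U \<Longrightarrow> has_wirtinger f_z (f_zz z) (of_real (f_zb z)) z"
    and "continuous_on U f_zz" "continuous_on U f_zb" "continuous_on U f" "continuous_on U f_z"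
proof -
  show 1: "z \<in> U \<Longrightarrow> has_wirtinger (\<lambda>z. of_real (f z)) (f_z z) (cnj (f_z z)) z" for z
    using assms by (auto simp: C2_real_def)
  show 2: "z \<in> U \<Longrightarrow> has_wirtinger f_z (f_zz z) (of_real (f_zb z)) z" for z
    using assms by (auto simp: C2_real_def)
  show "continuous_on U f_zz" "continuous_on U f_zb"
    using assms by (auto simp: C2_real_def)
  have "continuous_on U (\<lambda>z. Re (complex_of_real (f z)))"
    by (intro continuous_on_Re has_wirtinger_imp_continuous_on[OF 1])
  then show "continuous_on U f" by simp
  show "continuous_on U f_z" by (rule has_wirtinger_imp_continuous_on[OF 2])
qed

lemma has_wirtinger_of_real_exp:
  assumes "has_wirtinger (\<lambda>z. complex_of_real (f z)) a b z"
  shows "has_wirtinger (\<lambda>z. complex_of_real (exp (f z))) (of_real (exp (f z)) * a) (of_real (exp (f z)) * b) z"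
  by (rule has_wirtinger_real_chain[OF assms]) (rule DERIV_exp)

text \<open>A twisted Bochner-Kodaira estimate with multiplier \<open>w = - g - exp g\<close>, which
  is nonnegative because \<open>exp g \<le> 1 / 2\<close>. With
  \<open>D = \<beta>_z + \<phi>_z * \<beta>\<close>, the functions
  \<open>- w_zb |\<beta>|^2 + w |D|^2 + w \<phi>_zb |\<beta>|^2\<close> and
  \<open>w |\<beta>_b|^2 + 2 Re (w_z \<beta>_b cnj \<beta>)\<close> have the same integral against
  \<open>exp \<phi>\<close>. The summand \<open>exp g\<close> of the multiplier produces
  \<open>exp g |g_z|^2 |\<beta>|^2\<close> on the left, and this absorbs the cross term on the
  right.\<close>

lemma dbar_inequality:
  assumes U: "open U"
    and \<phi>: "C2_real U \<phi> \<phi>_z \<phi>_zz \<phi>_zb" "\<And>z. z \<in> U \<Longrightarrow> 0 \<le> \<phi>_zb z"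
    and g: "C2_real U g g_z g_zz g_zb" "\<And>z. z \<in> U \<Longrightarrow> 0 \<le> g_zb z" "\<And>z. z \<in> U \<Longrightarrow> exp (g z) \<le> 1 / 2"
    and \<beta>: "\<And>z. has_wirtinger \<beta> (\<beta>_z z) (\<beta>_b z) z" "\<And>z. has_wirtinger \<beta>_z (\<beta>_zz z) (\<beta>_zb z) z"
      "\<And>z. has_wirtinger \<beta>_b (\<beta>_zb z) (\<beta>_bb z) z"
    and c: "continuous_on UNIV \<beta>_zz" "continuous_on UNIV \<beta>_zb" "continuous_on UNIV \<beta>_bb"
    and S: "compact S" "S \<subseteq> U" and 0: "\<And>z. z \<notin> S \<Longrightarrow> \<beta> z = 0"
  shows "(\<integral>z. indicator S z *\<^sub>R (g_zb z * (cmod (\<beta> z))\<^sup>2 * exp (\<phi> z)) \<partial>lborel)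
       \<le> 5 * (\<integral>z. indicator S z *\<^sub>R ((cmod (\<beta>_b z))\<^sup>2 * exp (\<phi> z - g z)) \<partial>lborel)"
proof -
  note P = C2_realD[OF \<phi>(1)] and G = C2_realD[OF g(1)]
  have c\<beta>: "continuous_on U \<beta>" "continuous_on U \<beta>_z" "continuous_on U \<beta>_b" "continuous_on U \<beta>_zz" "continuous_on U \<beta>_zb" "continuous_on U \<beta>_bb"
    using has_wirtinger_imp_continuous_on[OF \<beta>(1), where S=U] has_wirtinger_imp_continuous_on[OF \<beta>(2), where S=U]
      has_wirtinger_imp_continuous_on[OF \<beta>(3), where S=U] c continuous_on_subset by blast+
  let ?e = "\<lambda>z. complex_of_real (exp (\<phi> z))"
  let ?E = "\<lambda>z. complex_of_real (exp (g z))"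
  let ?w = "\<lambda>z. - complex_of_real (g z) - ?E z"
  let ?wz = "\<lambda>z. - g_z z - ?E z * g_z z"
  let ?wb = "\<lambda>z. - cnj (g_z z) - ?E z * cnj (g_z z)"
  let ?wzz = "\<lambda>z. - g_zz z - (?E z * g_zz z + ?E z * g_z z * g_z z)"
  let ?wzb = "\<lambda>z. - of_real (g_zb z) - (?E z * of_real (g_zb z) + ?E z * cnj (g_z z) * g_z z)"
  let ?D = "\<lambda>z. \<beta>_z z + \<phi>_z z * \<beta> z"
  let ?Dz = "\<lambda>z. \<beta>_zz z + (\<phi>_z z * \<beta>_z z + \<phi>_zz z * \<beta> z)"
  let ?Db = "\<lambda>z. \<beta>_zb z + (\<phi>_z z * \<beta>_b z + of_real (\<phi>_zb z) * \<beta> z)"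
  have dw: "has_wirtinger ?w (?wz z) (?wb z) z" if "z \<in> U" for z
    by (intro has_wirtinger_diff has_wirtinger_minus has_wirtinger_of_real_exp G(1) that)
  have dwz: "has_wirtinger ?wz (?wzz z) (?wzb z) z" if "z \<in> U" for z
    by (intro has_wirtinger_diff has_wirtinger_minus has_wirtinger_mult has_wirtinger_of_real_exp G(1,2) that)
  have de: "has_wirtinger ?e (?e z * \<phi>_z z) (?e z * cnj (\<phi>_z z)) z" if "z \<in> U" for z
    by (intro has_wirtinger_of_real_exp P(1) that)
  have dD: "has_wirtinger ?D (?Dz z) (?Db z) z" if "z \<in> U" for z
    by (intro has_wirtinger_add has_wirtinger_mult \<beta> P(2) that)
  \<comment> \<open>The z-derivative of \<open>?X\<close> and the conjugate derivative of
    \<open>?Y\<close> both have integral 0, and their difference contains no second derivatives of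
    \<beta>.\<close>
  let ?X = "\<lambda>z. ((?w z * \<beta> z) * cnj (?D z)) * ?e z"
  let ?XA = "\<lambda>z. ((?w z * \<beta> z) * cnj (?D z)) * (?e z * \<phi>_z z) + ((?w z * \<beta> z) * cnj (?Db z) + (?w z * \<beta>_z z + ?wz z * \<beta> z) * cnj (?D z)) * ?e z"
  let ?XB = "\<lambda>z. ((?w z * \<beta> z) * cnj (?D z)) * (?e z * cnj (\<phi>_z z)) + ((?w z * \<beta> z) * cnj (?Dz z) + (?w z * \<beta>_b z + ?wb z * \<beta> z) * cnj (?D z)) * ?e z"
  let ?Y = "\<lambda>z. (?wz z * (\<beta> z * cnj (\<beta> z)) + (?w z * \<beta> z) * cnj (\<beta>_b z)) * ?e z"
  let ?YA = "\<lambda>z. (?wz z * (\<beta> z * cnj (\<beta> z)) + (?w z * \<beta> z) * cnj (\<beta>_b z)) * (?e z * \<phi>_z z)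
     + ((?wz z * (\<beta> z * cnj (\<beta>_b z) + \<beta>_z z * cnj (\<beta> z)) + ?wzz z * (\<beta> z * cnj (\<beta> z)))
        + ((?w z * \<beta> z) * cnj (\<beta>_bb z) + (?w z * \<beta>_z z + ?wz z * \<beta> z) * cnj (\<beta>_b z))) * ?e z"
  let ?YB = "\<lambda>z. (?wz z * (\<beta> z * cnj (\<beta> z)) + (?w z * \<beta> z) * cnj (\<beta>_b z)) * (?e z * cnj (\<phi>_z z))
     + ((?wz z * (\<beta> z * cnj (\<beta>_z z) + \<beta>_b z * cnj (\<beta> z)) + ?wzb z * (\<beta> z * cnj (\<beta> z)))
        + ((?w z * \<beta> z) * cnj (\<beta>_zb z) + (?w z * \<beta>_b z + ?wb z * \<beta> z) * cnj (\<beta>_b z))) * ?e z"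
  have dX: "has_wirtinger ?X (?XA z) (?XB z) z" if "z \<in> U" for z
    by (intro has_wirtinger_mult has_wirtinger_cnj dw dD de \<beta> that)
  have dY: "has_wirtinger ?Y (?YA z) (?YB z) z" if "z \<in> U" for z
    by (intro has_wirtinger_add has_wirtinger_mult has_wirtinger_cnj dw dwz de \<beta> that)
  note ci = continuous_intros P(3-6) G(3-6) c\<beta>
  have X1: "integrable lborel (\<lambda>z. indicator S z *\<^sub>R ?XA z)" "(\<integral>z. indicator S z *\<^sub>R ?XA z \<partial>lborel) = 0"
    by (rule integral_wirtinger_local[where b = ?XB, OF U dX _ _ S]; (intro ci | simp add: 0))+
  have Y1: "integrable lborel (\<lambda>z. indicator S z *\<^sub>R ?YB z)" "(\<integral>z. indicator S z *\<^sub>R ?YB z \<partial>lborel) = 0"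
    by (rule integral_wirtinger_local[where a = ?YA, OF U dY _ _ S]; (intro ci | simp add: 0))+
  define T where "T z = ?XA z - ?YB z" for z
  have T: "T z = - ?wzb z * (\<beta> z * cnj (\<beta> z)) * ?e z + ?w z * (?D z * cnj (?D z)) * ?e z
      + ?w z * of_real (\<phi>_zb z) * (\<beta> z * cnj (\<beta> z)) * ?e z - ?w z * (\<beta>_b z * cnj (\<beta>_b z)) * ?e z
      - (?wz z * \<beta>_b z * cnj (\<beta> z) + cnj (?wz z * \<beta>_b z * cnj (\<beta> z))) * ?e z" for z
    unfolding T_def by (simp add: algebra_simps)
  have iT: "integrable lborel (\<lambda>z. indicator S z *\<^sub>R T z)"
    unfolding T_def scaleR_diff_right by (rule Bochner_Integration.integrable_diff[OF X1(1) Y1(1)])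
  have T0: "(\<integral>z. indicator S z *\<^sub>R T z \<partial>lborel) = 0"
    unfolding T_def scaleR_diff_right by (subst Bochner_Integration.integral_diff[OF X1(1) Y1(1)]) (simp only: X1(2) Y1(2) diff_self)
  have ReT: "g_zb z * (cmod (\<beta> z))\<^sup>2 * exp (\<phi> z) - 5 * ((cmod (\<beta>_b z))\<^sup>2 * exp (\<phi> z - g z)) \<le> Re (T z)" if z: "z \<in> U" for z
  proof -
    define E e b d D where "E = exp (g z)" and "e = exp (\<phi> z)" and "b = cmod (\<beta> z)" and "d = cmod (\<beta>_b z)" and "D = cmod (?D z)"
    define w where "w = - g z - E"
    have E: "0 < E" "E \<le> 1 / 2" using g(3)[OF z] by (auto simp: E_def)
    have e: "0 < e" by (simp add: e_def)
    have "ln (exp (g z)) \<le> ln (1/2)" using E(2) unfolding E_def by (subst ln_le_cancel_iff) auto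
    then have "g z \<le> ln (1/2)" by simp
    then have "g z \<le> - 1 / 2" using ln_le_minus_one[of "1/2 :: real"] by simp
    then have w0: "0 \<le> w" using E by (simp add: w_def)
    have "- g z \<le> exp (- g z)" using exp_ge_add_one_self[of "- g z"] by linarith
    then have "- g z \<le> 1 / E" by (simp add: E_def exp_minus inverse_eq_divide)
    then have w1: "w \<le> 1 / E" using E(1) unfolding w_def by linarith
    define q where "q = cmod (g_z z)"
    define r where "r = Re (?wz z * \<beta>_b z * cnj (\<beta> z))"
    have n2: "x * cnj x = complex_of_real ((cmod x)\<^sup>2)" for x by (rule complex_norm_square[symmetric])
    have Tr: "T z = complex_of_real ((g_zb z + E * g_zb z + E * q\<^sup>2) * b\<^sup>2 * e + w * D\<^sup>2 * e + w * \<phi>_zb z * b\<^sup>2 * e - w * d\<^sup>2 * e - 2 * r * e)"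
    proof -
      have wr: "?w z = of_real w" by (simp add: w_def E_def)
      have wzb: "?wzb z = - of_real (g_zb z + E * g_zb z + E * q\<^sup>2)"
        by (simp add: E_def q_def n2 mult.assoc mult.commute[of "cnj (g_z z)"])
      have rr: "?wz z * \<beta>_b z * cnj (\<beta> z) + cnj (?wz z * \<beta>_b z * cnj (\<beta> z)) = of_real (2 * r)"
        unfolding r_def by (rule complex_add_cnj)
      show ?thesis
        unfolding T n2 wr wzb rr b_def[symmetric] d_def[symmetric] D_def[symmetric] e_def[symmetric] by simp
    qed
    have "\<bar>r\<bar> \<le> cmod (?wz z * \<beta>_b z * cnj (\<beta> z))" unfolding r_def by (rule abs_Re_le_cmod)
    also have "\<dots> = (1 + E) * q * d * b"
    proof -
      have "?wz z = of_real (- (1 + E)) * g_z z" by (simp add: E_def algebra_simps)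
      then have "cmod (?wz z) = (1 + E) * q" using E by (simp only: norm_mult norm_of_real q_def abs_minus_cancel abs_of_nonneg)
      then show ?thesis by (simp only: norm_mult complex_mod_cnj b_def d_def)
    qed
    also have "\<dots> \<le> 2 * q * d * b"
      using E by (intro mult_right_mono) (auto simp: q_def d_def b_def)
    finally have "\<bar>r\<bar> \<le> 2 * (q * d * b)" by (simp only: mult.assoc)
    then have r: "2 * r \<le> 4 * (q * d * b)" by linarith
    \<comment> \<open>Young's inequality for the cross term, weighted so that its first part is
      exactly the term available on the left. The rest, \<open>4 * d\<^sup>2 / E\<close>, and the
      bound \<open>w \<le> 1 / E\<close> add up to the factor 5.\<close>
    have "0 \<le> (E * q * b - 2 * d)\<^sup>2 / E" using E by simp
    also have "\<dots> = E * q\<^sup>2 * b\<^sup>2 + 4 * d\<^sup>2 / E - 4 * (q * d * b)"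
      using E by (simp add: power2_eq_square field_simps)
    finally have r2: "2 * r \<le> E * q\<^sup>2 * b\<^sup>2 + 4 * (d\<^sup>2 / E)" using r by (simp only: times_divide_eq_right)
    have "w * d\<^sup>2 \<le> 1 / E * d\<^sup>2" using w1 by (intro mult_right_mono) auto
    moreover have "0 \<le> E * g_zb z * b\<^sup>2" "0 \<le> w * D\<^sup>2" "0 \<le> w * \<phi>_zb z * b\<^sup>2"
      using E w0 g(2)[OF z] \<phi>(2)[OF z] by auto
    ultimately have "g_zb z * b\<^sup>2 - 5 * (d\<^sup>2 / E) \<le> (g_zb z + E * g_zb z + E * q\<^sup>2) * b\<^sup>2 + w * D\<^sup>2 + w * \<phi>_zb z * b\<^sup>2 - w * d\<^sup>2 - 2 * r"
      using r2 by (simp add: algebra_simps)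
    then have "(g_zb z * b\<^sup>2 - 5 * (d\<^sup>2 / E)) * e \<le> ((g_zb z + E * g_zb z + E * q\<^sup>2) * b\<^sup>2 + w * D\<^sup>2 + w * \<phi>_zb z * b\<^sup>2 - w * d\<^sup>2 - 2 * r) * e"
      using e by (intro mult_right_mono) auto
    moreover have "exp (\<phi> z - g z) = e / E" by (simp add: e_def E_def exp_diff)
    ultimately show ?thesis unfolding Tr Re_complex_of_real
      by (simp add: b_def[symmetric] d_def[symmetric] e_def[symmetric] algebra_simps)
  qed
  have i1: "integrable lborel (\<lambda>z. indicator S z *\<^sub>R (g_zb z * (cmod (\<beta> z))\<^sup>2 * exp (\<phi> z)))"
    by (rule borel_integrable_compact[OF S(1)]) (rule continuous_on_subset[OF _ S(2)], intro ci)
  have i2: "integrable lborel (\<lambda>z. indicator S z *\<^sub>R ((cmod (\<beta>_b z))\<^sup>2 * exp (\<phi> z - g z)))"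
    by (rule borel_integrable_compact[OF S(1)]) (rule continuous_on_subset[OF _ S(2)], intro ci)
  have "(\<integral>z. indicator S z *\<^sub>R (g_zb z * (cmod (\<beta> z))\<^sup>2 * exp (\<phi> z)) - 5 * (indicator S z *\<^sub>R ((cmod (\<beta>_b z))\<^sup>2 * exp (\<phi> z - g z))) \<partial>lborel)
     \<le> (\<integral>z. Re (indicator S z *\<^sub>R T z) \<partial>lborel)"
  proof (rule integral_mono)
    show "integrable lborel (\<lambda>z. Re (indicator S z *\<^sub>R T z))" using iT by (rule integrable_Re)
    fix z show "indicator S z *\<^sub>R (g_zb z * (cmod (\<beta> z))\<^sup>2 * exp (\<phi> z)) - 5 * (indicator S z *\<^sub>R ((cmod (\<beta>_b z))\<^sup>2 * exp (\<phi> z - g z))) \<le> Re (indicator S z *\<^sub>R T z)"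
      using ReT[of z] S(2) by (cases "z \<in> S") auto
  qed (use i1 i2 in auto)
  also have "(\<integral>z. Re (indicator S z *\<^sub>R T z) \<partial>lborel) = 0"
    by (subst integral_Re[OF iT]) (simp only: T0 zero_complex.sel)
  finally show ?thesis using i1 i2 by simp
qed

section \<open>Square integrable holomorphic functions\<close>

text \<open>The difference quotient \<open>g\<close> of \<open>f\<close> at \<open>z\<close> is
  holomorphic, so the dbar-derivative of \<open>bump_base ^ 4 * g\<close> falls on the first factor
  and is a constant multiple of \<open>bump * (f - f z)\<close>. Its integral vanishes, which is the
  mean value property for this weight.\<close>

lemma holomorphic_bump_mean:
  assumes f: "f holomorphic_on ball z \<rho>" and \<epsilon>: "0 < \<epsilon>" "\<epsilon> < \<rho>"
  shows "integrable lborel (\<lambda>w. indicator (cball z \<epsilon>) w *\<^sub>R (of_real (bump ((w - z) / of_real \<epsilon>)) * f w))"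
    and "(\<integral>w. indicator (cball z \<epsilon>) w *\<^sub>R (of_real (bump ((w - z) / of_real \<epsilon>)) * f w) \<partial>lborel) = of_real (moll_mass \<epsilon>) * f z"
proof -
  define g where "g w = (if w = z then deriv f z else (f w - f z) / (w - z))" for w
  have g: "g holomorphic_on ball z \<rho>" unfolding g_def by (rule pole_lemma_open[OF f]) simp
  define c where "c = complex_of_real (1 / \<epsilon>)"
  define s where "s w = complex_of_real (bump_base (c * (w - z)))" for w
  have s: "has_wirtinger (\<lambda>w. s w ^ Suc (Suc 2)) (- 4 * s w ^ 3 * cnj (c * (w - z)) * c) (- 4 * s w ^ 3 * (c * (w - z)) * cnj c) w" for w
  proof -
    have "has_wirtinger (\<lambda>u. of_real (bump_base (c * u)) ^ Suc (Suc 2)) (- 4 * s w ^ 3 * cnj (c * (w - z)) * c) (- 4 * s w ^ 3 * (c * (w - z)) * cnj c) (w + - z)"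
      by (rule has_wirtinger_eq[OF has_wirtinger_linear[OF has_wirtinger_bump_base_power]]) (auto simp: s_def eval_nat_numeral)
    from has_wirtinger_shift[OF this] show ?thesis by (simp add: s_def)
  qed
  have s0: "s w = 0" if "w \<notin> cball z \<epsilon>" for w
    using that \<epsilon> unfolding s_def c_def by (simp add: bump_base_eq_0 norm_mult norm_divide dist_norm norm_minus_commute field_simps)
  have cs: "continuous_on S s" for S unfolding s_def
    by (intro continuous_intros continuous_on_compose2[OF continuous_bump_base[of UNIV]]) auto
  have dg: "has_wirtinger g (deriv g w) 0 w" if "w \<in> ball z \<rho>" for w
    using g that by (intro has_wirtinger_field_derivative holomorphic_derivI[of g "ball z \<rho>"]) auto
  have cg: "continuous_on (ball z \<rho>) g" "continuous_on (ball z \<rho>) (deriv g)"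
    by (intro holomorphic_on_imp_continuous_on g holomorphic_deriv open_ball)+
  let ?a = "\<lambda>w. s w ^ Suc (Suc 2) * deriv g w + (- 4 * s w ^ 3 * cnj (c * (w - z)) * c) * g w"
  let ?b = "\<lambda>w. s w ^ Suc (Suc 2) * 0 + (- 4 * s w ^ 3 * (c * (w - z)) * cnj c) * g w"
  have I: "integrable lborel (\<lambda>w. indicator (cball z \<epsilon>) w *\<^sub>R ?b w)" "(\<integral>w. indicator (cball z \<epsilon>) w *\<^sub>R ?b w \<partial>lborel) = 0"
  proof -
    have X: "has_wirtinger (\<lambda>w. s w ^ Suc (Suc 2) * g w) (?a w) (?b w) w" if "w \<in> ball z \<rho>" for w
      by (rule has_wirtinger_mult[OF s dg[OF that]])
    have sub: "cball z \<epsilon> \<subseteq> ball z \<rho>" using \<epsilon> by auto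
    note r = integral_wirtinger_local[OF open_ball X _ _ compact_cball sub]
    show "integrable lborel (\<lambda>w. indicator (cball z \<epsilon>) w *\<^sub>R ?b w)"
      by (rule r(3)) (assumption | (intro continuous_intros cs cg)[1] | simp add: s0)+
    show "(\<integral>w. indicator (cball z \<epsilon>) w *\<^sub>R ?b w \<partial>lborel) = 0"
      by (rule r(4)) (assumption | (intro continuous_intros cs cg)[1] | simp add: s0)+
  qed
  have b: "?b w = (- 4 * (c * cnj c)) * (of_real (bump ((w - z) / of_real \<epsilon>)) * (f w - f z))" for w
    by (simp add: g_def s_def c_def bump_def)
  define q where "q = - 4 * (c * cnj c)"
  have c0: "q \<noteq> 0" using \<epsilon> by (simp add: c_def q_def)
  define K where "K w = indicator (cball z \<epsilon>) w *\<^sub>R (of_real (bump ((w - z) / of_real \<epsilon>)) * (f w - f z))" for w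
  have Kb: "indicator (cball z \<epsilon>) w *\<^sub>R ?b w = q * K w" for w
    unfolding b K_def q_def by (simp only: mult_scaleR_right)
  have iK: "integrable lborel K"
  proof -
    have "integrable lborel (\<lambda>w. inverse q * (q * K w))"
      using I(1) unfolding Kb by (rule integrable_mult_right)
    then show ?thesis using c0 by (simp add: mult.assoc[symmetric])
  qed
  have K0: "(\<integral>w. K w \<partial>lborel) = 0"
    using I(2) unfolding Kb using c0 by simp
  have bump_sym: "bump ((w - z) / of_real \<epsilon>) = bump ((z - w) / of_real \<epsilon>)" for w
    using bump_uminus[of "(w - z) / of_real \<epsilon>"] by (simp add: minus_divide_left)
  have ib: "integrable lborel (\<lambda>w. bump ((w - z) / of_real \<epsilon>))"
    unfolding bump_sym by (rule integrable_bump_scaled[OF \<epsilon>(1)])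
  have bz: "(\<integral>w. bump ((w - z) / of_real \<epsilon>) \<partial>lborel) = moll_mass \<epsilon>"
    unfolding bump_sym by (rule integral_bump_scaled)
  have eq: "indicator (cball z \<epsilon>) w *\<^sub>R (of_real (bump ((w - z) / of_real \<epsilon>)) * f w) = K w + of_real (bump ((w - z) / of_real \<epsilon>)) * f z" for w
  proof (cases "w \<in> cball z \<epsilon>")
    case True then show ?thesis by (simp add: K_def algebra_simps)
  next
    case False
    then have "bump ((w - z) / of_real \<epsilon>) = 0"
      using \<epsilon> by (intro bump_scaled_eq_0) (auto simp: dist_norm norm_minus_commute)
    then show ?thesis using False by (simp add: K_def)
  qed
  have ib': "integrable lborel (\<lambda>w. complex_of_real (bump ((w - z) / of_real \<epsilon>)) * f z)" using ib by simp
  show "integrable lborel (\<lambda>w. indicator (cball z \<epsilon>) w *\<^sub>R (of_real (bump ((w - z) / of_real \<epsilon>)) * f w))"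
    unfolding eq by (rule Bochner_Integration.integrable_add[OF iK ib'])
  show "(\<integral>w. indicator (cball z \<epsilon>) w *\<^sub>R (of_real (bump ((w - z) / of_real \<epsilon>)) * f w) \<partial>lborel) = of_real (moll_mass \<epsilon>) * f z"
    unfolding eq by (subst Bochner_Integration.integral_add[OF iK ib']) (simp add: K0 bz integral_complex_of_real)
qed

text \<open>Cauchy-Schwarz in the bump mean value formula, with the bump at most 1 on a disc of area
  \<open>pi * \<epsilon>\<^sup>2\<close>.\<close>

lemma holomorphic_L2_bound:
  assumes f: "f holomorphic_on ball z \<rho>" and \<epsilon>: "0 < \<epsilon>" "\<epsilon> < \<rho>"
  shows "ennreal ((cmod (f z))\<^sup>2) \<le> ennreal (pi * \<epsilon>\<^sup>2 / (moll_mass \<epsilon>)\<^sup>2) * (\<integral>\<^sup>+w\<in>cball z \<epsilon>. ennreal ((cmod (f w))\<^sup>2) \<partial>lborel)"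
proof -
  note H = holomorphic_bump_mean[OF f \<epsilon>]
  have m: "0 < moll_mass \<epsilon>" by (rule moll_mass_pos[OF \<epsilon>(1)])
  define F where "F w = indicator (cball z \<epsilon>) w *\<^sub>R f w" for w
  have F [measurable]: "F \<in> borel_measurable borel"
    unfolding F_def
    by (rule borel_measurable_continuous_on_indicator)
       (use \<epsilon> in \<open>auto intro!: continuous_on_subset[OF holomorphic_on_imp_continuous_on[OF f]]\<close>)
  have "ennreal (moll_mass \<epsilon> * cmod (f z)) = ennreal (cmod (of_real (moll_mass \<epsilon>) * f z))"
    using m by (simp add: norm_mult)
  also have "\<dots> \<le> (\<integral>\<^sup>+w. ennreal (cmod (indicator (cball z \<epsilon>) w *\<^sub>R (of_real (bump ((w - z) / of_real \<epsilon>)) * f w))) \<partial>lborel)"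
    unfolding H(2)[symmetric] by (rule integral_norm_bound_ennreal[OF H(1)])
  also have "\<dots> \<le> (\<integral>\<^sup>+w. indicator (cball z \<epsilon>) w * ennreal (cmod (F w)) \<partial>lborel)"
    by (rule nn_integral_mono)
       (auto simp: F_def indicator_def norm_mult bump_nonneg intro!: ennreal_leI mult_left_le_one_le bump_le_1)
  finally have "ennreal (moll_mass \<epsilon> * cmod (f z)) ^ 2 \<le> (\<integral>\<^sup>+w. indicator (cball z \<epsilon>) w * ennreal (cmod (F w)) \<partial>lborel) ^ 2"
    by (rule power_mono) simp
  also have "\<dots> \<le> (\<integral>\<^sup>+w. (indicator (cball z \<epsilon>) w)\<^sup>2 \<partial>lborel) * (\<integral>\<^sup>+w. (ennreal (cmod (F w)))\<^sup>2 \<partial>lborel)"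
    by (rule Cauchy_Schwarz_nn_integral) (auto intro!: borel_measurable_indicator)
  also have "(\<integral>\<^sup>+w. (indicator (cball z \<epsilon>) w)\<^sup>2 \<partial>lborel) = emeasure lborel (cball z \<epsilon>)"
  proof -
    have "(indicator A w :: ennreal)\<^sup>2 = indicator A w" for A and w :: complex
      by (simp add: indicator_def)
    then show ?thesis by (simp only:) (rule nn_integral_indicator, simp)
  qed
  also have "emeasure lborel (cball z \<epsilon>) = ennreal (pi * \<epsilon>\<^sup>2)"
    using \<epsilon> by (simp add: emeasure_cball unit_ball_vol_2)
  also have "(\<integral>\<^sup>+w. (ennreal (cmod (F w)))\<^sup>2 \<partial>lborel) = (\<integral>\<^sup>+w\<in>cball z \<epsilon>. ennreal ((cmod (f w))\<^sup>2) \<partial>lborel)"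
    by (intro nn_integral_cong) (auto simp: F_def indicator_def ennreal_power)
  finally have le: "ennreal ((moll_mass \<epsilon> * cmod (f z))\<^sup>2) \<le> ennreal (pi * \<epsilon>\<^sup>2) * (\<integral>\<^sup>+w\<in>cball z \<epsilon>. ennreal ((cmod (f w))\<^sup>2) \<partial>lborel)"
    using m by (simp add: ennreal_power)
  have "ennreal ((cmod (f z))\<^sup>2) = ennreal (1 / (moll_mass \<epsilon>)\<^sup>2) * ennreal ((moll_mass \<epsilon> * cmod (f z))\<^sup>2)"
    using m by (subst ennreal_mult[symmetric]) (auto simp: power_mult_distrib)
  also have "\<dots> \<le> ennreal (1 / (moll_mass \<epsilon>)\<^sup>2) * (ennreal (pi * \<epsilon>\<^sup>2) * (\<integral>\<^sup>+w\<in>cball z \<epsilon>. ennreal ((cmod (f w))\<^sup>2) \<partial>lborel))"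
    by (rule mult_left_mono[OF le]) simp
  also have "\<dots> = ennreal (pi * \<epsilon>\<^sup>2 / (moll_mass \<epsilon>)\<^sup>2) * (\<integral>\<^sup>+w\<in>cball z \<epsilon>. ennreal ((cmod (f w))\<^sup>2) \<partial>lborel)"
    by (subst mult.assoc[symmetric], subst ennreal_mult[symmetric]) auto
  finally show ?thesis .
qed

lemma holomorphic_compact_L2_bound:
  assumes D: "open D" and L: "compact L" "L \<subseteq> D"
  obtains L' C where "compact L'" "L' \<subseteq> D" "0 \<le> C"
    "\<And>f z. f holomorphic_on D \<Longrightarrow> z \<in> L \<Longrightarrow> ennreal ((cmod (f z))\<^sup>2) \<le> ennreal C * (\<integral>\<^sup>+w\<in>L'. ennreal ((cmod (f w))\<^sup>2) \<partial>lborel)"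
proof (cases "L = {}")
  case True
  then show ?thesis using that[of "{}" 0] by auto
next
  case False
  obtain e where e: "0 < e" "{x. infdist x L \<le> e} \<subseteq> D"
    using compact_in_open_separated[OF False L(1) D L(2)] by blast
  have sub: "cball z e \<subseteq> {x. infdist x L \<le> e}" if "z \<in> L" for z
  proof
    fix x assume "x \<in> cball z e"
    then show "x \<in> {x. infdist x L \<le> e}" using infdist_le[OF that, of x] by (simp add: dist_commute)
  qed
  show ?thesis
  proof (rule that[of "{x. infdist x L \<le> e}" "pi * (e/2)\<^sup>2 / (moll_mass (e/2))\<^sup>2"])
    show "compact {x. infdist x L \<le> e}" by (rule compact_infdist_le[OF False L(1) e(1)])
    fix f z assume f: "f holomorphic_on D" and z: "z \<in> L"
    have f': "f holomorphic_on ball z e"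
      by (rule holomorphic_on_subset[OF f]) (use sub[OF z] e(2) ball_subset_cball in blast)
    have "ennreal ((cmod (f z))\<^sup>2) \<le> ennreal (pi * (e/2)\<^sup>2 / (moll_mass (e/2))\<^sup>2) * (\<integral>\<^sup>+w\<in>cball z (e/2). ennreal ((cmod (f w))\<^sup>2) \<partial>lborel)"
      by (rule holomorphic_L2_bound[OF f']) (use e in auto)
    also have "\<dots> \<le> ennreal (pi * (e/2)\<^sup>2 / (moll_mass (e/2))\<^sup>2) * (\<integral>\<^sup>+w\<in>{x. infdist x L \<le> e}. ennreal ((cmod (f w))\<^sup>2) \<partial>lborel)"
    proof (intro mult_left_mono nn_integral_mono)
      have "cball z (e/2) \<subseteq> cball z e" using e(1) by (intro subset_cball) simp
      with sub[OF z] have "cball z (e/2) \<subseteq> {x. infdist x L \<le> e}" by blast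
      then show "indicator (cball z (e/2)) x \<le> (indicator {x. infdist x L \<le> e} x :: ennreal)" for x
        by (auto simp: indicator_def)
    qed auto
    finally show "ennreal ((cmod (f z))\<^sup>2) \<le> ennreal (pi * (e/2)\<^sup>2 / (moll_mass (e/2))\<^sup>2) * (\<integral>\<^sup>+w\<in>{x. infdist x L \<le> e}. ennreal ((cmod (f w))\<^sup>2) \<partial>lborel)" .
  qed (use e in auto)
qed

lemma holomorphic_measurable:
  assumes "f holomorphic_on D" "open D"
  shows "(\<lambda>z. indicator D z *\<^sub>R f z) \<in> borel_measurable borel"
  by (rule borel_measurable_continuous_on_indicator) (use assms holomorphic_on_imp_continuous_on in auto)

text \<open>Normal families with varying domains and weights. Weights bounded below on compact sets
  turn the norm bounds into local uniform bounds; Montel's theorem on each \<open>D k\<close> and a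
  diagonal sequence give the limit, and Fatou's lemma bounds its norm. Almost everywhere convergence
  of the weights suffices.\<close>

lemma bergman_limit:
  fixes D :: "nat \<Rightarrow> complex set" and f :: "nat \<Rightarrow> complex \<Rightarrow> complex" and W :: "nat \<Rightarrow> complex \<Rightarrow> real"
  assumes D: "\<And>n. open (D n)" "\<And>n. D n \<subseteq> D (Suc n)"
    and f: "\<And>n. f n holomorphic_on D n"
    and W: "\<And>n. W n \<in> borel_measurable borel" "\<And>n z. 0 \<le> W n z"
    and low: "\<And>L. compact L \<Longrightarrow> L \<subseteq> (\<Union>n. D n) \<Longrightarrow> \<exists>c>0. \<forall>n. \<forall>z\<in>L. c \<le> W n z"
    and B: "\<And>n. (\<integral>\<^sup>+z\<in>D n. ennreal ((cmod (f n z))\<^sup>2 * W n z) \<partial>lborel) \<le> ennreal (B n)" "B \<longlonglongrightarrow> b"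
    and lim: "AE z in lborel. z \<in> (\<Union>n. D n) \<longrightarrow> (\<lambda>n. W n z) \<longlonglongrightarrow> W' z"
  obtains g r where "strict_mono (r :: nat \<Rightarrow> nat)" "g holomorphic_on (\<Union>n. D n)"
    "\<And>z. z \<in> (\<Union>n. D n) \<Longrightarrow> (\<lambda>n. f (r n) z) \<longlonglongrightarrow> g z"
    "(\<integral>\<^sup>+z\<in>(\<Union>n. D n). ennreal ((cmod (g z))\<^sup>2 * W' z) \<partial>lborel) \<le> ennreal b"
proof -
  have Dmono: "D m \<subseteq> D n" if "m \<le> n" for m n using that D(2) by (rule lift_Suc_mono_le[rotated])
  obtain B' where B': "\<And>n. B n \<le> B'"
    using convergent_imp_Bseq[OF convergentI[OF B(2)]] unfolding Bseq_def by (metis abs_le_iff real_norm_def)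
  have B'b: "ennreal (B n) \<le> ennreal B'" for n by (rule ennreal_leI[OF B'])
  have loc: "\<exists>M. \<forall>n\<ge>k. \<forall>z\<in>L. cmod (f n z) \<le> M" if L: "compact L" "L \<subseteq> D k" for k L
  proof -
    obtain L' C where L': "compact L'" "L' \<subseteq> D k" "0 \<le> C"
      "\<And>f z. f holomorphic_on D k \<Longrightarrow> z \<in> L \<Longrightarrow> ennreal ((cmod (f z))\<^sup>2) \<le> ennreal C * (\<integral>\<^sup>+w\<in>L'. ennreal ((cmod (f w))\<^sup>2) \<partial>lborel)"
      by (rule holomorphic_compact_L2_bound[OF D(1) L]) blast
    obtain c where c: "c > 0" "\<And>n z. z \<in> L' \<Longrightarrow> c \<le> W n z" using low[OF L'(1)] L'(2) by blast
    have bd: "(cmod (f n z))\<^sup>2 \<le> C * (1 / c * max B' 0)" if n: "k \<le> n" and z: "z \<in> L" for n z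
    proof -
      have hol: "f n holomorphic_on D k" by (rule holomorphic_on_subset[OF f Dmono[OF n]])
      have "(\<integral>\<^sup>+w\<in>L'. ennreal ((cmod (f n w))\<^sup>2) \<partial>lborel) \<le> (\<integral>\<^sup>+w. ennreal (1 / c) * (ennreal ((cmod (f n w))\<^sup>2 * W n w) * indicator (D n) w) \<partial>lborel)"
      proof (rule nn_integral_mono)
        fix w
        show "ennreal ((cmod (f n w))\<^sup>2) * indicator L' w \<le> ennreal (1 / c) * (ennreal ((cmod (f n w))\<^sup>2 * W n w) * indicator (D n) w)"
        proof (cases "w \<in> L'")
          case True
          then have "w \<in> D n" using L'(2) Dmono[OF n] by auto
          moreover have "(cmod (f n w))\<^sup>2 * c \<le> (cmod (f n w))\<^sup>2 * W n w"
            by (rule mult_left_mono[OF c(2)[OF True]]) simp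
          then have "(cmod (f n w))\<^sup>2 \<le> 1 / c * ((cmod (f n w))\<^sup>2 * W n w)" using c(1) by (simp add: field_simps)
          then have "ennreal ((cmod (f n w))\<^sup>2) \<le> ennreal (1 / c) * ennreal ((cmod (f n w))\<^sup>2 * W n w)"
            using c(1) W(2) by (subst ennreal_mult[symmetric]) (auto intro!: ennreal_leI)
          ultimately show ?thesis using True by simp
        qed simp
      qed
      also have "\<dots> = ennreal (1 / c) * (\<integral>\<^sup>+w\<in>D n. ennreal ((cmod (f n w))\<^sup>2 * W n w) \<partial>lborel)"
      proof (rule nn_integral_cmult)
        have "(\<lambda>w. ennreal ((cmod (indicator (D n) w *\<^sub>R f n w))\<^sup>2 * W n w)) \<in> borel_measurable lborel"
          using holomorphic_measurable[OF f D(1), of n] W(1)[of n] by measurable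
        also have "(\<lambda>w. ennreal ((cmod (indicator (D n) w *\<^sub>R f n w))\<^sup>2 * W n w)) = (\<lambda>w. ennreal ((cmod (f n w))\<^sup>2 * W n w) * indicator (D n) w)"
          by (auto simp: indicator_def)
        finally show "(\<lambda>w. ennreal ((cmod (f n w))\<^sup>2 * W n w) * indicator (D n) w) \<in> borel_measurable lborel" .
      qed
      also have "\<dots> \<le> ennreal (1 / c) * ennreal (max B' 0)"
        by (intro mult_left_mono order_trans[OF B(1)] ennreal_leI) (auto simp: B' le_max_iff_disj)
      also have "\<dots> = ennreal (1 / c * max B' 0)" using c(1) by (intro ennreal_mult[symmetric]) auto
      finally have "ennreal ((cmod (f n z))\<^sup>2) \<le> ennreal C * ennreal (1 / c * max B' 0)"
        using L'(4)[OF hol z] by (meson mult_left_mono order_trans zero_le)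
      also have "\<dots> = ennreal (C * (1 / c * max B' 0))" using L'(3) c(1) by (intro ennreal_mult[symmetric]) auto
      finally show ?thesis using L'(3) c(1) by (subst (asm) ennreal_le_iff) auto
    qed
    have "cmod (f n z) \<le> sqrt (C * (1 / c * max B' 0))" if "k \<le> n" "z \<in> L" for n z
      using bd[OF that] by (intro real_le_rsqrt)
    then show ?thesis by (intro exI[of _ "sqrt (C * (1 / c * max B' 0))"]) simp
  qed
  define P where "P k s = (\<exists>g. g holomorphic_on D k \<and> (\<forall>z\<in>D k. (\<lambda>n. f (s n) z) \<longlonglongrightarrow> g z))" for k and s :: "nat \<Rightarrow> nat"
  interpret subseqs P
  proof
    fix k and s :: "nat \<Rightarrow> nat" assume s: "strict_mono s"
    \<comment> \<open>Only members of index at least \<open>k\<close> are known to be holomorphic on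
      \<open>D k\<close>; the shift by \<open>k\<close> discards the others.\<close>
    have sk: "k \<le> s (n + k)" for n using seq_suble[OF s, of "n + k"] by simp
    obtain g r where gr: "g holomorphic_on D k" "strict_mono (r :: nat \<Rightarrow> nat)" "\<And>z. z \<in> D k \<Longrightarrow> (\<lambda>n. f (s (r n + k)) z) \<longlonglongrightarrow> g z"
    proof (rule Montel[of "D k" "range (\<lambda>n. f (s (n + k)))" "\<lambda>n. f (s (n + k))"])
      show "h holomorphic_on D k" if "h \<in> range (\<lambda>n. f (s (n + k)))" for h
        using that holomorphic_on_subset[OF f Dmono[OF sk]] by auto
      show "\<exists>B. \<forall>h\<in>range (\<lambda>n. f (s (n + k))). \<forall>z\<in>L. cmod (h z) \<le> B" if "compact L" "L \<subseteq> D k" for L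
        using loc[OF that] sk by (metis (no_types, lifting) rangeE)
    qed (use D in auto)
    have "strict_mono (\<lambda>n. r n + k)" using gr(2) by (simp add: strict_mono_def)
    moreover have "P k (s \<circ> (\<lambda>n. r n + k))"
      unfolding P_def o_def using gr(1,3) by blast
    ultimately show "\<exists>r'. strict_mono r' \<and> P k (s \<circ> r')" by blast
  qed
  have stable: "P k (s \<circ> r)" if "strict_mono r" "P k s" for r s k
  proof -
    obtain g where g: "g holomorphic_on D k" "\<And>z. z \<in> D k \<Longrightarrow> (\<lambda>n. f (s n) z) \<longlonglongrightarrow> g z"
      using \<open>P k s\<close> unfolding P_def by blast
    have "(\<lambda>n. f ((s \<circ> r) n) z) \<longlonglongrightarrow> g z" if "z \<in> D k" for z
      using LIMSEQ_subseq_LIMSEQ[OF g(2)[OF that] \<open>strict_mono r\<close>] by (simp add: o_def)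
    then show ?thesis unfolding P_def using g(1) by blast
  qed
  have Pd: "P k diagseq" for k
  proof -
    \<comment> \<open>The diagonal sequence is a subsequence of the k-th one only after its first
      terms, which do not affect the limit.\<close>
    have "P k (diagseq \<circ> ((+) (Suc k)))" by (rule diagseq_holds) (use stable in blast)
    then obtain g where g: "g holomorphic_on D k" "\<And>z. z \<in> D k \<Longrightarrow> (\<lambda>n. f (diagseq (Suc k + n)) z) \<longlonglongrightarrow> g z"
      unfolding P_def o_def by blast
    have "(\<lambda>n. f (diagseq n) z) \<longlonglongrightarrow> g z" if "z \<in> D k" for z
      using LIMSEQ_offset[of "\<lambda>n. f (diagseq n) z" "Suc k" "g z"] g(2)[OF that] by (simp add: add.commute)
    then show ?thesis unfolding P_def using g(1) by blast
  qed
  define g where "g z = lim (\<lambda>n. f (diagseq n) z)" for z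
  have gk: "g holomorphic_on D k" and gl: "\<And>z. z \<in> D k \<Longrightarrow> (\<lambda>n. f (diagseq n) z) \<longlonglongrightarrow> g z" for k
  proof -
    obtain h where h: "h holomorphic_on D k" "\<And>z. z \<in> D k \<Longrightarrow> (\<lambda>n. f (diagseq n) z) \<longlonglongrightarrow> h z"
      using Pd[of k] unfolding P_def by blast
    then have "\<And>z. z \<in> D k \<Longrightarrow> h z = g z" unfolding g_def by (metis limI)
    then show "g holomorphic_on D k" "\<And>z. z \<in> D k \<Longrightarrow> (\<lambda>n. f (diagseq n) z) \<longlonglongrightarrow> g z"
      using h holomorphic_transform[OF h(1)] by auto
  qed
  have ghol: "g holomorphic_on (\<Union>n. D n)" by (rule holomorphic_on_UN_open) (use gk D in auto)
  define u where "u n z = ennreal ((cmod (f (diagseq n) z))\<^sup>2 * W (diagseq n) z) * indicator (D (diagseq n)) z" for n z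
  have mu: "u n \<in> borel_measurable lborel" for n
  proof -
    have "(\<lambda>w. ennreal ((cmod (indicator (D (diagseq n)) w *\<^sub>R f (diagseq n) w))\<^sup>2 * W (diagseq n) w)) \<in> borel_measurable lborel"
      using holomorphic_measurable[OF f D(1), of "diagseq n"] W(1)[of "diagseq n"] by measurable
    also have "(\<lambda>w. ennreal ((cmod (indicator (D (diagseq n)) w *\<^sub>R f (diagseq n) w))\<^sup>2 * W (diagseq n) w)) = u n"
      by (auto simp: indicator_def u_def)
    finally show ?thesis .
  qed
  have "(\<integral>\<^sup>+z\<in>(\<Union>n. D n). ennreal ((cmod (g z))\<^sup>2 * W' z) \<partial>lborel) \<le> (\<integral>\<^sup>+z. liminf (\<lambda>n. u n z) \<partial>lborel)"
  proof (rule nn_integral_mono_AE)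
    show "AE z in lborel. ennreal ((cmod (g z))\<^sup>2 * W' z) * indicator (\<Union>n. D n) z \<le> liminf (\<lambda>n. u n z)"
      using lim
    proof eventually_elim
      case (elim z)
      show ?case
      proof (cases "z \<in> (\<Union>n. D n)")
        case True
        then obtain k where k: "z \<in> D k" by blast
        have "(\<lambda>n. W (diagseq n) z) \<longlonglongrightarrow> W' z"
          using LIMSEQ_subseq_LIMSEQ[OF elim[rule_format, OF True] subseq_diagseq] by (simp add: o_def)
        then have "(\<lambda>n. ennreal ((cmod (f (diagseq n) z))\<^sup>2 * W (diagseq n) z)) \<longlonglongrightarrow> ennreal ((cmod (g z))\<^sup>2 * W' z)"
          by (intro tendsto_intros gl[OF k])
        moreover have "\<forall>\<^sub>F n in sequentially. ennreal ((cmod (f (diagseq n) z))\<^sup>2 * W (diagseq n) z) = u n z"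
          unfolding eventually_sequentially
        proof (intro exI allI impI)
          fix n assume "k \<le> n"
          then have "k \<le> diagseq n" using seq_suble[OF subseq_diagseq, of n] by simp
          then have "z \<in> D (diagseq n)" using Dmono k by blast
          then show "ennreal ((cmod (f (diagseq n) z))\<^sup>2 * W (diagseq n) z) = u n z" by (simp add: u_def)
        qed
        ultimately have "(\<lambda>n. u n z) \<longlonglongrightarrow> ennreal ((cmod (g z))\<^sup>2 * W' z)" by (rule Lim_transform_eventually)
        then have "liminf (\<lambda>n. u n z) = ennreal ((cmod (g z))\<^sup>2 * W' z)" by (intro lim_imp_Liminf) auto
        then show ?thesis using True by simp
      qed simp
    qed
  qed
  also have "\<dots> \<le> liminf (\<lambda>n. \<integral>\<^sup>+z. u n z \<partial>lborel)" by (rule nn_integral_liminf[OF mu])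
  also have "\<dots> \<le> liminf (\<lambda>n. ennreal (B (diagseq n)))"
    by (rule Liminf_mono) (simp add: u_def B(1))
  also have "\<dots> = ennreal b"
    using LIMSEQ_subseq_LIMSEQ[OF B(2) subseq_diagseq] by (intro lim_imp_Liminf tendsto_intros) (auto simp: o_def)
  finally show ?thesis using that[OF subseq_diagseq ghol] gl by blast
qed

section \<open>Weighted norms and the minimal function\<close>

definition bergman_L2 :: "complex set \<Rightarrow> (complex \<Rightarrow> real) \<Rightarrow> (complex \<Rightarrow> complex) \<Rightarrow> bool" where
  "bergman_L2 D W f \<longleftrightarrow> f holomorphic_on D \<and> integrable lborel (\<lambda>z. indicator D z *\<^sub>R ((cmod (f z))\<^sup>2 * W z))"

definition bergman_sq :: "complex set \<Rightarrow> (complex \<Rightarrow> real) \<Rightarrow> (complex \<Rightarrow> complex) \<Rightarrow> real" where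
  "bergman_sq D W f = (\<integral>z. indicator D z *\<^sub>R ((cmod (f z))\<^sup>2 * W z) \<partial>lborel)"

lemma bergman_sq_measurable:
  assumes "f holomorphic_on D" "g holomorphic_on D" "open D" and [measurable]: "W \<in> borel_measurable borel"
  shows "(\<lambda>z. indicator D z *\<^sub>R ((cmod (f z))\<^sup>2 * W z)) \<in> borel_measurable borel"
    and "(\<lambda>z. indicator D z *\<^sub>R (cnj (f z) * g z * of_real (W z))) \<in> borel_measurable borel"
proof -
  define F G where "F z = indicator D z *\<^sub>R f z" and "G z = indicator D z *\<^sub>R g z" for z
  have [measurable]: "F \<in> borel_measurable borel" "G \<in> borel_measurable borel"
    unfolding F_def G_def using assms by (auto intro: holomorphic_measurable)
  have "(\<lambda>z. (cmod (F z))\<^sup>2 * W z) \<in> borel_measurable borel" by measurable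
  also have "(\<lambda>z. (cmod (F z))\<^sup>2 * W z) = (\<lambda>z. indicator D z *\<^sub>R ((cmod (f z))\<^sup>2 * W z))"
    by (auto simp: F_def indicator_def)
  finally show "(\<lambda>z. indicator D z *\<^sub>R ((cmod (f z))\<^sup>2 * W z)) \<in> borel_measurable borel" .
  have [measurable]: "(\<lambda>z. cnj (F z)) \<in> borel_measurable borel" "(\<lambda>z. complex_of_real (W z)) \<in> borel_measurable borel"
    by (rule measurable_compose[OF _ borel_measurable_continuous_onI[of cnj]], simp_all add: continuous_on_cnj)
  have "(\<lambda>z. cnj (F z) * G z * of_real (W z)) \<in> borel_measurable borel" by measurable
  also have "(\<lambda>z. cnj (F z) * G z * of_real (W z)) = (\<lambda>z. indicator D z *\<^sub>R (cnj (f z) * g z * of_real (W z)))"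
    by (auto simp: F_def G_def indicator_def)
  finally show "(\<lambda>z. indicator D z *\<^sub>R (cnj (f z) * g z * of_real (W z))) \<in> borel_measurable borel" .
qed

lemma bergman_inner_integrable:
  assumes f: "bergman_L2 D W f" and g: "bergman_L2 D W g" and D: "open D" and W: "W \<in> borel_measurable borel" "\<And>z. 0 \<le> W z"
  shows "integrable lborel (\<lambda>z. indicator D z *\<^sub>R (cnj (f z) * g z * of_real (W z)))"
proof (rule Bochner_Integration.integrable_bound)
  show "integrable lborel (\<lambda>z. indicator D z *\<^sub>R ((cmod (f z))\<^sup>2 * W z) + indicator D z *\<^sub>R ((cmod (g z))\<^sup>2 * W z))"
    using f g by (auto simp: bergman_L2_def)
  show "(\<lambda>z. indicator D z *\<^sub>R (cnj (f z) * g z * of_real (W z))) \<in> borel_measurable lborel"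
    using bergman_sq_measurable(2)[OF _ _ D W(1)] f g by (simp add: bergman_L2_def)
  show "AE z in lborel. norm (indicator D z *\<^sub>R (cnj (f z) * g z * of_real (W z)))
      \<le> norm (indicator D z *\<^sub>R ((cmod (f z))\<^sup>2 * W z) + indicator D z *\<^sub>R ((cmod (g z))\<^sup>2 * W z))"
  proof (rule AE_I2)
    fix z
    have "2 * (cmod (f z) * cmod (g z)) \<le> (cmod (f z))\<^sup>2 + (cmod (g z))\<^sup>2"
      using sum_squares_bound[of "cmod (f z)" "cmod (g z)"] by simp
    moreover have "0 \<le> cmod (f z) * cmod (g z)" by simp
    ultimately have "cmod (f z) * cmod (g z) \<le> (cmod (f z))\<^sup>2 + (cmod (g z))\<^sup>2" by linarith
    then have "cmod (f z) * cmod (g z) * W z \<le> ((cmod (f z))\<^sup>2 + (cmod (g z))\<^sup>2) * W z"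
      by (rule mult_right_mono) (rule W(2))
    then show "norm (indicator D z *\<^sub>R (cnj (f z) * g z * of_real (W z)))
      \<le> norm (indicator D z *\<^sub>R ((cmod (f z))\<^sup>2 * W z) + indicator D z *\<^sub>R ((cmod (g z))\<^sup>2 * W z))"
      using W(2)[of z] by (cases "z \<in> D") (auto simp: norm_mult algebra_simps)
  qed
qed

lemma bergman_sq_add:
  assumes f: "bergman_L2 D W f" and g: "bergman_L2 D W g" and D: "open D" and W: "W \<in> borel_measurable borel" "\<And>z. 0 \<le> W z"
  shows "bergman_L2 D W (\<lambda>z. f z + t * g z)"
    and "bergman_sq D W (\<lambda>z. f z + t * g z) = bergman_sq D W f + 2 * Re (t * (\<integral>z. indicator D z *\<^sub>R (cnj (f z) * g z * of_real (W z)) \<partial>lborel)) + (cmod t)\<^sup>2 * bergman_sq D W g"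
proof -
  let ?I = "\<lambda>z. indicator D z *\<^sub>R (cnj (f z) * g z * of_real (W z))"
  note i = bergman_inner_integrable[OF f g D W]
  have eq: "indicator D z *\<^sub>R ((cmod (f z + t * g z))\<^sup>2 * W z) =
      indicator D z *\<^sub>R ((cmod (f z))\<^sup>2 * W z) + 2 * Re (t * ?I z) + (cmod t)\<^sup>2 * (indicator D z *\<^sub>R ((cmod (g z))\<^sup>2 * W z))" for z
  proof -
    have "complex_of_real ((cmod (f z + t * g z))\<^sup>2) = (f z + t * g z) * cnj (f z + t * g z)" by (rule complex_norm_square)
    also have "\<dots> = f z * cnj (f z) + (t * (cnj (f z) * g z) + cnj (t * (cnj (f z) * g z))) + (t * cnj t) * (g z * cnj (g z))"
      by (simp add: algebra_simps)
    also have "\<dots> = complex_of_real ((cmod (f z))\<^sup>2 + 2 * Re (t * (cnj (f z) * g z)) + (cmod t)\<^sup>2 * (cmod (g z))\<^sup>2)"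
      by (simp only: complex_add_cnj complex_norm_square[symmetric] of_real_add of_real_mult)
    finally have "(cmod (f z + t * g z))\<^sup>2 = (cmod (f z))\<^sup>2 + 2 * Re (t * (cnj (f z) * g z)) + (cmod t)\<^sup>2 * (cmod (g z))\<^sup>2"
      by (simp only: of_real_eq_iff)
    moreover have "Re (t * (cnj (f z) * g z * complex_of_real (W z))) = Re (t * (cnj (f z) * g z)) * W z"
      by (simp only: mult.assoc[symmetric] Re_complex_of_real times_complex.sel Im_complex_of_real mult_zero_right diff_0_right)
    ultimately show ?thesis by (cases "z \<in> D") (simp_all add: algebra_simps del: times_complex.sel)
  qed
  have iti: "integrable lborel (\<lambda>z. t * ?I z)" by (rule integrable_mult_right[OF i])
  have i2: "integrable lborel (\<lambda>z. 2 * Re (t * ?I z))" by (rule integrable_mult_right[OF integrable_Re[OF iti]])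
  have if': "integrable lborel (\<lambda>z. indicator D z *\<^sub>R ((cmod (f z))\<^sup>2 * W z))" using f by (simp add: bergman_L2_def)
  have ig': "integrable lborel (\<lambda>z. (cmod t)\<^sup>2 * (indicator D z *\<^sub>R ((cmod (g z))\<^sup>2 * W z)))" using g by (simp add: bergman_L2_def)
  show "bergman_L2 D W (\<lambda>z. f z + t * g z)"
    unfolding bergman_L2_def eq
    by (intro conjI Bochner_Integration.integrable_add i2 if' ig')
       (use f g in \<open>auto simp: bergman_L2_def intro!: holomorphic_intros\<close>)
  have "(\<integral>z. 2 * Re (t * ?I z) \<partial>lborel) = 2 * Re (t * (\<integral>z. ?I z \<partial>lborel))"
    using i by (simp only: integral_mult_right_zero integral_Re[OF iti])
  then show "bergman_sq D W (\<lambda>z. f z + t * g z) = bergman_sq D W f + 2 * Re (t * (\<integral>z. ?I z \<partial>lborel)) + (cmod t)\<^sup>2 * bergman_sq D W g"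
    unfolding bergman_sq_def eq
    by (simp only: Bochner_Integration.integral_add[OF Bochner_Integration.integrable_add[OF if' i2] ig']
        Bochner_Integration.integral_add[OF if' i2] integral_mult_right_zero)
qed

lemma bergman_L2_bounded:
  assumes f: "f holomorphic_on D" "\<And>z. z \<in> D \<Longrightarrow> cmod (f z) \<le> M" and D: "open D" "bounded D"
    and W: "W \<in> borel_measurable borel" "\<And>z. 0 \<le> W z" "\<And>z. z \<in> D \<Longrightarrow> W z \<le> b"
  shows "bergman_L2 D W f"
  unfolding bergman_L2_def
proof
  show "integrable lborel (\<lambda>z. indicator D z *\<^sub>R ((cmod (f z))\<^sup>2 * W z))"
  proof (rule integrableI_bounded_set[where A=D and B="M\<^sup>2 * b"])
    show "D \<in> sets lborel" using D by simp
    show "(\<lambda>z. indicator D z *\<^sub>R ((cmod (f z))\<^sup>2 * W z)) \<in> borel_measurable lborel"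
      using bergman_sq_measurable(1)[OF f(1) f(1) D(1) W(1)] by simp
    show "emeasure lborel D < \<infinity>" by (rule emeasure_bounded_finite[OF D(2)])
    show "AE x in lborel. x \<in> D \<longrightarrow> norm (indicator D x *\<^sub>R ((cmod (f x))\<^sup>2 * W x)) \<le> M\<^sup>2 * b"
    proof (rule AE_I2, rule impI)
      fix z assume z: "z \<in> D"
      have "(cmod (f z))\<^sup>2 * W z \<le> M\<^sup>2 * b"
        by (intro mult_mono power_mono f(2) W z) auto
      then show "norm (indicator D z *\<^sub>R ((cmod (f z))\<^sup>2 * W z)) \<le> M\<^sup>2 * b"
        using z W(2)[of z] by simp
    qed
  qed auto
qed (rule f(1))

text \<open>A limit of a minimizing sequence, taken by normal families, attains the infimum of the
  norm among functions with value 1 at \<open>z0\<close>. Adding multiples of a function vanishing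
  at \<open>z0\<close> stays in the competition, and the first variation gives
  orthogonality.\<close>

lemma bergman_minimizer:
  assumes D: "open D" "bounded D" and z0: "z0 \<in> D"
    and W: "W \<in> borel_measurable borel" "\<And>z. 0 \<le> W z" "\<And>z. z \<in> D \<Longrightarrow> a \<le> W z" "\<And>z. z \<in> D \<Longrightarrow> W z \<le> b" "0 < a"
  obtains f where "bergman_L2 D W f" "f z0 = 1"
    "\<And>g. bergman_L2 D W g \<Longrightarrow> g z0 = 0 \<Longrightarrow> (\<integral>z. indicator D z *\<^sub>R (cnj (f z) * g z * of_real (W z)) \<partial>lborel) = 0"
proof -
  define A where "A = bergman_sq D W ` {h. bergman_L2 D W h \<and> h z0 = 1}"
  have one: "bergman_L2 D W (\<lambda>z. 1)" by (rule bergman_L2_bounded[OF _ _ D W(1,2,4), of _ 1]) auto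
  then have Ane: "A \<noteq> {}" by (auto simp: A_def)
  have sq0: "0 \<le> bergman_sq D W h" for h unfolding bergman_sq_def
    by (rule Bochner_Integration.integral_nonneg) (simp add: W(2))
  then have Abd: "bdd_below A" by (auto simp: A_def intro!: bdd_belowI[of _ 0])
  define N where "N = Inf A"
  have N0: "0 \<le> N" unfolding N_def by (rule cInf_greatest[OF Ane]) (auto simp: A_def sq0)
  have Nle: "N \<le> bergman_sq D W h" if "bergman_L2 D W h" "h z0 = 1" for h
    unfolding N_def by (rule cInf_lower[OF _ Abd]) (use that in \<open>auto simp: A_def\<close>)
  have "\<exists>h. bergman_L2 D W h \<and> h z0 = 1 \<and> bergman_sq D W h < N + inverse (real (Suc n))" for n
  proof -
    have "N < N + inverse (real (Suc n))" by simp
    then have "\<exists>x\<in>A. x < N + inverse (real (Suc n))"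
      using cInf_less_iff[OF Ane Abd] unfolding N_def[symmetric] by blast
    then show ?thesis unfolding A_def by blast
  qed
  then obtain h where h: "\<And>n. bergman_L2 D W (h n)" "\<And>n. h n z0 = 1" "\<And>n. bergman_sq D W (h n) < N + inverse (real (Suc n))"
    by metis
  have nn: "(\<integral>\<^sup>+z\<in>D. ennreal ((cmod (g z))\<^sup>2 * W z) \<partial>lborel) = ennreal (bergman_sq D W g)" if "bergman_L2 D W g" for g
  proof -
    have "(\<integral>\<^sup>+z\<in>D. ennreal ((cmod (g z))\<^sup>2 * W z) \<partial>lborel) = (\<integral>\<^sup>+z. ennreal (indicator D z *\<^sub>R ((cmod (g z))\<^sup>2 * W z)) \<partial>lborel)"
      by (intro nn_integral_cong) (auto simp: indicator_def)
    also have "\<dots> = ennreal (bergman_sq D W g)" unfolding bergman_sq_def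
      by (rule nn_integral_eq_integral) (use that W(2) in \<open>auto simp: bergman_L2_def\<close>)
    finally show ?thesis .
  qed
  obtain f r where f: "strict_mono (r :: nat \<Rightarrow> nat)" "f holomorphic_on (\<Union>n::nat. D)"
    "\<And>z. z \<in> (\<Union>n::nat. D) \<Longrightarrow> (\<lambda>n. h (r n) z) \<longlonglongrightarrow> f z"
    "(\<integral>\<^sup>+z\<in>(\<Union>n::nat. D). ennreal ((cmod (f z))\<^sup>2 * W z) \<partial>lborel) \<le> ennreal N"
  proof (rule bergman_limit[of "\<lambda>n. D" h "\<lambda>n. W" "\<lambda>n. N + inverse (real (Suc n))" N W])
    show "(\<integral>\<^sup>+z\<in>D. ennreal ((cmod (h n z))\<^sup>2 * W z) \<partial>lborel) \<le> ennreal (N + inverse (real (Suc n)))" for n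
      unfolding nn[OF h(1)] using h(3)[of n] by (intro ennreal_leI) simp
    show "(\<lambda>n. N + inverse (real (Suc n))) \<longlonglongrightarrow> N"
      using tendsto_add[OF tendsto_const LIMSEQ_inverse_real_of_nat, of N] by simp
    show "\<exists>c>0. \<forall>n::nat. \<forall>z\<in>L. c \<le> W z" if "compact L" "L \<subseteq> (\<Union>n::nat. D)" for L
      using that W(3,5) by (intro exI[of _ a]) auto
    show "h n holomorphic_on D" for n using h(1) by (simp add: bergman_L2_def)
  qed (use D W in auto)
  have fhol: "f holomorphic_on D" using f(2) by simp
  have fn: "(\<integral>\<^sup>+z. ennreal (norm (indicator D z *\<^sub>R ((cmod (f z))\<^sup>2 * W z))) \<partial>lborel) \<le> ennreal N"
  proof -
    have "(\<integral>\<^sup>+z. ennreal (norm (indicator D z *\<^sub>R ((cmod (f z))\<^sup>2 * W z))) \<partial>lborel) = (\<integral>\<^sup>+z\<in>D. ennreal ((cmod (f z))\<^sup>2 * W z) \<partial>lborel)"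
      using W(2) by (intro nn_integral_cong) (auto simp: indicator_def)
    then show ?thesis using f(4) by simp
  qed
  have fL: "bergman_L2 D W f" unfolding bergman_L2_def
  proof (intro conjI fhol integrableI_bounded)
    show "(\<integral>\<^sup>+z. ennreal (norm (indicator D z *\<^sub>R ((cmod (f z))\<^sup>2 * W z))) \<partial>lborel) < \<infinity>"
      using fn by (rule le_less_trans) simp
  qed (use bergman_sq_measurable(1)[OF fhol fhol D(1) W(1)] in simp)
  have f1: "f z0 = 1"
    using f(3)[of z0] z0 h(2) by (simp add: LIMSEQ_const_iff)
  have "ennreal (bergman_sq D W f) \<le> ennreal N"
    unfolding nn[OF fL, symmetric] using f(4) by simp
  then have fN: "bergman_sq D W f \<le> N" using N0 by (simp add: ennreal_le_iff)
  show ?thesis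
  proof (rule that[OF fL f1])
    fix g assume g: "bergman_L2 D W g" "g z0 = 0"
    define c where "c = (\<integral>z. indicator D z *\<^sub>R (cnj (f z) * g z * of_real (W z)) \<partial>lborel)"
    define G where "G = bergman_sq D W g"
    have G0: "0 \<le> G" by (simp add: G_def sq0)
    have ineq: "0 \<le> 2 * Re (t * c) + (cmod t)\<^sup>2 * G" for t
    proof -
      note a = bergman_sq_add[OF fL g(1) D(1) W(1,2), of t]
      have "N \<le> bergman_sq D W (\<lambda>z. f z + t * g z)"
        by (rule Nle[OF a(1)]) (simp add: f1 g(2))
      then show ?thesis using fN unfolding a(2) c_def[symmetric] G_def[symmetric] by linarith
    qed
    \<comment> \<open>The perturbation \<open>t = - s * cnj c\<close> changes the square norm by
      \<open>s * |c|^2 * (s * G - 2)\<close>. The denominator \<open>G + 1\<close> allows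
      \<open>G = 0\<close> and makes the bracket negative, so \<open>c\<close> must be 0.\<close>
    define s where "s = 1 / (G + 1)"
    have s: "0 < s" "s * G < 1" using G0 by (auto simp: s_def field_simps)
    have "0 \<le> 2 * Re (- of_real s * cnj c * c) + (cmod (- of_real s * cnj c))\<^sup>2 * G" by (rule ineq)
    also have "Re (- of_real s * cnj c * c) = - s * (cmod c)\<^sup>2"
      unfolding cmod_power2 by (simp add: power2_eq_square algebra_simps)
    also have "(cmod (- of_real s * cnj c))\<^sup>2 = s\<^sup>2 * (cmod c)\<^sup>2" using s by (simp add: norm_mult power_mult_distrib)
    finally have "0 \<le> s * (cmod c)\<^sup>2 * (s * G - 2)" by (simp add: algebra_simps power2_eq_square)
    then have "(cmod c)\<^sup>2 \<le> 0" using s by (auto simp: zero_le_mult_iff mult_le_0_iff)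
    then show "(\<integral>z. indicator D z *\<^sub>R (cnj (f z) * g z * of_real (W z)) \<partial>lborel) = 0" by (simp add: c_def)
  qed
qed

section \<open>Smoothed Cauchy transforms\<close>

text \<open>The Cauchy transform of \<open>h\<close> with the kernel smoothed at scale \<delta>. At
  points farther than \<delta> from the support of \<open>h\<close> it is the exact integral of
  \<open>h z / (\<zeta> - z)\<close>; its dbar-derivative, defined next, averages \<open>h\<close>
  over a disc of radius \<delta>.\<close>

definition cauchy_smooth :: "(complex \<Rightarrow> complex) \<Rightarrow> real \<Rightarrow> complex \<Rightarrow> complex" where
  "cauchy_smooth h \<delta> \<zeta> = (\<integral>z. h z * (of_real (1 / \<delta>) * cauchy_ker (of_real (1 / \<delta>) * (\<zeta> - z))) \<partial>lborel)"

definition cauchy_smooth_b :: "(complex \<Rightarrow> complex) \<Rightarrow> real \<Rightarrow> complex \<Rightarrow> complex" where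
  "cauchy_smooth_b h \<delta> \<zeta> = (\<integral>z. h z * (of_real (1 / \<delta>) * (4 * of_real (bump (of_real (1 / \<delta>) * (\<zeta> - z))) * of_real (1 / \<delta>))) \<partial>lborel)"

lemma continuous_bounded_outside:
  fixes f :: "complex \<Rightarrow> complex"
  assumes "continuous_on UNIV f" "\<And>u. 1 \<le> cmod u \<Longrightarrow> cmod (f u) \<le> c"
  obtains B where "0 \<le> B" "\<And>z. cmod (f z) \<le> B"
proof -
  have "bounded (f ` cball 0 1)"
    by (intro compact_imp_bounded compact_continuous_image continuous_on_subset[OF assms(1)]) auto
  then obtain B where B: "\<forall>y\<in>f ` cball 0 1. norm y \<le> B" unfolding bounded_iff by metis
  have "cmod (f z) \<le> max 0 (max B c)" for z
    using B assms(2)[of z] by (cases "cmod z \<le> 1") (auto simp: le_max_iff_disj)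
  then show ?thesis using that[of "max 0 (max B c)"] by simp
qed

lemma has_wirtinger_convolution_scaled:
  assumes g: "integrable lborel g" and k: "\<And>u. has_wirtinger k (ka u) (kb u) u"
    and ca: "continuous_on UNIV ka" and cb: "continuous_on UNIV kb"
    and B: "\<And>u. cmod (k u) \<le> B" and Ba: "\<And>u. cmod (ka u) \<le> B" and Bb: "\<And>u. cmod (kb u) \<le> B"
  shows "has_wirtinger (\<lambda>\<zeta>. \<integral>z. g z * (d * k (of_real c * (\<zeta> - z))) \<partial>lborel)
           (\<integral>z. g z * (d * (ka (of_real c * (\<zeta> - z)) * of_real c)) \<partial>lborel)
           (\<integral>z. g z * (d * (kb (of_real c * (\<zeta> - z)) * of_real c)) \<partial>lborel) \<zeta>"
proof -
  have B0: "0 \<le> B" using B[of 0] norm_ge_zero order_trans by blast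
  have cc: "continuous_on UNIV (\<lambda>w. d * (f (of_real c * w) * of_real c))" if "continuous_on UNIV f" for f :: "complex \<Rightarrow> complex"
    by (intro continuous_intros continuous_on_compose2[OF that]) auto
  have bb: "cmod (d * (x * of_real c)) \<le> cmod d * B * (1 + \<bar>c\<bar>)" if "cmod x \<le> B" for x
  proof -
    have "cmod d * (cmod x * \<bar>c\<bar>) \<le> cmod d * (B * (1 + \<bar>c\<bar>))"
      by (intro mult_left_mono mult_mono that) (auto simp: B0)
    then show ?thesis by (simp add: norm_mult mult.assoc)
  qed
  have b1: "cmod (d * x) \<le> cmod d * B * (1 + \<bar>c\<bar>)" if "cmod x \<le> B" for x
  proof -
    have "cmod d * (cmod x * 1) \<le> cmod d * (B * (1 + \<bar>c\<bar>))"
      by (intro mult_left_mono mult_mono that) (auto simp: B0)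
    then show ?thesis by (simp add: norm_mult mult.assoc)
  qed
  have kk: "has_wirtinger (\<lambda>w. d * k (of_real c * w)) (d * (ka (of_real c * w) * of_real c)) (d * (kb (of_real c * w) * of_real c)) w" for w
    using has_wirtinger_mult[OF has_wirtinger_const[of d] has_wirtinger_linear[OF k, of "of_real c" w]] by simp
  show ?thesis
    by (rule has_wirtinger_convolution[OF g kk cc[OF ca] cc[OF cb] b1[OF B] bb[OF Ba] bb[OF Bb]])
qed

lemma cauchy_smooth_C2:
  assumes h: "integrable lborel h"
  obtains \<beta>_z \<beta>_zz \<beta>_zb \<beta>_bb where
    "\<And>z. has_wirtinger (cauchy_smooth h \<delta>) (\<beta>_z z) (cauchy_smooth_b h \<delta> z) z"
    "\<And>z. has_wirtinger \<beta>_z (\<beta>_zz z) (\<beta>_zb z) z" "\<And>z. has_wirtinger (cauchy_smooth_b h \<delta>) (\<beta>_zb z) (\<beta>_bb z) z"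
    "continuous_on UNIV \<beta>_zz" "continuous_on UNIV \<beta>_zb" "continuous_on UNIV \<beta>_bb"
proof -
  let ?b = "\<lambda>u. 4 * complex_of_real (bump u)"
  have c: "continuous_on UNIV cauchy_ker" "continuous_on UNIV cauchy_ker_z" "continuous_on UNIV ?b"
    "continuous_on UNIV cauchy_ker_zb" "continuous_on UNIV cauchy_ker_bb" "continuous_on UNIV cauchy_ker_zz"
    by (rule has_wirtinger_imp_continuous_on[OF has_wirtinger_cauchy_ker],
        rule has_wirtinger_imp_continuous_on[OF has_wirtinger_cauchy_ker_z],
        rule has_wirtinger_imp_continuous_on[OF has_wirtinger_cauchy_ker_b],
        unfold cauchy_ker_zb_def cauchy_ker_bb_def,
        (intro continuous_intros continuous_bump_base)+, rule continuous_cauchy_ker_zz)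
  have inv: "1 \<le> cmod u \<Longrightarrow> 1 / cmod u ^ n \<le> 1" for u n using one_le_power[of "cmod u" n] by (simp add: divide_simps)
  have inv3: "1 \<le> cmod u \<Longrightarrow> 2 / cmod u ^ 3 \<le> 2" for u using one_le_power[of "cmod u" 3] by (simp add: divide_simps)
  obtain B1 where B1: "0 \<le> B1" "\<And>z. cmod (cauchy_ker z) \<le> B1"
    by (rule continuous_bounded_outside[OF c(1), of 1]) (use inv[of _ 1] in \<open>auto simp: cauchy_ker_def norm_divide\<close>)
  obtain B2 where B2: "0 \<le> B2" "\<And>z. cmod (cauchy_ker_z z) \<le> B2"
    by (rule continuous_bounded_outside[OF c(2), of 1]) (use inv[of _ 2] in \<open>auto simp: cauchy_ker_z_def norm_divide norm_power\<close>)
  obtain B3 where B3: "0 \<le> B3" "\<And>z. cmod (?b z) \<le> B3"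
    by (rule continuous_bounded_outside[OF c(3), of 0]) (auto simp: bump_eq_0)
  obtain B4 where B4: "0 \<le> B4" "\<And>z. cmod (cauchy_ker_zb z) \<le> B4"
    by (rule continuous_bounded_outside[OF c(4), of 0]) (auto simp: cauchy_ker_zb_def bump_base_eq_0)
  obtain B5 where B5: "0 \<le> B5" "\<And>z. cmod (cauchy_ker_bb z) \<le> B5"
    by (rule continuous_bounded_outside[OF c(5), of 0]) (auto simp: cauchy_ker_bb_def bump_base_eq_0)
  obtain B6 where B6: "0 \<le> B6" "\<And>z. cmod (cauchy_ker_zz z) \<le> B6"
    by (rule continuous_bounded_outside[OF c(6), of 2]) (use inv3 in \<open>auto simp: cauchy_ker_zz_def norm_divide norm_power\<close>)
  define B where "B = B1 + B2 + B3 + B4 + B5 + B6"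
  have B: "cmod (cauchy_ker u) \<le> B" "cmod (cauchy_ker_z u) \<le> B" "cmod (?b u) \<le> B"
    "cmod (cauchy_ker_zb u) \<le> B" "cmod (cauchy_ker_bb u) \<le> B" "cmod (cauchy_ker_zz u) \<le> B" for u
    using B1(1) B1(2)[of u] B2(1) B2(2)[of u] B3(1) B3(2)[of u] B4(1) B4(2)[of u] B5(1) B5(2)[of u] B6(1) B6(2)[of u]
    unfolding B_def by linarith+
  let ?c = "complex_of_real (1 / \<delta>)"
  define bz where "bz \<zeta> = (\<integral>z. h z * (?c * (cauchy_ker_z (?c * (\<zeta> - z)) * ?c)) \<partial>lborel)" for \<zeta>
  define bzz where "bzz \<zeta> = (\<integral>z. h z * (?c * ?c * (cauchy_ker_zz (?c * (\<zeta> - z)) * ?c)) \<partial>lborel)" for \<zeta>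
  define bzb where "bzb \<zeta> = (\<integral>z. h z * (?c * ?c * (cauchy_ker_zb (?c * (\<zeta> - z)) * ?c)) \<partial>lborel)" for \<zeta>
  define bbb where "bbb \<zeta> = (\<integral>z. h z * (?c * ?c * (cauchy_ker_bb (?c * (\<zeta> - z)) * ?c)) \<partial>lborel)" for \<zeta>
  have 1: "has_wirtinger (cauchy_smooth h \<delta>) (bz z) (cauchy_smooth_b h \<delta> z) z" for z
    using has_wirtinger_convolution_scaled[OF h has_wirtinger_cauchy_ker c(2,3) B(1-3), of ?c "1 / \<delta>" z]
    unfolding cauchy_smooth_def[abs_def] cauchy_smooth_b_def bz_def by (simp add: mult.assoc)
  have 2: "has_wirtinger bz (bzz z) (bzb z) z" for z
    using has_wirtinger_convolution_scaled[OF h has_wirtinger_cauchy_ker_z c(6,4) B(2,6,4), of "?c * ?c" "1 / \<delta>" z]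
    unfolding bz_def[abs_def] bzz_def bzb_def by (simp add: mult_ac)
  have 3: "has_wirtinger (cauchy_smooth_b h \<delta>) (bzb z) (bbb z) z" for z
    using has_wirtinger_convolution_scaled[OF h has_wirtinger_cauchy_ker_b c(4,5) B(3,4,5), of "?c * ?c" "1 / \<delta>" z]
    unfolding cauchy_smooth_b_def[abs_def] bzb_def bbb_def by (simp add: mult_ac)
  have cont: "continuous_on UNIV (\<lambda>\<zeta>. \<integral>z. h z * (?c * ?c * (k (?c * (\<zeta> - z)) * ?c)) \<partial>lborel)"
    if k: "continuous_on UNIV k" "\<And>u. cmod (k u) \<le> B" for k
  proof -
    have bd: "cmod (?c * ?c * (k (?c * u) * ?c)) \<le> cmod ?c * cmod ?c * (B * cmod ?c)" for u
      unfolding norm_mult by (intro mult_left_mono mult_right_mono k(2)) auto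
    show ?thesis
      by (rule continuous_convolution[OF h _ bd]) (intro continuous_intros continuous_on_compose2[OF k(1)], auto)
  qed
  show ?thesis
    by (rule that[OF 1 2 3]) (unfold bzz_def bzb_def bbb_def, (intro cont c B)+)
qed

section \<open>Calculus of C2 data and regularized logarithms\<close>

lemma C2_real_subset: "C2_real U f fz fzz fzb \<Longrightarrow> V \<subseteq> U \<Longrightarrow> C2_real V f fz fzz fzb"
  unfolding C2_real_def by (auto intro: continuous_on_subset)

lemma C2_real_add:
  assumes "C2_real U f fz fzz fzb" "C2_real U g gz gzz gzb"
  shows "C2_real U (\<lambda>z. f z + g z) (\<lambda>z. fz z + gz z) (\<lambda>z. fzz z + gzz z) (\<lambda>z. fzb z + gzb z)"
  using assms unfolding C2_real_def of_real_add complex_cnj_add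
  by (simp add: has_wirtinger_add continuous_on_add)

lemma C2_real_cmult:
  assumes "C2_real U f fz fzz fzb"
  shows "C2_real U (\<lambda>z. c * f z) (\<lambda>z. of_real c * fz z) (\<lambda>z. of_real c * fzz z) (\<lambda>z. c * fzb z)"
proof -
  have "has_wirtinger (\<lambda>z. of_real c * F z) (of_real c * a) (of_real c * b) z" if "has_wirtinger F a b z" for F a b z
    using has_wirtinger_mult[OF has_wirtinger_const[of "of_real c"] that] by simp
  then show ?thesis
    using assms unfolding C2_real_def by (auto intro!: continuous_intros)
qed

lemma C2_real_const: "C2_real U (\<lambda>z. c) (\<lambda>z. 0) (\<lambda>z. 0) (\<lambda>z. 0)"
  unfolding C2_real_def by (auto simp: has_wirtinger_const)

lemma C2_real_sum:
  assumes "\<And>i. i \<in> I \<Longrightarrow> C2_real U (f i) (fz i) (fzz i) (fzb i)"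
  shows "C2_real U (\<lambda>z. \<Sum>i\<in>I. f i z) (\<lambda>z. \<Sum>i\<in>I. fz i z) (\<lambda>z. \<Sum>i\<in>I. fzz i z) (\<lambda>z. \<Sum>i\<in>I. fzb i z)"
  using assms
proof (induction I rule: infinite_finite_induct)
  case (insert i I)
  then show ?case by (simp add: C2_real_add)
qed (simp_all add: C2_real_const)

text \<open>These are derivatives of \<open>ln (|z - a|^2 + c)\<close>. The parameter covers two
  uses: \<open>c > 0\<close> gives a smooth function on the plane whose Laplacian concentrates at
  \<open>a\<close>, and \<open>c = 0\<close> a function that is harmonic off \<open>a\<close>, since
  then \<open>log_zb\<close> is 0.\<close>

definition log_z :: "complex \<Rightarrow> real \<Rightarrow> complex \<Rightarrow> complex" where
  "log_z a c z = cnj (z - a) / of_real ((cmod (z - a))\<^sup>2 + c)"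

definition log_zz :: "complex \<Rightarrow> real \<Rightarrow> complex \<Rightarrow> complex" where
  "log_zz a c z = - (cnj (z - a))\<^sup>2 / (of_real ((cmod (z - a))\<^sup>2 + c))\<^sup>2"

definition log_zb :: "complex \<Rightarrow> real \<Rightarrow> complex \<Rightarrow> real" where
  "log_zb a c z = c / ((cmod (z - a))\<^sup>2 + c)\<^sup>2"

lemma C2_real_log:
  assumes pos: "\<And>z. z \<in> U \<Longrightarrow> 0 < (cmod (z - a))\<^sup>2 + c"
  shows "C2_real U (\<lambda>z. ln ((cmod (z - a))\<^sup>2 + c)) (log_z a c) (log_zz a c) (log_zb a c)"
  unfolding C2_real_def
proof (intro conjI ballI)
  fix z assume z: "z \<in> U"
  have n: "has_wirtinger (\<lambda>z. complex_of_real ((cmod (z - a))\<^sup>2 + c)) (cnj (z - a)) (z - a) z"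
  proof -
    have "has_wirtinger (\<lambda>z. complex_of_real ((cmod z)\<^sup>2) + complex_of_real c) (cnj (z + - a)) (z + - a) (z + - a)"
      using has_wirtinger_add[OF has_wirtinger_norm2 has_wirtinger_const[of "of_real c"], of "z + - a"] by (simp only: add_0_right)
    from has_wirtinger_shift[OF this] show ?thesis by simp
  qed
  let ?q = "complex_of_real ((cmod (z - a))\<^sup>2 + c)"
  have q0: "?q \<noteq> 0" using pos[OF z] by (simp only: of_real_eq_0_iff)
  have w: "has_wirtinger (\<lambda>z. complex_of_real (ln ((cmod (z - a))\<^sup>2 + c)))
     (of_real (1 / ((cmod (z - a))\<^sup>2 + c)) * cnj (z - a)) (of_real (1 / ((cmod (z - a))\<^sup>2 + c)) * (z - a)) z"
    by (rule has_wirtinger_real_chain[OF n, of ln]) (rule DERIV_ln_divide[OF pos[OF z]])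
  show "has_wirtinger (\<lambda>z. complex_of_real (ln ((cmod (z - a))\<^sup>2 + c))) (log_z a c z) (cnj (log_z a c z)) z"
    by (rule has_wirtinger_eq[OF w]) (auto simp: log_z_def)
  have inv: "((\<lambda>x. 1 / x) has_field_derivative (- 1 / ?q\<^sup>2)) (at ?q)"
    using q0 by (auto intro!: derivative_eq_intros simp: power2_eq_square)
  have ca: "has_wirtinger (\<lambda>z. cnj (z - a)) 0 1 z"
    using has_wirtinger_cnj[OF has_wirtinger_diff[OF has_wirtinger_ident has_wirtinger_const[of a]], of z] by simp
  have "has_wirtinger (\<lambda>z. cnj (z - a) * (1 / complex_of_real ((cmod (z - a))\<^sup>2 + c)))
    (cnj (z - a) * (- 1 / ?q\<^sup>2 * cnj (z - a)) + 0 * (1 / ?q)) (cnj (z - a) * (- 1 / ?q\<^sup>2 * (z - a)) + 1 * (1 / ?q)) z"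
    by (intro has_wirtinger_mult ca has_wirtinger_chain[OF n inv])
  then have "has_wirtinger (\<lambda>z. cnj (z - a) * (1 / complex_of_real ((cmod (z - a))\<^sup>2 + c))) (log_zz a c z) (of_real (log_zb a c z)) z"
  proof (rule has_wirtinger_eq)
    show "cnj (z - a) * (- 1 / ?q\<^sup>2 * cnj (z - a)) + 0 * (1 / ?q) = log_zz a c z"
      by (simp add: log_zz_def power2_eq_square)
    have "cnj (z - a) * (- 1 / ?q\<^sup>2 * (z - a)) = - of_real ((cmod (z - a))\<^sup>2) / ?q\<^sup>2"
      by (simp only: complex_norm_square) (simp add: mult.commute)
    moreover have "- complex_of_real n / (of_real (n + c))\<^sup>2 + 1 * (1 / of_real (n + c)) = of_real (c / (n + c)\<^sup>2)"
      if "n + c > 0" for n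
    proof -
      define q where "q = n + c"
      have "- n / q\<^sup>2 + 1 * (1 / q) = (q - n) / q\<^sup>2" using that by (simp add: q_def[symmetric] diff_divide_distrib power2_eq_square)
      then have "complex_of_real (- n / q\<^sup>2 + 1 * (1 / q)) = of_real (c / q\<^sup>2)" by (simp add: q_def)
      then show ?thesis unfolding q_def[symmetric] by simp
    qed
    ultimately show "cnj (z - a) * (- 1 / ?q\<^sup>2 * (z - a)) + 1 * (1 / ?q) = of_real (log_zb a c z)"
      using pos[OF z] by (simp only: log_zb_def)
  qed
  then show "has_wirtinger (log_z a c) (log_zz a c z) (of_real (log_zb a c z)) z"
    by (rule has_wirtinger_transform[of _ _ _ _ UNIV]) (auto simp: log_z_def)
next
  have nz: "complex_of_real ((cmod (z - a))\<^sup>2 + c) \<noteq> 0" if "z \<in> U" for z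
    using pos[OF that] by (simp only: of_real_eq_0_iff)
  show "continuous_on U (log_zz a c)" unfolding log_zz_def
    by (intro continuous_intros) (use nz in \<open>auto simp del: of_real_add of_real_power\<close>)
  show "continuous_on U (log_zb a c)" unfolding log_zb_def
    by (intro continuous_intros) (use pos in \<open>force\<close>)
qed

section \<open>Estimates for the smoothed Cauchy transform\<close>

text \<open>Cauchy-Schwarz on the disc of radius \<delta>: the kernel is at most
  \<open>4 / \<delta>\<^sup>2\<close> there, and its square times the area
  \<open>pi * \<delta>\<^sup>2\<close> is the constant.\<close>

lemma cauchy_smooth_b_bound:
  assumes h: "integrable lborel h" and \<delta>: "0 < \<delta>"
  shows "ennreal ((cmod (cauchy_smooth_b h \<delta> \<zeta>))\<^sup>2) \<le> ennreal (16 * pi / \<delta>\<^sup>2) * (\<integral>\<^sup>+z. ennreal ((cmod (h z))\<^sup>2) * indicator {..<\<delta>} (cmod (\<zeta> - z)) \<partial>lborel)"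
proof -
  have hm [measurable]: "h \<in> borel_measurable borel" using h by auto
  define k where "k z = complex_of_real (1 / \<delta>) * (4 * of_real (bump (of_real (1 / \<delta>) * (\<zeta> - z))) * of_real (1 / \<delta>))" for z
  have [measurable]: "k \<in> borel_measurable borel" unfolding k_def by measurable
  define \<iota> :: "complex \<Rightarrow> ennreal" where "\<iota> z = indicator {..<\<delta>} (cmod (\<zeta> - z))" for z
  have \<iota>m [measurable]: "\<iota> \<in> borel_measurable borel" unfolding \<iota>_def
    by (rule measurable_compose[OF borel_measurable_continuous_onI borel_measurable_indicator]) (auto intro!: continuous_intros)
  have mh: "(\<lambda>z. ennreal (cmod (h z))) \<in> borel_measurable borel" by measurable
  have kb: "cmod (k z) \<le> 4 / \<delta>\<^sup>2" for z
    using bump_le_1[of "of_real (1 / \<delta>) * (\<zeta> - z)"] bump_nonneg[of "of_real (1 / \<delta>) * (\<zeta> - z)"] \<delta>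
    by (simp add: k_def norm_mult norm_divide divide_simps power2_eq_square)
  have k0: "k z = 0" if "\<not> cmod (\<zeta> - z) < \<delta>" for z
    using that \<delta> by (simp add: k_def bump_eq_0 norm_mult norm_divide)
  have int: "integrable lborel (\<lambda>z. h z * k z)"
  proof (rule Bochner_Integration.integrable_bound[of _ "\<lambda>z. (4 / \<delta>\<^sup>2) * norm (h z)"])
    show "AE z in lborel. norm (h z * k z) \<le> norm ((4 / \<delta>\<^sup>2) * norm (h z))"
    proof (rule AE_I2)
      fix z
      have "norm (h z) * norm (k z) \<le> norm (h z) * (4 / \<delta>\<^sup>2)" by (intro mult_left_mono kb) auto
      then show "norm (h z * k z) \<le> norm ((4 / \<delta>\<^sup>2) * norm (h z))" by (simp add: norm_mult mult.commute)
    qed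
  qed (use h in \<open>simp, measurable\<close>)
  have "ennreal (cmod (cauchy_smooth_b h \<delta> \<zeta>)) \<le> (\<integral>\<^sup>+z. ennreal (cmod (h z * k z)) \<partial>lborel)"
    unfolding cauchy_smooth_b_def k_def[symmetric] by (rule integral_norm_bound_ennreal[OF int])
  also have "\<dots> \<le> (\<integral>\<^sup>+z. ennreal (4 / \<delta>\<^sup>2) * ((ennreal (cmod (h z)) * \<iota> z) * \<iota> z) \<partial>lborel)"
  proof (rule nn_integral_mono)
    fix z
    show "ennreal (cmod (h z * k z)) \<le> ennreal (4 / \<delta>\<^sup>2) * ((ennreal (cmod (h z)) * \<iota> z) * \<iota> z)"
    proof (cases "cmod (\<zeta> - z) < \<delta>")
      case True
      have "norm (h z) * norm (k z) \<le> norm (h z) * (4 / \<delta>\<^sup>2)" by (intro mult_left_mono kb) auto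
      then have "ennreal (cmod (h z * k z)) \<le> ennreal (4 / \<delta>\<^sup>2 * cmod (h z))"
        unfolding norm_mult by (intro ennreal_leI) (simp only: mult.commute)
      also have "\<dots> = ennreal (4 / \<delta>\<^sup>2) * ennreal (cmod (h z))" by (rule ennreal_mult) auto
      finally show ?thesis using True by (simp only: \<iota>_def indicator_simps lessThan_iff mult_1_right)
    next
      case False
      then have "k z = 0" by (rule k0)
      then show ?thesis by simp
    qed
  qed
  also have "\<dots> = ennreal (4 / \<delta>\<^sup>2) * (\<integral>\<^sup>+z. (ennreal (cmod (h z)) * \<iota> z) * \<iota> z \<partial>lborel)"
    by (rule nn_integral_cmult) (use mh \<iota>m in \<open>auto intro!: borel_measurable_times_ennreal\<close>)
  finally have "(ennreal (cmod (cauchy_smooth_b h \<delta> \<zeta>)))\<^sup>2 \<le> (ennreal (4 / \<delta>\<^sup>2) * (\<integral>\<^sup>+z. (ennreal (cmod (h z)) * \<iota> z) * \<iota> z \<partial>lborel))\<^sup>2"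
    by (rule power_mono) (rule zero_le)
  also have "\<dots> = ennreal (16 / \<delta>^4) * (\<integral>\<^sup>+z. (ennreal (cmod (h z)) * \<iota> z) * \<iota> z \<partial>lborel)\<^sup>2"
    by (simp add: power_mult_distrib ennreal_power power_divide)
  also have "\<dots> \<le> ennreal (16 / \<delta>^4) * ((\<integral>\<^sup>+z. (ennreal (cmod (h z)) * \<iota> z)\<^sup>2 \<partial>lborel) * (\<integral>\<^sup>+z. (\<iota> z)\<^sup>2 \<partial>lborel))"
    by (intro mult_left_mono Cauchy_Schwarz_nn_integral) (use mh \<iota>m in \<open>auto intro!: borel_measurable_times_ennreal\<close>)
  also have "(\<integral>\<^sup>+z. (\<iota> z)\<^sup>2 \<partial>lborel) = (\<integral>\<^sup>+z. indicator (ball \<zeta> \<delta>) z \<partial>lborel)"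
    by (intro nn_integral_cong) (auto simp: \<iota>_def indicator_def dist_norm)
  also have "\<dots> = ennreal (pi * \<delta>\<^sup>2)" using \<delta> by (simp add: emeasure_ball_complex)
  also have "(\<integral>\<^sup>+z. (ennreal (cmod (h z)) * \<iota> z)\<^sup>2 \<partial>lborel) = (\<integral>\<^sup>+z. ennreal ((cmod (h z))\<^sup>2) * \<iota> z \<partial>lborel)"
    by (intro nn_integral_cong) (auto simp: \<iota>_def indicator_def ennreal_power)
  also have "ennreal (16 / \<delta>^4) * ((\<integral>\<^sup>+z. ennreal ((cmod (h z))\<^sup>2) * \<iota> z \<partial>lborel) * ennreal (pi * \<delta>\<^sup>2)) =
     (ennreal (16 / \<delta>^4) * ennreal (pi * \<delta>\<^sup>2)) * (\<integral>\<^sup>+z. ennreal ((cmod (h z))\<^sup>2) * \<iota> z \<partial>lborel)"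
    by (simp only: mult_ac)
  also have "ennreal (16 / \<delta>^4) * ennreal (pi * \<delta>\<^sup>2) = ennreal (16 * pi / \<delta>\<^sup>2)"
    using \<delta> by (subst ennreal_mult[symmetric]) (auto simp: power2_eq_square power4_eq_xxxx)
  finally show ?thesis by (simp add: ennreal_power \<iota>_def)
qed

lemma cauchy_ker_bound: "cmod (cauchy_ker u) * cmod u \<le> 1"
proof (cases "u = 0")
  case False
  have "cmod (1 - complex_of_real (bump_base u) ^ 4) = \<bar>1 - bump_base u ^ 4\<bar>"
    by (metis norm_of_real of_real_1 of_real_diff of_real_power)
  also have "\<dots> \<le> 1" using bump_base_nonneg[of u] bump_base_le_1[of u] power_le_one[of "bump_base u" 4] by simp
  finally show ?thesis using False by (simp add: cauchy_ker_alt norm_divide)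
qed simp

text \<open>For \<zeta> near \<open>z0\<close> the quotient \<open>(z - z0) / (\<zeta> - z)\<close>
  is close to -1 except when \<open>z\<close> is close to \<zeta>, so the transform of
  \<open>(z - z0) * m\<close> is close to minus the integral of \<open>m\<close>. The estimate tends
  to 0 with \<delta>.\<close>

lemma cauchy_smooth_near:
  assumes m: "integrable lborel m" and h: "integrable lborel (\<lambda>z. (z - z0) * m z)"
    and N: "(\<integral>z. m z \<partial>lborel) = of_real N"
    and B: "\<And>z. z \<in> ball z0 (2 * r) \<Longrightarrow> cmod (m z) \<le> B" and \<delta>: "0 < \<delta>" "\<delta> \<le> r" and \<zeta>: "cmod (\<zeta> - z0) \<le> \<delta>"
  shows "cmod (cauchy_smooth (\<lambda>z. (z - z0) * m z) \<delta> \<zeta> + of_real N) \<le> B * (4 * pi * r * \<delta> + 2 * pi * \<delta>\<^sup>2) + \<delta> / r * (\<integral>z. cmod (m z) \<partial>lborel)"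
proof -
  have r: "0 < r" using \<delta> by simp
  have B0: "0 \<le> B" by (rule order_trans[OF norm_ge_zero B[of z0]]) (use r in simp)
  have [measurable]: "m \<in> borel_measurable borel" using m by auto
  let ?k = "\<lambda>z. complex_of_real (1 / \<delta>) * cauchy_ker (of_real (1 / \<delta>) * (\<zeta> - z))"
  let ?h = "\<lambda>z. (z - z0) * m z"
  have ck: "continuous_on UNIV cauchy_ker" by (rule has_wirtinger_imp_continuous_on[OF has_wirtinger_cauchy_ker])
  obtain M where M: "0 \<le> M" "\<And>z. cmod (cauchy_ker z) \<le> M"
  proof (rule continuous_bounded_outside[OF ck, of 1])
    fix u :: complex assume "1 \<le> cmod u"
    then have "cmod (cauchy_ker u) * 1 \<le> cmod (cauchy_ker u) * cmod u" by (intro mult_left_mono) auto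
    then show "cmod (cauchy_ker u) \<le> 1" using cauchy_ker_bound[of u] by simp
  qed blast
  have mk: "(\<lambda>w. complex_of_real (1 / \<delta>) * cauchy_ker (of_real (1 / \<delta>) * w)) \<in> borel_measurable borel"
    by (intro borel_measurable_continuous_onI continuous_intros continuous_on_compose2[OF ck]) auto
  have kbd: "cmod (complex_of_real (1 / \<delta>) * cauchy_ker (of_real (1 / \<delta>) * w)) \<le> (1 / \<delta>) * M" for w
    using M(2)[of "of_real (1 / \<delta>) * w"] \<delta> by (simp add: norm_mult norm_divide divide_right_mono)
  have ihk: "integrable lborel (\<lambda>z. ?h z * ?k z)" by (rule integrable_mult_bounded[OF h mk kbd])
  have kin: "cmod (?k z) * cmod (\<zeta> - z) \<le> 1" for z
    using cauchy_ker_bound[of "of_real (1 / \<delta>) * (\<zeta> - z)"] \<delta> by (simp add: norm_mult norm_divide)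
  have kout: "?k z = 1 / (\<zeta> - z)" if "\<delta> \<le> cmod (\<zeta> - z)" for z
    using that \<delta> by (simp add: cauchy_ker_def norm_mult norm_divide)
  have eq: "cauchy_smooth ?h \<delta> \<zeta> + of_real N = (\<integral>z. ?h z * ?k z + m z \<partial>lborel)"
    unfolding cauchy_smooth_def N[symmetric] by (rule Bochner_Integration.integral_add[OF ihk m, symmetric])
  \<comment> \<open>Off the \<delta>-disc the kernel is exact and the deviation equals
    \<open>(\<zeta> - z0) / (\<zeta> - z)\<close>; inside it only the bound
    \<open>1 / |\<zeta> - z|\<close> for the kernel is used, at the cost of the indicator
    term.\<close>
  have pw: "cmod (?h z * ?k z + m z) \<le> cmod (m z) * (\<delta> / cmod (\<zeta> - z) + 2 * indicator (ball \<zeta> \<delta>) z)" if z: "z \<noteq> \<zeta>" for z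
  proof -
    have u: "0 < cmod (\<zeta> - z)" using z by simp
    have "cmod ((z - z0) * ?k z + 1) \<le> \<delta> / cmod (\<zeta> - z) + 2 * indicator (ball \<zeta> \<delta>) z"
    proof (cases "cmod (\<zeta> - z) < \<delta>")
      case True
      have "cmod (z - z0) \<le> cmod (\<zeta> - z) + \<delta>" using \<zeta> norm_triangle_ineq4[of "\<zeta> - z0" "\<zeta> - z"] by simp
      moreover have "cmod (?k z) \<le> 1 / cmod (\<zeta> - z)" using kin[of z] u by (simp add: pos_le_divide_eq)
      ultimately have "cmod (z - z0) * cmod (?k z) \<le> (cmod (\<zeta> - z) + \<delta>) * (1 / cmod (\<zeta> - z))"
        using \<delta> by (intro mult_mono) auto
      also have "\<dots> = 1 + \<delta> / cmod (\<zeta> - z)" using u by (simp add: field_simps)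
      finally have "cmod ((z - z0) * ?k z) + cmod 1 \<le> 2 + \<delta> / cmod (\<zeta> - z)" by (simp only: norm_mult norm_one)
      then have "cmod ((z - z0) * ?k z + 1) \<le> 2 + \<delta> / cmod (\<zeta> - z)" using norm_triangle_ineq order_trans by blast
      then show ?thesis using True by (simp add: dist_norm)
    next
      case False
      have "(z - z0) * ?k z + 1 = (\<zeta> - z0) / (\<zeta> - z)" using z kout[of z] False by (simp only: not_less) (simp add: field_simps)
      then have "cmod ((z - z0) * ?k z + 1) = cmod (\<zeta> - z0) / cmod (\<zeta> - z)" by (simp only: norm_divide)
      also have "\<dots> \<le> \<delta> / cmod (\<zeta> - z)" using \<zeta> u by (simp add: divide_right_mono)
      finally show ?thesis using False by (simp add: dist_norm)
    qed
    then have "cmod (m z) * cmod ((z - z0) * ?k z + 1) \<le> cmod (m z) * (\<delta> / cmod (\<zeta> - z) + 2 * indicator (ball \<zeta> \<delta>) z)"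
      by (rule mult_left_mono) simp
    moreover have "?h z * ?k z + m z = m z * ((z - z0) * ?k z + 1)" by (simp add: algebra_simps)
    ultimately show ?thesis by (simp only: norm_mult)
  qed
  \<comment> \<open>The first two majorants serve \<open>z\<close> within distance \<open>r\<close>
    of \<zeta>, where \<open>m\<close> is bounded by \<open>B\<close>; the third serves the
    remaining \<open>z\<close>, where \<open>1 / |\<zeta> - z|\<close> is at most
    \<open>1 / r\<close>.\<close>
  let ?F1 = "\<lambda>z. ennreal (B * \<delta>) * (ennreal (1 / cmod (\<zeta> - z)) * indicator (ball \<zeta> r) z)"
  let ?F2 = "\<lambda>z. ennreal (B * 2) * indicator (ball \<zeta> \<delta>) z :: ennreal"
  let ?F3 = "\<lambda>z. ennreal (\<delta> / r) * ennreal (cmod (m z))"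
  have "ennreal (cmod (cauchy_smooth ?h \<delta> \<zeta> + of_real N)) \<le> (\<integral>\<^sup>+z. ennreal (cmod (?h z * ?k z + m z)) \<partial>lborel)"
    unfolding eq by (rule integral_norm_bound_ennreal) (use ihk m in auto)
  also have "\<dots> \<le> (\<integral>\<^sup>+z. (?F1 z + ?F2 z) + ?F3 z \<partial>lborel)"
  proof (rule nn_integral_mono_AE)
    show "AE z in lborel. ennreal (cmod (?h z * ?k z + m z)) \<le> (?F1 z + ?F2 z) + ?F3 z"
      using AE_lborel_singleton[of \<zeta>]
    proof eventually_elim
      case (elim z)
      then have u: "0 < cmod (\<zeta> - z)" by simp
      show ?case
      proof (cases "cmod (\<zeta> - z) < r")
        case True
        have "z \<in> ball z0 (2 * r)"
          using True \<zeta> \<delta> norm_triangle_ineq4[of "\<zeta> - z0" "\<zeta> - z"] by (simp add: dist_norm norm_minus_commute)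
        then have mB: "cmod (m z) \<le> B" by (rule B)
        have "cmod (?h z * ?k z + m z) \<le> B * (\<delta> / cmod (\<zeta> - z) + 2 * indicator (ball \<zeta> \<delta>) z)"
          by (rule order_trans[OF pw[OF elim] mult_right_mono[OF mB]]) (use \<delta> in auto)
        also have "\<dots> = (B * \<delta>) * (1 / cmod (\<zeta> - z)) + (B * 2) * indicator (ball \<zeta> \<delta>) z" by (simp add: algebra_simps)
        finally have "ennreal (cmod (?h z * ?k z + m z)) \<le> ennreal ((B * \<delta>) * (1 / cmod (\<zeta> - z)) + (B * 2) * indicator (ball \<zeta> \<delta>) z)"
          by (rule ennreal_leI)
        also have "\<dots> = ennreal ((B * \<delta>) * (1 / cmod (\<zeta> - z))) + ennreal ((B * 2) * indicator (ball \<zeta> \<delta>) z)"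
          using B0 \<delta> by (intro ennreal_plus) auto
        also have "\<dots> = ?F1 z + ?F2 z"
        proof -
          have "ennreal ((B * \<delta>) * (1 / cmod (\<zeta> - z))) = ?F1 z"
            using True B0 \<delta> by (subst ennreal_mult) (auto simp: dist_norm)
          moreover have "ennreal ((B * 2) * indicator (ball \<zeta> \<delta>) z) = ?F2 z" by (simp add: indicator_def)
          ultimately show ?thesis by simp
        qed
        also have "\<dots> \<le> (?F1 z + ?F2 z) + ?F3 z" by simp
        finally show ?thesis .
      next
        case False
        then have nb: "z \<notin> ball \<zeta> \<delta>" using \<delta> by (simp add: dist_norm)
        have "cmod (?h z * ?k z + m z) \<le> cmod (m z) * (\<delta> / cmod (\<zeta> - z))" using pw[OF elim] nb by simp
        also have "\<dots> \<le> cmod (m z) * (\<delta> / r)" using False r \<delta> u by (intro mult_left_mono divide_left_mono) auto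
        finally have "ennreal (cmod (?h z * ?k z + m z)) \<le> ennreal (\<delta> / r * cmod (m z))"
          by (intro ennreal_leI) (simp only: mult.commute)
        also have "\<dots> = ?F3 z" using \<delta> r by (intro ennreal_mult) auto
        also have "\<dots> \<le> (?F1 z + ?F2 z) + ?F3 z" by (simp add: add_increasing)
        finally show ?thesis .
      qed
    qed
  qed
  also have "\<dots> = (\<integral>\<^sup>+z. ?F1 z \<partial>lborel) + (\<integral>\<^sup>+z. ?F2 z \<partial>lborel) + (\<integral>\<^sup>+z. ?F3 z \<partial>lborel)"
    by (subst nn_integral_add, (intro borel_measurable_add borel_measurable_times_ennreal borel_measurable_indicator; measurable)+)
       (subst nn_integral_add, (intro borel_measurable_times_ennreal borel_measurable_indicator; measurable)+, simp)
  also have "\<dots> \<le> ennreal (B * \<delta> * (4 * pi * r)) + ennreal (B * 2 * (pi * \<delta>\<^sup>2)) + ennreal (\<delta> / r * (\<integral>z. cmod (m z) \<partial>lborel))"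
  proof (intro add_mono)
    have "(\<integral>\<^sup>+z. ?F1 z \<partial>lborel) = ennreal (B * \<delta>) * (\<integral>\<^sup>+z. ennreal (1 / cmod (\<zeta> - z)) * indicator (ball \<zeta> r) z \<partial>lborel)"
      by (rule nn_integral_cmult) (intro borel_measurable_times_ennreal borel_measurable_indicator; measurable)
    also have "\<dots> \<le> ennreal (B * \<delta>) * ennreal (4 * pi * r)"
      by (intro mult_left_mono nn_integral_inverse_cmod r) auto
    also have "\<dots> = ennreal (B * \<delta> * (4 * pi * r))" using B0 \<delta> by (intro ennreal_mult[symmetric]) auto
    finally show "(\<integral>\<^sup>+z. ?F1 z \<partial>lborel) \<le> ennreal (B * \<delta> * (4 * pi * r))" .
    show "(\<integral>\<^sup>+z. ?F2 z \<partial>lborel) \<le> ennreal (B * 2 * (pi * \<delta>\<^sup>2))"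
      using B0 \<delta> by (simp add: nn_integral_cmult_indicator emeasure_ball_complex ennreal_mult[symmetric])
    have "(\<integral>\<^sup>+z. ?F3 z \<partial>lborel) = ennreal (\<delta> / r) * (\<integral>\<^sup>+z. ennreal (cmod (m z)) \<partial>lborel)"
      by (rule nn_integral_cmult) measurable
    also have "(\<integral>\<^sup>+z. ennreal (cmod (m z)) \<partial>lborel) = ennreal (\<integral>z. cmod (m z) \<partial>lborel)"
      by (rule nn_integral_eq_integral) (use m in auto)
    finally show "(\<integral>\<^sup>+z. ?F3 z \<partial>lborel) \<le> ennreal (\<delta> / r * (\<integral>z. cmod (m z) \<partial>lborel))"
      using \<delta> r by (simp add: ennreal_mult[symmetric])
  qed
  also have "\<dots> = ennreal (B * \<delta> * (4 * pi * r) + B * 2 * (pi * \<delta>\<^sup>2) + \<delta> / r * (\<integral>z. cmod (m z) \<partial>lborel))"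
    using B0 \<delta> r by (simp add: ennreal_plus)
  finally have "cmod (cauchy_smooth ?h \<delta> \<zeta> + of_real N) \<le> B * \<delta> * (4 * pi * r) + B * 2 * (pi * \<delta>\<^sup>2) + \<delta> / r * (\<integral>z. cmod (m z) \<partial>lborel)"
    using B0 \<delta> r by (subst (asm) ennreal_le_iff) (auto intro!: add_nonneg_nonneg)
  then show ?thesis by (simp add: algebra_simps)
qed

text \<open>After the pointwise bound, Fubini's theorem integrates out \<zeta> over a disc of area
  \<open>pi * \<delta>\<^sup>2\<close>. The hypothesis \<open>bd\<close> says that moving the weight
  from \<zeta> to \<open>z\<close> costs at most a factor 4; \<open>16 * pi\<close>, 4 and
  \<open>pi\<close> make up the constant.\<close>

lemma cauchy_smooth_b_weighted:
  assumes h: "integrable lborel h" and \<delta>: "0 < \<delta>" and F [measurable]: "F \<in> borel_measurable borel"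
    and A: "\<And>\<zeta>. \<zeta> \<in> S \<Longrightarrow> 0 \<le> A \<zeta>"
    and bd: "\<And>\<zeta> z. \<zeta> \<in> S \<Longrightarrow> cmod (\<zeta> - z) < \<delta> \<Longrightarrow> ennreal ((cmod (h z))\<^sup>2 * A \<zeta>) \<le> 4 * F z"
  shows "(\<integral>\<^sup>+\<zeta>\<in>S. ennreal ((cmod (cauchy_smooth_b h \<delta> \<zeta>))\<^sup>2 * A \<zeta>) \<partial>lborel) \<le> ennreal (64 * pi\<^sup>2) * (\<integral>\<^sup>+z. F z \<partial>lborel)"
proof -
  have hm [measurable]: "h \<in> borel_measurable borel" using h by auto
  define I :: "complex \<Rightarrow> complex \<Rightarrow> ennreal" where "I \<zeta> z = indicator {..<\<delta>} (cmod (\<zeta> - z))" for \<zeta> z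
  have im: "(indicator {..<\<delta>} :: real \<Rightarrow> ennreal) \<in> borel_measurable borel" by simp
  have Im2: "(\<lambda>p. I (snd p) (fst p)) \<in> borel_measurable (borel \<Otimes>\<^sub>M borel)" unfolding I_def
    by (rule measurable_compose[OF _ im]) measurable
  have Im: "I \<zeta> \<in> borel_measurable borel" for \<zeta> unfolding I_def
    by (rule measurable_compose[OF _ im]) measurable
  have Im': "(\<lambda>\<zeta>. I \<zeta> z) \<in> borel_measurable borel" for z unfolding I_def
    by (rule measurable_compose[OF _ im]) measurable
  let ?c = "ennreal (16 * pi / \<delta>\<^sup>2)"
  have "(\<integral>\<^sup>+\<zeta>\<in>S. ennreal ((cmod (cauchy_smooth_b h \<delta> \<zeta>))\<^sup>2 * A \<zeta>) \<partial>lborel) \<le> (\<integral>\<^sup>+\<zeta>. \<integral>\<^sup>+z. ?c * (4 * F z * I \<zeta> z) \<partial>lborel \<partial>lborel)"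
  proof (rule nn_integral_mono)
    fix \<zeta>
    show "ennreal ((cmod (cauchy_smooth_b h \<delta> \<zeta>))\<^sup>2 * A \<zeta>) * indicator S \<zeta> \<le> (\<integral>\<^sup>+z. ?c * (4 * F z * I \<zeta> z) \<partial>lborel)"
    proof (cases "\<zeta> \<in> S")
      case True
      have mh: "(\<lambda>z. ennreal ((cmod (h z))\<^sup>2) * I \<zeta> z) \<in> borel_measurable lborel"
        using Im[of \<zeta>] by (intro borel_measurable_times_ennreal) auto
      have "ennreal ((cmod (cauchy_smooth_b h \<delta> \<zeta>))\<^sup>2 * A \<zeta>) = ennreal (A \<zeta>) * ennreal ((cmod (cauchy_smooth_b h \<delta> \<zeta>))\<^sup>2)"
        using A[OF True] by (subst ennreal_mult[symmetric]) (auto simp: mult.commute)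
      also have "\<dots> \<le> ennreal (A \<zeta>) * (?c * (\<integral>\<^sup>+z. ennreal ((cmod (h z))\<^sup>2) * I \<zeta> z \<partial>lborel))"
        unfolding I_def by (intro mult_left_mono cauchy_smooth_b_bound[OF h \<delta>]) simp
      also have "\<dots> = ?c * (ennreal (A \<zeta>) * (\<integral>\<^sup>+z. ennreal ((cmod (h z))\<^sup>2) * I \<zeta> z \<partial>lborel))"
        by (rule mult.left_commute)
      also have "ennreal (A \<zeta>) * (\<integral>\<^sup>+z. ennreal ((cmod (h z))\<^sup>2) * I \<zeta> z \<partial>lborel) = (\<integral>\<^sup>+z. ennreal (A \<zeta>) * (ennreal ((cmod (h z))\<^sup>2) * I \<zeta> z) \<partial>lborel)"
        by (rule nn_integral_cmult[OF mh, symmetric])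
      also have "?c * \<dots> = (\<integral>\<^sup>+z. ?c * (ennreal (A \<zeta>) * (ennreal ((cmod (h z))\<^sup>2) * I \<zeta> z)) \<partial>lborel)"
        by (rule nn_integral_cmult[symmetric]) (intro borel_measurable_times_ennreal borel_measurable_const mh)
      also have "\<dots> \<le> (\<integral>\<^sup>+z. ?c * (4 * F z * I \<zeta> z) \<partial>lborel)"
      proof (rule nn_integral_mono, rule mult_left_mono)
        fix z
        show "ennreal (A \<zeta>) * (ennreal ((cmod (h z))\<^sup>2) * I \<zeta> z) \<le> 4 * F z * I \<zeta> z"
        proof (cases "cmod (\<zeta> - z) < \<delta>")
          case T: True
          have "ennreal (A \<zeta>) * ennreal ((cmod (h z))\<^sup>2) = ennreal ((cmod (h z))\<^sup>2 * A \<zeta>)"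
            using A[OF True] by (subst ennreal_mult[symmetric]) (auto simp: mult.commute)
          also have "\<dots> \<le> 4 * F z" by (rule bd[OF True T])
          finally show ?thesis using T by (simp add: I_def)
        qed (simp add: I_def)
      qed simp
      finally show ?thesis using True by simp
    qed simp
  qed
  also have "\<dots> = (\<integral>\<^sup>+z. \<integral>\<^sup>+\<zeta>. ?c * (4 * F z * I \<zeta> z) \<partial>lborel \<partial>lborel)"
  proof (rule lborel_pair.Fubini')
    have "(\<lambda>p. ?c * (4 * F (fst p) * I (snd p) (fst p))) \<in> borel_measurable (borel \<Otimes>\<^sub>M borel)"
      by (intro borel_measurable_times_ennreal Im2 measurable_compose[OF measurable_fst F]) auto
    then show "(\<lambda>(z, \<zeta>). ?c * (4 * F z * I \<zeta> z)) \<in> borel_measurable (lborel \<Otimes>\<^sub>M lborel)"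
      by (simp add: case_prod_beta' cong: measurable_cong_sets)
  qed
  also have "\<dots> = (\<integral>\<^sup>+z. ennreal (64 * pi\<^sup>2) * F z \<partial>lborel)"
  proof (rule nn_integral_cong)
    fix z
    have "(\<integral>\<^sup>+\<zeta>. ?c * (4 * F z * I \<zeta> z) \<partial>lborel) = ?c * (4 * F z) * (\<integral>\<^sup>+\<zeta>. I \<zeta> z \<partial>lborel)"
      using Im'[of z] by (subst nn_integral_cmult[symmetric]) (auto simp: mult.assoc)
    also have "(\<integral>\<^sup>+\<zeta>. I \<zeta> z \<partial>lborel) = (\<integral>\<^sup>+\<zeta>. indicator (ball z \<delta>) \<zeta> \<partial>lborel)"
      by (intro nn_integral_cong) (auto simp: I_def indicator_def dist_norm norm_minus_commute)
    also have "\<dots> = ennreal (pi * \<delta>\<^sup>2)" using \<delta> by (simp add: emeasure_ball_complex)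
    also have "?c * (4 * F z) * ennreal (pi * \<delta>\<^sup>2) = (?c * ennreal 4 * ennreal (pi * \<delta>\<^sup>2)) * F z"
      by (simp add: mult_ac)
    also have "?c * ennreal 4 * ennreal (pi * \<delta>\<^sup>2) = ennreal (64 * pi\<^sup>2)"
    proof -
      have "?c * ennreal 4 * ennreal (pi * \<delta>\<^sup>2) = ennreal (16 * pi / \<delta>\<^sup>2 * 4 * (pi * \<delta>\<^sup>2))"
        by (simp add: ennreal_mult[symmetric] del: ennreal_numeral)
      also have "16 * pi / \<delta>\<^sup>2 * 4 * (pi * \<delta>\<^sup>2) = 64 * pi\<^sup>2" using \<delta> by (simp add: power2_eq_square)
      finally show ?thesis .
    qed
    finally show "(\<integral>\<^sup>+\<zeta>. ?c * (4 * F z * I \<zeta> z) \<partial>lborel) = ennreal (64 * pi\<^sup>2) * F z" .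
  qed
  also have "\<dots> = ennreal (64 * pi\<^sup>2) * (\<integral>\<^sup>+z. F z \<partial>lborel)"
    by (rule nn_integral_cmult) simp
  finally show ?thesis .
qed

section \<open>Extension from one point\<close>

text \<open>Let \<open>N\<close> be the square norm of the minimal function. The dbar-inequality is
  applied to \<beta> with weight \<open>\<phi> - 2 * h\<close> and
  \<open>g = ln (|z - z0|^2 + \<delta>\<^sup>2) - 2 * h\<close>. As \<open>h\<close> is harmonic,
  \<open>g_zb\<close> approximates a point mass at \<open>z0\<close>, where \<beta> is close to
  \<open>- N\<close>: the left-hand side is at least a multiple of \<open>N\<^sup>2\<close>. The
  right-hand side is at most a multiple of \<open>N\<close>, and dividing by \<open>N\<close> bounds
  the norm.\<close>

theorem ohsawa_takegoshi_bounded: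
  assumes D: "open D" "bounded D" "z0 \<in> D" and U: "open U" "closure D \<subseteq> U"
    and \<phi>: "C2_real U \<phi> \<phi>_z \<phi>_zz \<phi>_zb" "\<And>z. z \<in> U \<Longrightarrow> 0 \<le> \<phi>_zb z"
    and h: "C2_real U h h_z h_zz h_zb" "\<And>z. z \<in> U \<Longrightarrow> h_zb z = 0"
    and dom: "\<And>z. z \<in> U \<Longrightarrow> 4 * (cmod (z - z0))\<^sup>2 \<le> exp (2 * h z)"
  obtains f where "f holomorphic_on D" "f z0 = 1"
    "(\<integral>\<^sup>+z\<in>D. ennreal ((cmod (f z))\<^sup>2 * exp (- \<phi> z)) \<partial>lborel) \<le> ennreal (10240 * pi * exp (2 * h z0 - \<phi> z0))"
proof -
  define Kc where "Kc = closure D"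
  have Kc: "compact Kc" "D \<subseteq> Kc" "Kc \<noteq> {}" "Kc \<subseteq> U"
    using D U closure_subset by (auto simp: Kc_def compact_closure)
  obtain \<delta>0 where \<delta>0: "0 < \<delta>0" "{x. infdist x Kc \<le> \<delta>0} \<subseteq> U"
    using compact_in_open_separated[OF Kc(3,1) U(1) Kc(4)] by blast
  define S0 where "S0 = {x. infdist x Kc \<le> \<delta>0}"
  have S0: "compact S0" "S0 \<subseteq> U" "Kc \<subseteq> S0"
    using compact_infdist_le[OF Kc(3,1) \<delta>0(1)] \<delta>0 by (auto simp: S0_def)
  define U' where "U' = {x. infdist x Kc < \<delta>0}"
  have U': "open U'" "U' \<subseteq> S0" "U' \<subseteq> U" using \<delta>0(2)
    by (auto simp: U'_def S0_def intro!: open_Collect_less continuous_intros)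
  note P = C2_realD[OF \<phi>(1)] and H = C2_realD[OF h(1)]
  have c\<phi>: "continuous_on S0 \<phi>" and ch: "continuous_on S0 h"
    using P(5) H(5) S0(2) by (auto intro: continuous_on_subset)
  obtain B\<phi> where B\<phi>: "\<And>z. z \<in> S0 \<Longrightarrow> \<bar>\<phi> z\<bar> \<le> B\<phi>"
    using compact_imp_bounded[OF compact_continuous_image[OF c\<phi> S0(1)]] unfolding bounded_iff by (metis imageI real_norm_def)
  obtain Bh where Bh: "\<And>z. z \<in> S0 \<Longrightarrow> \<bar>h z\<bar> \<le> Bh"
    using compact_imp_bounded[OF compact_continuous_image[OF ch S0(1)]] unfolding bounded_iff by (metis imageI real_norm_def)
  have z0K: "z0 \<in> Kc" and z0S: "z0 \<in> S0" using D(3) Kc(2) S0(3) by auto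
  define W where "W z = indicator D z *\<^sub>R exp (- \<phi> z)" for z
  have DS: "z \<in> D \<Longrightarrow> z \<in> S0" for z using Kc(2) S0(3) by auto
  have W: "W \<in> borel_measurable borel" "\<And>z. 0 \<le> W z" "\<And>z. z \<in> D \<Longrightarrow> exp (- B\<phi>) \<le> W z" "\<And>z. z \<in> D \<Longrightarrow> W z \<le> exp B\<phi>" "0 < exp (- B\<phi>)"
  proof -
    show "W \<in> borel_measurable borel" unfolding W_def
      by (rule borel_measurable_continuous_on_indicator)
         (use D in \<open>auto intro!: continuous_intros continuous_on_subset[OF c\<phi>] DS\<close>)
    show "exp (- B\<phi>) \<le> W z" "W z \<le> exp B\<phi>" if "z \<in> D" for z
      using B\<phi>[OF DS[OF that]] that by (auto simp: W_def)
  qed (auto simp: W_def)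
  obtain f where f: "bergman_L2 D W f" "f z0 = 1"
    and orth: "\<And>g. bergman_L2 D W g \<Longrightarrow> g z0 = 0 \<Longrightarrow> (\<integral>z. indicator D z *\<^sub>R (cnj (f z) * g z * of_real (W z)) \<partial>lborel) = 0"
    by (rule bergman_minimizer[OF D W], assumption, assumption, rule that; assumption)
  have fhol: "f holomorphic_on D" using f(1) by (simp add: bergman_L2_def)
  define N where "N = bergman_sq D W f"
  have N0: "0 \<le> N" unfolding N_def bergman_sq_def by (rule Bochner_Integration.integral_nonneg) (simp add: W)
  define F where "F z = indicator D z *\<^sub>R ((cmod (f z))\<^sup>2 * W z)" for z
  have F0: "0 \<le> F z" for z by (simp add: F_def W)
  have Fm: "F \<in> borel_measurable borel" unfolding F_def by (rule bergman_sq_measurable(1)[OF fhol fhol D(1) W(1)])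
  have FN: "(\<integral>\<^sup>+z. ennreal (F z) \<partial>lborel) = ennreal N" unfolding N_def bergman_sq_def
    by (subst F_def[symmetric])+ (rule nn_integral_eq_integral, use f F0 in \<open>auto simp: bergman_L2_def F_def\<close>)
  have Feq: "(\<integral>\<^sup>+z\<in>D. ennreal ((cmod (f z))\<^sup>2 * exp (- \<phi> z)) \<partial>lborel) = ennreal N"
    unfolding FN[symmetric] by (intro nn_integral_cong) (auto simp: F_def W_def indicator_def)
  have main: "N * N * exp (\<phi> z0 - 2 * h z0) \<le> 10240 * pi * N"
  proof (cases "N = 0")
    case False
    then have Npos: "0 < N" using N0 by simp
    have one: "bergman_L2 D W (\<lambda>z. 1)" by (rule bergman_L2_bounded[OF _ _ D(1,2) W(1,2,4), of _ 1]) auto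
    \<comment> \<open>Integration against \<open>m\<close> is the inner product with the minimal
      function. The factor \<open>z - z0\<close> in \<open>hh\<close> below makes the functions
      tested against \<open>m\<close> vanish at \<open>z0\<close>.\<close>
    define m where "m z = indicator D z *\<^sub>R (cnj (f z) * 1 * of_real (W z))" for z
    have im: "integrable lborel m" unfolding m_def by (rule bergman_inner_integrable[OF f(1) one D(1) W(1,2)])
    have mN: "(\<integral>z. m z \<partial>lborel) = of_real N"
    proof -
      \<comment> \<open>\<open>1 - f\<close> vanishes at \<open>z0\<close>, so it is orthogonal to
        \<open>f\<close>; this evaluates the integral of \<open>m\<close> as
        \<open>N\<close>.\<close>
      have g: "bergman_L2 D W (\<lambda>z. 1 + (-1) * f z)" by (rule bergman_sq_add(1)[OF one f(1) D(1) W(1,2)])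
      have iff': "integrable lborel (\<lambda>z. complex_of_real (F z))" using f(1) unfolding bergman_L2_def F_def by (intro integrable_of_real) blast
      have "indicator D z *\<^sub>R (cnj (f z) * (1 + (-1) * f z) * of_real (W z)) = m z - complex_of_real (F z)" for z
      proof -
        have "complex_of_real ((cmod (f z))\<^sup>2) = f z * cnj (f z)" by (rule complex_norm_square)
        then show ?thesis by (cases "z \<in> D") (simp_all add: m_def F_def algebra_simps)
      qed
      then have "(\<integral>z. m z - complex_of_real (F z) \<partial>lborel) = 0"
        using orth[OF g] f(2) by simp
      moreover have "(\<integral>z. F z \<partial>lborel) = N" by (simp add: N_def bergman_sq_def F_def)
      ultimately show ?thesis using im iff' by (simp add: integral_complex_of_real)
    qed
    obtain RD where RD: "\<And>z. z \<in> D \<Longrightarrow> cmod (z - z0) \<le> RD" "0 \<le> RD"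
    proof -
      obtain R where R: "\<And>z. z \<in> D \<Longrightarrow> cmod z \<le> R" using D(2) unfolding bounded_iff by blast
      have "cmod (z - z0) \<le> R + cmod z0" if "z \<in> D" for z
        using R[OF that] norm_triangle_ineq4[of z z0] by linarith
      moreover have "0 \<le> R + cmod z0" using R[OF D(3)] by (meson add_nonneg_nonneg norm_ge_zero order_trans)
      ultimately show ?thesis using that by blast
    qed
    define hh where "hh z = (z - z0) * m z" for z
    have ih: "integrable lborel hh"
    proof (rule Bochner_Integration.integrable_bound[of _ "\<lambda>z. RD * norm (m z)"])
      show "AE z in lborel. norm (hh z) \<le> norm (RD * norm (m z))"
      proof (rule AE_I2)
        fix z show "norm (hh z) \<le> norm (RD * norm (m z))"
          using RD by (cases "z \<in> D") (auto simp: hh_def m_def norm_mult intro!: mult_right_mono)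
      qed
      have "m \<in> borel_measurable borel" using im by auto
      then show "hh \<in> borel_measurable lborel" unfolding hh_def by (intro borel_measurable_times) auto
    qed (use im in auto)
    obtain r where r: "0 < r" "cball z0 (2 * r) \<subseteq> D"
    proof -
      obtain e where "0 < e" "cball z0 e \<subseteq> D" using D(1,3) open_contains_cball by blast
      then show ?thesis using that[of "e / 2"] by simp
    qed
    obtain B where B: "\<And>z. z \<in> ball z0 (2 * r) \<Longrightarrow> cmod (m z) \<le> B"
    proof -
      have "continuous_on (cball z0 (2 * r)) (\<lambda>z. cnj (f z) * 1 * of_real (exp (- \<phi> z)))"
        by (intro continuous_intros continuous_on_subset[OF holomorphic_on_imp_continuous_on[OF fhol] r(2)] continuous_on_subset[OF c\<phi>])
           (use r(2) DS in auto)
      then have "bounded ((\<lambda>z. cnj (f z) * 1 * of_real (exp (- \<phi> z))) ` cball z0 (2 * r))"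
        by (intro compact_imp_bounded compact_continuous_image) auto
      then obtain B where B: "\<And>z. z \<in> cball z0 (2 * r) \<Longrightarrow> cmod (cnj (f z) * 1 * of_real (exp (- \<phi> z))) \<le> B"
        unfolding bounded_iff by blast
      show ?thesis
      proof (rule that[of B])
        fix z assume "z \<in> ball z0 (2 * r)"
        then have z: "z \<in> cball z0 (2 * r)" by auto
        then have "z \<in> D" using r(2) by auto
        then show "cmod (m z) \<le> B" using B[OF z] by (simp add: m_def W_def)
      qed
    qed
    have B0: "0 \<le> B" by (rule order_trans[OF norm_ge_zero B[of z0]]) (use r in simp)
    define Q where "Q = (\<integral>z. cmod (m z) \<partial>lborel)"
    have Q0: "0 \<le> Q" by (simp add: Q_def)
    have ev1: "\<forall>\<^sub>F \<delta> in at_right 0. B * (4 * pi * r * \<delta> + 2 * pi * \<delta>\<^sup>2) + \<delta> / r * Q < N / 2"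
    proof -
      have "((\<lambda>\<delta>. B * (4 * pi * r * \<delta> + 2 * pi * \<delta>\<^sup>2) + \<delta> / r * Q) \<longlongrightarrow> B * (4 * pi * r * 0 + 2 * pi * 0\<^sup>2) + 0 / r * Q) (at_right 0)"
        by (intro tendsto_intros) (use r in auto)
      then show ?thesis using Npos by (intro order_tendstoD(2)) auto
    qed
    have ev2: "\<forall>\<^sub>F \<delta> in at_right 0. \<delta>\<^sup>2 * exp (2 * Bh) < 1 / 4"
    proof -
      have "((\<lambda>\<delta>::real. \<delta>\<^sup>2 * exp (2 * Bh)) \<longlongrightarrow> 0\<^sup>2 * exp (2 * Bh)) (at_right 0)" by (intro tendsto_intros)
      then show ?thesis by (intro order_tendstoD(2)) auto
    qed
    \<comment> \<open>Oscillation below \<open>ln 2\<close> at scale \<delta> means that the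
      exponential weights change by a factor of at most 2.\<close>
    obtain d1 where d1: "0 < d1" "\<And>z w. z \<in> S0 \<Longrightarrow> w \<in> S0 \<Longrightarrow> dist z w < d1 \<Longrightarrow> dist (\<phi> z) (\<phi> w) < ln 2"
      using compact_uniformly_continuous[OF c\<phi> S0(1)] unfolding uniformly_continuous_on_def
      by (metis dist_commute ln_gt_zero one_less_numeral_iff semiring_norm(76))
    have cd: "continuous_on S0 (\<lambda>z. \<phi> z - 2 * h z)" by (intro continuous_intros c\<phi> ch)
    obtain d2 where d2: "0 < d2" "\<And>z w. z \<in> S0 \<Longrightarrow> w \<in> S0 \<Longrightarrow> dist z w < d2 \<Longrightarrow> dist (\<phi> z - 2 * h z) (\<phi> w - 2 * h w) < ln 2"
      using compact_uniformly_continuous[OF cd S0(1)] unfolding uniformly_continuous_on_def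
      by (metis dist_commute ln_gt_zero one_less_numeral_iff semiring_norm(76))
    have "\<forall>\<^sub>F \<delta> in at_right 0. \<delta> < Min {\<delta>0, d1, d2, r}"
      by (rule order_tendstoD(2)[OF tendsto_ident_at]) (use \<delta>0 d1 d2 r in auto)
    then have "\<forall>\<^sub>F \<delta> in at_right 0. 0 < \<delta> \<and> \<delta> < Min {\<delta>0, d1, d2, r} \<and> \<delta>\<^sup>2 * exp (2 * Bh) < 1 / 4 \<and> B * (4 * pi * r * \<delta> + 2 * pi * \<delta>\<^sup>2) + \<delta> / r * Q < N / 2"
      using ev1 ev2 eventually_at_right_less[of "0::real"] by eventually_elim auto
    then obtain \<delta> where \<delta>': "0 < \<delta> \<and> \<delta> < Min {\<delta>0, d1, d2, r} \<and> \<delta>\<^sup>2 * exp (2 * Bh) < 1 / 4 \<and> B * (4 * pi * r * \<delta> + 2 * pi * \<delta>\<^sup>2) + \<delta> / r * Q < N / 2"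
      using eventually_happens trivial_limit_at_right_real by (metis (no_types, lifting))
    then have \<delta>: "0 < \<delta>" "\<delta> < \<delta>0" "\<delta> < d1" "\<delta> < d2" "\<delta> < r" "\<delta>\<^sup>2 * exp (2 * Bh) < 1 / 4"
      "B * (4 * pi * r * \<delta> + 2 * pi * \<delta>\<^sup>2) + \<delta> / r * Q < N / 2" by auto
    define S where "S = {x. infdist x Kc \<le> \<delta>}"
    have S: "compact S" "S \<subseteq> U'" using compact_infdist_le[OF Kc(3,1) \<delta>(1)] \<delta>(2) by (auto simp: S_def U'_def)
    have SS0: "S \<subseteq> S0" using S(2) U'(2) by auto
    have ballS: "ball z \<delta> \<subseteq> S" if "z \<in> Kc" for z
    proof
      fix x assume "x \<in> ball z \<delta>"
      then show "x \<in> S" using infdist_le[OF that, of x] by (simp add: S_def dist_commute)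
    qed
    define \<beta> where "\<beta> = cauchy_smooth hh \<delta>"
    obtain \<beta>_z \<beta>_zz \<beta>_zb \<beta>_bb where \<beta>:
      "\<And>z. has_wirtinger \<beta> (\<beta>_z z) (cauchy_smooth_b hh \<delta> z) z"
      "\<And>z. has_wirtinger \<beta>_z (\<beta>_zz z) (\<beta>_zb z) z" "\<And>z. has_wirtinger (cauchy_smooth_b hh \<delta>) (\<beta>_zb z) (\<beta>_bb z) z"
      "continuous_on UNIV \<beta>_zz" "continuous_on UNIV \<beta>_zb" "continuous_on UNIV \<beta>_bb"
      unfolding \<beta>_def by (rule cauchy_smooth_C2[OF ih, of \<delta>]) blast
    \<comment> \<open>Off \<open>S\<close> the kernel is exact, and \<beta> at \<zeta> is the inner
      product of \<open>f\<close> with \<open>(z - z0) / (\<zeta> - z)\<close>. This function is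
      bounded and holomorphic on \<open>D\<close> and vanishes at \<open>z0\<close>, so minimality
      gives 0.\<close>
    have \<beta>0: "\<beta> \<zeta> = 0" if "\<zeta> \<notin> S" for \<zeta>
    proof -
      have far: "\<delta> < cmod (\<zeta> - z)" if "z \<in> D" for z
        using infdist_le[of z Kc \<zeta>] that Kc(2) \<open>\<zeta> \<notin> S\<close> by (auto simp: S_def dist_norm)
      let ?g = "\<lambda>z. (z - z0) / (\<zeta> - z)"
      have gL: "bergman_L2 D W ?g"
      proof (rule bergman_L2_bounded[OF _ _ D(1,2) W(1,2,4), of _ "RD / \<delta>"])
        have "\<zeta> \<notin> D" using far \<delta>(1) by force
        then show "?g holomorphic_on D" by (intro holomorphic_intros) auto
        fix z assume z: "z \<in> D"
        show "cmod (?g z) \<le> RD / \<delta>" unfolding norm_divide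
          using far[OF z] RD(1)[OF z] RD(2) \<delta>(1) by (intro frac_le) auto
      qed
      have "\<beta> \<zeta> = (\<integral>z. indicator D z *\<^sub>R (cnj (f z) * ?g z * of_real (W z)) \<partial>lborel)"
        unfolding \<beta>_def cauchy_smooth_def
      proof (rule Bochner_Integration.integral_cong[OF refl])
        fix z
        show "hh z * (complex_of_real (1 / \<delta>) * cauchy_ker (of_real (1 / \<delta>) * (\<zeta> - z))) = indicator D z *\<^sub>R (cnj (f z) * ?g z * of_real (W z))"
        proof (cases "z \<in> D")
          case True
          have "\<not> cmod (of_real (1 / \<delta>) * (\<zeta> - z)) < 1" using far[OF True] \<delta>(1) by (simp add: norm_mult norm_divide)
          then have "complex_of_real (1 / \<delta>) * cauchy_ker (of_real (1 / \<delta>) * (\<zeta> - z)) = 1 / (\<zeta> - z)"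
            using \<delta>(1) by (simp add: cauchy_ker_def)
          then show ?thesis using True by (simp add: hh_def m_def)
        qed (simp add: hh_def m_def)
      qed
      also have "\<dots> = 0" by (rule orth[OF gL]) simp
      finally show ?thesis .
    qed
    have near: "N / 2 \<le> cmod (\<beta> \<zeta>)" if "\<zeta> \<in> ball z0 \<delta>" for \<zeta>
    proof -
      have "cmod (\<beta> \<zeta> + of_real N) \<le> B * (4 * pi * r * \<delta> + 2 * pi * \<delta>\<^sup>2) + \<delta> / r * Q"
        unfolding \<beta>_def hh_def[abs_def] Q_def
        by (rule cauchy_smooth_near[OF im ih[unfolded hh_def] mN B])
           (use \<delta> that in \<open>auto simp: dist_norm norm_minus_commute\<close>)
      then have "cmod (\<beta> \<zeta> + of_real N) < N / 2" using \<delta>(7) by (rule le_less_trans)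
      moreover have "cmod (complex_of_real N) = N" using N0 by simp
      moreover have "cmod (complex_of_real N) \<le> cmod (\<beta> \<zeta> + of_real N) + cmod (\<beta> \<zeta>)"
        using norm_triangle_ineq4[of "\<beta> \<zeta> + of_real N" "\<beta> \<zeta>"] by simp
      ultimately show ?thesis by linarith
    qed
    define \<phi>' where "\<phi>' z = \<phi> z + (-2) * h z" for z
    define g where "g z = ln ((cmod (z - z0))\<^sup>2 + \<delta>\<^sup>2) + (-2) * h z" for z
    define g_zb where "g_zb z = log_zb z0 (\<delta>\<^sup>2) z + (-2) * h_zb z" for z
    have pos: "0 < (cmod (z - z0))\<^sup>2 + \<delta>\<^sup>2" for z using \<delta>(1) by (simp add: add_nonneg_pos)
    note hU = C2_real_cmult[OF C2_real_subset[OF h(1) U'(3)], of "-2"]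
    note \<phi>C = C2_real_add[OF C2_real_subset[OF \<phi>(1) U'(3)] hU]
    note gC = C2_real_add[OF C2_real_log[OF pos] hU]
    have gzb: "z \<in> U' \<Longrightarrow> g_zb z = log_zb z0 (\<delta>\<^sup>2) z" for z using h(2) U'(3) by (auto simp: g_zb_def)
    have eg: "exp (g z) = ((cmod (z - z0))\<^sup>2 + \<delta>\<^sup>2) * exp (- (2 * h z))" for z
      using pos[of z] by (simp add: g_def exp_add exp_diff exp_minus divide_inverse)
    have ineq: "(\<integral>z. indicator S z *\<^sub>R (g_zb z * (cmod (\<beta> z))\<^sup>2 * exp (\<phi>' z)) \<partial>lborel)
       \<le> 5 * (\<integral>z. indicator S z *\<^sub>R ((cmod (cauchy_smooth_b hh \<delta> z))\<^sup>2 * exp (\<phi>' z - g z)) \<partial>lborel)"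
      unfolding \<phi>'_def g_def g_zb_def
    proof (rule dbar_inequality[OF U'(1) \<phi>C _ gC _ _ \<beta>(1-3) \<beta>(4-6) S \<beta>0])
      fix z assume z: "z \<in> U'"
      then have zU: "z \<in> U" and zS: "z \<in> S0" using U' by auto
      show "0 \<le> \<phi>_zb z + (-2) * h_zb z" using \<phi>(2)[OF zU] h(2)[OF zU] by simp
      show "0 \<le> log_zb z0 (\<delta>\<^sup>2) z + (-2) * h_zb z" using h(2)[OF zU] by (simp add: log_zb_def)
      \<comment> \<open>The two summands of \<open>exp g\<close> are at most \<open>1 / 4\<close>
        each: the first by \<open>dom\<close>, the second because \<delta> is small against
        \<open>exp (2 * Bh)\<close>.\<close>
      have "(cmod (z - z0))\<^sup>2 * exp (- (2 * h z)) \<le> (exp (2 * h z) / 4) * exp (- (2 * h z))"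
        by (rule mult_right_mono) (use dom[OF zU] in auto)
      then have 1: "(cmod (z - z0))\<^sup>2 * exp (- (2 * h z)) \<le> 1 / 4" by (simp add: exp_minus)
      have "\<delta>\<^sup>2 * exp (- (2 * h z)) \<le> \<delta>\<^sup>2 * exp (2 * Bh)"
        using Bh[OF zS] by (intro mult_left_mono) auto
      then have 2: "\<delta>\<^sup>2 * exp (- (2 * h z)) \<le> 1 / 4" using \<delta>(6) by simp
      show "exp (ln ((cmod (z - z0))\<^sup>2 + \<delta>\<^sup>2) + (-2) * h z) \<le> 1 / 2"
        unfolding g_def[symmetric] eg using 1 2 by (simp add: distrib_right)
    qed
    have c\<beta>: "continuous_on X \<beta>" "continuous_on X (cauchy_smooth_b hh \<delta>)" for X
      using has_wirtinger_imp_continuous_on[OF \<beta>(1)] has_wirtinger_imp_continuous_on[OF \<beta>(3)] by blast+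
    have c\<phi>S: "continuous_on S \<phi>" "continuous_on S h" using c\<phi> ch SS0 continuous_on_subset by blast+
    define A where "A z = exp (\<phi> z) / ((cmod (z - z0))\<^sup>2 + \<delta>\<^sup>2)" for z
    \<comment> \<open>The harmonic function cancels here, and the remaining denominator compensates
      the factor \<open>z - z0\<close> of \<open>hh\<close>.\<close>
    have eA: "exp (\<phi>' z - g z) = A z" for z
      using pos[of z] by (simp add: \<phi>'_def g_def A_def exp_diff exp_add)
    have upper: "(\<integral>z. indicator S z *\<^sub>R ((cmod (cauchy_smooth_b hh \<delta> z))\<^sup>2 * exp (\<phi>' z - g z)) \<partial>lborel) \<le> 64 * pi\<^sup>2 * N"
    proof -
      have i: "integrable lborel (\<lambda>z. indicator S z *\<^sub>R ((cmod (cauchy_smooth_b hh \<delta> z))\<^sup>2 * A z))"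
        unfolding A_def
        by (intro borel_integrable_compact[OF S(1)] continuous_intros c\<beta> c\<phi>S) (use \<delta>(1) in auto)
      have "ennreal (\<integral>z. indicator S z *\<^sub>R ((cmod (cauchy_smooth_b hh \<delta> z))\<^sup>2 * A z) \<partial>lborel)
         = (\<integral>\<^sup>+z. ennreal (indicator S z *\<^sub>R ((cmod (cauchy_smooth_b hh \<delta> z))\<^sup>2 * A z)) \<partial>lborel)"
        by (rule nn_integral_eq_integral[OF i, symmetric]) (use pos in \<open>auto simp: A_def less_imp_le\<close>)
      also have "\<dots> = (\<integral>\<^sup>+z\<in>S. ennreal ((cmod (cauchy_smooth_b hh \<delta> z))\<^sup>2 * A z) \<partial>lborel)"
        by (intro nn_integral_cong) (auto simp: indicator_def)
      also have "\<dots> \<le> ennreal (64 * pi\<^sup>2) * (\<integral>\<^sup>+z. ennreal (F z) \<partial>lborel)"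
      proof (rule cauchy_smooth_b_weighted[OF ih \<delta>(1)])
        show "(\<lambda>z. ennreal (F z)) \<in> borel_measurable borel" using Fm by measurable
        show "0 \<le> A \<zeta>" for \<zeta> using pos[of \<zeta>] by (simp add: A_def)
        \<comment> \<open>The factor 4 allowed for moving the weight splits as 2 for
          \<open>exp \<phi>\<close> and 2 for \<open>|z - z0|^2\<close> against
          \<open>|\<zeta> - z0|^2 + \<delta>\<^sup>2\<close>.\<close>
        fix \<zeta> z assume \<zeta>: "\<zeta> \<in> S" and close: "cmod (\<zeta> - z) < \<delta>"
        have "(cmod (hh z))\<^sup>2 * A \<zeta> \<le> 4 * F z"
        proof (cases "z \<in> D")
          case True
          have "dist (\<phi> \<zeta>) (\<phi> z) < ln 2"
            using \<zeta> SS0 DS[OF True] close \<delta>(3) by (intro d1(2)) (auto simp: dist_norm)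
          then have "\<phi> \<zeta> \<le> \<phi> z + ln 2" by (simp add: dist_real_def)
          then have "exp (\<phi> \<zeta>) \<le> exp (\<phi> z + ln 2)" by simp
          then have e: "exp (\<phi> \<zeta>) \<le> 2 * exp (\<phi> z)" by (simp add: exp_add)
          have "(cmod (z - z0))\<^sup>2 \<le> (cmod (\<zeta> - z0) + \<delta>)\<^sup>2"
            using close norm_triangle_ineq4[of "\<zeta> - z0" "\<zeta> - z"] by (intro power_mono) auto
          also have "\<dots> \<le> 2 * ((cmod (\<zeta> - z0))\<^sup>2 + \<delta>\<^sup>2)"
            using sum_squares_bound[of "cmod (\<zeta> - z0)" \<delta>] by (simp add: power2_sum)
          finally have q: "(cmod (z - z0))\<^sup>2 \<le> 2 * ((cmod (\<zeta> - z0))\<^sup>2 + \<delta>\<^sup>2)" .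
          have "(cmod (z - z0))\<^sup>2 * exp (\<phi> \<zeta>) \<le> (2 * ((cmod (\<zeta> - z0))\<^sup>2 + \<delta>\<^sup>2)) * (2 * exp (\<phi> z))"
            by (intro mult_mono q e) (use pos[of \<zeta>] in auto)
          then have le: "(cmod (z - z0))\<^sup>2 * A \<zeta> \<le> 4 * exp (\<phi> z)"
            unfolding A_def using pos[of \<zeta>] by (simp add: pos_divide_le_eq algebra_simps)
          have "(cmod (hh z))\<^sup>2 * A \<zeta> = ((cmod (f z))\<^sup>2 * (exp (- \<phi> z))\<^sup>2) * ((cmod (z - z0))\<^sup>2 * A \<zeta>)"
            using True by (simp add: hh_def m_def W_def norm_mult power_mult_distrib mult_ac)
          also have "\<dots> \<le> ((cmod (f z))\<^sup>2 * (exp (- \<phi> z))\<^sup>2) * (4 * exp (\<phi> z))"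
            by (intro mult_left_mono le) auto
          also have "\<dots> = 4 * F z"
            using True by (simp add: F_def W_def power2_eq_square exp_minus)
          finally show ?thesis .
        next
          case False then show ?thesis by (simp add: hh_def m_def F_def)
        qed
        then have "ennreal ((cmod (hh z))\<^sup>2 * A \<zeta>) \<le> ennreal (4 * F z)" by (rule ennreal_leI)
        then show "ennreal ((cmod (hh z))\<^sup>2 * A \<zeta>) \<le> 4 * ennreal (F z)" using F0[of z] by (simp add: ennreal_mult)
      qed
      also have "\<dots> = ennreal (64 * pi\<^sup>2 * N)" unfolding FN using N0 by (simp add: ennreal_mult)
      finally show ?thesis unfolding eA using N0 by (subst (asm) ennreal_le_iff) auto
    qed
    have lower: "pi * N\<^sup>2 / 32 * exp (\<phi> z0 - 2 * h z0) \<le> (\<integral>z. indicator S z *\<^sub>R (g_zb z * (cmod (\<beta> z))\<^sup>2 * exp (\<phi>' z)) \<partial>lborel)"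
    proof -
      \<comment> \<open>On the \<delta>-disc about \<open>z0\<close> the three factors bound
        \<open>log_zb\<close>, the square of \<open>cmod (\<beta> z)\<close> and the exponential
        from below. Times the area \<open>pi * \<delta>\<^sup>2\<close> they give
        \<open>pi * N\<^sup>2 / 32\<close>, free of \<delta>.\<close>
      define c where "c = 1 / (4 * \<delta>\<^sup>2) * (N\<^sup>2 / 4) * (exp (\<phi> z0 - 2 * h z0) / 2)"
      have eq: "indicator S z *\<^sub>R (g_zb z * (cmod (\<beta> z))\<^sup>2 * exp (\<phi>' z)) = indicator S z *\<^sub>R (log_zb z0 (\<delta>\<^sup>2) z * (cmod (\<beta> z))\<^sup>2 * exp (\<phi> z + (-2) * h z))" for z
        using gzb S(2) by (cases "z \<in> S") (auto simp: \<phi>'_def)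
      have "pi * N\<^sup>2 / 32 * exp (\<phi> z0 - 2 * h z0) = (\<integral>z. c * indicator (ball z0 \<delta>) z \<partial>lborel)"
      proof -
        have "measure lborel (ball z0 \<delta>) = pi * \<delta>\<^sup>2" using \<delta>(1) by (simp add: measure_def emeasure_ball_complex)
        then show ?thesis using \<delta>(1) by (simp add: c_def power2_eq_square)
      qed
      also have "\<dots> \<le> (\<integral>z. indicator S z *\<^sub>R (g_zb z * (cmod (\<beta> z))\<^sup>2 * exp (\<phi>' z)) \<partial>lborel)"
      proof (rule integral_mono)
        show "integrable lborel (\<lambda>z. c * indicator (ball z0 \<delta>) z)"
          using emeasure_lborel_ball_finite[of z0 \<delta>] by (intro integrable_mult_right integrable_real_indicator) auto
        show "integrable lborel (\<lambda>z. indicator S z *\<^sub>R (g_zb z * (cmod (\<beta> z))\<^sup>2 * exp (\<phi>' z)))"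
          unfolding eq log_zb_def
          by (intro borel_integrable_compact[OF S(1)] continuous_intros c\<beta> c\<phi>S) (use \<delta>(1) in auto)
        fix z
        show "c * indicator (ball z0 \<delta>) z \<le> indicator S z *\<^sub>R (g_zb z * (cmod (\<beta> z))\<^sup>2 * exp (\<phi>' z))"
        proof (cases "z \<in> ball z0 \<delta>")
          case True
          then have zS: "z \<in> S" using ballS[OF z0K] by auto
          have zd: "cmod (z - z0) < \<delta>" using True by (simp add: dist_norm norm_minus_commute)
          have "(cmod (z - z0))\<^sup>2 \<le> \<delta>\<^sup>2" using zd by (intro power_mono) auto
          then have "((cmod (z - z0))\<^sup>2 + \<delta>\<^sup>2)\<^sup>2 \<le> (2 * \<delta>\<^sup>2)\<^sup>2" by (intro power_mono) auto
          then have "\<delta>\<^sup>2 / (2 * \<delta>\<^sup>2)\<^sup>2 \<le> log_zb z0 (\<delta>\<^sup>2) z"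
            unfolding log_zb_def using \<delta>(1) pos[of z] by (intro divide_left_mono) auto
          moreover have "\<delta>\<^sup>2 / (2 * \<delta>\<^sup>2)\<^sup>2 = 1 / (4 * \<delta>\<^sup>2)" using \<delta>(1) by (simp add: power2_eq_square)
          ultimately have 1: "1 / (4 * \<delta>\<^sup>2) \<le> log_zb z0 (\<delta>\<^sup>2) z" by simp
          have "(N / 2)\<^sup>2 \<le> (cmod (\<beta> z))\<^sup>2" using near[OF True] N0 by (intro power_mono) auto
          then have 2: "N\<^sup>2 / 4 \<le> (cmod (\<beta> z))\<^sup>2" by (simp add: power_divide)
          have "dist (\<phi> z - 2 * h z) (\<phi> z0 - 2 * h z0) < ln 2"
            using zS SS0 z0S zd \<delta>(4) by (intro d2(2)) (auto simp: dist_norm)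
          then have "\<phi> z0 - 2 * h z0 - ln 2 \<le> \<phi>' z" by (simp add: dist_real_def \<phi>'_def)
          then have "exp (\<phi> z0 - 2 * h z0 - ln 2) \<le> exp (\<phi>' z)" by simp
          then have 3: "exp (\<phi> z0 - 2 * h z0) / 2 \<le> exp (\<phi>' z)" by (simp add: exp_diff)
          have "c \<le> log_zb z0 (\<delta>\<^sup>2) z * (cmod (\<beta> z))\<^sup>2 * exp (\<phi>' z)"
            unfolding c_def by (intro mult_mono 1 2 3) (auto simp: log_zb_def)
          then show ?thesis using True zS S(2) gzb[of z] by auto
        next
          case False
          have "0 \<le> indicator S z *\<^sub>R (log_zb z0 (\<delta>\<^sup>2) z * (cmod (\<beta> z))\<^sup>2 * exp (\<phi> z + (-2) * h z))"
            by (auto simp: log_zb_def indicator_def)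
          then show ?thesis using False unfolding eq by simp
        qed
      qed
      finally show ?thesis .
    qed
    have "pi * N\<^sup>2 / 32 * exp (\<phi> z0 - 2 * h z0) \<le> 5 * (64 * pi\<^sup>2 * N)"
      using lower ineq upper by linarith
    then have "pi * (N * N * exp (\<phi> z0 - 2 * h z0)) \<le> pi * (10240 * pi * N)"
      by (simp add: power2_eq_square algebra_simps)
    then show ?thesis by simp
  qed simp
  have "N \<le> 10240 * pi * exp (2 * h z0 - \<phi> z0)"
  proof (cases "N = 0")
    case False
    then have "N * exp (\<phi> z0 - 2 * h z0) \<le> 10240 * pi" using main N0 by (simp add: mult_ac)
    then have "N * exp (\<phi> z0 - 2 * h z0) * exp (2 * h z0 - \<phi> z0) \<le> 10240 * pi * exp (2 * h z0 - \<phi> z0)"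
      by (rule mult_right_mono) simp
    then show ?thesis by (simp add: mult.assoc exp_add[symmetric])
  qed simp
  then show ?thesis using that[OF fhol f(2)] Feq by (simp add: ennreal_leI)
qed

section \<open>Logarithmic potentials\<close>

lemma holomorphic_circle_mean:
  assumes g: "g holomorphic_on ball 0 R" and R: "1 < R"
  shows "((\<lambda>t. g (cis t)) has_integral (of_real (2 * pi) * g 0)) {0..2*pi}"
proof -
  have "((\<lambda>u. g u / (u - 0)) has_contour_integral (2 * of_real pi * \<i> * g 0)) (circlepath 0 1)"
    by (rule Cauchy_integral_circlepath_simple)
       (use R in \<open>auto intro!: holomorphic_on_subset[OF g]\<close>)
  then have "((\<lambda>t. g (0 + of_real 1 * cis t) / (0 + of_real 1 * cis t - 0) * of_real 1 * \<i> * cis t) has_integral (2 * of_real pi * \<i> * g 0)) {0..2*pi}"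
    unfolding circlepath_def by (subst (asm) has_contour_integral_part_circlepath_iff) auto
  then have "((\<lambda>t. \<i> * g (cis t)) has_integral (2 * of_real pi * \<i> * g 0)) {0..2*pi}"
    by (rule has_integral_eq[rotated]) (simp add: field_simps)
  from has_integral_mult_right[OF this, of "- \<i>"]
  show ?thesis by (simp add: mult_ac)
qed

text \<open>With \<open>c = q / p\<close> the function \<open>Ln (1 + c * z)\<close> is holomorphic
  on a disc of radius larger than 1, because \<open>1 + c * z\<close> stays in the right half plane.
  The real part of its circle mean is its value 0 at the centre.\<close>

lemma log_circle_mean:
  assumes p: "0 < p" and q: "cmod q < p"
  shows "((\<lambda>t. ln ((cmod (of_real p + q * cis t))\<^sup>2)) has_integral (2 * pi * ln (p\<^sup>2))) {0..2*pi}"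
proof -
  define c where "c = q / of_real p"
  have c: "cmod c < 1" using p q by (simp add: c_def norm_divide)
  obtain R where R: "1 < R" "cmod c * R < 1"
  proof (cases "c = 0")
    case True then show ?thesis using that[of 2] by simp
  next
    case False
    then have "1 < 1 / cmod c" using c by simp
    then obtain R where "1 < R" "R < 1 / cmod c" using dense by blast
    then show ?thesis using that[of R] False by (simp add: field_simps)
  qed
  have re: "0 < Re (1 + c * z)" if "z \<in> ball 0 R" for z
  proof -
    have "cmod (c * z) \<le> cmod c * R" using that by (simp add: norm_mult mult_left_mono)
    then show ?thesis using R(2) abs_Re_le_cmod[of "c * z"] by simp
  qed
  have "(\<lambda>z. Ln (1 + c * z)) holomorphic_on ball 0 R"
    by (intro holomorphic_intros) (use re in \<open>force simp: complex_nonpos_Reals_iff\<close>)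
  from holomorphic_circle_mean[OF this R(1)]
  have "((\<lambda>t. Ln (1 + c * cis t)) has_integral 0) {0..2*pi}" by simp
  from has_integral_linear[OF this bounded_linear_Re]
  have "((\<lambda>t. Re (Ln (1 + c * cis t))) has_integral 0) {0..2*pi}" by (simp add: o_def)
  from has_integral_add[OF has_integral_mult_right[OF this, of 2] has_integral_const_real[of "ln (p\<^sup>2)" 0 "2 * pi"]]
  have "((\<lambda>t. 2 * Re (Ln (1 + c * cis t)) + ln (p\<^sup>2)) has_integral (2 * pi * ln (p\<^sup>2))) {0..2*pi}" by simp
  then show ?thesis
  proof (rule has_integral_eq[rotated])
    fix t
    have nz: "1 + c * cis t \<noteq> 0" using re[of "cis t"] R(1) by force
    have "of_real p + q * cis t = of_real p * (1 + c * cis t)" using p by (simp add: c_def field_simps)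
    then have "cmod (of_real p + q * cis t) = p * cmod (1 + c * cis t)" using p by (simp only: norm_mult norm_of_real abs_of_pos)
    then have "ln ((cmod (of_real p + q * cis t))\<^sup>2) = ln (p\<^sup>2) + ln ((cmod (1 + c * cis t))\<^sup>2)"
      using p nz by (simp add: power_mult_distrib ln_mult)
    moreover have "ln ((cmod (1 + c * cis t))\<^sup>2) = 2 * ln (cmod (1 + c * cis t))"
      using nz by (subst ln_realpow) auto
    moreover have "Re (Ln (1 + c * cis t)) = ln (cmod (1 + c * cis t))" using nz by (rule Re_Ln)
    ultimately show "2 * Re (Ln (1 + c * cis t)) + ln (p\<^sup>2) = ln ((cmod (of_real p + q * cis t))\<^sup>2)"
      by linarith
  qed
qed

text \<open>The mean is computed exactly. On the circle, \<open>|u + rcis r t|^2 + c\<close> with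
  \<open>u = z - a\<close> equals \<open>|p + q * cis t|^2\<close> for suitable
  \<open>p > |q|\<close>, so the mean of its logarithm is \<open>ln (p\<^sup>2)\<close>, and
  \<open>p\<^sup>2\<close> is at least the value at the centre.\<close>

lemma log_submean:
  assumes c: "0 < c" and r: "0 < r"
  shows "2 * pi * ln ((cmod (z - a))\<^sup>2 + c) \<le> integral {0..2*pi} (\<lambda>t. ln ((cmod (z + rcis r t - a))\<^sup>2 + c))"
proof -
  define u where "u = z - a"
  define X where "X = (cmod u)\<^sup>2 + c"
  define A where "A = X + r\<^sup>2"
  define d where "d = sqrt ((X - r\<^sup>2)\<^sup>2 + 4 * r\<^sup>2 * c)"
  have d2: "d\<^sup>2 = (X - r\<^sup>2)\<^sup>2 + 4 * r\<^sup>2 * c" unfolding d_def using c by (simp add: real_sqrt_pow2)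
  have X: "0 < X" using c by (simp add: X_def add_nonneg_pos)
  have "\<bar>X - r\<^sup>2\<bar> \<le> d" unfolding d_def using c by (intro real_le_rsqrt) simp
  then have dge: "X - r\<^sup>2 \<le> d" "r\<^sup>2 - X \<le> d" by auto
  \<comment> \<open>Comparing coefficients demands \<open>p * q = r * cnj u\<close> and
    \<open>p\<^sup>2 + |q|^2 = A\<close>. Hence \<open>P = p\<^sup>2\<close> solves
    \<open>P\<^sup>2 - A * P + r\<^sup>2 * |u|^2 = 0\<close>; the larger root is taken so that
    \<open>|q| < p\<close>.\<close>
  define P where "P = (A + d) / 2"
  have PX: "X \<le> P" "r\<^sup>2 \<le> P" using dge by (auto simp: P_def A_def)
  have P0: "0 < P" using X PX by simp
  have Peq: "P * P - A * P + r\<^sup>2 * (cmod u)\<^sup>2 = 0"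
  proof -
    have "4 * (P * P - A * P) = d\<^sup>2 - A\<^sup>2" by (simp add: P_def power2_eq_square field_simps)
    also have "\<dots> = - 4 * (r\<^sup>2 * (cmod u)\<^sup>2)" unfolding d2 A_def X_def by (simp add: power2_eq_square algebra_simps)
    finally show ?thesis by simp
  qed
  define p where "p = sqrt P"
  have p: "0 < p" "p\<^sup>2 = P" using P0 by (auto simp: p_def)
  define q where "q = of_real r * cnj u / of_real p"
  have nq: "cmod q = r * cmod u / p" using p r by (simp add: q_def norm_mult norm_divide)
  have "r * cmod u < P"
  proof (cases "r \<le> cmod u")
    case True
    have "r * cmod u \<le> cmod u * cmod u" using True by (intro mult_right_mono) auto
    also have "\<dots> < X" using c by (simp add: X_def power2_eq_square)
    finally show ?thesis using PX by simp
  next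
    case False
    then have "r * cmod u < r * r" using r by simp
    then show ?thesis using PX by (simp add: power2_eq_square)
  qed
  then have "cmod q < p" using p unfolding nq by (simp add: pos_divide_less_eq power2_eq_square)
  from log_circle_mean[OF p(1) this]
  have I: "((\<lambda>t. ln ((cmod (of_real p + q * cis t))\<^sup>2)) has_integral (2 * pi * ln P)) {0..2*pi}" by (simp add: p(2))
  have eq: "(cmod (of_real p + q * cis t))\<^sup>2 = (cmod (z + rcis r t - a))\<^sup>2 + c" for t
  proof -
    have n: "(cmod (x + y))\<^sup>2 = (cmod x)\<^sup>2 + (cmod y)\<^sup>2 + 2 * Re (cnj x * y)" for x y
      unfolding cmod_power2 by (simp add: power2_eq_square algebra_simps)
    have "(cmod (of_real p + q * cis t))\<^sup>2 = p\<^sup>2 + (cmod q)\<^sup>2 + 2 * Re (of_real p * (q * cis t))"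
      unfolding n using p(1) by (simp add: norm_mult)
    also have "of_real p * (q * cis t) = cnj u * rcis r t" using p(1) by (simp add: q_def rcis_def)
    also have "p\<^sup>2 + (cmod q)\<^sup>2 = A"
    proof -
      have "(cmod q)\<^sup>2 = r\<^sup>2 * (cmod u)\<^sup>2 / P" by (simp add: nq power_divide power_mult_distrib p(2))
      also have "\<dots> = A - P" using Peq P0 by (simp add: field_simps)
      finally show ?thesis by (simp add: p(2))
    qed
    also have "A + 2 * Re (cnj u * rcis r t) = (cmod (u + rcis r t))\<^sup>2 + c"
      unfolding n using r by (simp add: A_def X_def)
    finally show ?thesis by (simp add: u_def algebra_simps)
  qed
  have "ln X \<le> ln P" using X PX by simp
  then have "2 * pi * ln X \<le> 2 * pi * ln P" by (intro mult_left_mono) auto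
  also have "\<dots> = integral {0..2*pi} (\<lambda>t. ln ((cmod (z + rcis r t - a))\<^sup>2 + c))"
    using integral_unique[OF I] unfolding eq by simp
  finally show ?thesis by (simp add: X_def u_def)
qed

section \<open>The minimax argument\<close>

text \<open>For negative \<open>x = - y\<close>, the product
  \<open>(1 - y + y\<^sup>2) * (1 + y)\<close> is \<open>1 + y^3\<close>, hence at least 1, and
  \<open>1 + y \<le> exp y\<close>.\<close>

lemma exp_le_quadratic:
  fixes x :: real
  assumes "\<bar>x\<bar> \<le> 1" shows "exp x \<le> 1 + x + x\<^sup>2"
proof (cases "0 \<le> x")
  case True
  then show ?thesis using assms by (intro exp_bound) auto
next
  case False
  define y where "y = - x"
  have y: "0 < y" using False by (simp add: y_def)
  have "1 \<le> (1 - y + y\<^sup>2) * (1 + y)" using y by (simp add: power2_eq_square algebra_simps)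
  also have "\<dots> \<le> (1 - y + y\<^sup>2) * exp y"
  proof (rule mult_left_mono)
    have "0 \<le> (y - 1 / 2)\<^sup>2 + 3 / 4" by simp
    then show "0 \<le> 1 - y + y\<^sup>2" by (simp add: power2_eq_square algebra_simps)
  qed simp
  finally have "exp (- y) \<le> 1 - y + y\<^sup>2" by (simp add: exp_minus pos_le_divide_eq[symmetric] inverse_eq_divide pos_divide_le_eq)
  then show ?thesis by (simp add: y_def)
qed

text \<open>
  Multiplicative weights: the potential
  \<open>\<Sum>z. exp (- \<lambda> \<Sum>i a z (w i))\<close> decays geometrically if each \<open>w i\<close> is a good answer to the normalized weights.
\<close>
lemma minimax_multiplicative_weights:
  fixes a :: "'z \<Rightarrow> 'w \<Rightarrow> real"
  assumes F: "finite F" "F \<noteq> {}" and A: "\<And>z w. z \<in> F \<Longrightarrow> w \<in> K \<Longrightarrow> \<bar>a z w\<bar> \<le> A"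
    and v: "\<And>\<nu>. (\<And>z. z \<in> F \<Longrightarrow> 0 \<le> \<nu> z) \<Longrightarrow> (\<Sum>z\<in>F. \<nu> z) = 1 \<Longrightarrow> \<exists>w\<in>K. v \<le> (\<Sum>z\<in>F. \<nu> z * a z w)"
    and \<eta>: "0 < \<eta>"
  obtains n ws where "0 < n" "\<And>i. i < n \<Longrightarrow> ws i \<in> K" "\<And>z. z \<in> F \<Longrightarrow> real n * (v - \<eta>) \<le> (\<Sum>i<n. a z (ws i))"
proof -
  define A' where "A' = max A 1"
  have A': "1 \<le> A'" "\<And>z w. z \<in> F \<Longrightarrow> w \<in> K \<Longrightarrow> \<bar>a z w\<bar> \<le> A'" using A by (auto simp: A'_def le_max_iff_disj)
  \<comment> \<open>The first bound keeps the exponents within the range of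
    \<open>exp_le_quadratic\<close>; the second makes the quadratic loss per round at most half of
    \<eta>, relative to \<open>l\<close>.\<close>
  define l where "l = min (1 / A') (\<eta> / (2 * A'\<^sup>2))"
  have l: "0 < l" "l * A' \<le> 1" "l * A'\<^sup>2 \<le> \<eta> / 2"
  proof -
    show "0 < l" using A' \<eta> by (simp add: l_def)
    have "l * A' \<le> (1 / A') * A'" using A' by (intro mult_right_mono) (auto simp: l_def)
    then show "l * A' \<le> 1" using A' by simp
    have "l * A'\<^sup>2 \<le> (\<eta> / (2 * A'\<^sup>2)) * A'\<^sup>2" using A' by (intro mult_right_mono) (auto simp: l_def)
    then show "l * A'\<^sup>2 \<le> \<eta> / 2" using A' by simp
  qed
  define \<Phi> where "\<Phi> ws n = (\<Sum>z\<in>F. exp (- l * (\<Sum>i<n. a z (ws i))))" for ws :: "nat \<Rightarrow> 'w" and n :: nat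
  have step: "\<exists>ws. (\<forall>i<n. ws i \<in> K) \<and> \<Phi> ws n \<le> real (card F) * exp (real n * (- l * v + (l * A')\<^sup>2))" for n
  proof (induction n)
    case 0
    show ?case by (simp add: \<Phi>_def)
  next
    case (Suc n)
    then obtain ws where ws: "\<forall>i<n. ws i \<in> K" "\<Phi> ws n \<le> real (card F) * exp (real n * (- l * v + (l * A')\<^sup>2))" by blast
    define e where "e z = exp (- l * (\<Sum>i<n. a z (ws i)))" for z
    have \<Phi>pos: "0 < \<Phi> ws n" unfolding \<Phi>_def using F by (intro sum_pos) auto
    obtain w where w: "w \<in> K" "v \<le> (\<Sum>z\<in>F. e z / \<Phi> ws n * a z w)"
    proof -
      have "(\<Sum>z\<in>F. e z / \<Phi> ws n) = 1" using \<Phi>pos by (simp add: sum_divide_distrib[symmetric] e_def \<Phi>_def)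
      then show ?thesis using v[of "\<lambda>z. e z / \<Phi> ws n"] \<Phi>pos that by (auto simp: e_def)
    qed
    have "(\<Sum>z\<in>F. e z / \<Phi> ws n * a z w) = (\<Sum>z\<in>F. e z * a z w) / \<Phi> ws n" by (simp add: sum_divide_distrib)
    then have wv: "v * \<Phi> ws n \<le> (\<Sum>z\<in>F. e z * a z w)" using w(2) \<Phi>pos by (simp add: pos_le_divide_eq)
    let ?ws = "ws(n := w)"
    have "\<Phi> ?ws (Suc n) = (\<Sum>z\<in>F. e z * exp (- l * a z w))"
      unfolding \<Phi>_def e_def by (intro sum.cong) (auto simp: exp_add[symmetric] algebra_simps)
    also have "\<dots> \<le> (\<Sum>z\<in>F. e z * (1 - l * a z w + (l * A')\<^sup>2))"
    proof (intro sum_mono mult_left_mono)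
      fix z assume z: "z \<in> F"
      have ab: "\<bar>l * a z w\<bar> \<le> l * A'" using A'(2)[OF z w(1)] l(1) by (simp add: abs_mult)
      then have "\<bar>- l * a z w\<bar> \<le> 1" using l(2) by simp
      then have "exp (- l * a z w) \<le> 1 + (- l * a z w) + (- l * a z w)\<^sup>2"
        by (rule exp_le_quadratic)
      moreover have "(- l * a z w)\<^sup>2 \<le> (l * A')\<^sup>2" using ab by (metis abs_minus_cancel mult_minus_left power2_abs power_mono abs_ge_zero)
      ultimately show "exp (- l * a z w) \<le> 1 - l * a z w + (l * A')\<^sup>2" by simp
    qed (simp add: e_def)
    also have "\<dots> = \<Phi> ws n * (1 + (l * A')\<^sup>2) - l * (\<Sum>z\<in>F. e z * a z w)"
    proof -
      have "\<Phi> ws n = (\<Sum>z\<in>F. e z)" by (simp add: \<Phi>_def e_def)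
      then show ?thesis by (simp add: algebra_simps sum.distrib sum_subtractf sum_distrib_left sum_distrib_right)
    qed
    also have "\<dots> \<le> \<Phi> ws n * (1 + (l * A')\<^sup>2) - l * (v * \<Phi> ws n)" using wv l(1) by simp
    also have "\<dots> = \<Phi> ws n * (1 + (- l * v + (l * A')\<^sup>2))" by (simp add: algebra_simps)
    also have "\<dots> \<le> \<Phi> ws n * exp (- l * v + (l * A')\<^sup>2)"
      using \<Phi>pos exp_ge_add_one_self[of "- l * v + (l * A')\<^sup>2"] by (intro mult_left_mono) auto
    also have "\<dots> \<le> real (card F) * exp (real n * (- l * v + (l * A')\<^sup>2)) * exp (- l * v + (l * A')\<^sup>2)"
      using ws(2) by (intro mult_right_mono) auto
    also have "\<dots> = real (card F) * exp (real (Suc n) * (- l * v + (l * A')\<^sup>2))"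
      by (simp add: exp_add[symmetric] algebra_simps)
    finally have "\<Phi> ?ws (Suc n) \<le> real (card F) * exp (real (Suc n) * (- l * v + (l * A')\<^sup>2))" .
    moreover have "\<forall>i<Suc n. ?ws i \<in> K" using ws(1) w(1) by (auto simp: less_Suc_eq)
    ultimately show ?case by blast
  qed
  \<comment> \<open>The other half of \<eta>, accumulated over \<open>n\<close> rounds, outweighs
    the initial potential \<open>card F\<close>.\<close>
  obtain n :: nat where n: "ln (real (card F)) / (l * \<eta> / 2) < real n" using reals_Archimedean2 by blast
  have cF: "1 \<le> real (card F)" using F by (simp add: Suc_le_eq card_gt_0_iff)
  have l\<eta>: "0 < l * \<eta> / 2" using l(1) \<eta> by simp
  have n0: "0 < n"
  proof -
    have "0 \<le> ln (real (card F)) / (l * \<eta> / 2)" using cF l\<eta> by (intro divide_nonneg_pos) auto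
    then show ?thesis using n by (metis gr0I not_less of_nat_0)
  qed
  have nn: "ln (real (card F)) \<le> real n * (l * \<eta> / 2)" using n l\<eta> by (simp add: pos_divide_less_eq)
  obtain ws where ws: "\<forall>i<n. ws i \<in> K" "\<Phi> ws n \<le> real (card F) * exp (real n * (- l * v + (l * A')\<^sup>2))" using step by blast
  show ?thesis
  proof (rule that[OF n0])
    show "ws i \<in> K" if "i < n" for i using ws(1) that by blast
    fix z assume z: "z \<in> F"
    have "exp (- l * (\<Sum>i<n. a z (ws i))) \<le> \<Phi> ws n"
      unfolding \<Phi>_def by (rule member_le_sum[OF z]) (use F in auto)
    also have "\<dots> \<le> exp (ln (real (card F)) + real n * (- l * v + (l * A')\<^sup>2))"
      using ws(2) cF by (simp add: exp_add)
    finally have "- l * (\<Sum>i<n. a z (ws i)) \<le> ln (real (card F)) + real n * (- l * v + (l * A')\<^sup>2)" by simp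
    also have "\<dots> \<le> real n * (l * \<eta> / 2) + real n * (- l * v + l * (\<eta> / 2))"
    proof -
      have "(l * A')\<^sup>2 = l * (l * A'\<^sup>2)" by (simp add: power2_eq_square)
      also have "\<dots> \<le> l * (\<eta> / 2)" using l by (intro mult_left_mono) auto
      finally have "real n * (- l * v + (l * A')\<^sup>2) \<le> real n * (- l * v + l * (\<eta> / 2))"
        by (intro mult_left_mono) auto
      then show ?thesis using nn by linarith
    qed
    also have "\<dots> = - l * (real n * (v - \<eta>))" by (simp add: algebra_simps)
    finally show "real n * (v - \<eta>) \<le> (\<Sum>i<n. a z (ws i))" using l(1) by simp
  qed
qed

text \<open>The hypothesis \<open>good\<close> is one side of a game with payoff
  \<open>ln |z - w|\<close>: every finite distribution of \<open>z\<close> has an answer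
  \<open>w\<close>. Multiplicative weights on a finite net of \<open>L\<close> interchange the
  quantifiers and give one average of answers that is good on the whole net. The constant depends on
  \<open>r\<close> and \<open>M\<close> only, not on \<open>L\<close>.\<close>

lemma potential_lower_bound:
  assumes K1: "compact K1" "K1 \<subseteq> cball 0 r" "K1 \<noteq> {}" and r: "0 \<le> r" and M: "0 \<le> M"
    and good: "\<And>F \<nu>. finite F \<Longrightarrow> F \<subseteq> ball 0 (2 * r + 2) - K1 \<Longrightarrow> (\<And>z. z \<in> F \<Longrightarrow> 0 \<le> \<nu> z) \<Longrightarrow> (\<Sum>z\<in>F. \<nu> z) = 1 \<Longrightarrow>
       \<exists>w\<in>K1. - M \<le> (\<Sum>z\<in>F. \<nu> z * ln (cmod (z - w)))"
    and L: "compact L" "L \<inter> K1 = {}"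
  obtains n ws where "0 < (n::nat)" "\<And>i. i < n \<Longrightarrow> ws i \<in> K1"
    "\<And>z. z \<in> L \<Longrightarrow> real n * (ln (1 + cmod z) - (M + 2 + ln (2 * r + 2) + ln 4)) \<le> (\<Sum>i<n. ln (cmod (z - ws i)))"
proof -
  \<comment> \<open>Outside this disc every single logarithm already satisfies the bound, since
    there \<open>1 + |z| \<le> 4 * |z - w|\<close>; this is the source of
    \<open>ln 4\<close>.\<close>
  define L' where "L' = L \<inter> cball 0 (2 * r + 1)"
  have L': "compact L'" "L' \<inter> K1 = {}" using L by (auto simp: L'_def compact_Int_closed)
  have l2: "ln (2::real) \<le> 1" using ln_le_minus_one[of "2::real"] by simp
  have far: "ln (1 + cmod z) - (M + 2 + ln (2 * r + 2) + ln 4) \<le> ln (cmod (z - w))" if z: "z \<in> L" "z \<notin> L'" and w: "w \<in> K1" for z w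
  proof -
    have zr: "2 * r + 1 < cmod z" using z by (auto simp: L'_def)
    have "cmod w \<le> r" using w K1(2) by auto
    then have "1 + cmod z \<le> 4 * cmod (z - w)" using zr r norm_triangle_ineq2[of z w] by simp
    then have le: "(1 + cmod z) / 4 \<le> cmod (z - w)" by simp
    have pos1: "0 < 1 + cmod z" using norm_ge_zero[of z] by linarith
    then have pos: "0 < (1 + cmod z) / 4" by simp
    have "ln ((1 + cmod z) / 4) \<le> ln (cmod (z - w))"
      using le pos by (rule ln_mono)
    moreover have "ln ((1 + cmod z) / 4) = ln (1 + cmod z) - ln 4" by (rule ln_divide_pos[OF pos1]) simp
    moreover have "0 \<le> ln (2 * r + 2)" using r by simp
    ultimately show ?thesis using M by linarith
  qed
  show ?thesis
  proof (cases "L' = {}")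
    case True
    obtain w where w: "w \<in> K1" using K1(3) by blast
    show ?thesis
      by (rule that[of 1 "\<lambda>_. w"]) (use far[OF _ _ w] w True in auto)
  next
    case False
    obtain d where d: "0 < d" "\<And>x y. x \<in> L' \<Longrightarrow> y \<in> K1 \<Longrightarrow> d \<le> dist x y"
      using separate_compact_closed[OF L'(1) compact_imp_closed[OF K1(1)] L'(2)] by blast
    \<comment> \<open>Mesh \<open>d / 2\<close>, with \<open>d\<close> at most the distance of any
      point of \<open>L'\<close> to any point of \<open>K1\<close>: passing from a net point to a
      nearby \<open>z\<close> at most halves \<open>|z - w|\<close>, which costs
      \<open>ln 2\<close>.\<close>
    obtain F where F: "finite F" "F \<subseteq> L'" "L' \<subseteq> (\<Union>x\<in>F. ball x (d / 2))"
    proof -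
      have "L' \<subseteq> (\<Union>x\<in>L'. ball x (d / 2))" using d(1) by auto
      then obtain F where "F \<subseteq> L'" "finite F" "L' \<subseteq> (\<Union>x\<in>F. ball x (d / 2))"
        using compactE_image[OF L'(1), of L' "\<lambda>x. ball x (d / 2)"] by blast
      then show ?thesis using that by blast
    qed
    have Fne: "F \<noteq> {}" using False F(3) by auto
    define A where "A = \<bar>ln d\<bar> + \<bar>ln (3 * r + 1)\<bar>"
    have A: "\<bar>ln (cmod (z - w))\<bar> \<le> A" if z: "z \<in> F" and w: "w \<in> K1" for z w
    proof -
      have "d \<le> cmod (z - w)" using d(2)[of z w] z w F(2) by (auto simp: dist_norm)
      moreover have "cmod (z - w) \<le> 3 * r + 1"
      proof -
        have "cmod z \<le> 2 * r + 1" "cmod w \<le> r" using z w F(2) K1(2) by (auto simp: L'_def)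
        then show ?thesis using norm_triangle_ineq4[of z w] by linarith
      qed
      ultimately have "ln d \<le> ln (cmod (z - w)) \<and> ln (cmod (z - w)) \<le> ln (3 * r + 1)"
        using d(1) by (intro conjI ln_mono) linarith+
      then show ?thesis unfolding A_def by linarith
    qed
    obtain n ws where n: "0 < n" "\<And>i. i < n \<Longrightarrow> ws i \<in> K1"
      "\<And>z. z \<in> F \<Longrightarrow> real n * (- M - 1) \<le> (\<Sum>i<n. ln (cmod (z - ws i)))"
    proof (rule minimax_multiplicative_weights[OF F(1) Fne, of K1 "\<lambda>z w. ln (cmod (z - w))" A "- M" 1])
      show "\<exists>w\<in>K1. - M \<le> (\<Sum>z\<in>F. \<nu> z * ln (cmod (z - w)))" if "\<And>z. z \<in> F \<Longrightarrow> 0 \<le> \<nu> z" "sum \<nu> F = 1" for \<nu>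
      proof (rule good[OF F(1) _ that])
        show "F \<subseteq> ball 0 (2 * r + 2) - K1" using F(2) L'(2) by (auto simp: L'_def)
      qed
    qed (use A in auto)
    show ?thesis
    proof (rule that[OF n(1,2)])
      fix z assume z: "z \<in> L"
      show "real n * (ln (1 + cmod z) - (M + 2 + ln (2 * r + 2) + ln 4)) \<le> (\<Sum>i<n. ln (cmod (z - ws i)))"
      proof (cases "z \<in> L'")
        case False
        have "(\<Sum>i<n. ln (1 + cmod z) - (M + 2 + ln (2 * r + 2) + ln 4)) \<le> (\<Sum>i<n. ln (cmod (z - ws i)))"
          by (intro sum_mono far[OF z False] n(2)) simp
        then show ?thesis by simp
      next
        case True
        then obtain x where x: "x \<in> F" "dist x z < d / 2" using F(3) by auto
        have "ln (cmod (x - ws i)) - ln 2 \<le> ln (cmod (z - ws i))" if i: "i < n" for i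
        proof -
          have dx: "d \<le> cmod (x - ws i)" using d(2)[of x "ws i"] x(1) F(2) n(2)[OF i] by (auto simp: dist_norm)
          have "cmod (x - ws i) \<le> cmod (x - z) + cmod (z - ws i)" using norm_triangle_ineq[of "x - z" "z - ws i"] by simp
          then have "cmod (x - ws i) / 2 \<le> cmod (z - ws i)" using x(2) dx by (simp add: dist_norm)
          then have "ln (cmod (x - ws i) / 2) \<le> ln (cmod (z - ws i))" using dx d(1) by (intro ln_mono) auto
          moreover have "ln (cmod (x - ws i) / 2) = ln (cmod (x - ws i)) - ln 2"
            using dx d(1) by (intro ln_divide_pos) auto
          ultimately show ?thesis by simp
        qed
        then have "(\<Sum>i<n. ln (cmod (x - ws i)) - ln 2) \<le> (\<Sum>i<n. ln (cmod (z - ws i)))" by (intro sum_mono) auto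
        then have "real n * (- M - 1) - real n * ln 2 \<le> (\<Sum>i<n. ln (cmod (z - ws i)))"
          using n(3)[OF x(1)] by (simp add: sum_subtractf)
        \<comment> \<open>\<open>M + 2\<close> covers the game value, the slack 1 and
          \<open>ln 2\<close>; on \<open>L'\<close> the term \<open>ln (1 + |z|)\<close> is at most
          \<open>ln (2 * r + 2)\<close>.\<close>
        moreover have "real n * (ln (1 + cmod z) - (M + 2 + ln (2 * r + 2) + ln 4)) \<le> real n * (- M - 1 - ln 2)"
        proof (intro mult_left_mono)
          have "1 + cmod z \<le> 2 * r + 2" using True by (auto simp: L'_def)
          moreover have "0 < 1 + cmod z" using norm_ge_zero[of z] by linarith
          ultimately have "ln (1 + cmod z) \<le> ln (2 * r + 2)" by (intro ln_mono)
          moreover have "0 \<le> ln (4::real)" by simp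
          ultimately show "ln (1 + cmod z) - (M + 2 + ln (2 * r + 2) + ln 4) \<le> - M - 1 - ln 2" using l2 by linarith
        qed simp
        ultimately show ?thesis by (simp add: algebra_simps)
      qed
    qed
  qed
qed

section \<open>Polar sets from series of potentials\<close>

lemma polar_subset: "polar K \<Longrightarrow> J \<subseteq> K \<Longrightarrow> polar J"
  unfolding polar_def by (meson order_trans)

lemma continuous_rcis_circle: "continuous_on S (\<lambda>t. z + rcis r t)"
  unfolding rcis_def cis.ctr Complex_eq by (intro continuous_intros)

lemma circle_integrable:
  fixes f :: "complex \<Rightarrow> real"
  assumes "continuous_on UNIV f"
  shows "(\<lambda>t. f (z + rcis r t)) integrable_on {0..2*pi}"
  by (intro integrable_continuous_interval continuous_on_compose2[OF assms continuous_rcis_circle]) auto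

lemma nn_integral_circle:
  fixes f :: "complex \<Rightarrow> real"
  assumes f: "continuous_on UNIV f" "\<And>w. 0 \<le> f w"
  shows "(\<integral>\<^sup>+t\<in>{0..2*pi}. ennreal (f (z + rcis r t)) \<partial>lborel) = ennreal (integral {0..2*pi} (\<lambda>t. f (z + rcis r t)))"
proof -
  define g where "g t = f (z + rcis r t)" for t
  have cg: "continuous_on {0..2*pi} g" unfolding g_def
    by (intro continuous_on_compose2[OF f(1) continuous_rcis_circle]) auto
  have i: "integrable lborel (\<lambda>t. indicator {0..2*pi} t *\<^sub>R g t)"
    by (rule borel_integrable_compact[OF compact_Icc cg])
  have "(\<integral>\<^sup>+t\<in>{0..2*pi}. ennreal (g t) \<partial>lborel) = (\<integral>\<^sup>+t. ennreal (indicator {0..2*pi} t *\<^sub>R g t) \<partial>lborel)"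
    by (intro nn_integral_cong) (auto simp: indicator_def)
  also have "\<dots> = ennreal (\<integral>t. indicator {0..2*pi} t *\<^sub>R g t \<partial>lborel)"
    by (rule nn_integral_eq_integral[OF i]) (auto simp: g_def f)
  also have "(\<integral>t. indicator {0..2*pi} t *\<^sub>R g t \<partial>lborel) = integral {0..2*pi} g"
    using set_borel_integral_eq_integral(2)[of "{0..2*pi}" g] i by (simp add: set_integrable_def set_lebesgue_integral_def)
  finally show ?thesis unfolding g_def .
qed

text \<open>
  The function \<open>s\<close> below is the sum of the \<open>v n\<close>; subtracting from the majorant \<open>ln (1 + |z|)\<close> a series of
  nonnegative terms makes the sum meaningful everywhere.
\<close>
lemma polar_series:
  fixes v :: "nat \<Rightarrow> complex \<Rightarrow> real"
  assumes cont: "\<And>n. continuous_on UNIV (v n)"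
    and mean: "\<And>n z r. 0 < r \<Longrightarrow> 2 * pi * v n z \<le> integral {0..2*pi} (\<lambda>t. v n (z + rcis r t))"
    and upper: "\<And>n z. v n z \<le> (1/2)^Suc n * ln (1 + cmod z)"
    and L1: "\<And>n. (\<integral>\<^sup>+z\<in>ball 0 1. ennreal ((1/2)^Suc n * ln (1 + cmod z) - v n z) \<partial>lborel) \<le> ennreal (C * (1/2)^Suc n)"
    and K: "K \<noteq> {}" "\<And>z. z \<in> K \<Longrightarrow> \<exists>m. \<forall>n\<ge>m. v n z \<le> - 1"
  shows "polar K"
proof -
  define L where "L z = ln (1 + cmod z)" for z :: complex
  have L0: "0 \<le> L z" for z by (simp add: L_def)
  have cL: "continuous_on UNIV L" unfolding L_def
    by (intro continuous_intros) (metis add_pos_nonneg norm_ge_zero less_numeral_extra(1) less_irrefl)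
  define T where "T n z = (1/2)^Suc n * L z - v n z" for n z
  have T0: "0 \<le> T n z" for n z using upper[of n z] by (simp add: T_def L_def)
  have cT: "continuous_on UNIV (T n)" for n unfolding T_def by (intro continuous_intros cL cont)
  have mT [measurable]: "T n \<in> borel_measurable borel" for n by (rule borel_measurable_continuous_onI[OF cT])
  define S where "S z = (\<Sum>n. ennreal (T n z))" for z
  have mS [measurable]: "S \<in> borel_measurable borel" unfolding S_def by measurable
  define s where "s z = ereal (L z) - enn2ereal (S z)" for z
  have sinf: "s z = - \<infinity> \<longleftrightarrow> S z = \<infinity>" for z unfolding s_def by (cases "S z") auto
  have notop: "s z \<noteq> \<infinity>" for z unfolding s_def by (cases "S z") auto
  have Ssum: "S z = ennreal (\<Sum>n. T n z)" "summable (\<lambda>n. T n z)" if "S z \<noteq> \<infinity>" for z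
  proof -
    show sm: "summable (\<lambda>n. T n z)"
      by (rule summable_suminf_not_top) (use that T0 in \<open>auto simp: S_def\<close>)
    show "S z = ennreal (\<Sum>n. T n z)" unfolding S_def
      by (rule suminf_ennreal2) (use T0 sm in auto)
  qed
  have usc: "upper_semicontinuous_on UNIV s"
  proof -
    have "open {z. s z < c}" for c
    proof (cases c)
      case (real x)
      \<comment> \<open>As the terms are nonnegative, the strict inequality is already witnessed by
        a partial sum, and partial sums are continuous.\<close>
      have "{z. s z < c} = (\<Union>N. {z. L z - x < (\<Sum>n<N. T n z)})"
      proof (intro set_eqI iffI)
        fix z assume "z \<in> (\<Union>N. {z. L z - x < (\<Sum>n<N. T n z)})"
        then obtain N where N: "L z - x < (\<Sum>n<N. T n z)" by auto
        show "z \<in> {z. s z < c}"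
        proof (cases "S z = \<infinity>")
          case True then show ?thesis using sinf[of z] real by simp
        next
          case False
          have "(\<Sum>n<N. T n z) \<le> (\<Sum>n. T n z)" by (rule sum_le_suminf[OF Ssum(2)[OF False]]) (auto simp: T0)
          then show ?thesis using N Ssum(1)[OF False] suminf_nonneg[OF Ssum(2)[OF False]] T0
            by (simp add: s_def real)
        qed
      next
        fix z assume z: "z \<in> {z. s z < c}"
        have "\<exists>N. L z - x < (\<Sum>n<N. T n z)"
        proof (rule ccontr)
          assume "\<nexists>N. L z - x < (\<Sum>n<N. T n z)"
          then have le: "(\<Sum>n<N. T n z) \<le> L z - x" for N by (simp add: not_less)
          have "S z \<le> ennreal (L z - x)" unfolding S_def
          proof (rule suminf_le_const)
            fix N show "(\<Sum>n<N. ennreal (T n z)) \<le> ennreal (L z - x)"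
              using le[of N] T0 by (simp add: sum_ennreal ennreal_leI)
          qed (rule summableI)
          moreover have Lx: "0 \<le> L z - x" using le[of 0] by simp
          ultimately have fin: "S z \<noteq> \<infinity>" by (auto simp: top_unique)
          then have "ereal x \<le> s z"
            using \<open>S z \<le> ennreal (L z - x)\<close> Ssum(1)[OF fin] suminf_nonneg[OF Ssum(2)[OF fin]] T0 Lx
            by (simp add: s_def ennreal_le_iff)
          then show False using z real by auto
        qed
        then show "z \<in> (\<Union>N. {z. L z - x < (\<Sum>n<N. T n z)})" by auto
      qed
      moreover have "open {z. L z - x < (\<Sum>n<N. T n z)}" for N
        by (intro open_Collect_less continuous_intros cL cT)
      ultimately show ?thesis by auto
    next
      case PInf
      then have "{z. s z < c} = UNIV" using notop by auto
      then show ?thesis by simp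
    qed simp
    then show ?thesis by (simp add: upper_semicontinuous_on_def)
  qed
  have ms: "s \<in> borel_measurable borel" by (rule usc_borel_measurable[OF usc])
  have sub: "s z \<le> circle_mean s z r" if r: "0 < r" for z r
  proof -
    define C where "C = ln (1 + cmod z + r)"
    have LC: "L w \<le> C" if "cmod w \<le> cmod z + r" for w
      unfolding L_def C_def using that by (intro ln_mono) (auto intro: add_pos_nonneg)
    have C0: "0 \<le> C" unfolding C_def using r norm_ge_zero[of z] by (intro ln_ge_zero) linarith
    have LC1: "L (z + rcis r t) \<le> C" for t
      by (rule LC, rule order_trans[OF norm_triangle_ineq]) (use r in \<open>simp add: norm_mult rcis_def\<close>)
    have LC2: "L z \<le> C" using LC[of z] r by simp
    have sC: "s w \<le> ereal C" if "L w \<le> C" for w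
    proof (cases "S w")
      case (real x) then show ?thesis using that by (simp add: s_def)
    next
      case top then show ?thesis using sinf[of w] by simp
    qed
    have ns: "neg_shift C s w = ennreal (C - L w) + S w" if "L w \<le> C" for w
    proof (cases "S w")
      case (real x)
      then have "neg_shift C s w = ennreal ((C - L w) + x)" by (simp add: neg_shift_def s_def algebra_simps)
      also have "\<dots> = ennreal (C - L w) + ennreal x" using that real by (intro ennreal_plus) auto
      finally show ?thesis using real by simp
    next
      case top then show ?thesis using sinf[of w] by (simp add: neg_shift_def)
    qed
    define IL where "IL = integral {0..2*pi} (\<lambda>t. L (z + rcis r t))"
    define \<tau> where "\<tau> n = integral {0..2*pi} (\<lambda>t. T n (z + rcis r t))" for n
    have mr [measurable]: "(\<lambda>t. z + rcis r t) \<in> borel_measurable borel"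
      by (rule borel_measurable_continuous_onI[OF continuous_rcis_circle])
    have mCL: "(\<lambda>t. ennreal (C - L (z + rcis r t)) * indicator {0..2*pi} t) \<in> borel_measurable lborel"
      using borel_measurable_continuous_onI[OF cL] by measurable
    have mST: "(\<lambda>t. S (z + rcis r t) * indicator {0..2*pi} t) \<in> borel_measurable lborel" by measurable
    have "(\<integral>\<^sup>+t\<in>{0..2*pi}. neg_shift C s (z + rcis r t) \<partial>lborel)
       = (\<integral>\<^sup>+t. ennreal (C - L (z + rcis r t)) * indicator {0..2*pi} t + S (z + rcis r t) * indicator {0..2*pi} t \<partial>lborel)"
      by (intro nn_integral_cong) (simp add: ns[OF LC1] distrib_right)
    also have "\<dots> = (\<integral>\<^sup>+t\<in>{0..2*pi}. ennreal (C - L (z + rcis r t)) \<partial>lborel) + (\<integral>\<^sup>+t\<in>{0..2*pi}. S (z + rcis r t) \<partial>lborel)"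
      by (rule nn_integral_add[OF mCL mST])
    also have "(\<integral>\<^sup>+t\<in>{0..2*pi}. ennreal (C - L (z + rcis r t)) \<partial>lborel) = ennreal (2 * pi * C - IL)"
    proof -
      have "(\<integral>\<^sup>+t\<in>{0..2*pi}. ennreal (C - L (z + rcis r t)) \<partial>lborel) = (\<integral>\<^sup>+t\<in>{0..2*pi}. ennreal (max 0 (C - L (z + rcis r t))) \<partial>lborel)"
        using LC1 by (intro nn_integral_cong) (simp add: max_def)
      also have "\<dots> = ennreal (integral {0..2*pi} (\<lambda>t. max 0 (C - L (z + rcis r t))))"
        by (rule nn_integral_circle[of "\<lambda>w. max 0 (C - L w)"]) (auto intro!: continuous_intros cL)
      also have "(\<lambda>t. max 0 (C - L (z + rcis r t))) = (\<lambda>t. C - L (z + rcis r t))" using LC1 by (auto simp: max_def fun_eq_iff)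
      also have "integral {0..2*pi} (\<lambda>t. C - L (z + rcis r t)) = 2 * pi * C - IL"
        unfolding IL_def by (subst Henstock_Kurzweil_Integration.integral_diff) (auto intro!: circle_integrable cL)
      finally show ?thesis .
    qed
    also have "(\<integral>\<^sup>+t\<in>{0..2*pi}. S (z + rcis r t) \<partial>lborel) = (\<Sum>n. ennreal (\<tau> n))"
    proof -
      have "(\<integral>\<^sup>+t\<in>{0..2*pi}. S (z + rcis r t) \<partial>lborel) = (\<integral>\<^sup>+t. (\<Sum>n. ennreal (T n (z + rcis r t)) * indicator {0..2*pi} t) \<partial>lborel)"
        unfolding S_def by (intro nn_integral_cong) (simp add: ennreal_suminf_multc)
      also have "\<dots> = (\<Sum>n. \<integral>\<^sup>+t. ennreal (T n (z + rcis r t)) * indicator {0..2*pi} t \<partial>lborel)"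
        by (rule nn_integral_suminf) measurable
      also have "\<dots> = (\<Sum>n. ennreal (\<tau> n))" unfolding \<tau>_def by (simp add: nn_integral_circle[OF cT T0])
      finally show ?thesis .
    qed
    also have "ennreal (2 * pi * C - IL) + (\<Sum>n. ennreal (\<tau> n)) \<le> ennreal (2 * pi) * neg_shift C s z"
    proof (cases "S z = \<infinity>")
      case True
      then show ?thesis unfolding ns[OF LC2] by (simp add: ennreal_mult_top)
    next
      case False
      note sm = Ssum(2)[OF False]
      define X where "X = (\<Sum>n. T n z)"
      have X0: "0 \<le> X" unfolding X_def by (rule suminf_nonneg[OF sm T0])
      \<comment> \<open>The mean inequality for \<open>v n\<close> bounds the circle integral of
        \<open>T n\<close> by this term. The geometric weights sum to 1, so the circle integrals of
        \<open>L\<close> cancel in the total and the inequality for \<open>s\<close>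
        remains.\<close>
      define \<sigma> where "\<sigma> n = (1/2)^Suc n * (IL - 2 * pi * L z) + 2 * pi * T n z" for n
      have \<tau>0: "0 \<le> \<tau> n" for n unfolding \<tau>_def
        by (rule Henstock_Kurzweil_Integration.integral_nonneg) (auto intro!: circle_integrable cT T0)
      have \<tau>\<sigma>: "\<tau> n \<le> \<sigma> n" for n
      proof -
        have "\<tau> n = (1/2)^Suc n * IL - integral {0..2*pi} (\<lambda>t. v n (z + rcis r t))"
          unfolding \<tau>_def T_def IL_def
          by (subst Henstock_Kurzweil_Integration.integral_diff)
             (auto intro!: circle_integrable[of "\<lambda>w. (1/2)^Suc n * L w"] circle_integrable cont continuous_intros cL simp del: power_Suc)
        also have "\<dots> \<le> (1/2)^Suc n * IL - 2 * pi * v n z" using mean[OF r, of n z] by simp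
        also have "\<dots> = \<sigma> n" by (simp add: \<sigma>_def T_def algebra_simps del: power_Suc)
        finally show ?thesis .
      qed
      have \<sigma>0: "0 \<le> \<sigma> n" for n by (rule order_trans[OF \<tau>0 \<tau>\<sigma>])
      have geo: "(\<lambda>n. (1/2::real)^Suc n) sums 1" using power_half_series .
      have \<sigma>s: "\<sigma> sums (1 * (IL - 2 * pi * L z) + 2 * pi * X)"
        unfolding \<sigma>_def X_def by (intro sums_add sums_mult sums_mult2 geo summable_sums sm)
      have "(\<Sum>n. ennreal (\<tau> n)) \<le> (\<Sum>n. ennreal (\<sigma> n))"
        by (intro suminf_le ennreal_leI \<tau>\<sigma> summableI)
      also have "\<dots> = ennreal (IL - 2 * pi * L z + 2 * pi * X)"
        using \<sigma>s by (intro suminf_ennreal_eq \<sigma>0) simp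
      finally have "ennreal (2 * pi * C - IL) + (\<Sum>n. ennreal (\<tau> n)) \<le> ennreal (2 * pi * C - IL) + ennreal (IL - 2 * pi * L z + 2 * pi * X)"
        by (rule add_left_mono)
      also have "\<dots> = ennreal (2 * pi * ((C - L z) + X))"
      proof -
        have "IL \<le> integral {0..2*pi} (\<lambda>t. C)" unfolding IL_def
          by (intro Henstock_Kurzweil_Integration.integral_le circle_integrable cL) (auto simp: LC1)
        moreover have "0 \<le> IL - 2 * pi * L z + 2 * pi * X"
          using suminf_nonneg[OF sums_summable[OF \<sigma>s] \<sigma>0] sums_unique[OF \<sigma>s] by simp
        ultimately show ?thesis by (subst ennreal_plus[symmetric]) (auto simp: algebra_simps)
      qed
      also have "\<dots> = ennreal (2 * pi) * (ennreal (C - L z) + ennreal X)"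
        using LC2 X0 by (simp add: ennreal_mult ennreal_plus)
      finally show ?thesis unfolding ns[OF LC2] Ssum(1)[OF False] X_def[symmetric] .
    qed
    finally show ?thesis
      by (intro submean_iff_neg_shift[OF ms C0, THEN iffD2] sC LC1 LC2)
  qed
  \<comment> \<open>By \<open>L1\<close> the sum \<open>S\<close> is integrable over the unit disc,
    so it is finite somewhere; thus \<open>s\<close> is not identically
    \<open>- \<infinity>\<close>.\<close>
  obtain z1 where z1: "S z1 \<noteq> \<infinity>"
  proof (rule ccontr)
    assume "\<not> thesis"
    then have all: "S z = \<infinity>" for z using that by blast
    have "(\<integral>\<^sup>+z\<in>ball 0 1. S z \<partial>lborel) = (\<integral>\<^sup>+z. (\<Sum>n. ennreal (T n z) * indicator (ball 0 1) z) \<partial>lborel)"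
      unfolding S_def by (intro nn_integral_cong) (simp add: ennreal_suminf_multc)
    also have "\<dots> = (\<Sum>n. \<integral>\<^sup>+z. ennreal (T n z) * indicator (ball 0 1) z \<partial>lborel)"
      by (rule nn_integral_suminf) (intro borel_measurable_times_ennreal borel_measurable_indicator, auto)
    also have "\<dots> \<le> (\<Sum>n. ennreal (max C 0 * (1/2)^Suc n))"
    proof (intro suminf_le summableI)
      fix n
      have "C * (1/2)^Suc n \<le> max C 0 * (1/2)^Suc n" by (intro mult_right_mono) auto
      then show "(\<integral>\<^sup>+z. ennreal (T n z) * indicator (ball 0 1) z \<partial>lborel) \<le> ennreal (max C 0 * (1/2)^Suc n)"
        using L1[of n] unfolding T_def L_def by (meson ennreal_leI order_trans)
    qed
    also have "\<dots> = ennreal (max C 0 * 1)"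
      by (intro suminf_ennreal_eq sums_mult power_half_series) auto
    finally have "(\<integral>\<^sup>+z\<in>ball 0 1. S z \<partial>lborel) < \<infinity>" by (auto intro: le_less_trans)
    moreover have "(\<integral>\<^sup>+z\<in>ball 0 1. S z \<partial>lborel) = \<infinity>"
    proof -
      have "(\<integral>\<^sup>+z. \<infinity> * indicator (ball (0::complex) 1) z \<partial>lborel) = \<infinity> * emeasure lborel (ball (0::complex) 1)"
        by (rule nn_integral_cmult_indicator) simp
      also have "\<dots> = \<infinity>" by (simp add: emeasure_ball_complex ennreal_top_mult)
      finally show ?thesis unfolding all .
    qed
    ultimately show False by simp
  qed
  have Kinf: "s z = - \<infinity>" if z: "z \<in> K" for z
  proof (rule ccontr)
    assume "s z \<noteq> - \<infinity>"
    then have fin: "S z \<noteq> \<infinity>" using sinf by simp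
    \<comment> \<open>On \<open>K\<close> a convergent series would have terms tending to 0, whereas
      \<open>v n z \<le> - 1\<close> forces \<open>T n z \<ge> 1\<close> for large
      \<open>n\<close>.\<close>
    have lim: "(\<lambda>n. T n z) \<longlonglongrightarrow> 0" by (rule summable_LIMSEQ_zero[OF Ssum(2)[OF fin]])
    obtain m where m: "\<And>n. m \<le> n \<Longrightarrow> v n z \<le> - 1" using K(2)[OF z] by blast
    have "1 \<le> T n z" if "m \<le> n" for n
    proof -
      have "0 \<le> (1/2)^Suc n * L z" by (intro mult_nonneg_nonneg L0) simp
      then show ?thesis using m[OF that] unfolding T_def by linarith
    qed
    then have "1 \<le> (0::real)" by (intro LIMSEQ_le_const[OF lim]) blast
    then show False by simp
  qed
  have "subharmonic_on UNIV s"
    unfolding subharmonic_on_def using usc notop sub z1 sinf by auto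
  moreover have "\<not> s constant_on UNIV"
  proof
    assume "s constant_on UNIV"
    then obtain c where c: "\<And>z. s z = c" unfolding constant_on_def by blast
    obtain k where "k \<in> K" using K(1) by blast
    then have "s z1 = - \<infinity>" using Kinf[of k] c by metis
    then show False using z1 sinf by blast
  qed
  ultimately show ?thesis unfolding polar_def using Kinf by blast
qed

text \<open>Failure of the game on every bounded part of \<open>K\<close>: finite probability
  measures \<nu> off that part have logarithmic potentials as negative on it as desired. The radius
  \<open>2 * n + 2\<close> keeps the measures bounded for each \<open>n\<close> and fits
  \<open>potential_lower_bound\<close>.\<close>

definition null_potentials :: "complex set \<Rightarrow> bool" where
  "null_potentials K \<longleftrightarrow> (\<forall>n::nat. \<forall>M. \<exists>F \<nu>. finite F \<and> F \<subseteq> ball 0 (2 * real n + 2) - K \<inter> cball 0 (real n) \<and>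
     (\<forall>z\<in>F. 0 \<le> \<nu> z) \<and> (\<Sum>z\<in>F. \<nu> z) = 1 \<and> (\<forall>w\<in>K \<inter> cball 0 (real n). (\<Sum>z\<in>F. \<nu> z * ln (cmod (z - w))) < - M))"

text \<open>\<open>1 / |a - z|\<close> majorizes \<open>- ln |a - z|\<close>; a bound uniform in
  \<open>a\<close> is what the normalization of potentials needs. The part within distance 1 of
  \<open>a\<close> contributes \<open>4 * pi\<close>, the rest at most the area
  \<open>pi\<close>.\<close>

lemma nn_integral_log_unit_ball:
  "(\<integral>\<^sup>+z\<in>ball 0 1. ennreal (1 / cmod (a - z)) \<partial>lborel) \<le> ennreal (5 * pi)"
proof -
  have "(\<integral>\<^sup>+z\<in>ball 0 1. ennreal (1 / cmod (a - z)) \<partial>lborel)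
     \<le> (\<integral>\<^sup>+z. ennreal (1 / cmod (a - z)) * indicator (ball a 1) z + indicator (ball 0 1) z \<partial>lborel)"
  proof (rule nn_integral_mono)
    fix z :: complex
    have "1 / cmod (a - z) \<le> 1" if "1 \<le> cmod (a - z)" using that by (simp add: divide_simps)
    then show "ennreal (1 / cmod (a - z)) * indicator (ball 0 1) z \<le> ennreal (1 / cmod (a - z)) * indicator (ball a 1) z + indicator (ball 0 1) z"
      by (cases "z \<in> ball a 1") (auto simp: indicator_def dist_norm)
  qed
  also have "\<dots> = (\<integral>\<^sup>+z. ennreal (1 / cmod (a - z)) * indicator (ball a 1) z \<partial>lborel) + ennreal (pi * 1\<^sup>2)"
    by (subst nn_integral_add) (auto simp: emeasure_ball_complex intro!: borel_measurable_times_ennreal borel_measurable_indicator)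
  also have "\<dots> \<le> ennreal (4 * pi * 1) + ennreal (pi * 1\<^sup>2)"
    by (intro add_right_mono nn_integral_inverse_cmod) simp
  also have "\<dots> = ennreal (5 * pi)" by (subst ennreal_plus[symmetric]) auto
  finally show ?thesis .
qed

text \<open>The potentials, regularized to be continuous, shifted by \<open>l n\<close> and scaled
  by \<open>c n\<close>, satisfy the hypotheses of \<open>polar_series\<close>. The scaling factors
  are fixed before the measures are chosen, so the potentials can be taken negative enough to
  survive it.\<close>

lemma null_potentials_imp_polar:
  assumes K: "closed K" "K \<noteq> {}" and null: "null_potentials K"
  shows "polar K"
proof -
  define R where "R n = 2 * real n + 2" for n
  define l where "l n = ln (R n + 1)" for n
  have l0: "0 \<le> l n" for n by (simp add: l_def R_def)
  \<comment> \<open>The numerator makes the series summable; the denominator makes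
    \<open>c n * l n\<close> summable too, as the bound on the unit disc requires.\<close>
  define c where "c n = (1/2)^Suc n / (1 + l n)" for n
  have c: "0 < c n" "c n \<le> (1/2)^Suc n" "c n * l n \<le> (1/2)^Suc n" for n
  proof -
    show "0 < c n" using l0[of n] by (simp add: c_def add_pos_nonneg)
    have "1 + l n > 0" using l0[of n] by simp
    then show "c n \<le> (1/2)^Suc n" "c n * l n \<le> (1/2)^Suc n"
      using l0[of n] unfolding c_def by (auto simp: pos_divide_le_eq algebra_simps simp del: power_Suc)
  qed
  \<comment> \<open>After multiplication by \<open>c n\<close> the term \<open>1 / c n\<close>
    becomes the required -1; the additional 1 pays for the regularization.\<close>
  define good where "good n F \<nu> \<longleftrightarrow> finite F \<and> F \<subseteq> ball 0 (R n) - K \<inter> cball 0 (real n) \<and> (\<forall>z\<in>F. 0 \<le> \<nu> z) \<and> (\<Sum>z\<in>F. \<nu> z) = 1 \<and>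
     (\<forall>w\<in>K \<inter> cball 0 (real n). (\<Sum>z\<in>F. \<nu> z * ln (cmod (z - w))) < - (1 / c n + 1))" for n F \<nu>
  have "\<forall>n. \<exists>F \<nu>. good n F \<nu>" using null unfolding null_potentials_def R_def good_def by blast
  from choice[OF this] obtain F where "\<forall>n. \<exists>\<nu>. good n (F n) \<nu>" ..
  from choice[OF this] obtain \<nu> where "\<forall>n. good n (F n) (\<nu> n)" ..
  then have F: "\<And>n. finite (F n)" "\<And>n. F n \<subseteq> ball 0 (R n) - K \<inter> cball 0 (real n)"
    "\<And>n z. z \<in> F n \<Longrightarrow> 0 \<le> \<nu> n z" "\<And>n. (\<Sum>z\<in>F n. \<nu> n z) = 1"
    "\<And>n w. w \<in> K \<inter> cball 0 (real n) \<Longrightarrow> (\<Sum>z\<in>F n. \<nu> n z * ln (cmod (z - w))) < - (1 / c n + 1)"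
    by (simp_all add: good_def)
  have "\<exists>d. 0 < d \<and> d \<le> 1 \<and> (\<forall>x\<in>F n. \<forall>y\<in>K \<inter> cball 0 (real n). d \<le> dist x y)" for n
  proof -
    have "compact (F n)" using F(1) by (rule finite_imp_compact)
    moreover have "closed (K \<inter> cball 0 (real n))" using K(1) by (intro closed_Int) auto
    moreover have "F n \<inter> (K \<inter> cball 0 (real n)) = {}" using F(2) by blast
    ultimately obtain d where d: "0 < d" "\<forall>x\<in>F n. \<forall>y\<in>K \<inter> cball 0 (real n). d \<le> dist x y"
      using separate_compact_closed[of "F n" "K \<inter> cball 0 (real n)"] by blast
    have "min d 1 \<le> dist x y" if "x \<in> F n" "y \<in> K \<inter> cball 0 (real n)" for x y
      using d(2) that by (meson min.coboundedI1)
    then show ?thesis using d(1) by (intro exI[of _ "min d 1"]) auto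
  qed
  then have "\<forall>n. \<exists>d. 0 < d \<and> d \<le> 1 \<and> (\<forall>x\<in>F n. \<forall>y\<in>K \<inter> cball 0 (real n). d \<le> dist x y)" ..
  from choice[OF this] obtain d where d': "\<forall>n. 0 < d n \<and> d n \<le> 1 \<and> (\<forall>x\<in>F n. \<forall>y\<in>K \<inter> cball 0 (real n). d n \<le> dist x y)" ..
  have d: "\<And>n. 0 < d n" "\<And>n. d n \<le> 1" "\<And>n x y. x \<in> F n \<Longrightarrow> y \<in> K \<inter> cball 0 (real n) \<Longrightarrow> d n \<le> dist x y"
    using d' by simp_all
  \<comment> \<open>Regularization at the scale of the distance from \<open>F n\<close> to the part
    of \<open>K\<close>: on that part it at most doubles \<open>|z - a|^2\<close>.\<close>
  define \<eta> where "\<eta> n = (d n)\<^sup>2" for n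
  have \<eta>: "0 < \<eta> n" "\<eta> n \<le> 1" for n using d(1)[of n] d(2)[of n] by (auto simp: \<eta>_def power_le_one)
  define v where "v n z = c n * (1 / 2 * (\<Sum>a\<in>F n. \<nu> n a * ln ((cmod (z - a))\<^sup>2 + \<eta> n)) - l n)" for n z
  have pos: "0 < (cmod (z - a))\<^sup>2 + \<eta> n" for z a n using \<eta>(1)[of n] by (simp add: add_nonneg_pos)
  show ?thesis
  proof (rule polar_series[of v "pi * 1 + pi * 1 + 5 * pi"])
    have clog: "continuous_on UNIV (\<lambda>z. ln ((cmod (z - a))\<^sup>2 + \<eta> n))" for a n
      using pos by (intro continuous_intros) (auto simp: less_imp_neq[THEN not_sym])
    show "continuous_on UNIV (v n)" for n unfolding v_def by (intro continuous_intros clog)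
    show "2 * pi * v n z \<le> integral {0..2*pi} (\<lambda>t. v n (z + rcis r t))" if r: "0 < r" for n z r
    proof -
      have i: "(\<lambda>t. ln ((cmod (z + rcis r t - a))\<^sup>2 + \<eta> n)) integrable_on {0..2*pi}" for a
        by (rule circle_integrable[OF clog])
      have "integral {0..2*pi} (\<lambda>t. v n (z + rcis r t)) = c n * (1 / 2 * (\<Sum>a\<in>F n. \<nu> n a * integral {0..2*pi} (\<lambda>t. ln ((cmod (z + rcis r t - a))\<^sup>2 + \<eta> n))) - 2 * pi * l n)"
      proof -
        have "((\<lambda>t. v n (z + rcis r t)) has_integral c n * (1 / 2 * (\<Sum>a\<in>F n. \<nu> n a * integral {0..2*pi} (\<lambda>t. ln ((cmod (z + rcis r t - a))\<^sup>2 + \<eta> n))) - (2 * pi - 0) *\<^sub>R l n)) {0..2*pi}"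
          unfolding v_def
          by (intro has_integral_mult_right has_integral_diff has_integral_sum F(1) integrable_integral i has_integral_const_real[of "l n" 0 "2*pi", simplified content_real])
             (auto intro: has_integral_const_real[of "l n" 0 "2*pi", simplified])
        then show ?thesis by (simp add: integral_unique)
      qed
      moreover have "(\<Sum>a\<in>F n. \<nu> n a * (2 * pi * ln ((cmod (z - a))\<^sup>2 + \<eta> n))) \<le> (\<Sum>a\<in>F n. \<nu> n a * integral {0..2*pi} (\<lambda>t. ln ((cmod (z + rcis r t - a))\<^sup>2 + \<eta> n)))"
        by (intro sum_mono mult_left_mono log_submean \<eta> r F(3))
      then have "c n * (1 / 2 * (\<Sum>a\<in>F n. \<nu> n a * (2 * pi * ln ((cmod (z - a))\<^sup>2 + \<eta> n))) - 2 * pi * l n) \<le> c n * (1 / 2 * (\<Sum>a\<in>F n. \<nu> n a * integral {0..2*pi} (\<lambda>t. ln ((cmod (z + rcis r t - a))\<^sup>2 + \<eta> n))) - 2 * pi * l n)"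
        using c(1)[of n] by (intro mult_left_mono) auto
      moreover have "2 * pi * v n z = c n * (1 / 2 * (\<Sum>a\<in>F n. \<nu> n a * (2 * pi * ln ((cmod (z - a))\<^sup>2 + \<eta> n))) - 2 * pi * l n)"
        by (simp add: v_def sum_distrib_left algebra_simps)
      ultimately show ?thesis by linarith
    qed
    show "v n z \<le> (1/2)^Suc n * ln (1 + cmod z)" for n z
    proof -
      have "ln ((cmod (z - a))\<^sup>2 + \<eta> n) \<le> 2 * (ln (1 + cmod z) + l n)" if a: "a \<in> F n" for a
      proof -
        have R0: "0 \<le> R n" by (simp add: R_def)
        have "cmod a \<le> R n" using F(2)[of n] a by auto
        then have "cmod (z - a) \<le> cmod z + R n" using norm_triangle_ineq4[of z a] by linarith
        then have "(cmod (z - a))\<^sup>2 \<le> (cmod z + R n)\<^sup>2" by (intro power_mono) auto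
        moreover have "(cmod z + R n)\<^sup>2 + 1 \<le> ((1 + cmod z) * (R n + 1))\<^sup>2"
        proof -
          have "(cmod z + R n)\<^sup>2 + 1 \<le> (cmod z + R n + 1)\<^sup>2" using R0 by (simp add: power2_eq_square algebra_simps)
          also have "\<dots> \<le> ((1 + cmod z) * (R n + 1))\<^sup>2" using R0 by (intro power_mono) (auto simp: algebra_simps)
          finally show ?thesis .
        qed
        ultimately have "(cmod (z - a))\<^sup>2 + \<eta> n \<le> ((1 + cmod z) * (R n + 1))\<^sup>2" using \<eta>(2)[of n] by linarith
        then have "ln ((cmod (z - a))\<^sup>2 + \<eta> n) \<le> ln (((1 + cmod z) * (R n + 1))\<^sup>2)" by (rule ln_mono) (rule pos)
        also have "\<dots> = 2 * ln ((1 + cmod z) * (R n + 1))" by (simp add: ln_realpow)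
        also have "ln ((1 + cmod z) * (R n + 1)) = ln (1 + cmod z) + l n"
          unfolding l_def using R0 norm_ge_zero[of z] by (intro ln_mult_pos) linarith+
        finally show ?thesis by simp
      qed
      then have "(\<Sum>a\<in>F n. \<nu> n a * ln ((cmod (z - a))\<^sup>2 + \<eta> n)) \<le> (\<Sum>a\<in>F n. \<nu> n a * (2 * (ln (1 + cmod z) + l n)))"
        by (intro sum_mono mult_left_mono F(3))
      also have "\<dots> = 2 * (ln (1 + cmod z) + l n)" using F(4)[of n] by (simp add: sum_distrib_right[symmetric])
      finally have "v n z \<le> c n * ln (1 + cmod z)"
        unfolding v_def using c(1)[of n] by (intro mult_left_mono) auto
      also have "\<dots> \<le> (1/2)^Suc n * ln (1 + cmod z)" by (intro mult_right_mono c(2)) auto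
      finally show ?thesis .
    qed
    show "(\<integral>\<^sup>+z\<in>ball 0 1. ennreal ((1/2)^Suc n * ln (1 + cmod z) - v n z) \<partial>lborel) \<le> ennreal ((pi * 1 + pi * 1 + 5 * pi) * (1/2)^Suc n)" for n
    proof -
      let ?h = "(1/2)^Suc n :: real"
      let ?g = "\<lambda>z. ennreal ?h * ((indicator (ball 0 1) z + indicator (ball 0 1) z) + (\<Sum>a\<in>F n. ennreal (\<nu> n a) * (ennreal (1 / cmod (a - z)) * indicator (ball 0 1) z)))"
      have "(\<integral>\<^sup>+z\<in>ball 0 1. ennreal (?h * ln (1 + cmod z) - v n z) \<partial>lborel) \<le> (\<integral>\<^sup>+z. ?g z \<partial>lborel)"
      proof (rule nn_integral_mono_AE)
        have "AE z in lborel. \<forall>a\<in>F n. z \<noteq> a"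
          using F(1)[of n] by (intro AE_finite_allI AE_lborel_singleton)
        then show "AE z in lborel. ennreal (?h * ln (1 + cmod z) - v n z) * indicator (ball 0 1) z \<le> ?g z"
        proof eventually_elim
          case (elim z)
          show ?case
          proof (cases "z \<in> ball 0 1")
            case True
            have "ln (1 + cmod z) \<le> cmod z" by (rule ln_add_one_self_le_self) simp
            then have L1: "ln (1 + cmod z) \<le> 1" using True by simp
            have t: "- 1 / 2 * ln ((cmod (z - a))\<^sup>2 + \<eta> n) \<le> 1 / cmod (a - z)" if a: "a \<in> F n" for a
            proof -
              have p: "0 < cmod (z - a)" using elim a by simp
              have "ln ((cmod (z - a))\<^sup>2) \<le> ln ((cmod (z - a))\<^sup>2 + \<eta> n)"
                by (rule ln_mono) (use \<eta>(1)[of n] p in auto)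
              then have "2 * ln (cmod (z - a)) \<le> ln ((cmod (z - a))\<^sup>2 + \<eta> n)" by (simp add: ln_realpow)
              moreover have "- ln (cmod (z - a)) \<le> 1 / cmod (z - a)"
                using ln_le_minus_one[of "1 / cmod (z - a)"] p by (simp add: ln_div)
              ultimately show ?thesis by (simp add: norm_minus_commute)
            qed
            have "?h * ln (1 + cmod z) - v n z = ?h * ln (1 + cmod z) + c n * l n + c n * (\<Sum>a\<in>F n. \<nu> n a * (- 1 / 2 * ln ((cmod (z - a))\<^sup>2 + \<eta> n)))"
              by (simp add: v_def sum_distrib_left sum_negf algebra_simps)
            also have "\<dots> \<le> ?h * 1 + ?h + c n * (\<Sum>a\<in>F n. \<nu> n a * (1 / cmod (a - z)))"
              using c(1)[of n] by (intro add_mono mult_left_mono sum_mono t L1 c(3) F(3)) auto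
            also have "\<dots> \<le> ?h * 1 + ?h + ?h * (\<Sum>a\<in>F n. \<nu> n a * (1 / cmod (a - z)))"
              by (intro add_left_mono mult_right_mono c(2) sum_nonneg mult_nonneg_nonneg F(3)) auto
            also have "\<dots> = ?h * (1 + 1 + (\<Sum>a\<in>F n. \<nu> n a * (1 / cmod (a - z))))" by (simp add: algebra_simps)
            finally have "ennreal (?h * ln (1 + cmod z) - v n z) \<le> ennreal (?h * (1 + 1 + (\<Sum>a\<in>F n. \<nu> n a * (1 / cmod (a - z)))))"
              by (rule ennreal_leI)
            also have "\<dots> = ennreal ?h * (ennreal 1 + ennreal 1 + (\<Sum>a\<in>F n. ennreal (\<nu> n a) * ennreal (1 / cmod (a - z))))"
            proof -
              have s0: "0 \<le> (\<Sum>a\<in>F n. \<nu> n a * (1 / cmod (a - z)))"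
                by (intro sum_nonneg mult_nonneg_nonneg F(3)) auto
              have "(\<Sum>a\<in>F n. ennreal (\<nu> n a) * ennreal (1 / cmod (a - z))) = (\<Sum>a\<in>F n. ennreal (\<nu> n a * (1 / cmod (a - z))))"
                by (intro sum.cong refl ennreal_mult[symmetric] F(3)) auto
              also have "\<dots> = ennreal (\<Sum>a\<in>F n. \<nu> n a * (1 / cmod (a - z)))"
                by (intro sum_ennreal mult_nonneg_nonneg F(3)) auto
              finally show ?thesis using s0 by (simp only: ennreal_mult ennreal_plus add_nonneg_nonneg zero_le_one zero_le_power zero_le_divide_1_iff zero_le_numeral)
            qed
            finally show ?thesis using True by simp
          qed simp
        qed
      qed
      also have "\<dots> = ennreal ?h * ((ennreal (pi * 1\<^sup>2) + ennreal (pi * 1\<^sup>2)) + (\<Sum>a\<in>F n. ennreal (\<nu> n a) * (\<integral>\<^sup>+z\<in>ball 0 1. ennreal (1 / cmod (a - z)) \<partial>lborel)))"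
      proof -
        have mi: "(indicator (ball (0::complex) 1) :: complex \<Rightarrow> ennreal) \<in> borel_measurable lborel"
          by (intro borel_measurable_indicator) auto
        have mf: "(\<lambda>z. ennreal (1 / cmod (a - z)) * indicator (ball 0 1) z) \<in> borel_measurable lborel" for a
          by (intro borel_measurable_times_ennreal mi) measurable
        have i1: "(\<integral>\<^sup>+z. indicator (ball (0::complex) 1) z \<partial>lborel) = ennreal (pi * 1\<^sup>2)" by (simp add: emeasure_ball_complex)
        have ms: "(\<lambda>z. \<Sum>a\<in>F n. ennreal (\<nu> n a) * (ennreal (1 / cmod (a - z)) * indicator (ball 0 1) z)) \<in> borel_measurable lborel"
          by (intro borel_measurable_sum borel_measurable_times_ennreal borel_measurable_const mf)
        have mii: "(\<lambda>z. indicator (ball (0::complex) 1) z + indicator (ball 0 1) z :: ennreal) \<in> borel_measurable lborel"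
          by (intro borel_measurable_add mi)
        have "(\<integral>\<^sup>+z. ?g z \<partial>lborel) = ennreal ?h * (\<integral>\<^sup>+z. (indicator (ball 0 1) z + indicator (ball 0 1) z) + (\<Sum>a\<in>F n. ennreal (\<nu> n a) * (ennreal (1 / cmod (a - z)) * indicator (ball 0 1) z)) \<partial>lborel)"
          by (rule nn_integral_cmult, rule borel_measurable_add[OF mii ms])
        also have "(\<integral>\<^sup>+z. (indicator (ball 0 1) z + indicator (ball 0 1) z) + (\<Sum>a\<in>F n. ennreal (\<nu> n a) * (ennreal (1 / cmod (a - z)) * indicator (ball 0 1) z)) \<partial>lborel) =
            (\<integral>\<^sup>+z. indicator (ball (0::complex) 1) z + indicator (ball 0 1) z \<partial>lborel) + (\<integral>\<^sup>+z. (\<Sum>a\<in>F n. ennreal (\<nu> n a) * (ennreal (1 / cmod (a - z)) * indicator (ball 0 1) z)) \<partial>lborel)"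
          by (rule nn_integral_add[OF mii ms])
        also have "(\<integral>\<^sup>+z. indicator (ball (0::complex) 1) z + indicator (ball 0 1) z \<partial>lborel) = ennreal (pi * 1\<^sup>2) + ennreal (pi * 1\<^sup>2)"
          by (subst nn_integral_add[OF mi mi]) (simp only: i1)
        also have "(\<integral>\<^sup>+z. (\<Sum>a\<in>F n. ennreal (\<nu> n a) * (ennreal (1 / cmod (a - z)) * indicator (ball 0 1) z)) \<partial>lborel) =
            (\<Sum>a\<in>F n. \<integral>\<^sup>+z. ennreal (\<nu> n a) * (ennreal (1 / cmod (a - z)) * indicator (ball 0 1) z) \<partial>lborel)"
          by (rule nn_integral_sum, intro borel_measurable_times_ennreal borel_measurable_const mf)
        also have "\<dots> = (\<Sum>a\<in>F n. ennreal (\<nu> n a) * (\<integral>\<^sup>+z. ennreal (1 / cmod (a - z)) * indicator (ball 0 1) z \<partial>lborel))"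
          by (intro sum.cong refl nn_integral_cmult mf)
        finally show ?thesis .
      qed
      also have "\<dots> \<le> ennreal ?h * ((ennreal (pi * 1\<^sup>2) + ennreal (pi * 1\<^sup>2)) + (\<Sum>a\<in>F n. ennreal (\<nu> n a) * ennreal (5 * pi)))"
        by (intro mult_left_mono add_left_mono sum_mono nn_integral_log_unit_ball) auto
      also have "(\<Sum>a\<in>F n. ennreal (\<nu> n a) * ennreal (5 * pi)) = ennreal (5 * pi)"
      proof -
        have "(\<Sum>a\<in>F n. ennreal (\<nu> n a)) = ennreal (\<Sum>a\<in>F n. \<nu> n a)" by (intro sum_ennreal F(3))
        also have "\<dots> = 1" using F(4)[of n] by simp
        finally show ?thesis by (simp add: sum_distrib_right[symmetric])
      qed
      also have "ennreal ?h * ((ennreal (pi * 1\<^sup>2) + ennreal (pi * 1\<^sup>2)) + ennreal (5 * pi)) = ennreal ((pi * 1 + pi * 1 + 5 * pi) * ?h)"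
        by (simp add: ennreal_plus[symmetric] ennreal_mult[symmetric] mult.commute del: ennreal_plus power_Suc)
      finally show ?thesis .
    qed
    show "K \<noteq> {}" by (rule K(2))
    fix z assume z: "z \<in> K"
    obtain m :: nat where m: "cmod z \<le> real m" using real_arch_simple by blast
    show "\<exists>m. \<forall>n\<ge>m. v n z \<le> - 1"
    proof (intro exI[of _ m] allI impI)
      fix n assume "m \<le> n"
      then have zn: "z \<in> K \<inter> cball 0 (real n)" using z m by auto
      have "ln ((cmod (z - a))\<^sup>2 + \<eta> n) \<le> 2 * ln (cmod (a - z)) + 1" if a: "a \<in> F n" for a
      proof -
        have da: "d n \<le> cmod (z - a)" using d(3)[OF a zn] by (simp add: dist_norm norm_minus_commute)
        have p: "0 < cmod (z - a)" using da d(1)[of n] by linarith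
        have "\<eta> n \<le> (cmod (z - a))\<^sup>2" unfolding \<eta>_def using da d(1)[of n] by (intro power_mono) auto
        then have "(cmod (z - a))\<^sup>2 + \<eta> n \<le> 2 * (cmod (z - a))\<^sup>2" by simp
        then have "ln ((cmod (z - a))\<^sup>2 + \<eta> n) \<le> ln (2 * (cmod (z - a))\<^sup>2)" by (rule ln_mono) (rule pos)
        also have "\<dots> = ln 2 + 2 * ln (cmod (z - a))" using p by (simp add: ln_mult ln_realpow)
        also have "ln 2 \<le> (1::real)" using ln_le_minus_one[of "2::real"] by simp
        finally show ?thesis by (simp add: norm_minus_commute)
      qed
      then have "(\<Sum>a\<in>F n. \<nu> n a * ln ((cmod (z - a))\<^sup>2 + \<eta> n)) \<le> (\<Sum>a\<in>F n. \<nu> n a * (2 * ln (cmod (a - z)) + 1))"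
        by (intro sum_mono mult_left_mono F(3))
      also have "\<dots> = 2 * (\<Sum>a\<in>F n. \<nu> n a * ln (cmod (a - z))) + 1"
        using F(4)[of n] by (simp add: distrib_left sum.distrib sum_distrib_left mult.left_commute)
      finally have "1 / 2 * (\<Sum>a\<in>F n. \<nu> n a * ln ((cmod (z - a))\<^sup>2 + \<eta> n)) - l n \<le> - (1 / c n)"
        using F(5)[OF zn] l0[of n] by linarith
      then have "v n z \<le> c n * (- (1 / c n))" unfolding v_def using c(1)[of n] by (intro mult_left_mono) auto
      also have "\<dots> = - 1" using c(1)[of n] by simp
      finally show "v n z \<le> - 1" .
    qed
  qed
qed

text \<open>A unit mass close enough to 0 has an arbitrarily negative potential at 0, so
  \<open>{0}\<close> is polar. The lemma serves to infer that a nonpolar set is nonempty.\<close>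

lemma polar_empty: "polar {}"
proof -
  have "null_potentials {0}" unfolding null_potentials_def
  proof (intro allI)
    fix n :: nat and M :: real
    define x where "x = exp (- (max M 0 + 1))"
    have x: "0 < x" "x < 1" by (auto simp: x_def)
    have "ln (cmod (complex_of_real x)) = - (max M 0 + 1)" using x by (simp add: x_def)
    then have "ln (cmod (complex_of_real x - 0)) < - M" by simp
    moreover have "complex_of_real x \<in> ball 0 (2 * real n + 2)" using x by simp
    ultimately show "\<exists>F \<nu>. finite F \<and> F \<subseteq> ball 0 (2 * real n + 2) - {0} \<inter> cball 0 (real n) \<and> (\<forall>z\<in>F. 0 \<le> \<nu> z) \<and> sum \<nu> F = 1 \<and>
       (\<forall>w\<in>{0} \<inter> cball 0 (real n). (\<Sum>z\<in>F. \<nu> z * ln (cmod (z - w))) < - M)"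
      using x by (intro exI[of _ "{complex_of_real x}"] exI[of _ "\<lambda>_. 1"]) auto
  qed
  then have "polar {0}" by (intro null_potentials_imp_polar) auto
  then show ?thesis by (rule polar_subset) simp
qed

text \<open>Negating \<open>null_potentials\<close> provides one radius and one \<open>M\<close> for
  which the game on that part of \<open>K\<close> has bounded value. Both are chosen before
  \<open>L\<close>, so the final bound is uniform in \<open>L\<close>.\<close>

lemma nonpolar_potential:
  assumes K: "closed K" "\<not> polar K"
  obtains K1 r M where "compact K1" "K1 \<subseteq> K" "K1 \<subseteq> cball 0 r" "0 \<le> r"
    "\<And>L. compact L \<Longrightarrow> L \<inter> K1 = {} \<Longrightarrow> \<exists>n ws. 0 < (n::nat) \<and> (\<forall>i<n. ws i \<in> K1) \<and>
       (\<forall>z\<in>L. real n * (ln (1 + cmod z) - M) \<le> (\<Sum>i<n. ln (cmod (z - ws i))))"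
proof -
  have "K \<noteq> {}" using K(2) polar_empty by auto
  then have "\<not> null_potentials K" using null_potentials_imp_polar K by blast
  then obtain n :: nat and M where no: "\<not> (\<exists>F \<nu>. finite F \<and> F \<subseteq> ball 0 (2 * real n + 2) - K \<inter> cball 0 (real n) \<and>
     (\<forall>z\<in>F. 0 \<le> \<nu> z) \<and> sum \<nu> F = 1 \<and> (\<forall>w\<in>K \<inter> cball 0 (real n). (\<Sum>z\<in>F. \<nu> z * ln (cmod (z - w))) < - M))"
    unfolding null_potentials_def by blast
  have nM: "\<exists>w\<in>K \<inter> cball 0 (real n). - M \<le> (\<Sum>z\<in>F. \<nu> z * ln (cmod (z - w)))"
    if "finite F" "F \<subseteq> ball 0 (2 * real n + 2) - K \<inter> cball 0 (real n)" "\<And>z. z \<in> F \<Longrightarrow> 0 \<le> \<nu> z" "sum \<nu> F = 1" for F \<nu>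
  proof (rule ccontr)
    assume "\<not> ?thesis"
    then have "\<forall>w\<in>K \<inter> cball 0 (real n). (\<Sum>z\<in>F. \<nu> z * ln (cmod (z - w))) < - M" by (simp add: not_le)
    with that no show False by blast
  qed
  define K1 where "K1 = K \<inter> cball 0 (real n)"
  have K1: "compact K1" "K1 \<subseteq> cball 0 (real n)" unfolding K1_def using K(1) by (auto intro: closed_Int_compact)
  have good: "\<exists>w\<in>K1. - (max M 0) \<le> (\<Sum>z\<in>F. \<nu> z * ln (cmod (z - w)))"
    if F\<nu>: "finite F" "F \<subseteq> ball 0 (2 * real n + 2) - K1" "\<And>z. z \<in> F \<Longrightarrow> 0 \<le> \<nu> z" "(\<Sum>z\<in>F. \<nu> z) = 1" for F \<nu>
  proof -
    obtain w where w: "w \<in> K1" "- M \<le> (\<Sum>z\<in>F. \<nu> z * ln (cmod (z - w)))"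
      using nM[OF F\<nu>(1) F\<nu>(2)[unfolded K1_def] F\<nu>(3,4)] unfolding K1_def by auto
    then have "- max M 0 \<le> (\<Sum>z\<in>F. \<nu> z * ln (cmod (z - w)))" by linarith
    then show ?thesis using w(1) ..
  qed
  \<comment> \<open>A point outside \<open>cball 0 n\<close> and inside the allowed ball. An answer
    to the unit mass there shows that \<open>K1\<close> is nonempty.\<close>
  have "complex_of_real (2 * real n + 1) \<in> ball 0 (2 * real n + 2) - K1"
  proof -
    have "cmod (complex_of_real (2 * real n + 1)) = 2 * real n + 1" by (simp only: norm_of_real)
    then show ?thesis using K1(2) by (auto simp del: of_real_add of_real_mult)
  qed
  then have "K1 \<noteq> {}" using good[of "{complex_of_real (2 * real n + 1)}" "\<lambda>_. 1"] by auto
  show ?thesis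
  proof (rule that[OF K1(1) _ K1(2)])
    fix L assume L: "compact L" "L \<inter> K1 = {}"
    show "\<exists>m ws. 0 < (m::nat) \<and> (\<forall>i<m. ws i \<in> K1) \<and>
       (\<forall>z\<in>L. real m * (ln (1 + cmod z) - (max M 0 + 2 + ln (2 * real n + 2) + ln 4)) \<le> (\<Sum>i<m. ln (cmod (z - ws i))))"
    proof -
      obtain m ws where "0 < (m::nat)" "\<And>i. i < m \<Longrightarrow> ws i \<in> K1"
        "\<And>z. z \<in> L \<Longrightarrow> real m * (ln (1 + cmod z) - (max M 0 + 2 + ln (2 * real n + 2) + ln 4)) \<le> (\<Sum>i<m. ln (cmod (z - ws i)))"
        by (rule potential_lower_bound[OF K1 \<open>K1 \<noteq> {}\<close> _ _ good L]) auto
      then show ?thesis by auto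
    qed
  qed (auto simp: K1_def)
qed

section \<open>Interpolation off nonpolar sets\<close>

text \<open>\<open>h\<close> is the average of the logarithms plus \<open>M + C\<close>, harmonic
  because all poles lie off \<open>U\<close>. The upper bound uses only that the poles lie in
  \<open>cball 0 r\<close>, so it does not depend on their number or position.\<close>

lemma log_potential_C2:
  assumes n: "0 < (n::nat)" and ws: "\<And>i. i < n \<Longrightarrow> ws i \<in> cball 0 r" "\<And>i. i < n \<Longrightarrow> ws i \<notin> U"
    and low: "\<And>z. z \<in> U \<Longrightarrow> real n * (ln (1 + cmod z) - M) \<le> (\<Sum>i<n. ln (cmod (z - ws i)))"
  obtains h h_z h_zz h_zb where "C2_real U h h_z h_zz h_zb" "\<And>z. z \<in> U \<Longrightarrow> h_zb z = 0"
    "\<And>z. z \<in> U \<Longrightarrow> ln (1 + cmod z) + C \<le> h z" "\<And>z. z \<in> U \<Longrightarrow> h z \<le> ln (cmod z + r) + M + C"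
proof -
  have pos: "0 < (cmod (z - ws i))\<^sup>2 + 0" if "z \<in> U" "i < n" for z i using that ws(2) by auto
  have eq: "1 / real n * (\<Sum>i<n. 1 / 2 * ln ((cmod (z - ws i))\<^sup>2 + 0)) = 1 / real n * (\<Sum>i<n. ln (cmod (z - ws i)))" if "z \<in> U" for z
    by (simp add: ln_realpow)
  have "C2_real U (\<lambda>z. 1 / real n * (\<Sum>i<n. 1 / 2 * ln ((cmod (z - ws i))\<^sup>2 + 0)) + (M + C))
     (\<lambda>z. of_real (1 / real n) * (\<Sum>i<n. of_real (1 / 2) * log_z (ws i) 0 z) + 0)
     (\<lambda>z. of_real (1 / real n) * (\<Sum>i<n. of_real (1 / 2) * log_zz (ws i) 0 z) + 0)
     (\<lambda>z. 1 / real n * (\<Sum>i<n. 1 / 2 * log_zb (ws i) 0 z) + 0)"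
    by (intro C2_real_add C2_real_cmult C2_real_sum C2_real_log C2_real_const pos) auto
  moreover have "1 / real n * (\<Sum>i<n. 1 / 2 * log_zb (ws i) 0 z) + 0 = 0" for z by (simp add: log_zb_def)
  moreover have "ln (1 + cmod z) + C \<le> 1 / real n * (\<Sum>i<n. 1 / 2 * ln ((cmod (z - ws i))\<^sup>2 + 0)) + (M + C)" if z: "z \<in> U" for z
    using low[OF z] n unfolding eq[OF z] by (simp add: field_simps)
  moreover have "1 / real n * (\<Sum>i<n. 1 / 2 * ln ((cmod (z - ws i))\<^sup>2 + 0)) + (M + C) \<le> ln (cmod z + r) + M + C" if z: "z \<in> U" for z
  proof -
    have "ln (cmod (z - ws i)) \<le> ln (cmod z + r)" if i: "i < n" for i
    proof (rule ln_mono)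
      show "0 < cmod (z - ws i)" using pos[OF z i] by simp
      show "cmod (z - ws i) \<le> cmod z + r" using ws(1)[OF i] norm_triangle_ineq4[of z "ws i"] by simp
    qed
    then have "(\<Sum>i<n. ln (cmod (z - ws i))) \<le> (\<Sum>i<n. ln (cmod z + r))" by (intro sum_mono) simp
    then show ?thesis using n unfolding eq[OF z] by (simp add: field_simps)
  qed
  ultimately show ?thesis by (rule that)
qed

lemma norm_diff_sq_bound: "(cmod (z - a))\<^sup>2 + 1 \<le> ((1 + cmod z) * (1 + cmod a))\<^sup>2"
proof -
  have "cmod (z - a) \<le> cmod z + cmod a" by (rule norm_triangle_ineq4)
  then have "(cmod (z - a))\<^sup>2 \<le> (cmod z + cmod a)\<^sup>2" by (intro power_mono) auto
  moreover have "(1 + cmod z + cmod a)\<^sup>2 = (cmod z + cmod a)\<^sup>2 + 1 + 2 * (cmod z + cmod a)"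
    by (simp add: power2_eq_square algebra_simps)
  moreover have "0 \<le> 2 * (cmod z + cmod a)" by simp
  ultimately have "(cmod (z - a))\<^sup>2 + 1 \<le> (1 + cmod z + cmod a)\<^sup>2" by linarith
  also have "\<dots> \<le> ((1 + cmod z) * (1 + cmod a))\<^sup>2" by (intro power_mono) (auto simp: algebra_simps)
  finally show ?thesis .
qed

text \<open>The weight is \<open>moll \<psi> \<epsilon>\<close> plus a pole
  \<open>ln (|z - a|^2 + \<delta>) - 2 * h\<close> for each \<open>a\<close> in \<open>Z\<close>.
  Each pole is subharmonic since \<open>h\<close> is harmonic, and \<open>exp (2 * h)\<close>
  dominates \<open>|z - a|^2 + 1\<close>, which turns the extension weight into the stated one. The
  bound at \<open>z0\<close> is free of \<epsilon>, \<delta> and \<open>U\<close>.\<close>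

lemma interpolation_bounded:
  assumes \<psi>: "subharmonic_on UNIV \<psi>" and D: "open D" "bounded D" "z0 \<in> D" and U: "open U" "closure D \<subseteq> U"
    and h: "C2_real U h h_z h_zz h_zb" "\<And>z. z \<in> U \<Longrightarrow> h_zb z = 0" "\<And>z. z \<in> U \<Longrightarrow> ln (1 + cmod z) + C \<le> h z"
    and C: "\<And>a. a \<in> insert z0 Z \<Longrightarrow> ln 2 + ln (1 + cmod a) \<le> C"
    and Z: "finite Z" "z0 \<notin> Z" and p: "\<psi> z0 = ereal p" and H: "h z0 \<le> H" and pos: "0 < \<epsilon>" "0 < \<delta>"
  obtains f where "f holomorphic_on D" "f z0 = 1"
    "(\<integral>\<^sup>+z\<in>D. ennreal ((cmod (f z))\<^sup>2 * (exp (- moll \<psi> \<epsilon> z) * (\<Prod>a\<in>Z. ((cmod (z - a))\<^sup>2 + 1) / ((cmod (z - a))\<^sup>2 + \<delta>)))) \<partial>lborel)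
      \<le> ennreal (10240 * pi * (exp (2 * H * (1 + real (card Z)) - p) / (\<Prod>a\<in>Z. (cmod (z0 - a))\<^sup>2)))"
proof -
  let ?W = "\<lambda>z. exp (- moll \<psi> \<epsilon> z) * (\<Prod>a\<in>Z. ((cmod (z - a))\<^sup>2 + 1) / ((cmod (z - a))\<^sup>2 + \<delta>))"
  \<comment> \<open>This is why \<open>C\<close> must exceed \<open>ln 2 + ln (1 + |a|)\<close>. For
    \<open>a = z0\<close> it gives the hypothesis \<open>dom\<close> of the extension
    theorem.\<close>
  have eh: "4 * ((cmod (z - a))\<^sup>2 + 1) \<le> exp (2 * h z)" if z: "z \<in> U" and a: "a \<in> insert z0 Z" for z a
  proof -
    have p: "0 < 1 + cmod z" "0 < 1 + cmod a" by (simp_all add: add_pos_nonneg)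
    have "4 * ((cmod (z - a))\<^sup>2 + 1) \<le> (2 * ((1 + cmod z) * (1 + cmod a)))\<^sup>2"
      using norm_diff_sq_bound[of z a] by (simp add: power_mult_distrib)
    also have "2 * ((1 + cmod z) * (1 + cmod a)) = exp (ln 2 + ln (1 + cmod a) + ln (1 + cmod z))"
      using p by (simp add: exp_add)
    also have "\<dots>\<^sup>2 = exp (2 * (ln 2 + ln (1 + cmod a) + ln (1 + cmod z)))" by (simp add: exp_of_nat2_mult[symmetric] power2_eq_square exp_add[symmetric])
    also have "\<dots> \<le> exp (2 * h z)" using h(3)[OF z] C[OF a] by simp
    finally show ?thesis .
  qed
  define \<phi> where "\<phi> z = moll \<psi> \<epsilon> z + (\<Sum>a\<in>Z. ln ((cmod (z - a))\<^sup>2 + \<delta>) + (- 2) * h z)" for z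
  have q: "0 < (cmod (z - a))\<^sup>2 + \<delta>" for z a using pos(2) by (simp add: add_nonneg_pos)
  have \<phi>: "C2_real U \<phi> (\<lambda>z. moll_z \<psi> \<epsilon> z + (\<Sum>a\<in>Z. log_z a \<delta> z + of_real (- 2) * h_z z))
     (\<lambda>z. moll_zz \<psi> \<epsilon> z + (\<Sum>a\<in>Z. log_zz a \<delta> z + of_real (- 2) * h_zz z))
     (\<lambda>z. moll_zb \<psi> \<epsilon> z + (\<Sum>a\<in>Z. log_zb a \<delta> z + (- 2) * h_zb z))"
    unfolding \<phi>_def by (intro C2_real_add C2_real_sum C2_real_cmult C2_real_log h(1) q C2_real_subset[OF moll_C2[OF \<psi> pos(1)]]) auto
  have \<phi>0: "0 \<le> moll_zb \<psi> \<epsilon> z + (\<Sum>a\<in>Z. log_zb a \<delta> z + (- 2) * h_zb z)" if "z \<in> U" for z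
    using h(2)[OF that] pos(2) by (intro add_nonneg_nonneg sum_nonneg moll_zb_nonneg[OF \<psi> pos(1)]) (simp_all add: log_zb_def)
  have dom: "4 * (cmod (z - z0))\<^sup>2 \<le> exp (2 * h z)" if "z \<in> U" for z using eh[OF that, of z0] by simp
  have e\<phi>: "exp (- \<phi> z) = exp (- moll \<psi> \<epsilon> z) * (\<Prod>a\<in>Z. exp (2 * h z) / ((cmod (z - a))\<^sup>2 + \<delta>))" for z
  proof -
    have "- \<phi> z = - moll \<psi> \<epsilon> z + (\<Sum>a\<in>Z. 2 * h z - ln ((cmod (z - a))\<^sup>2 + \<delta>))"
      by (simp add: \<phi>_def sum.distrib sum_subtractf)
    then have "exp (- \<phi> z) = exp (- moll \<psi> \<epsilon> z) * (\<Prod>a\<in>Z. exp (2 * h z - ln ((cmod (z - a))\<^sup>2 + \<delta>)))"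
      by (simp only: exp_add exp_sum[OF Z(1)])
    then show ?thesis by (simp only: exp_diff exp_ln[OF q])
  qed
  have z0U: "z0 \<in> U" using D(3) U(2) closure_subset by blast
  obtain f where f: "f holomorphic_on D" "f z0 = 1"
    "(\<integral>\<^sup>+z\<in>D. ennreal ((cmod (f z))\<^sup>2 * exp (- \<phi> z)) \<partial>lborel) \<le> ennreal (10240 * pi * exp (2 * h z0 - \<phi> z0))"
    by (rule ohsawa_takegoshi_bounded[OF D U \<phi> \<phi>0 h(1,2) dom])
  show ?thesis
  proof (rule that[OF f(1,2)])
    have "(\<integral>\<^sup>+z\<in>D. ennreal ((cmod (f z))\<^sup>2 * ?W z) \<partial>lborel)
        \<le> (\<integral>\<^sup>+z\<in>D. ennreal ((cmod (f z))\<^sup>2 * exp (- \<phi> z)) \<partial>lborel)"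
    proof (rule nn_integral_mono)
      fix z
      have "(\<Prod>a\<in>Z. ((cmod (z - a))\<^sup>2 + 1) / ((cmod (z - a))\<^sup>2 + \<delta>)) \<le> (\<Prod>a\<in>Z. exp (2 * h z) / ((cmod (z - a))\<^sup>2 + \<delta>))" if z: "z \<in> D"
      proof (intro prod_mono conjI divide_right_mono divide_nonneg_nonneg less_imp_le[OF q])
        fix a assume a: "a \<in> Z"
        have "z \<in> U" using z U(2) closure_subset by blast
        then have "4 * ((cmod (z - a))\<^sup>2 + 1) \<le> exp (2 * h z)" using a by (intro eh) auto
        moreover have "x \<le> 4 * x" if "0 \<le> x" for x :: real using that by simp
        ultimately show "(cmod (z - a))\<^sup>2 + 1 \<le> exp (2 * h z)" by (rule order_trans[rotated]) simp
      qed simp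
      then show "ennreal ((cmod (f z))\<^sup>2 * ?W z) * indicator D z
          \<le> ennreal ((cmod (f z))\<^sup>2 * exp (- \<phi> z)) * indicator D z"
        unfolding e\<phi> by (auto simp: indicator_def intro!: ennreal_leI mult_left_mono)
    qed
    also note f(3)
    \<comment> \<open>Both regularizations help at \<open>z0\<close>: the mollification is at least
      \<open>p\<close>, and each \<open>|z0 - a|^2 + \<delta>\<close> is at least
      \<open>|z0 - a|^2\<close>, which is positive.\<close>
    also have "exp (2 * h z0 - \<phi> z0) \<le> exp (2 * H * (1 + real (card Z)) - p) / (\<Prod>a\<in>Z. (cmod (z0 - a))\<^sup>2)"
    proof -
      have P: "0 < (cmod (z0 - a))\<^sup>2" if "a \<in> Z" for a using that Z(2) by auto
      then have P': "0 < (\<Prod>a\<in>Z. (cmod (z0 - a))\<^sup>2)" by (rule prod_pos)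
      have "p \<le> moll \<psi> \<epsilon> z0" using moll_ge[OF \<psi> pos(1), of z0] p by simp
      moreover have "h z0 * card Z \<le> H * card Z" using H by (rule mult_right_mono) simp
      ultimately have "2 * h z0 + (- moll \<psi> \<epsilon> z0 + 2 * h z0 * card Z) \<le> 2 * H * (1 + real (card Z)) - p"
        using H by (simp add: distrib_left)
      then have "exp (2 * h z0) * (exp (- moll \<psi> \<epsilon> z0) * exp (2 * h z0 * card Z)) \<le> exp (2 * H * (1 + real (card Z)) - p)"
        by (simp only: exp_add[symmetric] exp_le_cancel_iff)
      moreover have "(\<Prod>a\<in>Z. (cmod (z0 - a))\<^sup>2) \<le> (\<Prod>a\<in>Z. (cmod (z0 - a))\<^sup>2 + \<delta>)" using pos(2) by (intro prod_mono) auto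
      ultimately have "exp (2 * h z0) * (exp (- moll \<psi> \<epsilon> z0) * exp (2 * h z0 * card Z)) / (\<Prod>a\<in>Z. (cmod (z0 - a))\<^sup>2 + \<delta>)
          \<le> exp (2 * H * (1 + real (card Z)) - p) / (\<Prod>a\<in>Z. (cmod (z0 - a))\<^sup>2)"
        using P' by (intro frac_le) auto
      moreover have "exp (2 * h z0 - \<phi> z0) = exp (2 * h z0) * (exp (- moll \<psi> \<epsilon> z0) * exp (2 * h z0 * card Z)) / (\<Prod>a\<in>Z. (cmod (z0 - a))\<^sup>2 + \<delta>)"
      proof -
        have "exp (2 * h z0 - \<phi> z0) = exp (2 * h z0) * exp (- \<phi> z0)" by (simp add: exp_add[symmetric])
        moreover have "exp (2 * h z0) ^ card Z = exp (2 * h z0 * card Z)" by (simp add: exp_of_nat2_mult)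
        ultimately show ?thesis by (simp add: e\<phi> prod_dividef)
      qed
      ultimately show ?thesis by simp
    qed
    finally show "(\<integral>\<^sup>+z\<in>D. ennreal ((cmod (f z))\<^sup>2 * ?W z) \<partial>lborel)
      \<le> ennreal (10240 * pi * (exp (2 * H * (1 + real (card Z)) - p) / (\<Prod>a\<in>Z. (cmod (z0 - a))\<^sup>2)))"
      by (simp add: ennreal_leI)
  qed
qed

section \<open>Passage to the limit and vanishing at prescribed points\<close>

text \<open>Every dyadic annulus contributes at least \<open>pi / 2\<close>, whatever its
  radius.\<close>

lemma nn_integral_inverse_sq_infinite:
  assumes "0 < \<rho>"
  shows "(\<integral>\<^sup>+z\<in>ball a \<rho>. ennreal (1 / (cmod (z - a))\<^sup>2) \<partial>lborel) = \<infinity>"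
proof -
  define F where "F \<rho> = (\<integral>\<^sup>+z\<in>ball a \<rho>. ennreal (1 / (cmod (z - a))\<^sup>2) \<partial>lborel)" for \<rho>
  have m: "(\<lambda>z. ennreal (1 / (cmod (z - a))\<^sup>2)) \<in> borel_measurable lborel" by measurable
  have mA: "ball a \<rho> - ball a (\<rho> / 2) \<in> sets lborel" for \<rho> by simp
  have step: "ennreal (pi / 2) + F (\<rho> / 2) \<le> F \<rho>" if \<rho>: "0 < \<rho>" for \<rho>
  proof -
    have sub: "ball a (\<rho> / 2) \<subseteq> ball a \<rho>" using \<rho> by (intro subset_ball) simp
    have "ennreal (pi / 2) \<le> ennreal (1 / \<rho>\<^sup>2) * emeasure lborel (ball a \<rho> - ball a (\<rho> / 2))"
    proof -
      have "emeasure lborel (ball a \<rho> - ball a (\<rho> / 2)) = emeasure lborel (ball a \<rho>) - emeasure lborel (ball a (\<rho> / 2))"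
        by (rule emeasure_Diff) (use sub emeasure_ball_complex[of "\<rho> / 2" a] \<rho> in auto)
      also have "\<dots> = ennreal (pi * \<rho>\<^sup>2 - pi * (\<rho> / 2)\<^sup>2)"
        using \<rho> by (simp add: emeasure_ball_complex ennreal_minus)
      finally have "ennreal (1 / \<rho>\<^sup>2) * emeasure lborel (ball a \<rho> - ball a (\<rho> / 2)) = ennreal (1 / \<rho>\<^sup>2 * (pi * \<rho>\<^sup>2 - pi * (\<rho> / 2)\<^sup>2))"
        by (simp only: ennreal_mult' zero_le_divide_1_iff zero_le_power2)
      moreover have "pi / 2 \<le> 1 / \<rho>\<^sup>2 * (pi * \<rho>\<^sup>2 - pi * (\<rho> / 2)\<^sup>2)"
        using \<rho> by (simp add: field_simps)
      ultimately show ?thesis by (simp only: ennreal_leI)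
    qed
    also have "\<dots> = (\<integral>\<^sup>+z\<in>ball a \<rho> - ball a (\<rho> / 2). ennreal (1 / \<rho>\<^sup>2) \<partial>lborel)"
      by (rule nn_integral_cmult_indicator[OF mA, symmetric])
    also have "\<dots> \<le> (\<integral>\<^sup>+z\<in>ball a \<rho> - ball a (\<rho> / 2). ennreal (1 / (cmod (z - a))\<^sup>2) \<partial>lborel)"
    proof (rule nn_integral_mono)
      fix z
      show "ennreal (1 / \<rho>\<^sup>2) * indicator (ball a \<rho> - ball a (\<rho> / 2)) z \<le> ennreal (1 / (cmod (z - a))\<^sup>2) * indicator (ball a \<rho> - ball a (\<rho> / 2)) z"
      proof (cases "z \<in> ball a \<rho> - ball a (\<rho> / 2)")
        case True
        then have "0 < cmod (z - a)" "cmod (z - a) \<le> \<rho>" using \<rho> by (auto simp: dist_norm norm_minus_commute)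
        then have "1 / \<rho>\<^sup>2 \<le> 1 / (cmod (z - a))\<^sup>2" using \<rho> by (intro frac_le power_mono zero_less_power) auto
        then show ?thesis using True by (simp add: ennreal_leI)
      qed simp
    qed
    finally have "ennreal (pi / 2) + F (\<rho> / 2) \<le> (\<integral>\<^sup>+z\<in>ball a \<rho> - ball a (\<rho> / 2). ennreal (1 / (cmod (z - a))\<^sup>2) \<partial>lborel) + F (\<rho> / 2)"
      by (rule add_right_mono)
    also have "\<dots> = (\<integral>\<^sup>+z\<in>(ball a \<rho> - ball a (\<rho> / 2)) \<union> ball a (\<rho> / 2). ennreal (1 / (cmod (z - a))\<^sup>2) \<partial>lborel)"
      unfolding F_def by (rule nn_integral_disjoint_pair[OF m mA, symmetric]) auto
    also have "(ball a \<rho> - ball a (\<rho> / 2)) \<union> ball a (\<rho> / 2) = ball a \<rho>" using sub by blast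
    finally show ?thesis by (simp add: F_def)
  qed
  have "ennreal (real n * (pi / 2)) \<le> F \<rho>" if "0 < \<rho>" for n \<rho>
    using that
  proof (induction n arbitrary: \<rho>)
    case (Suc n)
    have "ennreal (real (Suc n) * (pi / 2)) = ennreal (pi / 2) + ennreal (real n * (pi / 2))"
      unfolding of_nat_Suc distrib_right mult_1 by (rule ennreal_plus) auto
    also have "\<dots> \<le> ennreal (pi / 2) + F (\<rho> / 2)" using Suc by (intro add_left_mono) auto
    also have "\<dots> \<le> F \<rho>" by (rule step[OF Suc.prems])
    finally show ?case .
  qed simp
  then have le: "ennreal (real n * (pi / 2)) \<le> F \<rho>" for n using assms .
  have "F \<rho> = \<infinity>"
  proof (rule ccontr)
    assume "F \<rho> \<noteq> \<infinity>"
    then obtain x where x: "0 \<le> x" "F \<rho> = ennreal x" by (cases "F \<rho>") auto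
    obtain n where "x / (pi / 2) < real n" using reals_Archimedean2 by blast
    then have "x < real n * (pi / 2)" by (simp add: field_simps)
    then show False using le[of n] x by simp
  qed
  then show ?thesis by (simp add: F_def)
qed

lemma moll_tendsto:
  assumes u: "subharmonic_on UNIV u" and q: "u z = ereal q"
  shows "(\<lambda>n. moll u (1 / real (Suc n)) z) \<longlonglongrightarrow> q"
proof (rule LIMSEQ_I)
  fix e :: real assume e: "0 < e"
  have "u z < ereal (q + e / 2)" using e q by simp
  then obtain d where d: "0 < d" "\<And>\<epsilon>. 0 < \<epsilon> \<Longrightarrow> \<epsilon> \<le> d \<Longrightarrow> moll u \<epsilon> z \<le> q + e / 2"
    by (rule moll_le_usc[OF u]) blast
  obtain N where N: "inverse (real (Suc N)) < d" using reals_Archimedean[OF d(1)] by blast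
  show "\<exists>N. \<forall>n\<ge>N. norm (moll u (1 / real (Suc n)) z - q) < e"
  proof (intro exI[of _ N] allI impI)
    fix n assume "N \<le> n"
    then have "1 / real (Suc n) \<le> inverse (real (Suc N))" by (simp add: field_simps)
    then have "moll u (1 / real (Suc n)) z \<le> q + e / 2" using N by (intro d(2)) auto
    moreover have "q \<le> moll u (1 / real (Suc n)) z" using moll_ge[OF u, of "1 / real (Suc n)" z] q by simp
    ultimately show "norm (moll u (1 / real (Suc n)) z - q) < e" using e by simp
  qed
qed

lemma exp_ereal_minus: "x = ereal q \<Longrightarrow> exp_ereal (- x) = ennreal (exp (- q))"
  by (simp add: exp_ereal_def)


text \<open>As the regularizations of \<open>\<psi>\<close> and of the poles are removed together,
  the weight acquires a factor \<open>1 / |z - a|^2\<close> at each \<open>a\<close> in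
  \<open>Z\<close>. Finiteness of the norm then forces a zero of the limit at every \<open>a\<close>
  off \<open>K\<close>.\<close>

lemma bergman_interpolation:
  assumes K: "closed K" "\<not> polar K" and \<psi>: "subharmonic_on UNIV \<psi>"
    and z0: "z0 \<notin> K" "\<psi> z0 \<noteq> - \<infinity>" and Z: "finite Z" "z0 \<notin> Z"
  obtains f where "f \<in> bergman_space \<psi> (- K)" "f z0 = 1" "\<And>a. a \<in> Z \<Longrightarrow> f a = 0"
proof -
  obtain K1 r M where K1: "compact K1" "K1 \<subseteq> K" "K1 \<subseteq> cball 0 r" "0 \<le> r"
    and pot: "\<And>L. compact L \<Longrightarrow> L \<inter> K1 = {} \<Longrightarrow> \<exists>n ws. 0 < (n::nat) \<and> (\<forall>i<n. ws i \<in> K1) \<and>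
       (\<forall>z\<in>L. real n * (ln (1 + cmod z) - M) \<le> (\<Sum>i<n. ln (cmod (z - ws i))))"
    by (rule nonpolar_potential[OF K]) blast
  have "K \<noteq> {}" using K(2) polar_empty by auto
  have K_iff: "z \<in> K \<longleftrightarrow> infdist z K = 0" for z
    by (rule in_closed_iff_infdist_zero[OF K(1) \<open>K \<noteq> {}\<close>])
  then have K_pos: "z \<notin> K \<Longrightarrow> 0 < infdist z K" for z by (simp add: less_le infdist_nonneg)
  have "\<psi> z0 \<noteq> \<infinity>" using \<psi> by (simp add: subharmonic_on_def)
  with z0(2) obtain p where p: "\<psi> z0 = ereal p" by (cases "\<psi> z0") auto
  define C where "C = ln 2 + (\<Sum>a\<in>insert z0 Z. ln (1 + cmod a))"
  have C: "ln 2 + ln (1 + cmod a) \<le> C" if "a \<in> insert z0 Z" for a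
    unfolding C_def using that Z(1) by (intro add_left_mono member_le_sum) auto
  define H where "H = ln (cmod z0 + r) + M + C"
  define B where "B = 10240 * pi * (exp (2 * H * (1 + real (card Z)) - p) / (\<Prod>a\<in>Z. (cmod (z0 - a))\<^sup>2))"
  obtain N1 where N1: "cmod z0 < real N1" using reals_Archimedean2 by blast
  obtain N2 where N2: "inverse (real (Suc N2)) < infdist z0 K" using reals_Archimedean[OF K_pos[OF z0(1)]] by blast
  \<comment> \<open>The offsets put \<open>z0\<close> into every \<open>D j\<close>, and they keep
    \<open>R j\<close> positive.\<close>
  define R where "R j = real (j + N1 + Suc N2)" for j
  have R: "0 < R j" for j by (simp add: R_def)
  define D where "D j = {z. cmod z < R j} \<inter> {z. 1 / R j < infdist z K}" for j
  have D: "open (D j)" "D j \<subseteq> D (Suc j)" "bounded (D j)" "z0 \<in> D j" for j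
  proof -
    show "open (D j)" unfolding D_def by (intro open_Int open_Collect_less continuous_intros)
    have "1 / R (Suc j) \<le> 1 / R j" using R[of j] by (intro divide_left_mono) (auto simp: R_def)
    then show "D j \<subseteq> D (Suc j)" by (auto simp: D_def R_def)
    have "D j \<subseteq> ball 0 (R j)" by (auto simp: D_def)
    then show "bounded (D j)" by (rule bounded_subset[OF bounded_ball])
    have "1 / R j \<le> inverse (real (Suc N2))" unfolding R_def by (simp add: field_simps)
    then show "z0 \<in> D j" using N1 N2 by (simp add: D_def R_def)
  qed
  have UD: "(\<Union>j. D j) = - K"
  proof (intro equalityI subsetI)
    fix z assume "z \<in> (\<Union>j. D j)"
    then obtain j where "z \<in> D j" by blast
    then have "0 < infdist z K" using R[of j] less_trans[of 0 "1 / R j" "infdist z K"] by (simp add: D_def)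
    then show "z \<in> - K" using K_iff by auto
  next
    fix z assume "z \<in> - K"
    then have z: "0 < infdist z K" using K_pos by simp
    obtain m1 where m1: "cmod z < real m1" using reals_Archimedean2 by blast
    obtain m2 where m2: "inverse (real (Suc m2)) < infdist z K" using reals_Archimedean[OF z] by blast
    have "1 / R (m1 + Suc m2) \<le> inverse (real (Suc m2))" unfolding R_def by (simp add: field_simps)
    then have "z \<in> D (m1 + Suc m2)" using m1 m2 by (simp add: D_def R_def)
    then show "z \<in> (\<Union>j. D j)" by blast
  qed
  define e where "e j = 1 / real (Suc j)" for j
  have e: "0 < e j" "e j \<le> 1" for j by (simp_all add: e_def)
  \<comment> \<open>The summand 1 in the numerators makes every quotient at least 1, so these
    weights dominate the ones without poles; lower bounds on compact sets and finiteness of the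
    original norm follow.\<close>
  define W where "W j z = exp (- moll \<psi> (e j) z) * (\<Prod>a\<in>Z. ((cmod (z - a))\<^sup>2 + 1) / ((cmod (z - a))\<^sup>2 + e j))" for j z
  define W' where "W' z = exp (- real_of_ereal (\<psi> z)) * (\<Prod>a\<in>Z. ((cmod (z - a))\<^sup>2 + 1) / (cmod (z - a))\<^sup>2)" for z
  define good where "good j f \<longleftrightarrow> f holomorphic_on D j \<and> f z0 = 1 \<and> (\<integral>\<^sup>+z\<in>D j. ennreal ((cmod (f z))\<^sup>2 * W j z) \<partial>lborel) \<le> ennreal B" for j f
  have "\<exists>f. good j f" for j
  proof -
    \<comment> \<open>The larger radius and the halved distance leave room for an open
      \<open>U\<close> with \<open>closure (D j) \<subseteq> U \<subseteq> L\<close>, and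
      \<open>L\<close> still avoids \<open>K\<close>.\<close>
    define L where "L = {z. cmod z \<le> R j + 1} \<inter> {z. 1 / (2 * R j) \<le> infdist z K}"
    define U where "U = {z. cmod z < R j + 1} \<inter> {z. 1 / (2 * R j) < infdist z K}"
    have UL: "U \<subseteq> L" by (auto simp: U_def L_def)
    have "L = cball 0 (R j + 1) \<inter> {z. 1 / (2 * R j) \<le> infdist z K}" by (auto simp: L_def)
    moreover have "closed {z. 1 / (2 * R j) \<le> infdist z K}" by (intro closed_Collect_le continuous_intros)
    ultimately have "compact L" by (simp add: compact_Int_closed)
    moreover have LK: "L \<inter> K1 = {}"
    proof -
      have "infdist z K = 0" if "z \<in> K1" for z using that K1(2) K_iff by blast
      moreover have "0 < 1 / (2 * R j)" using R[of j] by simp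
      ultimately show ?thesis by (fastforce simp: L_def)
    qed
    ultimately obtain n ws where n: "0 < (n::nat)" "\<forall>i<n. ws i \<in> K1"
      "\<forall>z\<in>L. real n * (ln (1 + cmod z) - M) \<le> (\<Sum>i<n. ln (cmod (z - ws i)))"
      using pot[of L] by blast
    have a1: "ws i \<in> cball 0 r" if "i < n" for i using n(2) K1(3) that by blast
    have a2: "ws i \<notin> U" if "i < n" for i using n(2) LK UL that by blast
    have a3: "real n * (ln (1 + cmod z) - M) \<le> (\<Sum>i<n. ln (cmod (z - ws i)))" if "z \<in> U" for z using n(3) UL that by blast
    obtain h h_z h_zz h_zb where h: "C2_real U h h_z h_zz h_zb" "\<And>z. z \<in> U \<Longrightarrow> h_zb z = 0"
      "\<And>z. z \<in> U \<Longrightarrow> ln (1 + cmod z) + C \<le> h z" "\<And>z. z \<in> U \<Longrightarrow> h z \<le> ln (cmod z + r) + M + C"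
      by (rule log_potential_C2[OF n(1) a1 a2 a3]) blast+
    have U: "open U" unfolding U_def by (intro open_Int open_Collect_less continuous_intros)
    have DU: "closure (D j) \<subseteq> U"
    proof -
      have "closure (D j) \<subseteq> {z. cmod z \<le> R j} \<inter> {z. 1 / R j \<le> infdist z K}"
        by (rule closure_minimal) (auto simp: D_def intro!: closed_Int closed_Collect_le continuous_intros)
      moreover have "1 / (2 * R j) < 1 / R j" using R[of j] by (intro divide_strict_left_mono) auto
      ultimately show ?thesis by (fastforce simp: U_def)
    qed
    have "z0 \<in> U" using D(4)[of j] DU closure_subset by blast
    then have hH: "h z0 \<le> H" unfolding H_def by (rule h(4))
    obtain f where "f holomorphic_on D j" "f z0 = 1"
      "(\<integral>\<^sup>+z\<in>D j. ennreal ((cmod (f z))\<^sup>2 * (exp (- moll \<psi> (e j) z) * (\<Prod>a\<in>Z. ((cmod (z - a))\<^sup>2 + 1) / ((cmod (z - a))\<^sup>2 + e j)))) \<partial>lborel) \<le> ennreal B"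
      unfolding B_def by (rule interpolation_bounded[OF \<psi> D(1,3,4) U DU h(1-3) C Z p hH e(1) e(1)])
    then show ?thesis unfolding W_def good_def by blast
  qed
  then have "\<forall>j. \<exists>f. good j f" ..
  from choice[OF this] obtain f where "\<forall>j. good j (f j)" ..
  then have f: "\<And>j. f j holomorphic_on D j" "\<And>j. f j z0 = 1" "\<And>j. (\<integral>\<^sup>+z\<in>D j. ennreal ((cmod (f j z))\<^sup>2 * W j z) \<partial>lborel) \<le> ennreal B"
    by (simp_all add: good_def)
  have qe: "0 < (cmod (z - a))\<^sup>2 + e j" for z a j using e(1)[of j] by (simp add: add_nonneg_pos)
  have Wm: "W j \<in> borel_measurable borel" for j
  proof (rule borel_measurable_continuous_onI)
    show "continuous_on UNIV (W j)" unfolding W_def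
      using qe[of _ _ j] by (intro continuous_intros moll_continuous[OF \<psi> e(1)]) (auto simp: less_imp_neq[THEN not_sym])
  qed
  have Wp: "0 \<le> W j z" for j z unfolding W_def
    using qe[of z _ j] by (intro mult_nonneg_nonneg prod_nonneg divide_nonneg_pos) auto
  have low: "\<exists>c>0. \<forall>j. \<forall>z\<in>L. c \<le> W j z" if L: "compact L" "L \<subseteq> (\<Union>j. D j)" for L
  proof -
    obtain s where s: "\<And>z. z \<in> L \<Longrightarrow> cmod z \<le> s" using compact_imp_bounded[OF L(1)] unfolding bounded_iff by blast
    obtain c where c: "\<And>z. z \<in> cball 0 (s + 1) \<Longrightarrow> \<psi> z < ereal c"
      by (rule subharmonic_bounded_above[OF \<psi> compact_cball[of 0 "s + 1"]]) blast
    have "exp (- c) \<le> W j z" if z: "z \<in> L" for j z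
    proof -
      have "moll \<psi> (e j) z \<le> c"
      proof (rule moll_neg_shift(2)[OF \<psi> e(1)])
        fix w assume "w \<in> ball z (e j)"
        then have "cmod w \<le> s + 1" using s[OF z] e(2)[of j] norm_triangle_sub[of w z] by (simp add: dist_norm norm_minus_commute)
        then show "\<psi> w \<le> ereal c" using c[of w] by simp
      qed
      moreover have "1 \<le> (\<Prod>a\<in>Z. ((cmod (z - a))\<^sup>2 + 1) / ((cmod (z - a))\<^sup>2 + e j))"
        using qe[of z _ j] e(2)[of j] by (intro prod_ge_1) auto
      ultimately have "exp (- c) * 1 \<le> W j z" unfolding W_def by (intro mult_mono) auto
      then show ?thesis by simp
    qed
    then show ?thesis by (intro exI[of _ "exp (- c)"]) auto
  qed
  have fin: "AE z in lborel. \<psi> z \<noteq> - \<infinity> \<and> (\<forall>a\<in>Z. z \<noteq> a)"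
    by (intro AE_conjI subharmonic_AE_finite[OF \<psi>] AE_finite_allI Z(1) AE_lborel_singleton)
  have lim: "(\<lambda>j. W j z) \<longlonglongrightarrow> W' z" if z: "\<psi> z \<noteq> - \<infinity> \<and> (\<forall>a\<in>Z. z \<noteq> a)" for z
  proof -
    have "\<psi> z \<noteq> \<infinity>" using \<psi> by (simp add: subharmonic_on_def)
    with z obtain q where q: "\<psi> z = ereal q" by (cases "\<psi> z") auto
    have "e \<longlonglongrightarrow> 0" unfolding e_def by (rule LIMSEQ_Suc[OF lim_1_over_n])
    then have "(\<lambda>j. W j z) \<longlonglongrightarrow> exp (- q) * (\<Prod>a\<in>Z. ((cmod (z - a))\<^sup>2 + 1) / ((cmod (z - a))\<^sup>2 + 0))"
      unfolding W_def using z by (intro tendsto_intros moll_tendsto[OF \<psi> q, folded e_def]) auto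
    then show ?thesis by (simp add: W'_def q)
  qed
  have limAE: "AE z in lborel. z \<in> (\<Union>j. D j) \<longrightarrow> (\<lambda>j. W j z) \<longlonglongrightarrow> W' z"
    using fin by eventually_elim (use lim in blast)
  have "\<exists>\<sigma> g. strict_mono (\<sigma> :: nat \<Rightarrow> nat) \<and> g holomorphic_on - K \<and> (\<forall>z\<in>-K. (\<lambda>j. f (\<sigma> j) z) \<longlonglongrightarrow> g z) \<and>
      (\<integral>\<^sup>+z\<in>-K. ennreal ((cmod (g z))\<^sup>2 * W' z) \<partial>lborel) \<le> ennreal B"
  proof (rule bergman_limit[OF D(1,2) f(1) Wm Wp low f(3) tendsto_const limAE], unfold UD)
    fix g \<sigma> assume "strict_mono (\<sigma> :: nat \<Rightarrow> nat)" "g holomorphic_on - K" "\<And>z. z \<in> - K \<Longrightarrow> (\<lambda>j. f (\<sigma> j) z) \<longlonglongrightarrow> g z"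
      "(\<integral>\<^sup>+z\<in>-K. ennreal ((cmod (g z))\<^sup>2 * W' z) \<partial>lborel) \<le> ennreal B"
    then show ?thesis by (intro exI[of _ \<sigma>] exI[of _ g]) simp
  qed
  then obtain \<sigma> g where \<sigma>: "strict_mono (\<sigma> :: nat \<Rightarrow> nat)" and g: "g holomorphic_on - K"
    "\<forall>z\<in>-K. (\<lambda>j. f (\<sigma> j) z) \<longlonglongrightarrow> g z"
    "(\<integral>\<^sup>+z\<in>-K. ennreal ((cmod (g z))\<^sup>2 * W' z) \<partial>lborel) \<le> ennreal B"
    by (elim exE conjE)
  have "(\<lambda>j. f (\<sigma> j) z0) \<longlonglongrightarrow> g z0" using z0 g(2) by simp
  then have g1: "g z0 = 1" unfolding f(2) by (simp add: LIMSEQ_const_iff)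
  have ga: "g a = 0" if a: "a \<in> Z" "a \<notin> K" for a
  proof (rule ccontr)
    assume "g a \<noteq> 0"
    have "open (- K)" using K(1) by (simp add: open_Compl)
    then have "isCont g a" using holomorphic_on_imp_continuous_on[OF g(1)] a(2) by (simp add: continuous_on_eq_continuous_at)
    then have "isCont (\<lambda>z. cmod (g z)) a" by (intro continuous_intros)
    then have "\<forall>\<^sub>F z in at a. cmod (g a) / 2 < cmod (g z)"
      using \<open>g a \<noteq> 0\<close> unfolding isCont_def by (intro order_tendstoD(1)) auto
    then obtain \<rho>1 where \<rho>1: "0 < \<rho>1" "\<And>z. z \<noteq> a \<Longrightarrow> dist z a < \<rho>1 \<Longrightarrow> cmod (g a) / 2 < cmod (g z)"
      unfolding eventually_at by auto
    obtain \<rho>2 where \<rho>2: "0 < \<rho>2" "ball a \<rho>2 \<subseteq> - K"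
      using \<open>open (- K)\<close> a(2) by (meson ComplI openE)
    define \<rho> where "\<rho> = min \<rho>1 \<rho>2"
    have \<rho>: "0 < \<rho>" "ball a \<rho> \<subseteq> - K" using \<rho>1(1) \<rho>2 by (auto simp: \<rho>_def)
    obtain c where c: "\<And>z. z \<in> cball a \<rho> \<Longrightarrow> \<psi> z < ereal c"
      by (rule subharmonic_bounded_above[OF \<psi> compact_cball[of a \<rho>]]) blast
    define b where "b = (cmod (g a) / 2)\<^sup>2 * exp (- c)"
    have b: "0 < b" using \<open>g a \<noteq> 0\<close> by (simp add: b_def)
    have "ennreal b * (\<integral>\<^sup>+z\<in>ball a \<rho>. ennreal (1 / (cmod (z - a))\<^sup>2) \<partial>lborel) = (\<integral>\<^sup>+z. ennreal b * (ennreal (1 / (cmod (z - a))\<^sup>2) * indicator (ball a \<rho>) z) \<partial>lborel)"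
      by (rule nn_integral_cmult[symmetric], intro borel_measurable_times_ennreal borel_measurable_indicator) auto
    also have "\<dots> \<le> (\<integral>\<^sup>+z\<in>-K. ennreal ((cmod (g z))\<^sup>2 * W' z) \<partial>lborel)"
    proof (rule nn_integral_mono_AE)
      show "AE z in lborel. ennreal b * (ennreal (1 / (cmod (z - a))\<^sup>2) * indicator (ball a \<rho>) z) \<le> ennreal ((cmod (g z))\<^sup>2 * W' z) * indicator (- K) z"
        using fin
      proof eventually_elim
        case (elim z)
        show ?case
        proof (cases "z \<in> ball a \<rho>")
          case True
          have za: "z \<noteq> a" using elim a(1) by blast
          have "cmod (g a) / 2 \<le> cmod (g z)" using \<rho>1(2)[OF za] True by (simp add: \<rho>_def dist_commute less_imp_le)
          then have "(cmod (g a) / 2)\<^sup>2 \<le> (cmod (g z))\<^sup>2" by (intro power_mono) auto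
          moreover have "exp (- c) \<le> exp (- real_of_ereal (\<psi> z))"
            using c[of z] True elim by (cases "\<psi> z") auto
          moreover have "1 / (cmod (z - a))\<^sup>2 \<le> (\<Prod>a\<in>Z. ((cmod (z - a))\<^sup>2 + 1) / (cmod (z - a))\<^sup>2)"
          proof -
            have "1 / (cmod (z - a))\<^sup>2 * 1 \<le> ((cmod (z - a))\<^sup>2 + 1) / (cmod (z - a))\<^sup>2 * (\<Prod>a\<in>Z - {a}. ((cmod (z - a))\<^sup>2 + 1) / (cmod (z - a))\<^sup>2)"
              using elim by (intro mult_mono divide_right_mono prod_ge_1) auto
            then show ?thesis by (simp add: prod.remove[OF Z(1) a(1)])
          qed
          ultimately have "(cmod (g a) / 2)\<^sup>2 * (exp (- c) * (1 / (cmod (z - a))\<^sup>2)) \<le> (cmod (g z))\<^sup>2 * W' z"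
            unfolding W'_def by (intro mult_mono) auto
          then have "ennreal (b * (1 / (cmod (z - a))\<^sup>2)) \<le> ennreal ((cmod (g z))\<^sup>2 * W' z)"
            by (intro ennreal_leI) (simp add: b_def mult.assoc)
          moreover have "ennreal b * (ennreal (1 / (cmod (z - a))\<^sup>2) * indicator (ball a \<rho>) z) = ennreal (b * (1 / (cmod (z - a))\<^sup>2))"
            using True b by (simp add: ennreal_mult'[symmetric])
          moreover have "z \<in> - K" using True \<rho>(2) by blast
          then have "indicator (- K) z = (1 :: ennreal)" by simp
          ultimately show ?thesis by (simp only: mult_1_right)
        qed simp
      qed
    qed
    also have "\<dots> \<le> ennreal B" by (rule g(3))
    finally show False
      unfolding nn_integral_inverse_sq_infinite[OF \<rho>(1)] using b by (simp add: ennreal_mult_top top_unique)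
  qed
  define G where "G z = (if z \<in> - K then g z else 0)" for z
  show ?thesis
  proof (rule that[of G])
    show "G z0 = 1" using z0 g1 by (simp add: G_def)
    \<comment> \<open>For \<open>a\<close> in \<open>K\<close> this is the convention of extending
      by 0.\<close>
    show "G a = 0" if "a \<in> Z" for a using ga[OF that] by (simp add: G_def)
    have "G holomorphic_on - K" using g(1) by (rule holomorphic_transform) (simp add: G_def)
    moreover have "bergman_sqnorm \<psi> (- K) G \<le> ennreal B"
    proof -
      have "bergman_sqnorm \<psi> (- K) G \<le> (\<integral>\<^sup>+z\<in>-K. ennreal ((cmod (g z))\<^sup>2 * W' z) \<partial>lborel)"
        unfolding bergman_sqnorm_def
      proof (rule nn_integral_mono_AE)
        show "AE z in lborel. ennreal ((cmod (G z))\<^sup>2) * exp_ereal (- \<psi> z) * indicator (- K) z \<le> ennreal ((cmod (g z))\<^sup>2 * W' z) * indicator (- K) z"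
          using fin
        proof eventually_elim
          case (elim z)
          have "\<psi> z \<noteq> \<infinity>" using \<psi> by (simp add: subharmonic_on_def)
          with elim obtain q where q: "\<psi> z = ereal q" by (cases "\<psi> z") auto
          have "exp (- q) * 1 \<le> W' z" unfolding W'_def using elim q
            by (intro mult_mono prod_ge_1) auto
          then have "ennreal ((cmod (g z))\<^sup>2 * exp (- q)) \<le> ennreal ((cmod (g z))\<^sup>2 * W' z)"
            by (intro ennreal_leI mult_left_mono) auto
          then show ?case by (cases "z \<in> - K") (simp_all add: G_def exp_ereal_minus[OF q] ennreal_mult')
        qed
      qed
      then show ?thesis using g(3) by (rule order_trans)
    qed
    then have "bergman_sqnorm \<psi> (- K) G < \<infinity>" by (rule le_less_trans) simp
    ultimately show "G \<in> bergman_space \<psi> (- K)" by (simp add: bergman_space_def G_def)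
  qed
qed

section \<open>Linear independence\<close>

lemma subharmonic_infinite_finite_values:
  assumes \<psi>: "subharmonic_on UNIV \<psi>" and U: "open U" "U \<noteq> {}"
  shows "infinite {z \<in> U. \<psi> z \<noteq> - \<infinity>}"
proof
  assume fin: "finite {z \<in> U. \<psi> z \<noteq> - \<infinity>}"
  have "AE z in lborel. \<forall>a\<in>{z \<in> U. \<psi> z \<noteq> - \<infinity>}. z \<noteq> a"
    by (intro AE_finite_allI fin AE_lborel_singleton)
  then have "AE z in lborel. z \<notin> U" using subharmonic_AE_finite[OF \<psi>] by eventually_elim blast
  moreover have "U \<in> sets lborel" using U(1) by simp
  ultimately have 0: "emeasure lborel U = 0" by (simp add: AE_iff_measurable[of U])
  obtain a \<rho> where a: "0 < \<rho>" "ball a \<rho> \<subseteq> U" using U by (meson ex_in_conv openE)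
  have "emeasure lborel (ball a \<rho>) \<le> emeasure lborel U" using a(2) U(1) by (intro emeasure_mono) auto
  then show False using 0 a(1) by (simp add: emeasure_ball_complex)
qed

lemma span_vanishing:
  assumes "\<And>g. g \<in> S \<Longrightarrow> g w = 0" and "g \<in> cfun.span S"
  shows "g w = 0"
proof -
  have "cfun.subspace {g. g w = 0}" by (simp add: cfun.subspace_def cscale_def)
  then have "cfun.span S \<subseteq> {g. g w = 0}" using assms(1) by (intro cfun.span_minimal) auto
  then show ?thesis using assms(2) by blast
qed

text \<open>The functions with smaller index all vanish at \<open>x m\<close>, and so does their
  span, whereas \<open>f m\<close> takes the value 1 there.\<close>

lemma triangular_independent:
  assumes diag: "\<And>i. i < n \<Longrightarrow> f i (x i) = 1" and upper: "\<And>i j. i < j \<Longrightarrow> j < n \<Longrightarrow> f i (x j) = 0"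
  shows "cfun.independent (f ` {..<n}) \<and> card (f ` {..<n}) = n"
proof -
  have "cfun.independent (f ` {..<m}) \<and> card (f ` {..<m}) = m" if "m \<le> n" for m
    using that
  proof (induction m)
    case (Suc m)
    have "f m \<notin> cfun.span (f ` {..<m})"
    proof
      assume "f m \<in> cfun.span (f ` {..<m})"
      then have "f m (x m) = 0" by (rule span_vanishing[rotated]) (use upper Suc.prems in auto)
      then show False using diag[of m] Suc.prems by simp
    qed
    note span = this
    have IH: "cfun.independent (f ` {..<m})" "card (f ` {..<m}) = m" using Suc by simp_all
    have "f m \<notin> f ` {..<m}" using span cfun.span_superset by (metis subsetD)
    then have "card (insert (f m) (f ` {..<m})) = Suc m" using IH(2) by (simp add: card_insert_disjoint)
    moreover have "cfun.independent (insert (f m) (f ` {..<m}))" by (rule cfun.independent_insertI[OF span IH(1)])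
    ultimately show ?case by (simp add: lessThan_Suc)
  qed (simp add: cfun.independent_empty)
  then show ?thesis by simp
qed

text \<open>Interpolation nodes must be points off \<open>K\<close> at which \<open>\<psi>\<close>
  is finite; there are infinitely many, since \<open>\<psi>\<close> is \<open>- \<infinity>\<close>
  on a null set only. Prescribing zeros at later nodes gives triangular families of any
  size.\<close>

lemma nonpolar_infinite_dimensional:
  assumes K: "closed K" "K \<noteq> UNIV" "\<not> polar K" and \<psi>: "subharmonic_on UNIV \<psi>"
  shows "infinite_dimensional (bergman_space \<psi> (- K))"
  unfolding infinite_dimensional_def
proof
  assume "\<exists>B. finite B \<and> B \<subseteq> bergman_space \<psi> (- K) \<and> bergman_space \<psi> (- K) \<subseteq> cfun.span B"
  then obtain B where B: "finite B" "bergman_space \<psi> (- K) \<subseteq> cfun.span B" by blast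
  define n where "n = Suc (card B)"
  have "infinite {z \<in> - K. \<psi> z \<noteq> - \<infinity>}"
    using K(1,2) by (intro subharmonic_infinite_finite_values[OF \<psi>]) (auto simp: open_Compl)
  then obtain x :: "nat \<Rightarrow> complex" where x: "inj x" "range x \<subseteq> {z \<in> - K. \<psi> z \<noteq> - \<infinity>}"
    using infinite_countable_subset by blast
  have "\<exists>f. f \<in> bergman_space \<psi> (- K) \<and> f (x i) = 1 \<and> (\<forall>j\<in>{i<..<n}. f (x j) = 0)" for i
  proof -
    have "x i \<notin> K" "\<psi> (x i) \<noteq> - \<infinity>" "x i \<notin> x ` {i<..<n}" using x by (auto dest: injD)
    then obtain f where "f \<in> bergman_space \<psi> (- K)" "f (x i) = 1" "\<And>a. a \<in> x ` {i<..<n} \<Longrightarrow> f a = 0"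
      using bergman_interpolation[OF K(1,3) \<psi>, of "x i" "x ` {i<..<n}"] by blast
    then show ?thesis by auto
  qed
  then have "\<forall>i. \<exists>f. f \<in> bergman_space \<psi> (- K) \<and> f (x i) = 1 \<and> (\<forall>j\<in>{i<..<n}. f (x j) = 0)" ..
  from choice[OF this] obtain f where f: "\<forall>i. f i \<in> bergman_space \<psi> (- K) \<and> f i (x i) = 1 \<and> (\<forall>j\<in>{i<..<n}. f i (x j) = 0)" ..
  have "cfun.independent (f ` {..<n}) \<and> card (f ` {..<n}) = n"
    by (rule triangular_independent[of n f x]) (use f in auto)
  moreover have "f ` {..<n} \<subseteq> cfun.span B" using f B(2) by blast
  ultimately have "n \<le> card B" using cfun.independent_span_bound[OF B(1), of "f ` {..<n}"] by simp
  then show False by (simp add: n_def)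
qed

section \<open>Removability of closed polar sets\<close>

lemma integrable_indicator_continuous:
  fixes f :: "complex \<Rightarrow> 'b::{banach,second_countable_topology}"
  assumes "compact S" "continuous_on S f"
  shows "integrable lborel (\<lambda>z. indicator S z *\<^sub>R f z)"
  by (rule borel_integrable_compact[OF assms, unfolded set_integrable_def])

text \<open>The dbar-derivative of \<open>\<alpha>\<^sup>2 * u_z / u\<close> has integral 0. Its
  Laplacian term has a sign, and the term \<open>- \<alpha>\<^sup>2 * |u_z / u|^2\<close> is
  controlled by the cross term with the derivative of \<alpha>. The bound for the gradient of
  \<open>ln u\<close> does not depend on \<open>u\<close>, however large \<open>u\<close>
  is.\<close>

lemma caccioppoli:
  assumes U: "open U" and u: "C2_real U u u_z u_zz u_zb" "\<And>z. z \<in> U \<Longrightarrow> u_zb z \<le> 0" "\<And>z. z \<in> U \<Longrightarrow> 0 < u z"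
    and \<alpha>: "\<And>z. has_wirtinger (\<lambda>z. complex_of_real (\<alpha> z)) (\<alpha>_z z) (cnj (\<alpha>_z z)) z" and c\<alpha>: "continuous_on UNIV \<alpha>_z"
    and S: "compact S" "S \<subseteq> U" and 0: "\<And>z. z \<notin> S \<Longrightarrow> \<alpha> z = 0"
  shows "(\<integral>z. indicator S z *\<^sub>R ((\<alpha> z)\<^sup>2 * (cmod (u_z z) / u z)\<^sup>2) \<partial>lborel) \<le> 4 * (\<integral>z. indicator S z *\<^sub>R (cmod (\<alpha>_z z))\<^sup>2 \<partial>lborel)"
proof -
  note C = C2_realD[OF u(1)]
  have u0: "u z \<noteq> 0" if "z \<in> U" for z using u(3)[OF that] by simp
  have c\<alpha>0: "continuous_on UNIV \<alpha>"
  proof -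
    have "continuous_on UNIV (\<lambda>z. Re (complex_of_real (\<alpha> z)))"
      by (intro continuous_on_Re has_wirtinger_imp_continuous_on[OF \<alpha>])
    then show ?thesis by simp
  qed
  note [continuous_intros] = continuous_on_subset[OF c\<alpha>0 subset_UNIV] continuous_on_subset[OF c\<alpha> subset_UNIV] C(3-6)
  let ?i = "\<lambda>z. complex_of_real (inverse (u z))" and ?a = "\<lambda>z. complex_of_real (\<alpha> z)"
  let ?Xa = "\<lambda>z. (?a z * ?a z * ?i z) * u_zz z + ((?a z * ?a z) * (of_real (- (inverse (u z) * inverse (u z))) * u_z z) + (?a z * \<alpha>_z z + \<alpha>_z z * ?a z) * ?i z) * u_z z"
  let ?Xb = "\<lambda>z. (?a z * ?a z * ?i z) * of_real (u_zb z) + ((?a z * ?a z) * (of_real (- (inverse (u z) * inverse (u z))) * cnj (u_z z)) + (?a z * cnj (\<alpha>_z z) + cnj (\<alpha>_z z) * ?a z) * ?i z) * u_z z"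
  have X: "has_wirtinger (\<lambda>z. (?a z * ?a z * ?i z) * u_z z) (?Xa z) (?Xb z) z" if z: "z \<in> U" for z
  proof (intro has_wirtinger_mult \<alpha> C(2)[OF z])
    show "has_wirtinger ?i (of_real (- (inverse (u z) * inverse (u z))) * u_z z) (of_real (- (inverse (u z) * inverse (u z))) * cnj (u_z z)) z"
      by (rule has_wirtinger_real_chain[OF C(1)[OF z]]) (use u0[OF z] in \<open>auto intro!: derivative_eq_intros\<close>)
  qed
  have ca: "continuous_on U ?Xa" using u0 by (intro continuous_intros) auto
  have cb: "continuous_on U ?Xb" using u0 by (intro continuous_intros) auto
  have X0: "(?a z * ?a z * ?i z) * u_z z = 0" if "z \<in> U" "z \<notin> S" for z using 0[OF that(2)] by simp
  have iX: "integrable lborel (\<lambda>z. indicator S z *\<^sub>R ?Xb z)" "(\<integral>z. indicator S z *\<^sub>R ?Xb z \<partial>lborel) = 0"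
    by (rule integral_wirtinger_local(3)[OF U X ca cb S X0], assumption, assumption, assumption)
       (rule integral_wirtinger_local(4)[OF U X ca cb S X0], assumption, assumption, assumption)
  let ?P = "\<lambda>z. (\<alpha> z)\<^sup>2 * (cmod (u_z z) / u z)\<^sup>2" and ?Q = "\<lambda>z. (cmod (\<alpha>_z z))\<^sup>2"
  have iP: "integrable lborel (\<lambda>z. indicator S z *\<^sub>R ?P z)"
    using u0 S(2) by (intro integrable_indicator_continuous S(1) continuous_on_subset[OF _ S(2)] continuous_intros) auto
  have iQ: "integrable lborel (\<lambda>z. indicator S z *\<^sub>R ?Q z)"
    by (intro integrable_indicator_continuous S(1) continuous_intros)
  have le: "Re (?Xb z) \<le> 2 * ?Q z - 1 / 2 * ?P z" if z: "z \<in> U" for z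
  proof -
    define v where "v = u_z z * ?i z"
    have v: "cmod v = cmod (u_z z) / u z" using u(3)[OF z] by (simp add: v_def norm_mult norm_inverse divide_inverse)
    have "?Xb z = of_real ((\<alpha> z)\<^sup>2 * (inverse (u z) * u_zb z)) - of_real ((\<alpha> z)\<^sup>2) * (v * cnj v) + 2 * ?a z * cnj (\<alpha>_z z) * v"
      by (simp add: v_def power2_eq_square algebra_simps)
    also have "v * cnj v = of_real ((cmod v)\<^sup>2)" by (rule complex_norm_square[symmetric])
    finally have "Re (?Xb z) = (\<alpha> z)\<^sup>2 * (inverse (u z) * u_zb z) - (\<alpha> z)\<^sup>2 * (cmod v)\<^sup>2 + Re (2 * ?a z * cnj (\<alpha>_z z) * v)"
      by (simp only: of_real_mult[symmetric] plus_complex.simps minus_complex.simps Re_complex_of_real)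
    moreover have "(\<alpha> z)\<^sup>2 * (inverse (u z) * u_zb z) \<le> 0"
      using u(2,3)[OF z] by (intro mult_nonneg_nonpos) auto
    moreover have "Re (2 * ?a z * cnj (\<alpha>_z z) * v) \<le> 2 * \<bar>\<alpha> z\<bar> * cmod (\<alpha>_z z) * cmod v"
      using complex_Re_le_cmod[of "2 * ?a z * cnj (\<alpha>_z z) * v"] by (simp add: norm_mult)
    moreover have "2 * \<bar>\<alpha> z\<bar> * cmod (\<alpha>_z z) * cmod v \<le> 1 / 2 * ((\<alpha> z)\<^sup>2 * (cmod v)\<^sup>2) + 2 * ?Q z"
    proof -
      \<comment> \<open>Half of the good term is given up to absorb the cross term, which leaves the
        constant 4 in the end.\<close>
      have "0 \<le> 1 / 2 * (\<bar>\<alpha> z\<bar> * cmod v - 2 * cmod (\<alpha>_z z))\<^sup>2" by simp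
      also have "\<dots> = 1 / 2 * (\<bar>\<alpha> z\<bar>\<^sup>2 * (cmod v)\<^sup>2) + 2 * ?Q z - 2 * \<bar>\<alpha> z\<bar> * cmod (\<alpha>_z z) * cmod v"
        by (simp add: power2_eq_square algebra_simps del: abs_mult_self_eq)
      finally show ?thesis by simp
    qed
    ultimately show ?thesis unfolding v by linarith
  qed
  have "0 = Re (\<integral>z. indicator S z *\<^sub>R ?Xb z \<partial>lborel)" unfolding iX(2) by simp
  also have "\<dots> = (\<integral>z. Re (indicator S z *\<^sub>R ?Xb z) \<partial>lborel)" by (rule integral_Re[OF iX(1), symmetric])
  also have "\<dots> \<le> (\<integral>z. 2 * (indicator S z *\<^sub>R ?Q z) - 1 / 2 * (indicator S z *\<^sub>R ?P z) \<partial>lborel)"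
  proof (rule integral_mono)
    show "integrable lborel (\<lambda>z. Re (indicator S z *\<^sub>R ?Xb z))" by (rule integrable_Re[OF iX(1)])
    show "integrable lborel (\<lambda>z. 2 * (indicator S z *\<^sub>R ?Q z) - 1 / 2 * (indicator S z *\<^sub>R ?P z))"
      by (intro Bochner_Integration.integrable_diff integrable_mult_right iP iQ)
    show "Re (indicator S z *\<^sub>R ?Xb z) \<le> 2 * (indicator S z *\<^sub>R ?Q z) - 1 / 2 * (indicator S z *\<^sub>R ?P z)" for z
    proof (cases "z \<in> S")
      case True
      then show ?thesis using le[of z] S(2) by (simp only: indicator_simps scaleR_one) auto
    qed simp
  qed
  also have "\<dots> = 2 * (\<integral>z. indicator S z *\<^sub>R ?Q z \<partial>lborel) - 1 / 2 * (\<integral>z. indicator S z *\<^sub>R ?P z \<partial>lborel)"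
    by (subst Bochner_Integration.integral_diff[OF integrable_mult_right[OF iQ] integrable_mult_right[OF iP]])
       (simp only: integral_mult_right_zero)
  finally show ?thesis by linarith
qed

text \<open>\<open>u\<close> is \<open>C + 1\<close> minus a mollification of \<open>s\<close>. The
  scale is chosen so small that all values of \<open>s\<close> averaged at points of
  \<open>S \<inter> K\<close> lie below \<open>C - E\<close>, which is possible by compactness and
  upper semicontinuity. The last claim bounds \<open>u\<close> independently of the scale where
  \<open>s\<close> is finite.\<close>

lemma polar_cutoff_potential:
  assumes s: "subharmonic_on UNIV s" and K: "closed K" "K \<subseteq> {z. s z = - \<infinity>}" and S: "compact S" "S \<subseteq> cball 0 R"
    and C: "\<And>z. z \<in> cball 0 (R + 1) \<Longrightarrow> s z \<le> ereal C"
  obtains u u_z u_zz u_zb where "C2_real UNIV u u_z u_zz u_zb" "\<And>z. u_zb z \<le> 0" "\<And>z. z \<in> S \<Longrightarrow> 1 \<le> u z"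
    "\<And>z. z \<in> S \<Longrightarrow> z \<in> K \<Longrightarrow> E < u z" "\<And>z q. s z = ereal q \<Longrightarrow> u z \<le> C + 1 - q"
proof -
  have "open {z. s z < ereal (C - E)}" using s by (auto simp: subharmonic_on_def upper_semicontinuous_on_def)
  then have "closed (- {z. s z < ereal (C - E)})" by (rule closed_Compl)
  moreover have "compact (S \<inter> K)" using S(1) K(1) by (rule compact_Int_closed)
  moreover have "(S \<inter> K) \<inter> - {z. s z < ereal (C - E)} = {}" using K(2) by auto
  ultimately obtain d where d: "0 < d" "\<forall>x\<in>S \<inter> K. \<forall>y\<in>- {z. s z < ereal (C - E)}. d \<le> dist x y"
    using separate_compact_closed[of "S \<inter> K" "- {z. s z < ereal (C - E)}"] by blast
  define \<epsilon> where "\<epsilon> = min d 1"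
  have \<epsilon>: "0 < \<epsilon>" "\<epsilon> \<le> d" "\<epsilon> \<le> 1" using d(1) by (auto simp: \<epsilon>_def)
  show ?thesis
  proof (rule that)
    show "C2_real UNIV (\<lambda>z. (- 1) * moll s \<epsilon> z + (C + 1)) (\<lambda>z. of_real (- 1) * moll_z s \<epsilon> z + 0)
       (\<lambda>z. of_real (- 1) * moll_zz s \<epsilon> z + 0) (\<lambda>z. (- 1) * moll_zb s \<epsilon> z + 0)"
      by (intro C2_real_add C2_real_cmult C2_real_const moll_C2 s \<epsilon>(1))
    show "(- 1) * moll_zb s \<epsilon> z + 0 \<le> 0" for z using moll_zb_nonneg[OF s \<epsilon>(1), of z] by simp
    show "1 \<le> (- 1) * moll s \<epsilon> z + (C + 1)" if z: "z \<in> S" for z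
    proof -
      have "moll s \<epsilon> z \<le> C"
      proof (rule moll_neg_shift(2)[OF s \<epsilon>(1)])
        fix w assume "w \<in> ball z \<epsilon>"
        then have "cmod w \<le> R + 1" using z S(2) \<epsilon>(3) norm_triangle_sub[of w z] by (auto simp: dist_norm norm_minus_commute)
        then show "s w \<le> ereal C" by (intro C) simp
      qed
      then show ?thesis by simp
    qed
    show "E < (- 1) * moll s \<epsilon> z + (C + 1)" if z: "z \<in> S" "z \<in> K" for z
    proof -
      have "moll s \<epsilon> z \<le> C - E"
      proof (rule moll_neg_shift(2)[OF s \<epsilon>(1)])
        fix w assume "w \<in> ball z \<epsilon>"
        then have "dist z w < d" using \<epsilon>(2) by simp
        then have "w \<notin> - {z. s z < ereal (C - E)}" using d(2) z by (auto simp: not_le[symmetric])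
        then show "s w \<le> ereal (C - E)" by (simp add: less_imp_le)
      qed
      then show ?thesis by simp
    qed
    show "(- 1) * moll s \<epsilon> z + (C + 1) \<le> C + 1 - q" if "s z = ereal q" for z q
      using moll_ge[OF s \<epsilon>(1), of z] that by simp
  qed
qed

text \<open>Equal to 1 at \<open>t = 1\<close> and to 0 from \<open>exp n\<close> on, with
  derivative of order \<open>1 / (n * t)\<close>: the factor \<open>1 / t\<close> is the one that
  the Caccioppoli inequality controls. The square makes the truncation continuously
  differentiable.\<close>

definition log_cutoff :: "real \<Rightarrow> real \<Rightarrow> real" where
  "log_cutoff n t = (max 0 (1 - ln t / n))\<^sup>2"

definition log_cutoff' :: "real \<Rightarrow> real \<Rightarrow> real" where
  "log_cutoff' n t = - (2 * max 0 (1 - ln t / n)) * (inverse t / n)"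

lemma log_cutoff_DERIV:
  assumes "0 < t" shows "(log_cutoff n has_real_derivative log_cutoff' n t) (at t)"
proof -
  have "((\<lambda>t. (max 0 (1 - ln t / n)) ^ Suc (Suc 0)) has_real_derivative
     (real (Suc (Suc 0)) * (max 0 (1 - ln t / n)) ^ Suc 0) * (0 - inverse t / n)) (at t)"
    by (rule DERIV_chain2[OF pos_power_has_real_derivative])
       (use assms in \<open>intro DERIV_diff DERIV_const DERIV_cdivide DERIV_ln\<close>)
  then show ?thesis unfolding log_cutoff_def[abs_def] log_cutoff'_def by (simp add: power2_eq_square mult.commute mult.left_commute)
qed

lemma log_cutoff_bounds:
  assumes n: "0 < n" and t: "1 \<le> t"
  shows "0 \<le> log_cutoff n t" "log_cutoff n t \<le> 1" "\<bar>log_cutoff' n t\<bar> \<le> 2 / (n * t)"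
proof -
  have m: "0 \<le> max 0 (1 - ln t / n)" "max 0 (1 - ln t / n) \<le> 1" using n t by auto
  then show "0 \<le> log_cutoff n t" "log_cutoff n t \<le> 1" by (auto simp: log_cutoff_def power_le_one)
  have "\<bar>log_cutoff' n t\<bar> = max 0 (1 - ln t / n) * (2 / (n * t))"
    using n t by (simp add: log_cutoff'_def abs_mult field_simps)
  also have "\<dots> \<le> 1 * (2 / (n * t))" using m n t by (intro mult_right_mono) auto
  finally show "\<bar>log_cutoff' n t\<bar> \<le> 2 / (n * t)" by simp
qed

lemma log_cutoff_eq_0: "0 < n \<Longrightarrow> exp n \<le> t \<Longrightarrow> log_cutoff n t = 0"
proof -
  assume a: "0 < n" "exp n \<le> t"
  have "n \<le> ln t" using a(2) by (metis exp_gt_zero ln_exp ln_mono)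
  then have "1 - ln t / n \<le> 0" using a(1) by simp
  then show ?thesis by (simp add: log_cutoff_def)
qed

text \<open>The cut-off is supported away from \<open>K\<close> and its contribution is of order \<open>1 / n\<close> by the
  Caccioppoli inequality.\<close>

lemma polar_dbar_bound:
  assumes K: "closed K" and u: "C2_real UNIV u u_z u_zz u_zb" "\<And>z. u_zb z \<le> 0" "\<And>z. z \<in> S \<Longrightarrow> 1 \<le> u z"
    and n: "0 < n" and E: "\<And>z. z \<in> S \<Longrightarrow> z \<in> K \<Longrightarrow> exp n < u z"
    and \<alpha>: "\<And>z. has_wirtinger (\<lambda>z. complex_of_real (\<alpha> z)) (\<alpha>_z z) (cnj (\<alpha>_z z)) z" and c\<alpha>: "continuous_on UNIV \<alpha>_z"
    and S: "compact S" and 0: "\<And>z. z \<notin> S \<Longrightarrow> \<alpha> z = 0"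
    and f: "f holomorphic_on - K" and L2: "integrable lborel (\<lambda>z. indicator (S - K) z *\<^sub>R (cmod (f z))\<^sup>2)"
  shows "cmod (\<integral>z. indicator (S - K) z *\<^sub>R (of_real (log_cutoff n (u z)) * (f z * cnj (\<alpha>_z z))) \<partial>lborel)
    \<le> ((\<integral>z. indicator (S - K) z *\<^sub>R (cmod (f z))\<^sup>2 \<partial>lborel) + 4 * (\<integral>z. indicator S z *\<^sub>R (cmod (\<alpha>_z z))\<^sup>2 \<partial>lborel)) / n"
proof -
  note C = C2_realD[OF u(1)]
  have c\<alpha>0: "continuous_on UNIV \<alpha>"
  proof -
    have "continuous_on UNIV (\<lambda>z. Re (complex_of_real (\<alpha> z)))"
      by (intro continuous_on_Re has_wirtinger_imp_continuous_on[OF \<alpha>])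
    then show ?thesis by simp
  qed
  define V where "V = {z. 0 < u z}"
  have V: "open V" unfolding V_def by (intro open_Collect_less continuous_intros C(5))
  have SV: "S \<subseteq> V" using u(3) by (fastforce simp: V_def)
  have oK: "open (- K)" using K by (rule open_Compl)
  define U where "U = V \<inter> - K"
  have U: "open U" unfolding U_def using V oK by (rule open_Int)
  \<comment> \<open>Within \<open>S\<close> the cut-off vanishes off this compact set, and
    \<open>T\<close> avoids \<open>K\<close> because \<open>u\<close> exceeds \<open>exp n\<close>
    there. So \<open>f\<close> is holomorphic near \<open>T\<close> and integration by parts is
    legitimate.\<close>
  define T where "T = S \<inter> {z. u z \<le> exp n}"
  have T: "compact T" "T \<subseteq> U" "T \<subseteq> S - K"
  proof -
    show "compact T" unfolding T_def by (intro compact_Int_closed S closed_Collect_le continuous_intros C(5))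
    show TK: "T \<subseteq> S - K" using E by (fastforce simp: T_def)
    then show "T \<subseteq> U" using SV by (auto simp: U_def)
  qed
  have cf: "continuous_on U f" using holomorphic_on_imp_continuous_on[OF f] by (rule continuous_on_subset) (auto simp: U_def)
  note [continuous_intros] = continuous_on_subset[OF c\<alpha>0 subset_UNIV] continuous_on_subset[OF c\<alpha> subset_UNIV]
     continuous_on_subset[OF C(5) subset_UNIV] continuous_on_subset[OF C(6) subset_UNIV] cf
  have u0: "u z \<noteq> 0" if "z \<in> U" for z using that by (simp add: U_def V_def)
  let ?a = "\<lambda>z. complex_of_real (\<alpha> z)" and ?e = "\<lambda>z. complex_of_real (log_cutoff n (u z))" and ?e' = "\<lambda>z. complex_of_real (log_cutoff' n (u z))"
  let ?Xa = "\<lambda>z. (f z * ?e z) * \<alpha>_z z + (f z * (?e' z * u_z z) + deriv f z * ?e z) * ?a z"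
  let ?Xb = "\<lambda>z. (f z * ?e z) * cnj (\<alpha>_z z) + (f z * (?e' z * cnj (u_z z)) + 0 * ?e z) * ?a z"
  have X: "has_wirtinger (\<lambda>z. (f z * ?e z) * ?a z) (?Xa z) (?Xb z) z" if z: "z \<in> U" for z
  proof (intro has_wirtinger_mult \<alpha>)
    show "has_wirtinger f (deriv f z) 0 z"
      by (rule has_wirtinger_field_derivative) (use holomorphic_derivI[OF f oK] z in \<open>auto simp: U_def\<close>)
    show "has_wirtinger ?e (?e' z * u_z z) (?e' z * cnj (u_z z)) z"
      by (rule has_wirtinger_real_chain[OF C(1) log_cutoff_DERIV]) (use z in \<open>auto simp: U_def V_def\<close>)
  qed
  have ce: "continuous_on U (\<lambda>z. log_cutoff n (u z))" "continuous_on U (\<lambda>z. log_cutoff' n (u z))"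
    unfolding log_cutoff_def log_cutoff'_def using u0 n by (intro continuous_intros; auto)+
  have cd: "continuous_on U (deriv f)"
    by (rule continuous_on_subset[OF holomorphic_on_imp_continuous_on[OF holomorphic_deriv[OF f oK]]]) (auto simp: U_def)
  have ca: "continuous_on U ?Xa" by (intro continuous_intros ce cd)
  have cb: "continuous_on U ?Xb" by (intro continuous_intros ce)
  have X0: "(f z * ?e z) * ?a z = 0" if "z \<in> U" "z \<notin> T" for z
    using that 0[of z] log_cutoff_eq_0[OF n, of "u z"] by (cases "z \<in> S") (auto simp: T_def)
  have iX: "(\<integral>z. indicator T z *\<^sub>R ?Xb z \<partial>lborel) = 0"
    by (rule integral_wirtinger_local(4)[OF U X ca cb T(1,2) X0])
  have i1: "integrable lborel (\<lambda>z. indicator T z *\<^sub>R (?e z * (f z * cnj (\<alpha>_z z))))"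
    by (intro integrable_indicator_continuous T(1) continuous_on_subset[OF _ T(2)] continuous_intros ce)
  have i2: "integrable lborel (\<lambda>z. indicator T z *\<^sub>R (f z * (?e' z * cnj (u_z z)) * ?a z))"
    by (intro integrable_indicator_continuous T(1) continuous_on_subset[OF _ T(2)] continuous_intros ce)
  have "(\<integral>z. indicator (S - K) z *\<^sub>R (?e z * (f z * cnj (\<alpha>_z z))) \<partial>lborel) = (\<integral>z. indicator T z *\<^sub>R (?e z * (f z * cnj (\<alpha>_z z))) \<partial>lborel)"
  proof (rule Bochner_Integration.integral_cong[OF refl])
    fix z show "indicator (S - K) z *\<^sub>R (?e z * (f z * cnj (\<alpha>_z z))) = indicator T z *\<^sub>R (?e z * (f z * cnj (\<alpha>_z z)))"
      using T(3) log_cutoff_eq_0[OF n, of "u z"] by (cases "z \<in> T"; cases "z \<in> S - K") (auto simp: T_def)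
  qed
  \<comment> \<open>Integration by parts moves the dbar-derivative from \<alpha> to the cut-off;
    there is no term from \<open>f\<close>, which is holomorphic near \<open>T\<close>.\<close>
  also have "\<dots> = - (\<integral>z. indicator T z *\<^sub>R (f z * (?e' z * cnj (u_z z)) * ?a z) \<partial>lborel)"
  proof -
    have "(\<integral>z. indicator T z *\<^sub>R (?e z * (f z * cnj (\<alpha>_z z))) + indicator T z *\<^sub>R (f z * (?e' z * cnj (u_z z)) * ?a z) \<partial>lborel) = (\<integral>z. indicator T z *\<^sub>R ?Xb z \<partial>lborel)"
      by (rule Bochner_Integration.integral_cong[OF refl]) (simp add: algebra_simps)
    also note iX
    finally have "(\<integral>z. indicator T z *\<^sub>R (?e z * (f z * cnj (\<alpha>_z z))) + indicator T z *\<^sub>R (f z * (?e' z * cnj (u_z z)) * ?a z) \<partial>lborel) = 0" .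
    then show ?thesis unfolding Bochner_Integration.integral_add[OF i1 i2] by (simp add: eq_neg_iff_add_eq_0)
  qed
  finally have eq: "(\<integral>z. indicator (S - K) z *\<^sub>R (?e z * (f z * cnj (\<alpha>_z z))) \<partial>lborel) = - (\<integral>z. indicator T z *\<^sub>R (f z * (?e' z * cnj (u_z z)) * ?a z) \<partial>lborel)" .
  let ?P = "\<lambda>z. (\<alpha> z)\<^sup>2 * (cmod (u_z z) / u z)\<^sup>2"
  have iP: "integrable lborel (\<lambda>z. indicator S z *\<^sub>R ?P z)"
    using SV by (intro integrable_indicator_continuous S continuous_intros) (auto simp: V_def)
  have "cmod (\<integral>z. indicator T z *\<^sub>R (f z * (?e' z * cnj (u_z z)) * ?a z) \<partial>lborel)
      \<le> (\<integral>z. cmod (indicator T z *\<^sub>R (f z * (?e' z * cnj (u_z z)) * ?a z)) \<partial>lborel)"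
    by (rule integral_norm_bound)
  also have "\<dots> \<le> (\<integral>z. 1 / n * (indicator (S - K) z *\<^sub>R (cmod (f z))\<^sup>2 + indicator S z *\<^sub>R ?P z) \<partial>lborel)"
  proof (rule integral_mono)
    show "integrable lborel (\<lambda>z. cmod (indicator T z *\<^sub>R (f z * (?e' z * cnj (u_z z)) * ?a z)))" by (rule integrable_norm[OF i2])
    show "integrable lborel (\<lambda>z. 1 / n * (indicator (S - K) z *\<^sub>R (cmod (f z))\<^sup>2 + indicator S z *\<^sub>R ?P z))"
      by (intro integrable_mult_right Bochner_Integration.integrable_add L2 iP)
    fix z
    show "cmod (indicator T z *\<^sub>R (f z * (?e' z * cnj (u_z z)) * ?a z)) \<le> 1 / n * (indicator (S - K) z *\<^sub>R (cmod (f z))\<^sup>2 + indicator S z *\<^sub>R ?P z)"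
    proof (cases "z \<in> T")
      case True
      then have z: "z \<in> S - K" "z \<in> S" using T(3) by auto
      define v where "v = \<bar>\<alpha> z\<bar> * (cmod (u_z z) / u z)"
      have "cmod (f z * (?e' z * cnj (u_z z)) * ?a z) = cmod (f z) * (\<bar>log_cutoff' n (u z)\<bar> * (cmod (u_z z) * \<bar>\<alpha> z\<bar>))"
        by (simp add: norm_mult)
      also have "\<dots> \<le> cmod (f z) * (2 / (n * u z) * (cmod (u_z z) * \<bar>\<alpha> z\<bar>))"
        by (intro mult_left_mono mult_right_mono log_cutoff_bounds n u(3) z) auto
      also have "\<dots> = 1 / n * (2 * cmod (f z) * v)" by (simp add: v_def)
      also have "\<dots> \<le> 1 / n * ((cmod (f z))\<^sup>2 + v\<^sup>2)"
        using n sum_squares_bound[of "cmod (f z)" v] by (intro mult_left_mono) auto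
      also have "v\<^sup>2 = ?P z" unfolding v_def power_mult_distrib power2_abs ..
      finally show ?thesis using True z by simp
    qed (use n in auto)
  qed
  also have "\<dots> = 1 / n * ((\<integral>z. indicator (S - K) z *\<^sub>R (cmod (f z))\<^sup>2 \<partial>lborel) + (\<integral>z. indicator S z *\<^sub>R ?P z \<partial>lborel))"
    by (simp only: integral_mult_right_zero Bochner_Integration.integral_add[OF L2 iP])
  also have "\<dots> \<le> 1 / n * ((\<integral>z. indicator (S - K) z *\<^sub>R (cmod (f z))\<^sup>2 \<partial>lborel) + 4 * (\<integral>z. indicator S z *\<^sub>R (cmod (\<alpha>_z z))\<^sup>2 \<partial>lborel))"
    using n by (intro mult_left_mono add_left_mono caccioppoli[OF V C2_real_subset[OF u(1)] u(2) _ \<alpha> c\<alpha> S SV 0]) (auto simp: V_def)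
  finally show ?thesis unfolding eq by simp
qed

lemma log_cutoff_antimono:
  assumes "0 < n" "1 \<le> t" "t \<le> t'" shows "log_cutoff n t' \<le> log_cutoff n t"
proof -
  have "ln t \<le> ln t'" using assms by (intro ln_mono) auto
  then have "1 - ln t' / n \<le> 1 - ln t / n" using assms(1) by (simp add: divide_right_mono)
  then show ?thesis unfolding log_cutoff_def by (intro power_mono max.mono) auto
qed

lemma log_cutoff_tendsto: "(\<lambda>n. log_cutoff (real (Suc n)) t) \<longlonglongrightarrow> 1"
proof -
  have "(\<lambda>n. ln t / real (Suc n)) \<longlonglongrightarrow> 0" by (rule LIMSEQ_Suc[OF lim_const_over_n])
  then have "(\<lambda>n. (max 0 (1 - ln t / real (Suc n)))\<^sup>2) \<longlonglongrightarrow> (max 0 (1 - 0))\<^sup>2" by (intro tendsto_intros)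
  then show ?thesis by (simp add: log_cutoff_def)
qed

text \<open>This says that \<open>f\<close>, extended across \<open>K\<close> by any values, is a
  weak solution of the Cauchy-Riemann equation, since \<open>K\<close> is a null set. The bound of
  order \<open>1 / n\<close> eliminates the cut-offs in the limit.\<close>

lemma polar_dbar_zero:
  assumes s: "subharmonic_on UNIV s" and K: "closed K" "K \<subseteq> {z. s z = - \<infinity>}"
    and \<alpha>: "\<And>z. has_wirtinger (\<lambda>z. complex_of_real (\<alpha> z)) (\<alpha>_z z) (cnj (\<alpha>_z z)) z" and c\<alpha>: "continuous_on UNIV \<alpha>_z"
    and S: "compact S" and 0: "\<And>z. z \<notin> S \<Longrightarrow> \<alpha> z = 0"
    and f: "f holomorphic_on - K" and L2: "integrable lborel (\<lambda>z. indicator (S - K) z *\<^sub>R (cmod (f z))\<^sup>2)"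
  shows "(\<integral>z. indicator (S - K) z *\<^sub>R (f z * cnj (\<alpha>_z z)) \<partial>lborel) = 0"
proof -
  obtain R where "\<forall>z\<in>S. cmod z \<le> R" using compact_imp_bounded[OF S] unfolding bounded_iff by blast
  then have R: "S \<subseteq> cball 0 R" by auto
  obtain C where C: "\<And>z. z \<in> cball 0 (R + 1) \<Longrightarrow> s z < ereal C"
    by (rule subharmonic_bounded_above[OF s compact_cball[of 0 "R + 1"]]) blast
  have C': "s z \<le> ereal C" if "z \<in> cball 0 (R + 1)" for z using C[OF that] by (rule less_imp_le)
  define h where "h z = f z * cnj (\<alpha>_z z)" for z
  define M where "M = (\<integral>z. indicator (S - K) z *\<^sub>R (cmod (f z))\<^sup>2 \<partial>lborel) + 4 * (\<integral>z. indicator S z *\<^sub>R (cmod (\<alpha>_z z))\<^sup>2 \<partial>lborel)"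
  \<comment> \<open>The potential behind the cut-off changes with \<open>n\<close>. What persists is
    the lower bound by the cut-off of the fixed number \<open>C + 1 - q\<close>, which tends to 1
    wherever \<open>s\<close> is finite.\<close>
  define good where "good n \<eta> \<longleftrightarrow> \<eta> \<in> borel_measurable borel \<and> (\<forall>z\<in>S. 0 \<le> \<eta> z \<and> \<eta> z \<le> 1) \<and>
      (\<forall>z\<in>S. \<forall>q. s z = ereal q \<longrightarrow> log_cutoff (real (Suc n)) (C + 1 - q) \<le> \<eta> z) \<and>
      cmod (\<integral>z. indicator (S - K) z *\<^sub>R (of_real (\<eta> z) * h z) \<partial>lborel) \<le> M / real (Suc n)" for n and \<eta> :: "complex \<Rightarrow> real"
  have "\<exists>\<eta>. good n \<eta>" for n
  proof -
    have n: "0 < real (Suc n)" by simp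
    obtain u u_z u_zz u_zb where u: "C2_real UNIV u u_z u_zz u_zb" "\<And>z. u_zb z \<le> 0" "\<And>z. z \<in> S \<Longrightarrow> 1 \<le> u z"
      "\<And>z. z \<in> S \<Longrightarrow> z \<in> K \<Longrightarrow> exp (real (Suc n)) < u z" "\<And>z q. s z = ereal q \<Longrightarrow> u z \<le> C + 1 - q"
      by (rule polar_cutoff_potential[OF s K S R C', of "exp (real (Suc n))"]) blast+
    have [measurable]: "u \<in> borel_measurable borel" by (rule borel_measurable_continuous_onI[OF C2_realD(5)[OF u(1)]])
    show ?thesis unfolding good_def
    proof (intro exI[of _ "\<lambda>z. log_cutoff (real (Suc n)) (u z)"] conjI ballI allI impI)
      show "(\<lambda>z. log_cutoff (real (Suc n)) (u z)) \<in> borel_measurable borel" unfolding log_cutoff_def by measurable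
      show "cmod (\<integral>z. indicator (S - K) z *\<^sub>R (of_real (log_cutoff (real (Suc n)) (u z)) * h z) \<partial>lborel) \<le> M / real (Suc n)"
        unfolding h_def M_def by (rule polar_dbar_bound[OF K(1) u(1,2,3) n u(4) \<alpha> c\<alpha> S 0 f L2])
    qed (use log_cutoff_bounds[OF n] u(3) u(5) in \<open>auto intro!: log_cutoff_antimono\<close>)
  qed
  then have "\<forall>n. \<exists>\<eta>. good n \<eta>" ..
  from choice[OF this] obtain \<eta> where "\<forall>n. good n (\<eta> n)" ..
  then have \<eta>m [measurable]: "\<eta> n \<in> borel_measurable borel" and \<eta>: "z \<in> S \<Longrightarrow> 0 \<le> \<eta> n z" "z \<in> S \<Longrightarrow> \<eta> n z \<le> 1"
      "z \<in> S \<Longrightarrow> s z = ereal q \<Longrightarrow> log_cutoff (real (Suc n)) (C + 1 - q) \<le> \<eta> n z"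
      and \<eta>M: "cmod (\<integral>z. indicator (S - K) z *\<^sub>R (of_real (\<eta> n z) * h z) \<partial>lborel) \<le> M / real (Suc n)" for n z q
    by (simp_all add: good_def)
  have oK: "open (- K)" using K(1) by (rule open_Compl)
  have hm [measurable]: "(\<lambda>z. indicator (S - K) z *\<^sub>R h z) \<in> borel_measurable borel"
  proof -
    define F where "F z = indicator (- K) z *\<^sub>R f z" for z
    have [measurable]: "F \<in> borel_measurable borel" unfolding F_def by (rule holomorphic_measurable[OF f oK])
    have [measurable]: "(\<lambda>z. cnj (\<alpha>_z z)) \<in> borel_measurable borel"
      by (intro borel_measurable_continuous_onI continuous_intros c\<alpha>)
    have [measurable]: "S \<in> sets borel" using S by (simp add: compact_imp_closed)
    have "(\<lambda>z. indicator S z *\<^sub>R (F z * cnj (\<alpha>_z z))) \<in> borel_measurable borel" by measurable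
    also have "(\<lambda>z. indicator S z *\<^sub>R (F z * cnj (\<alpha>_z z))) = (\<lambda>z. indicator (S - K) z *\<^sub>R h z)"
      by (auto simp: F_def h_def indicator_def)
    finally show ?thesis .
  qed
  have ih: "integrable lborel (\<lambda>z. indicator (S - K) z *\<^sub>R h z)"
  proof -
    obtain B where B: "\<And>z. z \<in> S \<Longrightarrow> cmod (\<alpha>_z z) \<le> B"
      using compact_imp_bounded[OF compact_continuous_image[OF continuous_on_subset[OF c\<alpha> subset_UNIV] S]]
      unfolding bounded_iff by auto
    have i1: "integrable lborel (\<lambda>z. indicator S z *\<^sub>R (1::real))" by (intro integrable_indicator_continuous S continuous_intros)
    show ?thesis
    proof (rule Bochner_Integration.integrable_bound)
      show "integrable lborel (\<lambda>z. \<bar>B\<bar> * (indicator S z *\<^sub>R (1::real) + indicator (S - K) z *\<^sub>R (cmod (f z))\<^sup>2))"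
        by (intro integrable_mult_right Bochner_Integration.integrable_add i1 L2)
      show "AE z in lborel. cmod (indicator (S - K) z *\<^sub>R h z) \<le> norm (\<bar>B\<bar> * (indicator S z *\<^sub>R (1::real) + indicator (S - K) z *\<^sub>R (cmod (f z))\<^sup>2))"
      proof (intro AE_I2)
        fix z
        have "cmod (f z) * cmod (\<alpha>_z z) \<le> \<bar>B\<bar> * (1 + (cmod (f z))\<^sup>2)" if "z \<in> S"
        proof -
          have "x \<le> 1 + x\<^sup>2" if "0 \<le> x" for x :: real using sum_squares_bound[of 1 x] that by simp
          then have "cmod (f z) \<le> 1 + (cmod (f z))\<^sup>2" by simp
          moreover have "cmod (\<alpha>_z z) \<le> \<bar>B\<bar>" using B[OF that] by simp
          ultimately have "cmod (f z) * cmod (\<alpha>_z z) \<le> (1 + (cmod (f z))\<^sup>2) * \<bar>B\<bar>" by (intro mult_mono) auto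
          then show ?thesis by (simp add: mult.commute)
        qed
        then show "cmod (indicator (S - K) z *\<^sub>R h z) \<le> norm (\<bar>B\<bar> * (indicator S z *\<^sub>R (1::real) + indicator (S - K) z *\<^sub>R (cmod (f z))\<^sup>2))"
          by (auto simp: indicator_def h_def norm_mult)
      qed
    qed (use hm in simp)
  qed
  have "(\<lambda>n. \<integral>z. indicator (S - K) z *\<^sub>R (of_real (\<eta> n z) * h z) \<partial>lborel) \<longlonglongrightarrow> (\<integral>z. indicator (S - K) z *\<^sub>R h z \<partial>lborel)"
  proof (rule integral_dominated_convergence[where w = "\<lambda>z. cmod (indicator (S - K) z *\<^sub>R h z)"])
    show "integrable lborel (\<lambda>z. cmod (indicator (S - K) z *\<^sub>R h z))" by (rule integrable_norm[OF ih])
    have "(\<lambda>z. of_real (\<eta> n z) * (indicator (S - K) z *\<^sub>R h z)) \<in> borel_measurable lborel" for n by measurable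
    then show "(\<lambda>z. indicator (S - K) z *\<^sub>R (of_real (\<eta> n z) * h z)) \<in> borel_measurable lborel" for n by simp
    show "AE z in lborel. cmod (indicator (S - K) z *\<^sub>R (of_real (\<eta> n z) * h z)) \<le> cmod (indicator (S - K) z *\<^sub>R h z)" for n
    proof (intro AE_I2)
      fix z
      have "\<bar>\<eta> n z\<bar> * cmod (h z) \<le> 1 * cmod (h z)" if "z \<in> S" using \<eta>(1,2)[OF that] by (intro mult_right_mono) auto
      then show "cmod (indicator (S - K) z *\<^sub>R (of_real (\<eta> n z) * h z)) \<le> cmod (indicator (S - K) z *\<^sub>R h z)"
        by (auto simp: indicator_def norm_mult)
    qed
    show "AE z in lborel. (\<lambda>n. indicator (S - K) z *\<^sub>R (of_real (\<eta> n z) * h z)) \<longlonglongrightarrow> indicator (S - K) z *\<^sub>R h z"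
      using subharmonic_AE_finite[OF s]
    proof eventually_elim
      case (elim z)
      show ?case
      proof (cases "z \<in> S")
        case True
        have "s z \<noteq> \<infinity>" using s by (simp add: subharmonic_on_def)
        with elim obtain q where q: "s z = ereal q" by (cases "s z") auto
        have "(\<lambda>n. \<eta> n z) \<longlonglongrightarrow> 1"
          by (rule tendsto_sandwich[OF _ _ log_cutoff_tendsto[of "C + 1 - q"] tendsto_const])
             (use \<eta>(2)[OF True] \<eta>(3)[OF True q] in auto)
        then have "(\<lambda>n. indicator (S - K) z *\<^sub>R (of_real (\<eta> n z) * h z)) \<longlonglongrightarrow> indicator (S - K) z *\<^sub>R (of_real 1 * h z)"
          by (intro tendsto_intros)
        then show ?thesis by simp
      qed simp
    qed
  qed (use hm in simp)
  moreover have "(\<lambda>n. \<integral>z. indicator (S - K) z *\<^sub>R (of_real (\<eta> n z) * h z) \<partial>lborel) \<longlonglongrightarrow> 0"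
  proof (rule Lim_null_comparison)
    show "\<forall>\<^sub>F n in sequentially. cmod (\<integral>z. indicator (S - K) z *\<^sub>R (of_real (\<eta> n z) * h z) \<partial>lborel) \<le> M / real (Suc n)"
      using \<eta>M by simp
    show "(\<lambda>n. M / real (Suc n)) \<longlonglongrightarrow> 0" by (rule LIMSEQ_Suc[OF lim_const_over_n])
  qed
  ultimately have "(\<integral>z. indicator (S - K) z *\<^sub>R h z \<partial>lborel) = 0" by (rule LIMSEQ_unique)
  then show ?thesis by (simp add: h_def)
qed

section \<open>Entire extension across the polar set\<close>

text \<open>The dbar-derivative of the convolution is the integral of \<open>f\<close> against the
  dbar-derivative of a bump centred at \<zeta>, hence 0 by \<open>polar_dbar_zero\<close>, even when
  that bump meets \<open>K\<close>.\<close>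

lemma polar_bump_convolution_entire:
  assumes s: "subharmonic_on UNIV s" and K: "closed K" "K \<subseteq> {z. s z = - \<infinity>}" and \<epsilon>: "0 < \<epsilon>"
    and f: "f holomorphic_on - K" and L2: "\<And>R. integrable lborel (\<lambda>z. indicator (cball 0 R - K) z *\<^sub>R (cmod (f z))\<^sup>2)"
  shows "(\<lambda>\<zeta>. \<integral>z. (indicator (- K) z *\<^sub>R f z) * of_real (bump ((\<zeta> - z) / of_real \<epsilon>)) \<partial>lborel) holomorphic_on UNIV"
proof -
  have oK: "open (- K)" using K(1) by (rule open_Compl)
  define c where "c = complex_of_real (1 / \<epsilon>)"
  have c: "u / of_real \<epsilon> = c * u" for u by (simp add: c_def)
  have cn: "cmod c = 1 / \<epsilon>" using \<epsilon> by (simp add: c_def norm_divide)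
  define k where "k u = complex_of_real (bump (c * u))" for u
  define ka where "ka u = bump_z (c * u) * c" for u
  have k: "has_wirtinger k (ka u) (cnj (ka u)) u" for u
    unfolding k_def ka_def complex_cnj_mult by (rule has_wirtinger_linear[OF has_wirtinger_bump])
  have ka0: "ka u = 0" "k u = 0" if "u \<notin> cball 0 \<epsilon>" for u
  proof -
    have "1 \<le> cmod (c * u)" using that \<epsilon> by (simp add: norm_mult cn field_simps)
    then show "ka u = 0" "k u = 0" by (simp_all add: ka_def k_def bump_derivs_eq_0 bump_eq_0)
  qed
  have cka: "continuous_on UNIV ka" unfolding ka_def
    by (intro continuous_intros continuous_on_compose2[OF bump_derivs_continuous(1)[of UNIV]]) auto
  obtain B1 where B1: "\<And>u. cmod (ka u) \<le> B1"
    by (rule continuous_compact_support_bounded[OF cka compact_cball ka0(1)]) blast+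
  define B where "B = max 1 B1"
  have B: "cmod (k u) \<le> B" "cmod (ka u) \<le> B" "cmod (cnj (ka u)) \<le> B" for u
  proof -
    have "cmod (k u) \<le> 1" using bump_nonneg[of "c * u"] bump_le_1[of "c * u"] by (simp add: k_def)
    then show "cmod (k u) \<le> B" by (simp add: B_def)
    show "cmod (ka u) \<le> B" "cmod (cnj (ka u)) \<le> B" using B1[of u] by (simp_all add: B_def)
  qed
  define F where "F \<zeta> = (\<integral>z. (indicator (- K) z *\<^sub>R f z) * k (\<zeta> - z) \<partial>lborel)" for \<zeta>
  have "\<exists>d. (F has_field_derivative d) (at \<zeta>)" for \<zeta>
  proof -
    \<comment> \<open>For points within distance 1 of \<zeta> the bump sees \<open>f\<close> inside
      \<open>cball 0 R\<close> only, where it is integrable; so \<open>F\<close> is locally a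
      convolution with an integrable function.\<close>
    define R where "R = cmod \<zeta> + 1 + \<epsilon>"
    define g where "g z = indicator (cball 0 R - K) z *\<^sub>R f z" for z
    have fm: "(\<lambda>z. indicator (- K) z *\<^sub>R f z) \<in> borel_measurable borel" by (rule holomorphic_measurable[OF f oK])
    have gm: "g \<in> borel_measurable lborel"
    proof -
      have "(\<lambda>z. indicator (cball 0 R) z *\<^sub>R (indicator (- K) z *\<^sub>R f z)) \<in> borel_measurable borel"
        by (intro borel_measurable_scaleR borel_measurable_indicator fm) auto
      also have "(\<lambda>z. indicator (cball 0 R) z *\<^sub>R (indicator (- K) z *\<^sub>R f z)) = g" by (auto simp: g_def indicator_def)
      finally show ?thesis by simp
    qed
    have gi: "integrable lborel g"
    proof (rule Bochner_Integration.integrable_bound[OF _ gm])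
      have i1: "integrable lborel (\<lambda>z. indicator (cball (0::complex) R) z *\<^sub>R (1::real))"
        by (intro integrable_indicator_continuous compact_cball continuous_intros)
      show "integrable lborel (\<lambda>z. indicator (cball 0 R) z *\<^sub>R (1::real) + indicator (cball 0 R - K) z *\<^sub>R (cmod (f z))\<^sup>2)"
        by (intro Bochner_Integration.integrable_add i1 L2)
      have "x \<le> 1 + x\<^sup>2" if "0 \<le> x" for x :: real using sum_squares_bound[of 1 x] that by simp
      then show "AE z in lborel. cmod (g z) \<le> norm (indicator (cball 0 R) z *\<^sub>R (1::real) + indicator (cball 0 R - K) z *\<^sub>R (cmod (f z))\<^sup>2)"
        by (intro AE_I2) (auto simp: g_def indicator_def)
    qed
    have 1: "has_wirtinger (\<lambda>\<zeta>. \<integral>z. g z * k (\<zeta> - z) \<partial>lborel) (\<integral>z. g z * ka (\<zeta> - z) \<partial>lborel) (\<integral>z. g z * cnj (ka (\<zeta> - z)) \<partial>lborel) \<zeta>"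
      by (rule has_wirtinger_convolution[OF gi k cka _ B]) (intro continuous_intros cka)
    have 2: "(\<integral>z. g z * k (\<xi> - z) \<partial>lborel) = F \<xi>" if "\<xi> \<in> ball \<zeta> 1" for \<xi>
      unfolding F_def
    proof (rule Bochner_Integration.integral_cong[OF refl])
      fix z
      show "g z * k (\<xi> - z) = (indicator (- K) z *\<^sub>R f z) * k (\<xi> - z)"
      proof (cases "cmod (\<xi> - z) \<le> \<epsilon>")
        case True
        have "cmod z \<le> cmod \<zeta> + cmod (\<xi> - \<zeta>) + cmod (\<xi> - z)"
          using norm_triangle_ineq4[of \<xi> "\<xi> - z"] norm_triangle_sub[of \<xi> \<zeta>] by simp
        then have "z \<in> cball 0 R" using True that by (simp add: R_def dist_norm norm_minus_commute)
        then show ?thesis by (simp add: g_def indicator_def)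
      next
        case False
        then show ?thesis by (simp add: ka0(2))
      qed
    qed
    have "has_wirtinger F (\<integral>z. g z * ka (\<zeta> - z) \<partial>lborel) (\<integral>z. g z * cnj (ka (\<zeta> - z)) \<partial>lborel) \<zeta>"
      by (rule has_wirtinger_transform[OF 1 open_ball[of \<zeta> 1]]) (use 2 in auto)
    moreover have "(\<integral>z. g z * cnj (ka (\<zeta> - z)) \<partial>lborel) = 0"
    proof -
      \<comment> \<open>The bump is even, so its derivative is odd. This exchanges differentiation
        in \<zeta> for differentiation in \<open>z\<close>, up to a sign.\<close>
      have odd: "ka (\<zeta> - z) = - ka (z + - \<zeta>)" for z
        by (simp add: ka_def bump_z_def bump_base_def norm_mult norm_minus_commute algebra_simps)
      have "(\<integral>z. indicator (cball \<zeta> \<epsilon> - K) z *\<^sub>R (f z * cnj (ka (z + - \<zeta>))) \<partial>lborel) = 0"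
      proof (rule polar_dbar_zero[OF s K, where \<alpha> = "\<lambda>z. bump (c * (z + - \<zeta>))"])
        show "has_wirtinger (\<lambda>z. complex_of_real (bump (c * (z + - \<zeta>)))) (ka (z + - \<zeta>)) (cnj (ka (z + - \<zeta>))) z" for z
          using has_wirtinger_shift[OF k] by (simp only: k_def)
        show "continuous_on UNIV (\<lambda>z. ka (z + - \<zeta>))" by (intro continuous_on_compose2[OF cka] continuous_intros) auto
        show "bump (c * (z + - \<zeta>)) = 0" if "z \<notin> cball \<zeta> \<epsilon>" for z
          using ka0(2)[of "z + - \<zeta>"] that by (simp add: k_def dist_norm norm_minus_commute)
        have "(\<lambda>z. indicator (cball \<zeta> \<epsilon> - K) z *\<^sub>R (cmod (f z))\<^sup>2) = (\<lambda>z. indicator (cball \<zeta> \<epsilon>) z *\<^sub>R (indicator (cball 0 R - K) z *\<^sub>R (cmod (f z))\<^sup>2))"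
        proof
          fix z
          have "z \<in> cball 0 R" if "z \<in> cball \<zeta> \<epsilon>"
            using that norm_triangle_sub[of z \<zeta>] by (simp add: R_def dist_norm norm_minus_commute)
          then show "indicator (cball \<zeta> \<epsilon> - K) z *\<^sub>R (cmod (f z))\<^sup>2 = indicator (cball \<zeta> \<epsilon>) z *\<^sub>R (indicator (cball 0 R - K) z *\<^sub>R (cmod (f z))\<^sup>2)"
            by (auto simp: indicator_def)
        qed
        then show "integrable lborel (\<lambda>z. indicator (cball \<zeta> \<epsilon> - K) z *\<^sub>R (cmod (f z))\<^sup>2)"
          using integrable_mult_indicator[OF _ L2[of R], of "cball \<zeta> \<epsilon>"] by simp
      qed (use f in auto)
      moreover have "g z * cnj (ka (\<zeta> - z)) = - (indicator (cball \<zeta> \<epsilon> - K) z *\<^sub>R (f z * cnj (ka (z + - \<zeta>))))" for z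
      proof (cases "z \<in> cball \<zeta> \<epsilon>")
        case True
        then have "z \<in> cball 0 R" using norm_triangle_sub[of z \<zeta>] by (simp add: R_def dist_norm norm_minus_commute)
        then show ?thesis using True unfolding odd by (simp add: g_def indicator_def)
      next
        case False
        then have "ka (\<zeta> - z) = 0" by (intro ka0(1)) (simp add: dist_norm norm_minus_commute)
        then show ?thesis using False by simp
      qed
      ultimately show ?thesis by simp
    qed
    ultimately have "has_wirtinger F (\<integral>z. g z * ka (\<zeta> - z) \<partial>lborel) 0 \<zeta>" by simp
    then show ?thesis using has_wirtinger_imp_field_derivative by blast
  qed
  then have "F holomorphic_on UNIV" by (simp add: holomorphic_on_def field_differentiable_def)
  then show ?thesis unfolding F_def k_def c .
qed

text \<open>At scale \<epsilon> the convolution is known to equal \<open>f\<close> only at points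
  whose distance from \<open>K\<close> exceeds \<epsilon>. Two scales agree on a small disc far from
  \<open>K\<close> and are entire, so they agree everywhere; a smaller scale then identifies the
  fixed extension at any given point off \<open>K\<close>.\<close>

lemma polar_extension:
  assumes s: "subharmonic_on UNIV s" and K: "closed K" "K \<subseteq> {z. s z = - \<infinity>}" "K \<noteq> UNIV"
    and f: "f holomorphic_on - K" and L2: "\<And>R. integrable lborel (\<lambda>z. indicator (cball 0 R - K) z *\<^sub>R (cmod (f z))\<^sup>2)"
  obtains g where "g holomorphic_on UNIV" "\<And>z. z \<notin> K \<Longrightarrow> g z = f z"
proof -
  have oK: "open (- K)" using K(1) by (rule open_Compl)
  define G where "G \<epsilon> \<zeta> = (\<integral>z. (indicator (- K) z *\<^sub>R f z) * of_real (bump ((\<zeta> - z) / of_real \<epsilon>)) \<partial>lborel) / of_real (moll_mass \<epsilon>)" for \<epsilon> \<zeta>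
  have G: "G \<epsilon> holomorphic_on UNIV" if "0 < \<epsilon>" for \<epsilon>
    unfolding G_def divide_inverse using polar_bump_convolution_entire[OF s K(1,2) that f L2]
    by (intro holomorphic_intros) (simp add: divide_inverse)
  have Gf: "G \<epsilon> z = f z" if \<epsilon>: "0 < \<epsilon>" "\<epsilon> < \<rho>" and b: "ball z \<rho> \<subseteq> - K" for \<epsilon> \<rho> z
  proof -
    have "(\<integral>w. (indicator (- K) w *\<^sub>R f w) * of_real (bump ((z - w) / of_real \<epsilon>)) \<partial>lborel)
       = (\<integral>w. indicator (cball z \<epsilon>) w *\<^sub>R (of_real (bump ((w - z) / of_real \<epsilon>)) * f w) \<partial>lborel)"
    proof (rule Bochner_Integration.integral_cong[OF refl])
      fix w
      have even: "bump ((z - w) / of_real \<epsilon>) = bump ((w - z) / of_real \<epsilon>)"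
        by (simp add: bump_def bump_base_def norm_divide norm_minus_commute)
      show "(indicator (- K) w *\<^sub>R f w) * of_real (bump ((z - w) / of_real \<epsilon>)) = indicator (cball z \<epsilon>) w *\<^sub>R (of_real (bump ((w - z) / of_real \<epsilon>)) * f w)"
      proof (cases "w \<in> cball z \<epsilon>")
        case True
        then have "w \<in> - K" using b \<epsilon>(2) by (intro subsetD[OF b]) simp
        then show ?thesis using True by (simp add: even)
      next
        case False
        then show ?thesis using bump_scaled_eq_0[OF \<epsilon>(1), of "z - w"] by (simp add: dist_norm)
      qed
    qed
    also have "\<dots> = of_real (moll_mass \<epsilon>) * f z"
      by (rule holomorphic_bump_mean(2)[OF holomorphic_on_subset[OF f b] \<epsilon>])
    finally show ?thesis using moll_mass_pos[OF \<epsilon>(1)] by (simp add: G_def)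
  qed
  obtain a where "a \<in> - K" using K(3) by auto
  then obtain r where r: "0 < r" "ball a r \<subseteq> - K" using oK by (meson openE)
  show ?thesis
  proof (rule that)
    show g: "G (r / 3) holomorphic_on UNIV" using r by (intro G) simp
    fix z assume "z \<notin> K"
    then obtain \<rho> where \<rho>: "0 < \<rho>" "ball z \<rho> \<subseteq> - K" using oK by (meson ComplI openE)
    \<comment> \<open>Small enough for the mean value property at \<open>z\<close> and, with room
      \<open>2 * r / 3\<close>, at all points of \<open>ball a (r / 3)\<close>.\<close>
    define \<epsilon> where "\<epsilon> = min (\<rho> / 2) (r / 3)"
    have \<epsilon>: "0 < \<epsilon>" "\<epsilon> < \<rho>" "\<epsilon> \<le> r / 3" using \<rho>(1) r(1) by (auto simp: \<epsilon>_def)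
    have eq: "G (r / 3) w = G \<epsilon> w" if w: "w \<in> ball a (r / 3)" for w
    proof -
      have "ball w (2 * r / 3) \<subseteq> ball a r"
      proof
        fix v assume "v \<in> ball w (2 * r / 3)"
        then show "v \<in> ball a r" using w dist_triangle[of a v w] by simp
      qed
      then have b: "ball w (2 * r / 3) \<subseteq> - K" using r(2) by blast
      have "G (r / 3) w = f w" using r(1) by (intro Gf[OF _ _ b]) auto
      moreover have "G \<epsilon> w = f w" using r(1) \<epsilon> by (intro Gf[OF _ _ b]) auto
      ultimately show ?thesis by simp
    qed
    have "G (r / 3) z = G \<epsilon> z"
      by (rule analytic_continuation_open[of "ball a (r / 3)" UNIV "G (r / 3)" "G \<epsilon>"]) (use r(1) g G[OF \<epsilon>(1)] eq in auto)
    also have "\<dots> = f z" by (rule Gf[OF \<epsilon>(1,2) \<rho>(2)])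
    finally show "G (r / 3) z = f z" .
  qed
qed

text \<open>\<open>\<psi>\<close> is bounded above on bounded sets, so its weight is bounded below
  there by a positive constant.\<close>

lemma bergman_space_locally_L2:
  assumes \<psi>: "subharmonic_on UNIV \<psi>" and K: "closed K" and f: "f \<in> bergman_space \<psi> (- K)"
  shows "integrable lborel (\<lambda>z. indicator (cball 0 R - K) z *\<^sub>R (cmod (f z))\<^sup>2)"
proof (rule integrableI_bounded)
  have hol: "f holomorphic_on - K" and fin: "bergman_sqnorm \<psi> (- K) f < \<infinity>" using f by (auto simp: bergman_space_def)
  have oK: "open (- K)" using K by (rule open_Compl)
  define F where "F z = indicator (- K) z *\<^sub>R f z" for z
  have [measurable]: "F \<in> borel_measurable borel" unfolding F_def by (rule holomorphic_measurable[OF hol oK])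
  have [measurable]: "cball (0::complex) R \<in> sets borel" by simp
  have "(\<lambda>z. indicator (cball 0 R) z *\<^sub>R (cmod (F z))\<^sup>2) \<in> borel_measurable borel" by measurable
  also have "(\<lambda>z. indicator (cball 0 R) z *\<^sub>R (cmod (F z))\<^sup>2) = (\<lambda>z. indicator (cball 0 R - K) z *\<^sub>R (cmod (f z))\<^sup>2)"
    by (auto simp: F_def indicator_def)
  finally show m: "(\<lambda>z. indicator (cball 0 R - K) z *\<^sub>R (cmod (f z))\<^sup>2) \<in> borel_measurable lborel" by simp
  obtain C where C: "\<And>z. z \<in> cball 0 R \<Longrightarrow> \<psi> z < ereal C"
    by (rule subharmonic_bounded_above[OF \<psi> compact_cball[of 0 R]]) blast
  have "ennreal (exp (- C)) * (\<integral>\<^sup>+z. ennreal (norm (indicator (cball 0 R - K) z *\<^sub>R (cmod (f z))\<^sup>2)) \<partial>lborel)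
     = (\<integral>\<^sup>+z. ennreal (exp (- C)) * ennreal (norm (indicator (cball 0 R - K) z *\<^sub>R (cmod (f z))\<^sup>2)) \<partial>lborel)"
    by (rule nn_integral_cmult[symmetric]) (rule measurable_compose[OF measurable_compose[OF m borel_measurable_norm] measurable_ennreal])
  also have "\<dots> \<le> bergman_sqnorm \<psi> (- K) f" unfolding bergman_sqnorm_def
  proof (rule nn_integral_mono_AE)
    show "AE z in lborel. ennreal (exp (- C)) * ennreal (norm (indicator (cball 0 R - K) z *\<^sub>R (cmod (f z))\<^sup>2))
        \<le> ennreal ((cmod (f z))\<^sup>2) * exp_ereal (- \<psi> z) * indicator (- K) z"
      using subharmonic_AE_finite[OF \<psi>]
    proof eventually_elim
      case (elim z)
      have "\<psi> z \<noteq> \<infinity>" using \<psi> by (simp add: subharmonic_on_def)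
      with elim obtain q where q: "\<psi> z = ereal q" by (cases "\<psi> z") auto
      show ?case
      proof (cases "z \<in> cball 0 R - K")
        case True
        have "exp (- C) * (cmod (f z))\<^sup>2 \<le> (cmod (f z))\<^sup>2 * exp (- q)"
          unfolding mult.commute[of "exp (- C)"] using C[of z] True q by (intro mult_left_mono) auto
        then have "ennreal (exp (- C) * (cmod (f z))\<^sup>2) \<le> ennreal ((cmod (f z))\<^sup>2 * exp (- q))" by (rule ennreal_leI)
        then show ?thesis using True by (simp add: exp_ereal_minus[OF q] ennreal_mult')
      qed simp
    qed
  qed
  also note fin
  finally show "(\<integral>\<^sup>+z. ennreal (norm (indicator (cball 0 R - K) z *\<^sub>R (cmod (f z))\<^sup>2)) \<partial>lborel) < \<infinity>"
    by (auto simp: ennreal_mult_less_top)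
qed

lemma bergman_sqnorm_Compl_null:
  assumes "AE z in lborel. z \<notin> K" "\<And>z. z \<notin> K \<Longrightarrow> f z = g z"
  shows "bergman_sqnorm \<psi> (- K) f = bergman_sqnorm \<psi> UNIV g"
  unfolding bergman_sqnorm_def
  by (rule nn_integral_cong_AE) (use assms(1) in eventually_elim, simp add: assms(2))

text \<open>The isomorphism is extension to an entire function; its inverse restricts and sets the
  values on \<open>K\<close> to 0. The norm is preserved because \<open>K\<close>, contained in the
  pole set of a subharmonic function, is a null set.\<close>

lemma polar_bergman_isomorphic:
  assumes K: "closed K" "K \<noteq> UNIV" "polar K" and \<psi>: "subharmonic_on UNIV \<psi>"
  shows "bergman_isomorphic \<psi> (- K) UNIV"
proof -
  obtain s where s: "subharmonic_on UNIV s" "K \<subseteq> {z. s z = - \<infinity>}" using K(3) unfolding polar_def by blast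
  have null: "AE z in lborel. z \<notin> K"
    using subharmonic_AE_finite[OF s(1)] by eventually_elim (use s(2) in blast)
  have oK: "open (- K)" "- K \<noteq> {}" using K(1,2) by auto
  \<comment> \<open>The choice is unique whenever an extension exists, by the identity theorem from
    the nonempty open set \<open>- K\<close>; linearity follows from this uniqueness.\<close>
  define T where "T f = (SOME g. g holomorphic_on UNIV \<and> (\<forall>z. z \<notin> K \<longrightarrow> g z = f z))" for f :: "complex \<Rightarrow> complex"
  have T_eq: "T f = g" if g: "g holomorphic_on UNIV" "\<And>z. z \<notin> K \<Longrightarrow> g z = f z" for f g
  proof -
    have T: "T f holomorphic_on UNIV \<and> (\<forall>z. z \<notin> K \<longrightarrow> T f z = f z)"
      unfolding T_def by (rule someI[of _ g]) (use g in blast)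
    have "T f z = g z" for z
      by (rule analytic_continuation_open[of "- K" UNIV "T f" g]) (use T g oK in auto)
    then show ?thesis by (rule ext)
  qed
  have T: "T f holomorphic_on UNIV" "z \<notin> K \<Longrightarrow> T f z = f z" if f: "f \<in> bergman_space \<psi> (- K)" for f z
  proof -
    have "f holomorphic_on - K" using f by (simp add: bergman_space_def)
    then obtain g where g: "g holomorphic_on UNIV" "\<And>z. z \<notin> K \<Longrightarrow> g z = f z"
      by (rule polar_extension[OF s(1) K(1) s(2) K(2) _ bergman_space_locally_L2[OF \<psi> K(1) f]]) blast
    then show "T f holomorphic_on UNIV" "z \<notin> K \<Longrightarrow> T f z = f z" using T_eq[of g f] by auto
  qed
  have norm: "bergman_sqnorm \<psi> UNIV (T f) = bergman_sqnorm \<psi> (- K) f" if "f \<in> bergman_space \<psi> (- K)" for f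
    by (rule bergman_sqnorm_Compl_null[OF null, symmetric]) (simp add: T(2)[OF that])
  define Q where "Q g = (\<lambda>z. if z \<in> - K then g z else 0)" for g :: "complex \<Rightarrow> complex"
  have "bij_betw T (bergman_space \<psi> (- K)) (bergman_space \<psi> UNIV)"
  proof (rule bij_betw_byWitness[where f' = Q])
    show "\<forall>f\<in>bergman_space \<psi> (- K). Q (T f) = f"
      using T(2) by (auto simp: Q_def fun_eq_iff bergman_space_def)
    show "\<forall>g\<in>bergman_space \<psi> UNIV. T (Q g) = g"
      by (auto intro!: T_eq simp: bergman_space_def Q_def)
    show "T ` bergman_space \<psi> (- K) \<subseteq> bergman_space \<psi> UNIV"
    proof
      fix h assume "h \<in> T ` bergman_space \<psi> (- K)"
      then obtain f where f: "f \<in> bergman_space \<psi> (- K)" "h = T f" by blast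
      then have "bergman_sqnorm \<psi> UNIV h < \<infinity>" using norm[OF f(1)] by (simp add: bergman_space_def)
      then show "h \<in> bergman_space \<psi> UNIV" using T(1)[OF f(1)] f(2) by (simp add: bergman_space_def)
    qed
    show "Q ` bergman_space \<psi> UNIV \<subseteq> bergman_space \<psi> (- K)"
    proof
      fix h assume "h \<in> Q ` bergman_space \<psi> UNIV"
      then obtain g where g: "g \<in> bergman_space \<psi> UNIV" "h = Q g" by blast
      have "bergman_sqnorm \<psi> (- K) h = bergman_sqnorm \<psi> UNIV g"
        by (rule bergman_sqnorm_Compl_null[OF null]) (simp add: g(2) Q_def)
      moreover have "h holomorphic_on - K"
      proof (rule holomorphic_transform[of g])
        show "g holomorphic_on - K" by (rule holomorphic_on_subset[of g UNIV]) (use g(1) in \<open>auto simp: bergman_space_def\<close>)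
      qed (simp add: g(2) Q_def)
      ultimately show "h \<in> bergman_space \<psi> (- K)" using g by (simp add: bergman_space_def Q_def)
    qed
  qed
  moreover have "T (f + g) = T f + T g" if f: "f \<in> bergman_space \<psi> (- K)" and g: "g \<in> bergman_space \<psi> (- K)" for f g
  proof (rule T_eq)
    have "(\<lambda>z. T f z + T g z) holomorphic_on UNIV" by (intro holomorphic_intros T(1) f g)
    then show "T f + T g holomorphic_on UNIV" by (simp add: plus_fun_def)
  qed (simp add: T(2)[OF f] T(2)[OF g])
  moreover have "T (cscale c f) = cscale c (T f)" if f: "f \<in> bergman_space \<psi> (- K)" for c f
  proof (rule T_eq)
    show "cscale c (T f) holomorphic_on UNIV" unfolding cscale_def by (intro holomorphic_intros T(1) f)
  qed (simp add: cscale_def T(2)[OF f])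
  moreover have "bergman_norm \<psi> UNIV (T f) = bergman_norm \<psi> (- K) f" if "f \<in> bergman_space \<psi> (- K)" for f
    by (simp add: bergman_norm_def norm[OF that])
  ultimately show ?thesis unfolding bergman_isomorphic_def by blast
qed

theorem corollary3p3:
  fixes K :: "complex set" and \<psi> :: "complex \<Rightarrow> ereal"
  assumes "closed K" and "K \<noteq> UNIV" and "subharmonic_on UNIV \<psi>"
  shows "(\<not> polar K \<longrightarrow> infinite_dimensional (bergman_space \<psi> (- K))) \<and>
         (polar K \<longrightarrow> bergman_isomorphic \<psi> (- K) UNIV)"
  using nonpolar_infinite_dimensional[OF assms(1,2) _ assms(3)] polar_bergman_isomorphic[OF assms(1,2) _ assms(3)]
  by blast

end
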